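(* Let $Z$ be an irreducible hermitian Jordan triple of rank $r$, type $(r,a,b)$, dimension $d$ and genus $p=2+a(r-1)+b$. Let $\ell=1$, $\alpha>0$, and for $\nu>0$ let $\rho$ be the $K$-invariant measure on $\mathring Z_1$ given by $$\int_{\mathring Z_1}f\,d\rho=\int_0^\infty d\tilde\rho(t)\int_{S_1}ds\ f(s\sqrt t),\qquad d\tilde\rho(t)=\alpha^p\,e^{-\nu t^\alpha}\,t^{\alpha(p-1)-1}\,dt .$$ Let $\mathcal K_1^\nu$ be the reproducing kernel of the Hilbert space $\mathcal H_\nu$ of all holomorphic functions on $\mathring Z_1$ that are square-integrable with respect to $\rho$. Then there exist $\eta>0$ and constants $b_0,\dots,b_{p-2}$, independent of $z$ and $\nu$, with $b_0=1$, such that for $z\in\mathring Z_1$ $$\frac{\Gamma(d/r)\,\Gamma(ar/2)}{\Gamma(a/2)\,\nu^{p-1}}\ e^{-\nu(z|z)^\alpha}\ \mathcal K_1^\nu(z,z)=\sum_{j=0}^{p-2}\frac{b_j}{\nu^j\,(z|z)^{j\alpha}}+O\big(e^{-\eta\nu(z|z)^\alpha}\big)\qquad\text{as }\nu\to+\infty.$$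
   Context: A hermitian Jordan triple is a finite-dimensional complex vector space $Z$ with a triple product $\{u;v;w\}=:D(u,v)w$, complex linear and symmetric in $u,w$, conjugate linear in $v$, satisfying $[D(x,y),D(u,v)]=D(\{x;y;u\},v)-D(u,\{v;x;y\})$, with $(u,v)\mapsto\operatorname{tr}D(u,v)$ a positive definite hermitian form; irreducible means not a direct sum of two non-zero ideals. Put $Q_uz=\frac12\{u;z;u\}$. A tripotent is $c$ with $Q_cc=c$. Let $e_1,\dots,e_r$ be a frame (maximal system of orthogonal minimal tripotents) and $Z_{ij}=\{z: D(e_k,e_k)z=(\delta_i^k+\delta_j^k)z\ \forall k\}$. Then $a=\dim Z_{ij}$ ($1\le i<j\le r$), $b=\dim Z_{0j}$ ($1\le j\le r$), and $d=\dim Z=r(1+\frac a2(r-1)+b)$. For $r=1$ the number $a$ plays no role (any positive value may be used; it cancels). $K$ is the identity component of the linear automorphism group of the triple; $(z|w)$ is the $K$-invariant hermitian inner product (linear in $z$) for which minimal tripotents have length 1. Every $z\in Z$ is $k(\sum\lambda_ie_i)$ with $k\in K$, $\lambda_i\ge0$, and its rank is the number of non-zero $\lambda_i$. $\mathring Z_1$ is the complex manifold of all elements of rank 1 (of dimension $p-1$), $S_1$ the compact manifold of tripotents of rank 1 with its $K$-invariant probability measure $ds$; one has $\mathring Z_1=\mathbb R_+S_1$. *)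

theory Defs
  imports "HOL-Probability.Probability" "HOL-Library.Landau_Symbols"
begin

section \<open>Hermitian Jordan triples\<close>

text \<open>
  The underlying complex vector space is \<open>complex ^ 'n\<close>, of complex dimension \<open>CARD('n)\<close>;
  choosing a basis, this is no restriction. Only the topology and the complex
  vector space structure (scalar multiplication \<open>*s\<close>) of \<open>complex ^ 'n\<close> are used,
  never its coordinatewise inner product. A triple product is a function \<open>T\<close> with
  \<open>T u v w\<close> standing for $\{u;v;w\}$, so that \<open>T u v\<close> is the operator $D(u,v)$.
\<close>

type_synonym 'n triple = "complex ^ 'n \<Rightarrow> complex ^ 'n \<Rightarrow> complex ^ 'n \<Rightarrow> complex ^ 'n"

definition hermitian_jordan_triple :: "'n::finite triple \<Rightarrow> bool" where
  "hermitian_jordan_triple T \<longleftrightarrow>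
     (\<forall>v w. Vector_Spaces.linear (*s) (*s) (\<lambda>u. T u v w)) \<and>
     (\<forall>u v w. T u v w = T w v u) \<and>
     (\<forall>u v v' w. T u (v + v') w = T u v w + T u v' w) \<and>
     (\<forall>c u v w. T u (c *s v) w = cnj c *s T u v w) \<and>
     (\<forall>x y u v w. T x y (T u v w) - T u v (T x y w) = T (T x y u) v w - T u (T v x y) w) \<and>
     (\<forall>u v. trace (matrix (T v u)) = cnj (trace (matrix (T u v)))) \<and>
     (\<forall>u. u \<noteq> 0 \<longrightarrow> 0 < Re (trace (matrix (T u u))))"

definition jt_ideal :: "'n::finite triple \<Rightarrow> (complex ^ 'n) set \<Rightarrow> bool" where
  "jt_ideal T I \<longleftrightarrow> vec.subspace I \<and>
     (\<forall>x\<in>I. \<forall>u v. T x u v \<in> I \<and> T u x v \<in> I \<and> T u v x \<in> I)"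

definition jt_irreducible :: "'n::finite triple \<Rightarrow> bool" where
  "jt_irreducible T \<longleftrightarrow>
     \<not> (\<exists>I J. jt_ideal T I \<and> jt_ideal T J \<and> I \<noteq> {0} \<and> J \<noteq> {0} \<and>
              I \<inter> J = {0} \<and> (\<forall>z. \<exists>x\<in>I. \<exists>y\<in>J. z = x + y))"

definition jt_Q :: "'n::finite triple \<Rightarrow> complex ^ 'n \<Rightarrow> complex ^ 'n \<Rightarrow> complex ^ 'n" where
  "jt_Q T u z = (1/2) *s T u z u"

definition tripotent :: "'n::finite triple \<Rightarrow> complex ^ 'n \<Rightarrow> bool" where
  "tripotent T c \<longleftrightarrow> jt_Q T c c = c"

definition jt_orthogonal :: "'n::finite triple \<Rightarrow> complex ^ 'n \<Rightarrow> complex ^ 'n \<Rightarrow> bool" where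
  "jt_orthogonal T u v \<longleftrightarrow> (\<forall>w. T u v w = 0)"

text \<open>
  Minimality refers to the usual order on tripotents: \<open>c \<le> c'\<close> iff \<open>c' - c\<close> is a tripotent
  orthogonal to \<open>c\<close>.
\<close>

definition minimal_tripotent :: "'n::finite triple \<Rightarrow> complex ^ 'n \<Rightarrow> bool" where
  "minimal_tripotent T c \<longleftrightarrow> tripotent T c \<and> c \<noteq> 0 \<and>
     \<not> (\<exists>u v. tripotent T u \<and> tripotent T v \<and> u \<noteq> 0 \<and> v \<noteq> 0 \<and>
              jt_orthogonal T u v \<and> c = u + v)"

text \<open>The frame \<open>e\<^sub>1, \<dots>, e\<^sub>r\<close>; the values of \<open>e\<close> outside \<open>{1..r}\<close> are irrelevant.\<close>

definition jt_frame :: "'n::finite triple \<Rightarrow> nat \<Rightarrow> (nat \<Rightarrow> complex ^ 'n) \<Rightarrow> bool" where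
  "jt_frame T r e \<longleftrightarrow>
     (\<forall>i\<in>{1..r}. minimal_tripotent T (e i)) \<and>
     (\<forall>i\<in>{1..r}. \<forall>j\<in>{1..r}. i \<noteq> j \<longrightarrow> jt_orthogonal T (e i) (e j)) \<and>
     \<not> (\<exists>c. minimal_tripotent T c \<and> (\<forall>i\<in>{1..r}. jt_orthogonal T c (e i)))"

definition joint_peirce ::
  "'n::finite triple \<Rightarrow> nat \<Rightarrow> (nat \<Rightarrow> complex ^ 'n) \<Rightarrow> nat \<Rightarrow> nat \<Rightarrow> (complex ^ 'n) set" where
  "joint_peirce T r e i j =
     {z. \<forall>k\<in>{1..r}. T (e k) (e k) z = (of_bool (i = k) + of_bool (j = k)) *s z}"

text \<open>
  \<open>vec.dim\<close> is the complex dimension. For \<open>r = 1\<close> the first condition is void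
  and \<open>a\<close> is an arbitrary positive number; for \<open>r > 1\<close> and irreducible \<open>T\<close>,
  positivity of \<open>a\<close> is a theorem and is not assumed.
\<close>

definition jt_type :: "'n::finite triple \<Rightarrow> (nat \<Rightarrow> complex ^ 'n) \<Rightarrow> nat \<Rightarrow> nat \<Rightarrow> nat \<Rightarrow> bool" where
  "jt_type T e r a b \<longleftrightarrow>
     (\<forall>i j. 1 \<le> i \<and> i < j \<and> j \<le> r \<longrightarrow> vec.dim (joint_peirce T r e i j) = a) \<and>
     (\<forall>j. 1 \<le> j \<and> j \<le> r \<longrightarrow> vec.dim (joint_peirce T r e 0 j) = b) \<and>
     (r = 1 \<longrightarrow> 0 < a)"

section \<open>The group \<open>K\<close>, invariant inner product, elements of rank one\<close>

definition jt_aut :: "'n::finite triple \<Rightarrow> (complex ^ 'n ^ 'n) set" where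
  "jt_aut T = {g. invertible g \<and> (\<forall>u v w. g *v T u v w = T (g *v u) (g *v v) (g *v w))}"

definition jt_K :: "'n::finite triple \<Rightarrow> (complex ^ 'n ^ 'n) set" where
  "jt_K T = connected_component_set (jt_aut T) (mat 1)"

definition jt_inner_product ::
  "'n::finite triple \<Rightarrow> (complex ^ 'n \<Rightarrow> complex ^ 'n \<Rightarrow> complex) \<Rightarrow> bool" where
  "jt_inner_product T ip \<longleftrightarrow>
     (\<forall>w. Vector_Spaces.linear (*s) (*) (\<lambda>z. ip z w)) \<and>
     (\<forall>z w. ip w z = cnj (ip z w)) \<and>
     (\<forall>z. z \<noteq> 0 \<longrightarrow> 0 < Re (ip z z)) \<and>
     (\<forall>k\<in>jt_K T. \<forall>z w. ip (k *v z) (k *v w) = ip z w) \<and>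
     (\<forall>c. minimal_tripotent T c \<longrightarrow> ip c c = 1)"

definition jt_has_rank ::
  "'n::finite triple \<Rightarrow> nat \<Rightarrow> (nat \<Rightarrow> complex ^ 'n) \<Rightarrow> complex ^ 'n \<Rightarrow> nat \<Rightarrow> bool" where
  "jt_has_rank T r e z l \<longleftrightarrow>
     (\<exists>k\<in>jt_K T. \<exists>c :: nat \<Rightarrow> real. (\<forall>i\<in>{1..r}. 0 \<le> c i) \<and>
        z = k *v (\<Sum>i=1..r. c i *\<^sub>R e i) \<and> card {i\<in>{1..r}. c i \<noteq> 0} = l)"

definition rank_one :: "'n::finite triple \<Rightarrow> nat \<Rightarrow> (nat \<Rightarrow> complex ^ 'n) \<Rightarrow> (complex ^ 'n) set" where
  "rank_one T r e = {z. jt_has_rank T r e z 1}"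

definition rank_one_tripotents ::
  "'n::finite triple \<Rightarrow> nat \<Rightarrow> (nat \<Rightarrow> complex ^ 'n) \<Rightarrow> (complex ^ 'n) set" where
  "rank_one_tripotents T r e = {c. tripotent T c \<and> jt_has_rank T r e c 1}"

lemma rank_one_scaleR:
  assumes "z \<in> rank_one T r e" "0 < t"
  shows "t *\<^sub>R z \<in> rank_one T r e"
proof -
  obtain k c where k: "k \<in> jt_K T" "\<forall>i\<in>{1..r}. 0 \<le> c i"
      "z = k *v (\<Sum>i=1..r. c i *\<^sub>R e i)" "card {i\<in>{1..r}. c i \<noteq> 0} = 1"
    using assms(1) by (auto simp: rank_one_def jt_has_rank_def)
  have "t *\<^sub>R (k *v x) = k *v (t *\<^sub>R x)" for x
    by (simp add: vec_eq_iff matrix_vector_mult_def scaleR_sum_right)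
  then have "t *\<^sub>R z = k *v (t *\<^sub>R (\<Sum>i=1..r. c i *\<^sub>R e i))"
    unfolding k(3) .
  also have "\<dots> = k *v (\<Sum>i=1..r. (t * c i) *\<^sub>R e i)"
    by (simp add: scaleR_sum_right)
  finally show ?thesis
    using k assms(2) unfolding rank_one_def jt_has_rank_def mem_Collect_eq
    by (intro bexI[OF _ k(1)] exI[of _ "\<lambda>i. t * c i"]) auto
qed

section \<open>The measures\<close>

definition invariant_prob_measure ::
  "'n::finite triple \<Rightarrow> (complex ^ 'n) set \<Rightarrow> (complex ^ 'n) measure \<Rightarrow> bool" where
  "invariant_prob_measure T S \<sigma> \<longleftrightarrow> prob_space \<sigma> \<and>
     space \<sigma> = S \<and> sets \<sigma> = sets (restrict_space borel S) \<and>
     (\<forall>k\<in>jt_K T. distr \<sigma> \<sigma> (\<lambda>s. k *v s) = \<sigma>)"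

definition radial_density :: "real \<Rightarrow> nat \<Rightarrow> real \<Rightarrow> real \<Rightarrow> real" where
  "radial_density \<alpha> p \<nu> t = \<alpha> ^ p * exp (- \<nu> * t powr \<alpha>) * t powr (\<alpha> * (real p - 1) - 1)"

lemma radial_density_measurable [measurable]: "radial_density \<alpha> p \<nu> \<in> borel_measurable borel"
proof -
  have "(\<lambda>t. radial_density \<alpha> p \<nu> t) \<in> borel_measurable borel"
    unfolding radial_density_def by measurable
  then show ?thesis by simp
qed

definition radial_measure :: "real \<Rightarrow> nat \<Rightarrow> real \<Rightarrow> real measure" where
  "radial_measure \<alpha> p \<nu> = density (restrict_space lborel {0<..}) (\<lambda>t. ennreal (radial_density \<alpha> p \<nu> t))"

definition polar_measure ::
  "(complex ^ 'n) set \<Rightarrow> (complex ^ 'n) measure \<Rightarrow> real \<Rightarrow> nat \<Rightarrow> real \<Rightarrow> (complex ^ 'n::finite) measure" where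
  "polar_measure Z1 \<sigma> \<alpha> p \<nu> =
     distr (radial_measure \<alpha> p \<nu> \<Otimes>\<^sub>M \<sigma>) (restrict_space borel Z1) (\<lambda>(t, s). sqrt t *\<^sub>R s)"

text \<open>The integral formula which characterises \<open>polar_measure\<close>.\<close>

lemma nn_integral_polar_measure:
  fixes T :: "'n::finite triple"
  assumes \<sigma>: "invariant_prob_measure T (rank_one_tripotents T r e) \<sigma>"
    and f: "f \<in> borel_measurable (restrict_space borel (rank_one T r e))"
  shows "(\<integral>\<^sup>+ z. f z \<partial>polar_measure (rank_one T r e) \<sigma> \<alpha> p \<nu>) =
         (\<integral>\<^sup>+ t\<in>{0<..}. ennreal (radial_density \<alpha> p \<nu> t) * (\<integral>\<^sup>+ s. f (sqrt t *\<^sub>R s) \<partial>\<sigma>) \<partial>lborel)"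
proof -
  interpret prob_space \<sigma> using \<sigma> by (simp add: invariant_prob_measure_def)
  let ?R = "radial_measure \<alpha> p \<nu>"
  have sp: "space \<sigma> = rank_one_tripotents T r e"
    and st: "sets \<sigma> = sets (restrict_space borel (rank_one_tripotents T r e))"
    using \<sigma> by (auto simp: invariant_prob_measure_def)
  have spR: "space ?R = {0<..}"
    by (simp add: radial_measure_def space_restrict_space)
  have stR: "sets ?R = sets (restrict_space borel {0<..})"
    by (simp add: radial_measure_def sets_restrict_space)
  have [measurable]: "(\<lambda>s. s) \<in> measurable \<sigma> borel"
    unfolding measurable_cong_sets[OF st refl] by (rule measurable_restrict_space1) simp
  have [measurable]: "(\<lambda>t. t) \<in> measurable ?R borel"
    unfolding measurable_cong_sets[OF stR refl] by (rule measurable_restrict_space1) simp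
  have fst': "fst \<in> measurable (?R \<Otimes>\<^sub>M \<sigma>) borel" and snd': "snd \<in> measurable (?R \<Otimes>\<^sub>M \<sigma>) borel"
    by measurable
  have m: "(\<lambda>(t, s). sqrt t *\<^sub>R s) \<in> measurable (?R \<Otimes>\<^sub>M \<sigma>) (restrict_space borel (rank_one T r e))"
  proof (rule measurable_restrict_space2)
    show "(\<lambda>(t, s). sqrt t *\<^sub>R s) \<in> space (?R \<Otimes>\<^sub>M \<sigma>) \<rightarrow> rank_one T r e"
      by (auto simp: space_pair_measure spR sp rank_one_tripotents_def rank_one_def
          intro!: rank_one_scaleR[unfolded rank_one_def, simplified])
    show "(\<lambda>(t, s). sqrt t *\<^sub>R s) \<in> borel_measurable (?R \<Otimes>\<^sub>M \<sigma>)"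
      unfolding case_prod_beta using fst' snd' by measurable
  qed
  let ?g = "\<lambda>x. f (case x of (t, s) \<Rightarrow> sqrt t *\<^sub>R s)"
  have g: "?g \<in> borel_measurable (?R \<Otimes>\<^sub>M \<sigma>)"
    by (rule measurable_compose[OF m f])
  have d: "(\<lambda>t. ennreal (radial_density \<alpha> p \<nu> t)) \<in> borel_measurable (restrict_space lborel {0<..})"
    by (intro measurable_restrict_space1 measurable_compose[OF _ measurable_ennreal]) simp
  have gi: "(\<lambda>t. \<integral>\<^sup>+ s. f (sqrt t *\<^sub>R s) \<partial>\<sigma>) \<in> borel_measurable (restrict_space lborel {0<..})"
    using borel_measurable_nn_integral_fst[OF g] by (simp add: radial_measure_def)
  have "(\<integral>\<^sup>+ z. f z \<partial>polar_measure (rank_one T r e) \<sigma> \<alpha> p \<nu>) = (\<integral>\<^sup>+ x. ?g x \<partial>(?R \<Otimes>\<^sub>M \<sigma>))"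
    unfolding polar_measure_def by (rule nn_integral_distr[OF m]) (simp add: f)
  also have "\<dots> = (\<integral>\<^sup>+ t. (\<integral>\<^sup>+ s. f (sqrt t *\<^sub>R s) \<partial>\<sigma>) \<partial>?R)"
    by (subst nn_integral_fst[OF g, symmetric]) simp
  also have "\<dots> = (\<integral>\<^sup>+ t. ennreal (radial_density \<alpha> p \<nu> t) * (\<integral>\<^sup>+ s. f (sqrt t *\<^sub>R s) \<partial>\<sigma>)
                    \<partial>restrict_space lborel {0<..})"
    unfolding radial_measure_def by (rule nn_integral_density[OF d gi])
  also have "\<dots> = (\<integral>\<^sup>+ t\<in>{0<..}. ennreal (radial_density \<alpha> p \<nu> t) * (\<integral>\<^sup>+ s. f (sqrt t *\<^sub>R s) \<partial>\<sigma>) \<partial>lborel)"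
    by (rule nn_integral_restrict_space) simp
  finally show ?thesis .
qed

section \<open>Holomorphic functions and the reproducing kernel\<close>

definition holomorphic_several :: "(complex ^ 'n::finite \<Rightarrow> complex) \<Rightarrow> (complex ^ 'n) set \<Rightarrow> bool" where
  "holomorphic_several F U \<longleftrightarrow>
     (\<forall>z\<in>U. \<exists>F'. Vector_Spaces.linear (*s) (*) F' \<and> (F has_derivative F') (at z))"

text \<open>
  The manifold \<open>M\<close> of elements of rank one carries the complex structure of an
  embedded (locally closed) complex submanifold, so its holomorphic functions are those which
  near each point of \<open>M\<close> extend to a holomorphic function on an open subset of the ambient space.
\<close>

definition holomorphic_on_submanifold ::
  "(complex ^ 'n::finite \<Rightarrow> complex) \<Rightarrow> (complex ^ 'n) set \<Rightarrow> bool" where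
  "holomorphic_on_submanifold f M \<longleftrightarrow>
     (\<forall>z\<in>M. \<exists>U F. open U \<and> z \<in> U \<and> holomorphic_several F U \<and> (\<forall>w\<in>U \<inter> M. f w = F w))"

text \<open>
  The elements are represented by functions on all of \<open>complex ^ 'n\<close>; if \<open>space \<rho> = M\<close>, then
  neither membership nor inner products depend on the values outside \<open>M\<close>.
\<close>

definition holomorphic_L2 ::
  "(complex ^ 'n::finite) set \<Rightarrow> (complex ^ 'n) measure \<Rightarrow> (complex ^ 'n \<Rightarrow> complex) set" where
  "holomorphic_L2 M \<rho> =
     {f. holomorphic_on_submanifold f M \<and> integrable \<rho> (\<lambda>z. (cmod (f z))\<^sup>2)}"

definition L2_reproducing_kernel ::
  "'z set \<Rightarrow> 'z measure \<Rightarrow> ('z \<Rightarrow> complex) set \<Rightarrow> ('z \<Rightarrow> 'z \<Rightarrow> complex) \<Rightarrow> bool" where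
  "L2_reproducing_kernel M \<rho> H \<K> \<longleftrightarrow>
     (\<forall>w\<in>M. (\<lambda>z. \<K> z w) \<in> H \<and> (\<forall>f\<in>H. f w = (LINT z|\<rho>. f z * cnj (\<K> z w))))"

end

theory Submission
  imports Defs "HOL-Complex_Analysis.Complex_Analysis" "HOL-Real_Asymp.Real_Asymp"
begin

text \<open>
  Let \<open>f\<close> be the kernel function at a point \<open>z = \<surd>x c\<close>, with \<open>c\<close> a tripotent of rank one and \<open>x = (z|z)\<close>. The
  value of the kernel at \<open>(z,z)\<close> is \<open>f z\<close>, so it suffices to know the Laurent expansion of \<open>\<tau> \<mapsto> f (\<tau>c)\<close> on the
  punctured plane.

  The link between this line and integrals over the whole manifold is provided by the group \<open>K\<close>. The Jordan
  identity makes \<open>\<i> D(u,u)\<close> a derivation, hence \<open>D(u,v)\<close> and \<open>D(v,u)\<close> are adjoint for the invariant inner product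
  (\<open>T_adjoint\<close>). From this come the Peirce decomposition, and the description of the elements of rank one as the
  non-zero solutions of \<open>{z;x;z} = 2(z|x)z\<close> for all \<open>x\<close> (\<open>rank_one_iff\<close>). That equation is preserved by the maps
  \<open>scaling c \<zeta>\<close>, which multiply the Peirce spaces of \<open>c\<close> of weight 2, 1, 0 by \<open>1\<close>, \<open>\<zeta>\<close>, \<open>\<zeta>\<^sup>2\<close>. For \<open>\<bar>\<zeta>\<bar> = 1\<close> they
  belong to \<open>K\<close>, and for \<open>\<zeta> = 0\<close> they retract \<open>s\<close> to \<open>(s|c)c\<close>. By the mean value property, integrating
  \<open>f (\<tau>s) X((s|c))\<close> over \<open>s\<close> therefore involves only the restriction of \<open>f\<close> to the line through \<open>c\<close>, and a homogeneous
  \<open>X\<close> selects a single Laurent coefficient (\<open>integral_coeff\<close>).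

  Applying the reproducing property to \<open>(\<cdot>|c)\<^sup>m\<close> yields the coefficients of positive index: their contribution to
  \<open>f z\<close> is \<open>x\<^sup>m\<close> divided by the moment of \<open>\<bar>(s|c)\<bar>\<^bsup>2m\<^esup>\<close> over \<open>s\<close> and by a moment of the radial measure. The
  remaining coefficients need not vanish, but they are bounded by the norm of \<open>f\<close> on a shell close to the origin
  (\<open>kernel_expansion\<close>). This bound contains the square root of the kernel itself, and the resulting quadratic
  inequality shows that the remaining coefficients contribute an exponentially small relative error.

  The moments over \<open>s\<close> are computed by partial integration along the vector fields \<open>D(c,u)\<close>, with \<open>u\<close> in the Peirce
  1-space of \<open>c\<close> (\<open>moment_formula\<close>). Their reciprocals are the values at \<open>m\<close> of a polynomial of degree \<open>p - 2\<close> with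
  leading coefficient \<open>\<Gamma>(a/2) / (\<Gamma>(d/r) \<Gamma>(ar/2))\<close> (\<open>inverse_moment_poly\<close>), which explains the number of terms and
  the normalising factor. Expanding this polynomial in falling factorials reduces the series to the sums
  \<open>\<Sum>\<^sub>m Y\<^bsup>qm+g-1\<^esup> / \<Gamma>(qm+g)\<close> with \<open>q = 1/\<alpha>\<close> and \<open>Y = \<nu> x\<^sup>\<alpha>\<close>. Such a sum is \<open>e\<^sup>Y/q\<close> up to a term of order \<open>e\<^bsup>\<kappa>Y\<^esup>\<close>
  with \<open>\<kappa> < 1\<close> (\<open>mittag_leffler_asymptotics\<close>), because its Laplace transform has a simple pole at \<open>1\<close> and no other
  singularity in some half-plane to the right of \<open>\<kappa>\<close>.
\<close>

no_notation fps_nth (infixl "$" 75)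

unbundle no fps_syntax

section \<open>Hermitian inner products and orthonormal bases\<close>

lemma scaleR_vec_complex: "r *\<^sub>R (v :: complex ^ 'n) = complex_of_real r *s v"
  by (simp add: vec_eq_iff) (simp add: scaleR_conv_of_real)

text \<open>Polarisation, with the vectors \<open>u + v\<close> and \<open>\<i>u + v\<close>.\<close>

lemma sesquilinear_zero:
  fixes f :: "complex ^ 'n \<Rightarrow> complex ^ 'n \<Rightarrow> complex"
  assumes add: "\<And>u u' v. f (u + u') v = f u v + f u' v" "\<And>u v v'. f u (v + v') = f u v + f u v'"
    and scale: "\<And>c u v. f (c *s u) v = c * f u v" "\<And>c u v. f u (c *s v) = cnj c * f u v"
    and self: "\<And>u. f u u = 0"
  shows "f u v = 0"
proof -
  have "f (u + v) (u + v) = f u u + f u v + (f v u + f v v)"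
    by (simp only: add add_ac)
  then have "f u v + f v u = 0" by (simp add: self)
  moreover have "f (\<i> *s u + v) (\<i> *s u + v) = \<i> * cnj \<i> * f u u + \<i> * f u v + (cnj \<i> * f v u + f v v)"
    by (simp only: add scale add_ac mult_ac distrib_left)
  then have "\<i> * (f u v - f v u) = 0" by (simp add: self algebra_simps)
  ultimately show ?thesis by (auto simp: complex_eq_iff)
qed

locale hermitian_form =
  fixes ip :: "complex ^ 'n::finite \<Rightarrow> complex ^ 'n \<Rightarrow> complex"
  assumes ip_linear: "\<And>w. Vector_Spaces.linear (*s) (*) (\<lambda>z. ip z w)"
    and ip_commute: "\<And>z w. ip w z = cnj (ip z w)"
    and ip_pos: "\<And>z. z \<noteq> 0 \<Longrightarrow> 0 < Re (ip z z)"
begin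

lemma ip_add_left: "ip (x + y) w = ip x w + ip y w"
  using ip_linear[of w] by (simp add: Vector_Spaces.linear_iff)

lemma ip_scale_left: "ip (c *s x) w = c * ip x w"
  using ip_linear[of w] by (simp add: Vector_Spaces.linear_iff)

lemma ip_add_right: "ip w (x + y) = ip w x + ip w y"
  by (metis ip_commute ip_add_left complex_cnj_add)

lemma ip_scale_right: "ip w (c *s x) = cnj c * ip w x"
  by (metis ip_commute ip_scale_left complex_cnj_mult)

lemma ip_zero_left [simp]: "ip 0 w = 0"
  using ip_scale_left[of 0 0 w] by simp

lemma ip_zero_right [simp]: "ip w 0 = 0"
  using ip_scale_right[of w 0 0] by simp

lemma ip_minus_left: "ip (- x) w = - ip x w"
  using ip_scale_left[of "-1" x w] by simp

lemma ip_minus_right: "ip w (- x) = - ip w x"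
  using ip_scale_right[of w "-1" x] by simp

lemma ip_diff_left: "ip (x - y) w = ip x w - ip y w"
  using ip_add_left[of x "- y" w] by (simp add: ip_minus_left)

lemma ip_diff_right: "ip w (x - y) = ip w x - ip w y"
  using ip_add_right[of w x "- y"] by (simp add: ip_minus_right)

lemma ip_sum_left: "ip (\<Sum>i\<in>I. f i) w = (\<Sum>i\<in>I. ip (f i) w)"
  by (induction I rule: infinite_finite_induct) (auto simp: ip_add_left)

lemma ip_sum_right: "ip w (\<Sum>i\<in>I. f i) = (\<Sum>i\<in>I. ip w (f i))"
  by (induction I rule: infinite_finite_induct) (auto simp: ip_add_right)

lemma ip_scaleR_left: "ip (r *\<^sub>R x) w = r * ip x w"
  by (simp add: scaleR_vec_complex ip_scale_left)

lemma ip_scaleR_right: "ip w (r *\<^sub>R x) = r * ip w x"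
  by (simp add: scaleR_vec_complex ip_scale_right)

lemmas ip_simps = ip_add_left ip_add_right ip_scale_left ip_scale_right ip_minus_left ip_minus_right
  ip_diff_left ip_diff_right ip_scaleR_left ip_scaleR_right

lemma Im_ip_self [simp]: "Im (ip z z) = 0"
  using ip_commute[of z z] by (simp add: complex_eq_iff)

lemma ip_self_Re: "ip z z = complex_of_real (Re (ip z z))"
  by (simp add: complex_eq_iff)

lemma ip_self_nonneg: "0 \<le> Re (ip z z)"
  using ip_pos[of z] by (cases "z = 0") auto

lemma ip_self_eq_0: "ip z z = 0 \<longleftrightarrow> z = 0"
  using ip_pos[of z] by (metis ip_zero_left less_irrefl zero_complex.simps(1))

lemma ip_Re_self_eq_0: "Re (ip z z) = 0 \<longleftrightarrow> z = 0"
  using ip_pos[of z] by (metis ip_zero_left less_irrefl zero_complex.simps(1))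

lemma ip_ext: "(\<And>w. ip x w = ip y w) \<Longrightarrow> x = y"
  by (metis ip_diff_left ip_self_eq_0 eq_iff_diff_eq_0)

lemma ip_mult_cnj: "ip x y * ip y x = complex_of_real ((cmod (ip x y))\<^sup>2)"
  by (metis ip_commute complex_norm_square)

lemma bounded_bilinear_ip: "bounded_bilinear ip"
proof -
  have "bilinear ip"
    unfolding bilinear_def
    by (intro conjI allI linearI; simp only: ip_add_left ip_add_right ip_scaleR_left ip_scaleR_right)
      (simp_all add: scaleR_conv_of_real)
  then show ?thesis by (simp add: bilinear_conv_bounded_bilinear)
qed

lemma continuous_ip [continuous_intros]:
  "continuous_on S f \<Longrightarrow> continuous_on S g \<Longrightarrow> continuous_on S (\<lambda>x. ip (f x) (g x))"
  by (rule bounded_bilinear.continuous_on[OF bounded_bilinear_ip])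

definition onb :: "(complex ^ 'n) set \<Rightarrow> (complex ^ 'n) set \<Rightarrow> bool" where
  "onb B W \<longleftrightarrow> finite B \<and> vec.span B = W \<and> (\<forall>u\<in>B. \<forall>v\<in>B. ip u v = of_bool (u = v))"

lemma onb_finite: "onb B W \<Longrightarrow> finite B"
  and onb_span: "onb B W \<Longrightarrow> vec.span B = W"
  and onb_ip: "onb B W \<Longrightarrow> u \<in> B \<Longrightarrow> v \<in> B \<Longrightarrow> ip u v = of_bool (u = v)"
  by (auto simp: onb_def)

lemma onb_subset: "onb B W \<Longrightarrow> u \<in> B \<Longrightarrow> u \<in> W"
  by (auto simp: onb_def vec.span_base)

lemma onb_coeff:
  assumes "finite B" "\<forall>u\<in>B. \<forall>v\<in>B. ip u v = of_bool (u = v)" "v \<in> B"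
  shows "ip (\<Sum>u\<in>B. c u *s u) v = c v"
proof -
  have "ip (\<Sum>u\<in>B. c u *s u) v = (\<Sum>u\<in>B. if u = v then c v else 0)"
    using assms by (auto simp: ip_sum_left ip_scale_left intro!: sum.cong)
  then show ?thesis using assms by simp
qed

lemma onb_expand:
  assumes "onb B W" "x \<in> W"
  shows "x = (\<Sum>u\<in>B. ip x u *s u)"
proof -
  obtain c where c: "x = (\<Sum>u\<in>B. c u *s u)"
    using assms vec.span_finite[of B] by (auto simp: onb_def)
  then show ?thesis
    using assms onb_coeff[of B _ c] by (auto simp: onb_def intro!: sum.cong)
qed

lemma onb_ip_expand:
  assumes "onb B W" "x \<in> W"
  shows "ip x y = (\<Sum>u\<in>B. ip x u * ip u y)"
  by (subst onb_expand[OF assms]) (simp add: ip_sum_left ip_scale_left)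

lemma onb_norm_expand:
  assumes "onb B W" "x \<in> W"
  shows "Re (ip x x) = (\<Sum>u\<in>B. (cmod (ip x u))\<^sup>2)"
proof -
  have "ip x x = (\<Sum>u\<in>B. complex_of_real ((cmod (ip x u))\<^sup>2))"
    unfolding onb_ip_expand[OF assms, of x] by (simp only: ip_mult_cnj)
  then show ?thesis by simp
qed

lemma independent_orthonormal:
  assumes "finite B" "\<forall>u\<in>B. \<forall>v\<in>B. ip u v = of_bool (u = v)"
  shows "vec.independent B"
  using assms onb_coeff[OF assms] by (subst vec.independent_explicit) (metis ip_zero_left)

lemma onb_card:
  assumes "onb B W"
  shows "card B = vec.dim W"
  using independent_orthonormal[of B] assms
  by (auto simp: onb_def vec.dim_span vec.dim_eq_card_independent)

lemma onb_extend:
  assumes B: "finite B" "\<forall>u\<in>B. \<forall>v\<in>B. ip u v = of_bool (u = v)" and x: "x \<notin> vec.span B"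
  shows "\<exists>y. y \<in> vec.span (insert x B) \<and> y \<notin> B \<and> (\<forall>u\<in>insert y B. \<forall>v\<in>insert y B. ip u v = of_bool (u = v))"
proof -
  define z where "z = x - (\<Sum>u\<in>B. ip x u *s u)"
  have s: "(\<Sum>u\<in>B. ip x u *s u) \<in> vec.span B"
    by (intro vec.span_sum vec.span_scale vec.span_base)
  have z0: "z \<noteq> 0" using x s by (auto simp: z_def)
  have zB: "ip z v = 0" if "v \<in> B" for v
    using onb_coeff[OF B that, of "ip x"] by (simp add: z_def ip_diff_left)
  define r where "r = sqrt (Re (ip z z))"
  have r: "r > 0" using ip_pos[OF z0] by (simp add: r_def)
  have rr: "ip z z = r * r"
    using ip_self_nonneg[of z] by (subst ip_self_Re) (simp add: r_def flip: of_real_mult)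
  define y where "y = (1 / complex_of_real r) *s z"
  have "ip y y = 1" using r rr by (simp add: y_def ip_scale_left ip_scale_right)
  moreover have yB: "ip y v = 0" "ip v y = 0" if "v \<in> B" for v
    using zB[OF that] ip_commute[of z v] by (simp_all add: y_def ip_scale_left ip_scale_right)
  moreover have "y \<notin> B" using calculation by auto
  moreover have "y \<in> vec.span (insert x B)"
    unfolding y_def z_def using s vec.span_mono[of B "insert x B"]
    by (intro vec.span_scale vec.span_diff) (auto intro: vec.span_base)
  ultimately show ?thesis using B by (intro exI[of _ y]) auto
qed

lemma onb_exists:
  assumes W: "vec.subspace W"
  shows "\<exists>B. onb B W"
proof -
  define P where "P B \<longleftrightarrow> finite B \<and> B \<subseteq> W \<and> (\<forall>u\<in>B. \<forall>v\<in>B. ip u v = of_bool (u = v))" for B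
  have "P {}" by (simp add: P_def)
  moreover have bd: "card B < Suc CARD('n)" if "P B" for B
  proof -
    have "card B = vec.dim B"
      using that independent_orthonormal[of B] by (simp add: P_def vec.dim_eq_card_independent)
    then show ?thesis
      using vec.dim_subset[of B UNIV] by (simp add: card_cart_basis)
  qed
  ultimately obtain B where B: "P B" and max: "\<And>B'. P B' \<Longrightarrow> card B' \<le> card B"
    using ex_has_greatest_nat[of P "{}" card "Suc CARD('n)"] by blast
  have "vec.span B = W"
  proof (rule ccontr)
    assume "vec.span B \<noteq> W"
    moreover have "vec.span B \<subseteq> W" using B W by (simp add: P_def vec.span_minimal)
    ultimately obtain x where x: "x \<in> W" "x \<notin> vec.span B" by auto
    then obtain y where y: "y \<in> vec.span (insert x B)" "y \<notin> B"
        "\<forall>u\<in>insert y B. \<forall>v\<in>insert y B. ip u v = of_bool (u = v)"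
      using onb_extend[of B x] B by (auto simp: P_def)
    have "y \<in> W" using y(1) x(1) B W by (meson P_def insert_subset subsetD vec.span_minimal)
    then have "P (insert y B)" using y B by (auto simp: P_def)
    then show False using max[of "insert y B"] y(2) B by (simp add: P_def)
  qed
  then show ?thesis using B by (auto simp: onb_def P_def)
qed

lemma onb_UN:
  assumes fin: "finite I" and B: "\<And>i. i \<in> I \<Longrightarrow> onb (B i) (W i)"
    and orth: "\<And>i j x y. i \<in> I \<Longrightarrow> j \<in> I \<Longrightarrow> i \<noteq> j \<Longrightarrow> x \<in> W i \<Longrightarrow> y \<in> W j \<Longrightarrow> ip x y = 0"
  shows "onb (\<Union>i\<in>I. B i) (vec.span (\<Union>i\<in>I. W i))"
    and "card (\<Union>i\<in>I. B i) = (\<Sum>i\<in>I. vec.dim (W i))"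
proof -
  have 1: "ip u v = of_bool (u = v)" if "i \<in> I" "j \<in> I" "u \<in> B i" "v \<in> B j" for i j u v
  proof (cases "i = j")
    case True
    then show ?thesis using onb_ip[OF B[OF that(1)]] that by auto
  next
    case False
    then have "ip u v = 0" using orth that onb_subset[OF B] by blast
    moreover have "u \<noteq> v" using onb_ip[OF B[OF that(1)] that(3,3)] \<open>ip u v = 0\<close> by auto
    ultimately show ?thesis by simp
  qed
  have "vec.span (\<Union>i\<in>I. W i) \<subseteq> vec.span (\<Union>i\<in>I. B i)"
  proof (rule vec.span_minimal)
    show "(\<Union>i\<in>I. W i) \<subseteq> vec.span (\<Union>i\<in>I. B i)"
      using onb_span[OF B] vec.span_mono[of "B _" "\<Union>i\<in>I. B i"] by blast
  qed simp
  moreover have "vec.span (\<Union>i\<in>I. B i) \<subseteq> vec.span (\<Union>i\<in>I. W i)"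
    using onb_subset[OF B] by (intro vec.span_mono) auto
  ultimately show "onb (\<Union>i\<in>I. B i) (vec.span (\<Union>i\<in>I. W i))"
    using fin onb_finite[OF B] 1 by (auto simp: onb_def)
  have "B i \<inter> B j = {}" if "i \<in> I" "j \<in> I" "i \<noteq> j" for i j
    using orth[OF that] onb_subset[OF B] onb_ip[OF B[OF that(1)]] that by force
  then have "card (\<Union>i\<in>I. B i) = (\<Sum>i\<in>I. card (B i))"
    using fin onb_finite[OF B] by (intro card_UN_disjoint) auto
  then show "card (\<Union>i\<in>I. B i) = (\<Sum>i\<in>I. vec.dim (W i))"
    using onb_card[OF B] by simp
qed

lemma trace_onb:
  assumes B: "onb B UNIV" and f: "Vector_Spaces.linear (*s) (*s) f"
  shows "trace (matrix f) = (\<Sum>u\<in>B. ip (f u) u)"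
proof -
  interpret f: Vector_Spaces.linear "(*s)" "(*s)" f by fact
  have "f (axis i 1) = (\<Sum>u\<in>B. ip (axis i 1) u *s f u)" for i
    by (subst onb_expand[OF B, of "axis i 1"]) (simp_all add: f.sum f.scale)
  then have "trace (matrix f) = (\<Sum>i\<in>UNIV. \<Sum>u\<in>B. ip (axis i 1) u * f u $ i)"
    by (simp add: trace_def matrix_def)
  also have "\<dots> = (\<Sum>u\<in>B. \<Sum>i\<in>UNIV. ip (axis i 1) u * f u $ i)" by (rule sum.swap)
  also have "\<dots> = (\<Sum>u\<in>B. ip (f u) u)"
  proof (rule sum.cong[OF refl])
    fix u
    have "ip (f u) u = ip (\<Sum>i\<in>UNIV. f u $ i *s axis i 1) u" by (simp add: basis_expansion)
    then show "(\<Sum>i\<in>UNIV. ip (axis i 1) u * f u $ i) = ip (f u) u"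
      by (simp add: ip_sum_left ip_scale_left mult.commute)
  qed
  finally show ?thesis .
qed

text \<open>
  The standard norm of \<open>complex ^ 'n\<close> enters only through this comparison, which makes the unit
  sphere of \<open>ip\<close> and the group \<open>K\<close> bounded.
\<close>

lemma norm_le_ip: "\<exists>C>0. \<forall>z. norm z \<le> C * sqrt (Re (ip z z))"
proof -
  obtain B where B: "onb B UNIV" using onb_exists[OF vec.subspace_UNIV] by auto
  define C where "C = 1 + (\<Sum>u\<in>B. norm u)"
  have C: "C > 0" by (simp add: C_def add_pos_nonneg sum_nonneg)
  have "norm z \<le> C * sqrt (Re (ip z z))" for z
  proof -
    have le: "cmod (ip z u) \<le> sqrt (Re (ip z z))" if "u \<in> B" for u
    proof -
      have "(cmod (ip z u))\<^sup>2 \<le> Re (ip z z)"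
        unfolding onb_norm_expand[OF B UNIV_I] using onb_finite[OF B] that
        by (intro member_le_sum) auto
      then show ?thesis by (simp add: real_le_rsqrt)
    qed
    have "norm (c *s u) = cmod c * norm u" for c and u :: "complex ^ 'n"
      by (simp add: norm_vec_def L2_set_right_distrib norm_mult)
    then have "norm z \<le> (\<Sum>u\<in>B. cmod (ip z u) * norm u)"
      using norm_sum[of "\<lambda>u. ip z u *s u" B] by (simp add: onb_expand[OF B UNIV_I, of z, symmetric])
    also have "\<dots> \<le> (\<Sum>u\<in>B. sqrt (Re (ip z z)) * norm u)"
      using le by (intro sum_mono mult_right_mono) auto
    also have "\<dots> \<le> C * sqrt (Re (ip z z))"
      using ip_self_nonneg[of z] by (simp add: C_def distrib_right sum_distrib_right mult.commute)
    finally show ?thesis .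
  qed
  then show ?thesis using C by blast
qed

lemma compact_ip_sphere: "compact {z. ip z z = 1}"
proof -
  obtain C where C: "\<And>z. norm z \<le> C * sqrt (Re (ip z z))" using norm_le_ip by blast
  have "bounded {z. ip z z = 1}"
    unfolding bounded_iff
  proof (intro exI[of _ C] ballI)
    fix z assume "z \<in> {z. ip z z = 1}"
    then have "ip z z = 1" by blast
    then show "norm z \<le> C" using C[of z] by (simp only: one_complex.sel real_sqrt_one mult_1_right)
  qed
  moreover have "closed {z. ip z z = 1}"
    by (intro closed_Collect_eq continuous_ip continuous_on_id continuous_on_const)
  ultimately show ?thesis by (simp add: compact_eq_bounded_closed)
qed

end

section \<open>One-parameter groups of matrices\<close>

abbreviation clinear :: "(complex ^ 'n \<Rightarrow> complex ^ 'm) \<Rightarrow> bool" where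
  "clinear \<equiv> Vector_Spaces.linear (*s) (*s)"

lemma clinear_iff: "clinear f \<longleftrightarrow> (\<forall>x y. f (x + y) = f x + f y) \<and> (\<forall>c x. f (c *s x) = c *s f x)"
  by (simp add: Vector_Spaces.linear_iff vec.vector_space_axioms)

lemma clinear_imp_linear: "clinear f \<Longrightarrow> linear f"
  by (rule linearI) (simp_all add: clinear_iff scaleR_vec_complex)

lemma clinear_bounded:
  fixes f :: "complex ^ 'n::finite \<Rightarrow> complex ^ 'm::finite"
  shows "clinear f \<Longrightarrow> bounded_linear f"
  by (simp add: clinear_imp_linear linear_conv_bounded_linear[symmetric])

lemma bounded_bilinear_smult_vec:
  "bounded_bilinear ((*s) :: complex \<Rightarrow> complex ^ 'n::finite \<Rightarrow> complex ^ 'n)"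
proof -
  have "bilinear ((*s) :: complex \<Rightarrow> complex ^ 'n \<Rightarrow> complex ^ 'n)"
    unfolding bilinear_def
    by (intro conjI allI linearI) (simp_all add: vec_eq_iff algebra_simps)
  then show ?thesis by (simp add: bilinear_conv_bounded_bilinear)
qed

lemma continuous_smult_vec [continuous_intros]:
  fixes f :: "'a::topological_space \<Rightarrow> complex" and g :: "'a \<Rightarrow> complex ^ 'n::finite"
  shows "continuous_on S f \<Longrightarrow> continuous_on S g \<Longrightarrow> continuous_on S (\<lambda>x. f x *s g x)"
  by (rule bounded_bilinear.continuous_on[OF bounded_bilinear_smult_vec])

lemma clinear_compow: "clinear (X :: complex ^ 'n \<Rightarrow> complex ^ 'n) \<Longrightarrow> clinear (X ^^ n)"
  by (induction n) (auto simp: clinear_iff)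

text \<open>
  Each component is a power series in \<open>t\<close>, so that termwise differentiation of scalar power
  series applies.
\<close>

definition exp_op :: "(complex ^ 'n \<Rightarrow> complex ^ 'n::finite) \<Rightarrow> real \<Rightarrow> complex ^ 'n \<Rightarrow> complex ^ 'n" where
  "exp_op X t z = (\<chi> i. \<Sum>n. ((X ^^ n) z $ i / fact n) * complex_of_real t ^ n)"

lemma summable_exp_op:
  assumes "clinear (X :: complex ^ 'n \<Rightarrow> complex ^ 'n::finite)"
  shows "summable (\<lambda>n. ((X ^^ n) z $ i / fact n) * (w :: complex) ^ n)"
proof -
  obtain B where B: "B > 0" "\<And>x. norm (X x) \<le> norm x * B"
    using bounded_linear.pos_bounded[OF clinear_bounded[OF assms]] by blast
  have 1: "norm ((X ^^ n) z) \<le> norm z * B ^ n" for n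
  proof (induction n)
    case (Suc n)
    have "norm ((X ^^ Suc n) z) \<le> norm ((X ^^ n) z) * B" using B(2) by simp
    also have "\<dots> \<le> norm z * B ^ n * B" using Suc B(1) by (intro mult_right_mono) auto
    finally show ?case by (simp add: mult_ac)
  qed simp
  have "norm (((X ^^ n) z $ i / fact n) * w ^ n) \<le> norm z * ((B * norm w) ^ n /\<^sub>R fact n)" for n
  proof -
    have "norm (((X ^^ n) z $ i / fact n) * w ^ n) = norm ((X ^^ n) z $ i) * (norm w ^ n / fact n)"
      by (simp add: norm_mult norm_divide norm_power)
    also have "\<dots> \<le> norm z * B ^ n * (norm w ^ n / fact n)"
      using order.trans[OF Finite_Cartesian_Product.norm_nth_le 1] by (intro mult_right_mono) auto
    finally show ?thesis by (simp add: power_mult_distrib divide_inverse mult_ac)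
  qed
  then show ?thesis
    by (intro summable_comparison_test'[OF summable_mult[OF summable_exp_generic]])
qed

lemma exp_op_0 [simp]: "exp_op X 0 z = z"
  by (simp add: exp_op_def vec_eq_iff) (subst suminf_finite[of "{0}"], auto)

lemma clinear_exp_op:
  assumes X: "clinear X"
  shows "clinear (exp_op X t)"
proof -
  note lin = clinear_compow[OF X, unfolded clinear_iff] and sm = summable_exp_op[OF X, of _ _ "complex_of_real t"]
  have "exp_op X t (x + y) $ i = exp_op X t x $ i + exp_op X t y $ i" for x y i
    unfolding exp_op_def vec_lambda_beta suminf_add[OF sm sm]
    by (rule suminf_cong) (simp add: lin add_divide_distrib distrib_right)
  moreover have "exp_op X t (c *s x) $ i = c * exp_op X t x $ i" for c x i
    unfolding exp_op_def vec_lambda_beta suminf_mult[OF sm, symmetric]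
    by (rule suminf_cong) (simp add: lin)
  ultimately show ?thesis by (simp add: clinear_iff vec_eq_iff)
qed

lemma exp_op_derivative:
  assumes X: "clinear X"
  shows "((\<lambda>t. exp_op X t z) has_vector_derivative exp_op X t (X z)) (at t within S)"
proof -
  have d: "((\<lambda>w. \<Sum>n. ((X ^^ n) z $ i / fact n) * w ^ n) has_field_derivative
      (\<Sum>n. ((X ^^ n) (X z) $ i / fact n) * w ^ n)) (at w)" for i and w :: complex
  proof -
    have "(\<Sum>n. diffs (\<lambda>n. (X ^^ n) z $ i / fact n) n * w ^ n) = (\<Sum>n. ((X ^^ n) (X z) $ i / fact n) * w ^ n)"
      by (simp add: diffs_def funpow_Suc_right del: funpow.simps of_nat_Suc)
    then show ?thesis
      using termdiffs_strong_converges_everywhere[of "\<lambda>n. (X ^^ n) z $ i / fact n" w]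
        summable_exp_op[OF X, of z i] by (simp del: times_divide_eq_left times_divide_eq_right)
  qed
  have "((\<lambda>t. exp_op X t z $ i) has_vector_derivative exp_op X t (X z) $ i) (at t within S)" for i
    using has_vector_derivative_real_field[OF d] by (simp add: exp_op_def)
  then have "((\<lambda>t. \<Sum>i\<in>UNIV. exp_op X t z $ i *s axis i 1) has_vector_derivative
      (\<Sum>i\<in>UNIV. exp_op X t (X z) $ i *s axis i 1)) (at t within S)"
    by (intro has_vector_derivative_sum bounded_linear.has_vector_derivative
        [OF bounded_bilinear.bounded_linear_left[OF bounded_bilinear_smult_vec]])
  then show ?thesis by (simp add: basis_expansion)
qed

lemma exp_op_commute:
  assumes X: "clinear X"
  shows "exp_op X t (X z) = X (exp_op X t z)"
proof -
  interpret X: Vector_Spaces.linear "(*s)" "(*s)" X by (rule X)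
  have comp: "X v $ i = (\<Sum>j\<in>UNIV. X (axis j 1) $ i * v $ j)" for v i
  proof -
    have "X v = X (\<Sum>j\<in>UNIV. v $ j *s axis j 1)" by (simp add: basis_expansion)
    then show ?thesis by (simp add: X.sum X.scale mult.commute)
  qed
  note sm = summable_exp_op[OF X, of z _ "complex_of_real t"]
  have "X (exp_op X t z) $ i = exp_op X t (X z) $ i" for i
  proof -
    have "X (exp_op X t z) $ i
        = (\<Sum>j\<in>UNIV. X (axis j 1) $ i * (\<Sum>n. ((X ^^ n) z $ j / fact n) * complex_of_real t ^ n))"
      by (simp only: comp[of "exp_op X t z" i]) (simp add: exp_op_def)
    also have "\<dots> = (\<Sum>j\<in>UNIV. \<Sum>n. X (axis j 1) $ i * (((X ^^ n) z $ j / fact n) * complex_of_real t ^ n))"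
      by (simp only: suminf_mult[OF sm])
    also have "\<dots> = (\<Sum>n. \<Sum>j\<in>UNIV. X (axis j 1) $ i * (((X ^^ n) z $ j / fact n) * complex_of_real t ^ n))"
      by (rule suminf_sum[symmetric]) (intro summable_mult sm)
    also have "\<dots> = (\<Sum>n. (X ((X ^^ n) z) $ i / fact n) * complex_of_real t ^ n)"
      by (rule suminf_cong) (simp add: comp[of "(X ^^ _) z"] sum_distrib_left sum_distrib_right sum_divide_distrib mult_ac)
    also have "\<dots> = exp_op X t (X z) $ i"
      by (simp add: exp_op_def funpow_swap1)
    finally show ?thesis .
  qed
  then show ?thesis by (simp add: vec_eq_iff)
qed

text \<open>
  The derivative of \<open>exp (- s X) (g s)\<close> vanishes; the product rule is applied after expanding
  \<open>g s\<close> in the standard basis.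
\<close>

lemma exp_op_solution:
  assumes X: "clinear (X :: complex ^ 'n \<Rightarrow> complex ^ 'n::finite)"
    and g: "\<And>t. (g has_vector_derivative X (g t)) (at t)"
  shows "exp_op X (- t) (g t) = g 0"
proof -
  have expand: "exp_op X t v = (\<Sum>i\<in>UNIV. v $ i *s exp_op X t (axis i 1))" for t v
  proof -
    interpret e: Vector_Spaces.linear "(*s)" "(*s)" "exp_op X t" by (rule clinear_exp_op[OF X])
    have "exp_op X t v = exp_op X t (\<Sum>i\<in>UNIV. v $ i *s axis i 1)" by (simp add: basis_expansion)
    then show ?thesis by (simp add: e.sum e.scale)
  qed
  have expandX: "(\<Sum>i\<in>UNIV. v $ i *s exp_op X t (X (axis i 1))) = exp_op X t (X v)" for t v
  proof -
    have "X (exp_op X t v) = (\<Sum>i\<in>UNIV. v $ i *s X (exp_op X t (axis i 1)))"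
    proof -
      interpret X: Vector_Spaces.linear "(*s)" "(*s)" X by (rule X)
      show ?thesis by (subst expand) (simp add: X.sum X.scale)
    qed
    then show ?thesis by (simp add: exp_op_commute[OF X])
  qed
    have "((\<lambda>s. \<Sum>i\<in>UNIV. g s $ i *s exp_op X (- s) (axis i 1)) has_vector_derivative 0) (at s)" for s
    proof -
      have 1: "((\<lambda>s. g s $ i) has_vector_derivative X (g s) $ i) (at s)" for i
        by (rule bounded_linear.has_vector_derivative[OF bounded_linear_vec_nth g])
      have 2: "((\<lambda>s. exp_op X (- s) v) has_vector_derivative - exp_op X (- s) (X v)) (at s)" for v
        using vector_diff_chain_at[OF has_vector_derivative_minus[OF has_vector_derivative_id] exp_op_derivative[OF X], of v s]
        by (simp add: o_def)
      have "((\<lambda>s. \<Sum>i\<in>UNIV. g s $ i *s exp_op X (- s) (axis i 1)) has_vector_derivative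
          (\<Sum>i\<in>UNIV. g s $ i *s (- exp_op X (- s) (X (axis i 1))) + X (g s) $ i *s exp_op X (- s) (axis i 1))) (at s)"
        by (intro has_vector_derivative_sum bounded_bilinear.has_vector_derivative[OF bounded_bilinear_smult_vec] 1 2)
      also have "(\<Sum>i\<in>UNIV. g s $ i *s (- exp_op X (- s) (X (axis i 1))) + X (g s) $ i *s exp_op X (- s) (axis i 1))
          = - (\<Sum>i\<in>UNIV. g s $ i *s exp_op X (- s) (X (axis i 1))) + (\<Sum>i\<in>UNIV. X (g s) $ i *s exp_op X (- s) (axis i 1))"
        by (simp add: sum.distrib sum_subtractf)
      also have "\<dots> = 0"
        by (simp add: expandX expand[of _ "X (g s)", symmetric])
      finally show ?thesis .
    qed
    then obtain c where c: "\<And>s. (\<Sum>i\<in>UNIV. g s $ i *s exp_op X (- s) (axis i 1)) = c"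
      using has_vector_derivative_zero_constant[OF convex_UNIV] by auto
    show ?thesis using c[of t] c[of 0] by (simp add: expand[symmetric] basis_expansion)
qed

lemma exp_op_inverse:
  assumes X: "clinear X"
  shows "exp_op X (- t) (exp_op X t z) = z"
  using exp_op_solution[OF X, of "\<lambda>t. exp_op X t z"] exp_op_derivative[OF X, of z]
  by (simp add: exp_op_commute[OF X])

lemma linear_ode_unique:
  assumes X: "clinear (X :: complex ^ 'n \<Rightarrow> complex ^ 'n::finite)"
    and g: "\<And>t. (g has_vector_derivative X (g t)) (at t)"
  shows "g t = exp_op X t (g 0)"
  using exp_op_solution[OF X g, of t] exp_op_inverse[OF X, of "- t" "g t"] by simp

section \<open>The associative inner product of a hermitian Jordan triple\<close>

locale jordan_triple =
  fixes T :: "'n::finite triple" and ip :: "complex ^ 'n \<Rightarrow> complex ^ 'n \<Rightarrow> complex"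
  assumes hjt: "hermitian_jordan_triple T" and jip: "jt_inner_product T ip"
begin

sublocale hermitian_form ip
proof (rule hermitian_form.intro)
  note j = jip[unfolded jt_inner_product_def]
  note a = j[THEN conjunct1] j[THEN conjunct2, THEN conjunct1] j[THEN conjunct2, THEN conjunct2, THEN conjunct1]
  show "Vector_Spaces.linear (*s) (*) (\<lambda>z. ip z w)" for w by (rule a(1)[rule_format])
  show "ip w z = cnj (ip z w)" for z w by (rule a(2)[rule_format])
  show "z \<noteq> 0 \<Longrightarrow> 0 < Re (ip z z)" for z by (rule a(3)[rule_format])
qed

lemmas T_axioms = hjt[unfolded hermitian_jordan_triple_def]

lemma T_clinear_left: "clinear (\<lambda>u. T u v w)"
  by (rule T_axioms[THEN conjunct1, rule_format])

lemma T_commute: "T u v w = T w v u"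
  by (rule T_axioms[THEN conjunct2, THEN conjunct1, rule_format])

lemma T_add_left: "T (x + y) v w = T x v w + T y v w"
  and T_scale_left: "T (c *s x) v w = c *s T x v w"
  using T_clinear_left[of v w] by (simp_all add: clinear_iff)

lemma T_add_mid: "T u (x + y) w = T u x w + T u y w"
  and T_scale_mid: "T u (c *s x) w = cnj c *s T u x w"
  using T_axioms[THEN conjunct2, THEN conjunct2, THEN conjunct1, rule_format]
    T_axioms[THEN conjunct2, THEN conjunct2, THEN conjunct2, THEN conjunct1, rule_format] .

lemma T_add_right: "T u v (x + y) = T u v x + T u v y"
  using T_add_left[of x y v u] by (simp add: T_commute[of _ v u])

lemma T_scale_right: "T u v (c *s x) = c *s T u v x"
  using T_scale_left[of c x v u] by (simp add: T_commute[of _ v u])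

lemma T_clinear: "clinear (T u v)"
  by (simp add: clinear_iff T_add_right T_scale_right)

lemma T_zero [simp]: "T 0 v w = 0" "T u 0 w = 0" "T u v 0 = 0"
  using T_scale_left[of 0 0 v w] T_scale_mid[of u 0 0 w] T_scale_right[of u v 0 0] by simp_all

lemma T_minus: "T (- u) v w = - T u v w" "T u (- v) w = - T u v w" "T u v (- w) = - T u v w"
  using T_scale_left[of "-1" u v w] T_scale_mid[of u "-1" v w] T_scale_right[of u v "-1" w] by simp_all

lemma T_diff: "T (u - u') v w = T u v w - T u' v w" "T u (v - v') w = T u v w - T u v' w"
    "T u v (w - w') = T u v w - T u v w'"
  using T_add_left[of u "- u'"] T_add_mid[of u v "- v'"] T_add_right[of u v w "- w'"]
  by (simp_all add: T_minus)

lemma T_scaleR: "T (r *\<^sub>R u) v w = r *\<^sub>R T u v w" "T u (r *\<^sub>R v) w = r *\<^sub>R T u v w"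
    "T u v (r *\<^sub>R w) = r *\<^sub>R T u v w"
  by (simp_all add: scaleR_vec_complex T_scale_left T_scale_mid T_scale_right)

lemma T_sum_left: "T (\<Sum>i\<in>I. f i) v w = (\<Sum>i\<in>I. T (f i) v w)"
  and T_sum_mid: "T u (\<Sum>i\<in>I. f i) w = (\<Sum>i\<in>I. T u (f i) w)"
  and T_sum_right: "T u v (\<Sum>i\<in>I. f i) = (\<Sum>i\<in>I. T u v (f i))"
  by (induction I rule: infinite_finite_induct) (auto simp: T_add_left T_add_mid T_add_right)

lemmas T_add = T_add_left T_add_mid T_add_right
lemmas T_scale = T_scale_left T_scale_mid T_scale_right

lemma jordan_identity:
  "T x y (T u v w) = T u v (T x y w) + T (T x y u) v w - T u (T v x y) w"
proof -
  have "T x y (T u v w) - T u v (T x y w) = T (T x y u) v w - T u (T v x y) w"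
    using T_axioms[THEN conjunct2, THEN conjunct2, THEN conjunct2, THEN conjunct2, THEN conjunct1, rule_format] .
  then show ?thesis by (simp add: algebra_simps)
qed

lemma bounded_bilinear_T: "bounded_bilinear (T u)"
proof -
  have "bilinear (T u)"
    unfolding bilinear_def by (intro conjI allI linearI) (simp_all add: T_add T_scaleR)
  then show ?thesis by (simp add: bilinear_conv_bounded_bilinear)
qed

lemma T_expand: "T u v w = (\<Sum>i\<in>UNIV. u $ i *s T (axis i 1) v w)"
  using T_sum_left[of "\<lambda>i. u $ i *s axis i 1" UNIV v w] by (simp add: T_scale_left basis_expansion)

lemma continuous_T [continuous_intros]:
  assumes "continuous_on S f" "continuous_on S g" "continuous_on S h"
  shows "continuous_on S (\<lambda>x. T (f x) (g x) (h x))"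
  unfolding T_expand[of "f _"]
  by (intro continuous_on_sum continuous_smult_vec continuous_on_component
      bounded_bilinear.continuous_on[OF bounded_bilinear_T] assms)

lemma T_has_vector_derivative:
  assumes u: "(u has_vector_derivative u') (at t within S)"
    and v: "(v has_vector_derivative v') (at t within S)"
    and w: "(w has_vector_derivative w') (at t within S)"
  shows "((\<lambda>t. T (u t) (v t) (w t)) has_vector_derivative
           T u' (v t) (w t) + T (u t) v' (w t) + T (u t) (v t) w') (at t within S)"
proof -
  have "((\<lambda>t. \<Sum>i\<in>UNIV. u t $ i *s T (axis i 1) (v t) (w t)) has_vector_derivative
      (\<Sum>i\<in>UNIV. u t $ i *s (T (axis i 1) (v t) w' + T (axis i 1) v' (w t)) + u' $ i *s T (axis i 1) (v t) (w t)))
      (at t within S)"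
    by (intro has_vector_derivative_sum bounded_bilinear.has_vector_derivative[OF bounded_bilinear_smult_vec]
        bounded_bilinear.has_vector_derivative[OF bounded_bilinear_T]
        bounded_linear.has_vector_derivative[OF bounded_linear_vec_nth] u v w)
  also have "(\<lambda>t. \<Sum>i\<in>UNIV. u t $ i *s T (axis i 1) (v t) (w t)) = (\<lambda>t. T (u t) (v t) (w t))"
    by (simp add: T_expand[of "u _"])
  also have "(\<Sum>i\<in>UNIV. u t $ i *s (T (axis i 1) (v t) w' + T (axis i 1) v' (w t)) + u' $ i *s T (axis i 1) (v t) (w t))
      = T u' (v t) (w t) + T (u t) v' (w t) + T (u t) (v t) w'"
    by (simp add: T_expand[of u'] T_expand[of "u t"] sum.distrib vec.scale_right_distrib)
  finally show ?thesis .
qed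

definition derivation :: "(complex ^ 'n \<Rightarrow> complex ^ 'n) \<Rightarrow> bool" where
  "derivation X \<longleftrightarrow> clinear X \<and> (\<forall>u v w. X (T u v w) = T (X u) v w + T u (X v) w + T u v (X w))"

text \<open>
  By the product rule the right-hand side solves \<open>y' = X y\<close>; the left-hand side is the solution
  with the same initial value.
\<close>

lemma exp_derivation_hom:
  assumes X: "derivation X"
  shows "exp_op X t (T u v w) = T (exp_op X t u) (exp_op X t v) (exp_op X t w)"
proof -
  have lin: "clinear X" and der: "\<And>u v w. X (T u v w) = T (X u) v w + T u (X v) w + T u v (X w)"
    using X by (auto simp: derivation_def)
  let ?g = "\<lambda>t. T (exp_op X t u) (exp_op X t v) (exp_op X t w)"
  have "(?g has_vector_derivative X (?g t)) (at t)" for t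
    unfolding der
    using T_has_vector_derivative[OF exp_op_derivative[OF lin] exp_op_derivative[OF lin] exp_op_derivative[OF lin]]
    by (simp add: exp_op_commute[OF lin])
  from linear_ode_unique[OF lin this, of t] show ?thesis by simp
qed

lemma matrix_exp_op: "clinear X \<Longrightarrow> matrix (exp_op X t) *v z = exp_op X t z"
  by (simp add: matrix_works clinear_exp_op)

lemma exp_derivation_in_K:
  assumes X: "derivation X"
  shows "matrix (exp_op X t) \<in> jt_K T"
proof -
  have lin: "clinear X" using X by (simp add: derivation_def)
  let ?M = "\<lambda>s. matrix (exp_op X s)"
  have aut: "?M s \<in> jt_aut T" for s
  proof -
    have "?M (- s) ** ?M s = mat 1" "?M s ** ?M (- s) = mat 1"
      using exp_op_inverse[OF lin, of s] exp_op_inverse[OF lin, of "- s"]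
      by (simp_all add: matrix_eq matrix_vector_mul_assoc[symmetric] matrix_exp_op[OF lin])
    then show ?thesis
      by (auto simp: jt_aut_def invertible_def matrix_exp_op[OF lin] exp_derivation_hom[OF X])
  qed
  have "continuous_on UNIV (\<lambda>s. exp_op X s z)" for z
    using exp_op_derivative[OF lin, of z] by (auto simp: continuous_on_eq_continuous_at intro!: has_vector_derivative_continuous)
  then have "continuous_on UNIV ?M"
    unfolding matrix_def by (intro continuous_on_vec_lambda continuous_on_component)
  then have "connected (range ?M)" by (intro connected_continuous_image) auto
  moreover have "mat 1 = ?M 0" by (simp add: matrix_eq matrix_exp_op[OF lin])
  then have "mat 1 \<in> range ?M" by (metis rangeI)
  ultimately have "connected_component (jt_aut T) (mat 1) (?M t)"
    using aut by (auto simp: connected_component_def intro!: exI[of _ "range ?M"])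
  then show ?thesis by (simp add: jt_K_def)
qed

lemma ip_K: "k \<in> jt_K T \<Longrightarrow> ip (k *v z) (k *v w) = ip z w"
  using jip[unfolded jt_inner_product_def, THEN conjunct2, THEN conjunct2, THEN conjunct2, THEN conjunct1]
  by (elim ballE allE) (assumption | contradiction)+

lemma ip_derivation:
  assumes X: "derivation X"
  shows "ip (X x) y + ip x (X y) = 0"
proof -
  have lin: "clinear X" using X by (simp add: derivation_def)
  have "ip (exp_op X t x) (exp_op X t y) = ip x y" for t
    using ip_K[OF exp_derivation_in_K[OF X, of t], of x y] by (simp add: matrix_exp_op[OF lin])
  then have "((\<lambda>t. ip x y) has_vector_derivative ip x (X y) + ip (X x) y) (at 0)"
    using bounded_bilinear.has_vector_derivative[OF bounded_bilinear_ip exp_op_derivative[OF lin] exp_op_derivative[OF lin], of x y 0 UNIV]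
    by simp
  then have "ip x (X y) + ip (X x) y = 0"
    using has_vector_derivative_const vector_derivative_unique_at by blast
  then show ?thesis by (simp add: add.commute)
qed

lemma derivation_T_self: "derivation (\<lambda>z. \<i> *s T u u z)"
  unfolding derivation_def
proof (intro conjI allI)
  show "clinear (\<lambda>z. \<i> *s T u u z)"
    by (simp add: clinear_iff T_add T_scale vec.scale_right_distrib vec.scale_left_commute)
  fix x y z
  show "\<i> *s T u u (T x y z) = T (\<i> *s T u u x) y z + T x (\<i> *s T u u y) z + T x y (\<i> *s T u u z)"
    unfolding jordan_identity[of u u x y z] T_commute[of y u u]
    by (simp add: T_scale vec.scale_right_distrib vec.scale_right_diff_distrib)
qed

text \<open>
  The operators \<open>\<i> D(u,u)\<close> are derivations, so they generate one-parameter subgroups of \<open>K\<close>, and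
  invariance of the inner product makes \<open>D(u,u)\<close> self-adjoint; polarisation does the rest.
\<close>

lemma T_adjoint: "ip (T u v x) y = ip x (T v u y)"
proof -
  define f where "f u v = ip (T u v x) y - ip x (T v u y)" for u v
  have "f u v = 0"
  proof (rule sesquilinear_zero[of f])
    show "f u u = 0" for u
      using ip_derivation[OF derivation_T_self, of u x y]
      by (simp add: f_def ip_simps flip: right_diff_distrib)
  qed (simp_all add: f_def T_add T_scale ip_simps algebra_simps)
  then show ?thesis by (simp add: f_def)
qed

end

section \<open>Peirce decomposition\<close>

context jordan_triple begin

text \<open>
  The cube of \<open>z\<close> being a multiple of \<open>z\<close> already forces the polynomial relation for \<open>D(z,z)\<close>
  behind the Peirce decomposition. With $Pw=\{z;w;z\}$ one gets $DP=PD=\mu P$ and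
  $2D^2-\mu D=P^2$ from two instances of the Jordan identity and, for the second relation, their
  adjoint.
\<close>

context
  fixes z and \<mu> :: real
  assumes cube: "T z z z = \<mu> *s z"
begin

lemma cube_shift: "2 *s T z (T z z w) y = \<mu> *s T z w y + T (T z w z) z y"
proof -
  have "T z z (T z w y) = T z w (T z z y) + \<mu> *s T z w y - T z (T z z w) y"
    using jordan_identity[of z z z w y] by (simp add: cube T_scale T_commute[of w z z])
  moreover have "T z w (T z z y) = T z z (T z w y) + T (T z w z) z y - T z (T z z w) y"
    by (rule jordan_identity)
  ultimately show ?thesis by (simp add: vec_eq_iff algebra_simps)
qed

lemma cube_PD: "T z (T z z w) z = \<mu> *s T z w z"
  and cube_DP: "T z z (T z w z) = \<mu> *s T z w z"
proof -
  have 1: "T z z (T z w z) = 2 * \<mu> *s T z w z - T z (T z z w) z"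
    using jordan_identity[of z z z w z] by (simp add: cube T_scale T_commute[of w z z] vec_eq_iff)
  have "2 *s T z (T z z w) z = \<mu> *s T z w z + T z z (T z w z)"
    using cube_shift[of w z] by (simp add: T_commute[of _ z z])
  have "T z (T z z w) z $ i = (\<mu> *s T z w z) $ i" for i
  proof -
    have "T z z (T z w z) $ i = 2 * \<mu> * T z w z $ i - T z (T z z w) z $ i" by (simp add: 1)
    moreover have "2 * T z (T z z w) z $ i = \<mu> * T z w z $ i + T z z (T z w z) $ i"
      using arg_cong[OF \<open>2 *s T z (T z z w) z = _\<close>, of "\<lambda>v. v $ i"] by simp
    ultimately show ?thesis by simp
  qed
  then show 2: "T z (T z z w) z = \<mu> *s T z w z" by (simp add: vec_eq_iff)
  show "T z z (T z w z) = \<mu> *s T z w z"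
    unfolding 1 2 by (simp add: vec_eq_iff)
qed

lemma cube_PP: "T z (T z w z) z = 2 *s T z z (T z z w) - \<mu> *s T z z w"
proof -
  have "2 *s T (T z z w) z y = \<mu> *s T w z y + T z (T z w z) y" for y
  proof (rule ip_ext)
    fix x
    have "ip (2 *s T (T z z w) z y) x = ip y (2 *s T z (T z z w) x)"
      by (simp add: ip_simps T_adjoint)
    also have "\<dots> = ip y (\<mu> *s T z w x + T (T z w z) z x)"
      by (simp only: cube_shift)
    finally show "ip (2 *s T (T z z w) z y) x = ip (\<mu> *s T w z y + T z (T z w z) y) x"
      by (simp add: ip_simps T_adjoint)
  qed
  from this[of z] show ?thesis
    by (simp add: T_commute[of _ z z] vec_eq_iff)
qed

lemma cube_cubic: "2 *s T z z (T z z (T z z w)) = 3 * \<mu> *s T z z (T z z w) - \<mu> * \<mu> *s T z z w"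
proof -
  have "T z z (2 *s T z z (T z z w) - \<mu> *s T z z w) = \<mu> *s (2 *s T z z (T z z w) - \<mu> *s T z z w)"
    unfolding cube_PP[symmetric] by (rule cube_DP)
  then show ?thesis
    by (simp add: T_diff T_scale vec_eq_iff algebra_simps)
qed

text \<open>
  The eigenvalues of \<open>D(z,z)\<close> are thus among \<open>0\<close>, \<open>\<mu>/2\<close>, \<open>\<mu>\<close>, and
  $\mu D=D^2+(2D-\frac2\mu D^2)^2$ exhibits the sign.
\<close>

lemma cube_quadratic_form:
  assumes "\<mu> \<noteq> 0"
  shows "0 \<le> \<mu> * Re (ip (T z z x) x)"
proof -
  define h where "h x = 2 *s T z z x - (2 / \<mu>) *s T z z (T z z x)" for x
  have sa: "ip (T z z x) y = ip x (T z z y)" for x y by (rule T_adjoint)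
  have "ip (h x) y = ip x (h y)" for x y
    by (simp add: h_def ip_simps sa)
  then have 1: "ip (h (h x)) x = ip (h x) (h x)" by simp
  have c3: "T z z (T z z (T z z w)) = (3 * \<mu> / 2) *s T z z (T z z w) - (\<mu> * \<mu> / 2) *s T z z w" for w
    using cube_cubic[of w] by (simp add: vec_eq_iff field_simps)
  have "\<mu> *s T z z x = T z z (T z z x) + h (h x)"
    using assms unfolding h_def
    by (simp add: T_add T_diff T_scale c3) (simp add: vec_eq_iff field_simps)
  then have "ip (\<mu> *s T z z x) x = ip (T z z (T z z x) + h (h x)) x" by simp
  then have "\<mu> * ip (T z z x) x = ip (T z z x) (T z z x) + ip (h x) (h x)"
    by (simp only: ip_simps 1 sa[of "T z z x" x])
  from arg_cong[OF this, of Re]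
  have "\<mu> * Re (ip (T z z x) x) = Re (ip (T z z x) (T z z x)) + Re (ip (h x) (h x))" by simp
  then show ?thesis using ip_self_nonneg by simp
qed

text \<open>
  For \<open>\<mu> = 0\<close> the self-adjoint operator \<open>D(z,z)\<close> would be nilpotent, for \<open>\<mu> < 0\<close> negative
  semidefinite; both contradict the positivity of its trace.
\<close>

lemma cube_pos:
  assumes z: "z \<noteq> 0"
  shows "\<mu> > 0"
proof -
  obtain B where B: "onb B UNIV" using onb_exists[OF vec.subspace_UNIV] by auto
  have "0 < Re (trace (matrix (T z z)))"
    using T_axioms[THEN conjunct2, THEN conjunct2, THEN conjunct2, THEN conjunct2, THEN conjunct2, THEN conjunct2] z
    by blast
  also have "trace (matrix (T z z)) = (\<Sum>u\<in>B. ip (T z z u) u)"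
    by (rule trace_onb[OF B T_clinear])
  finally have tr: "0 < (\<Sum>u\<in>B. Re (ip (T z z u) u))" by simp
  have "\<mu> \<noteq> 0"
  proof
    assume m: "\<mu> = 0"
    have c3: "T z z (T z z (T z z w)) = 0" for w using cube_cubic[of w] m by simp
    have "T z z (T z z w) = 0" for w
      using T_adjoint[of z z "T z z w" "T z z (T z z w)"] by (simp add: c3 ip_self_eq_0)
    then have "T z z w = 0" for w
      using T_adjoint[of z z "T z z w" w] by (simp add: ip_self_eq_0)
    then show False using tr by simp
  qed
  moreover have "\<not> \<mu> < 0"
  proof
    assume m: "\<mu> < 0"
    then have "Re (ip (T z z u) u) \<le> 0" for u
      using cube_quadratic_form[of u] by (simp add: zero_le_mult_iff)
    then show False using tr by (meson not_le sum_nonpos)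
  qed
  ultimately show ?thesis by simp
qed

end

lemma tripotent_iff: "tripotent T c \<longleftrightarrow> T c c c = 2 *s c"
  by (auto simp: tripotent_def jt_Q_def vec_eq_iff field_simps)

lemma orthogonal_sym: "jt_orthogonal T u v \<Longrightarrow> jt_orthogonal T v u"
  unfolding jt_orthogonal_def using T_adjoint ip_ext[of "T v u _" 0] by (metis ip_zero_left ip_zero_right)

definition peirce :: "complex ^ 'n \<Rightarrow> int \<Rightarrow> (complex ^ 'n) set" where
  "peirce c m = {z. T c c z = of_int m *s z}"

lemma peirce_iff: "z \<in> peirce c m \<longleftrightarrow> T c c z = of_int m *s z"
  by (simp add: peirce_def)

lemma subspace_peirce: "vec.subspace (peirce c m)"
  by (auto simp: vec.subspace_def peirce_iff T_add T_scale vec.scale_right_distrib vec.scale_left_commute mult.commute)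

text \<open>
  The Jordan identity says that \<open>D(c,c)\<close> acts on \<open>{x;y;z}\<close> as a derivation in which the conjugate
  linear argument \<open>y\<close> counts with the opposite sign.
\<close>

lemma peirce_T:
  assumes "x \<in> peirce c i" "y \<in> peirce c j" "z \<in> peirce c k"
  shows "T x y z \<in> peirce c (i - j + k)"
  using assms unfolding peirce_iff jordan_identity[of c c x y z] T_commute[of y c c]
  by (simp add: T_scale algebra_simps)

lemma peirce_orthogonal:
  assumes "x \<in> peirce c i" "y \<in> peirce c j" "i \<noteq> j"
  shows "ip x y = 0"
  using T_adjoint[of c c x y] assms by (simp add: peirce_iff ip_simps)

text \<open>
  The interpolation polynomials for the nodes \<open>2\<close>, \<open>1\<close>, \<open>0\<close>, applied to \<open>D(c,c)\<close>. For a tripotent \<open>c\<close>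
  these nodes are the possible eigenvalues, and the polynomials are the projections to the Peirce
  spaces.
\<close>

definition P2 :: "complex ^ 'n \<Rightarrow> complex ^ 'n \<Rightarrow> complex ^ 'n" where
  "P2 c z = (1/2) *s (T c c (T c c z) - T c c z)"
definition P1 :: "complex ^ 'n \<Rightarrow> complex ^ 'n \<Rightarrow> complex ^ 'n" where
  "P1 c z = 2 *s T c c z - T c c (T c c z)"
definition P0 :: "complex ^ 'n \<Rightarrow> complex ^ 'n \<Rightarrow> complex ^ 'n" where
  "P0 c z = z - (3/2) *s T c c z + (1/2) *s T c c (T c c z)"

lemma peirce_sum: "z = P2 c z + P1 c z + P0 c z"
  by (simp add: P2_def P1_def P0_def vec_eq_iff algebra_simps)

lemma clinear_P: "clinear (P2 c)" "clinear (P1 c)" "clinear (P0 c)"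
  unfolding P2_def P1_def P0_def
  by (auto simp: clinear_iff T_add T_scale vec_eq_iff algebra_simps)

lemma P_eigen:
  assumes "z \<in> peirce c m"
  shows "P2 c z = (of_int (m * (m - 1)) / 2) *s z" "P1 c z = of_int (m * (2 - m)) *s z"
    "P0 c z = (of_int ((m - 1) * (m - 2)) / 2) *s z"
  using assms unfolding P2_def P1_def P0_def peirce_iff
  by (simp_all add: T_scale) (simp_all add: vec_eq_iff field_simps)

context
  fixes c assumes c: "tripotent T c"
begin

lemma cubeT: "T c c c = complex_of_real 2 *s c"
  using c by (simp add: tripotent_iff)

lemma tripotent_cubic: "T c c (T c c (T c c w)) = 3 *s T c c (T c c w) - 2 *s T c c w"
proof -
  have "2 *s T c c (T c c (T c c w)) = 2 *s (3 *s T c c (T c c w) - 2 *s T c c w)"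
    using cube_cubic[OF cubeT, of w] by (simp add: vec_eq_iff algebra_simps)
  then show ?thesis by (simp only: vec.scale_cancel_left) simp
qed

lemma P_in_peirce: "P2 c z \<in> peirce c 2" "P1 c z \<in> peirce c 1" "P0 c z \<in> peirce c 0"
  by (simp_all add: P2_def P1_def P0_def peirce_iff T_add T_diff T_scale tripotent_cubic vec_eq_iff field_simps)

lemma peirce_cases:
  assumes "z \<in> peirce c m" "z \<noteq> 0"
  shows "m = 0 \<or> m = 1 \<or> m = 2"
proof -
  have "of_int (m * m * m) *s z = of_int (3 * m * m - 2 * m) *s z"
    using tripotent_cubic[of z] assms(1) unfolding peirce_iff
    by (simp add: T_scale algebra_simps)
  then have "m * m * m = 3 * m * m - 2 * m"
    using assms(2) by (metis vec.scale_cancel_right of_int_eq_iff)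
  then have "m * ((m - 1) * (m - 2)) = 0" by (simp add: algebra_simps)
  then show ?thesis by auto
qed

lemma self_peirce: "c \<in> peirce c 2"
  using c by (simp add: peirce_iff tripotent_iff)

text \<open>
  For \<open>w\<close> in the Peirce 0-space, \<open>{c;w;c}\<close> would have the impossible weight \<open>4\<close> and so vanishes;
  then \<open>cube_shift\<close> gives \<open>D(c,w) = 0\<close>.
\<close>

lemma peirce0_iff_orthogonal: "w \<in> peirce c 0 \<longleftrightarrow> jt_orthogonal T c w"
proof
  assume w: "w \<in> peirce c 0"
  have "T c w c \<in> peirce c 4" using peirce_T[OF self_peirce w self_peirce] by simp
  then have 0: "T c w c = 0" using peirce_cases by fastforce
  have "2 *s T c w y = 0" for y
    using cube_shift[OF cubeT, of w y] w 0 by (simp add: peirce_iff)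
  then show "jt_orthogonal T c w" by (simp add: jt_orthogonal_def)
next
  assume "jt_orthogonal T c w"
  then have "T w c c = 0" using orthogonal_sym by (auto simp: jt_orthogonal_def)
  then show "w \<in> peirce c 0" by (simp add: peirce_iff T_commute[of c c w])
qed

end

end

section \<open>Minimal tripotents\<close>

context jordan_triple begin

text \<open>
  On \<open>\<Sum>\<lambda>\<^sub>i e\<^sub>i\<close>, with orthogonal tripotents \<open>e\<^sub>i\<close> of length 1, this is \<open>2 \<Sum>\<lambda>\<^sub>i\<^sup>4\<close>; compared with the norm
  it is largest at tripotents of small length.
\<close>

definition quartic :: "complex ^ 'n \<Rightarrow> real" where
  "quartic z = Re (ip (T z z z) z)"

lemma quartic_scaleR: "quartic (s *\<^sub>R z) = s ^ 4 * quartic z"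
  by (simp add: quartic_def T_scaleR ip_simps power4_eq_xxxx)

lemma quartic_minus: "quartic (- z) = quartic z"
  using quartic_scaleR[of "-1" z] by simp

lemma continuous_quartic: "continuous_on S quartic"
  unfolding quartic_def by (intro continuous_intros)

lemma quartic_derivative:
  "((\<lambda>t. quartic (z + t *\<^sub>R h)) has_real_derivative 4 * Re (ip (T z z z) h)) (at 0)"
proof -
  have d: "((\<lambda>t. z + t *\<^sub>R h) has_vector_derivative h) (at t)" for t
    by (auto intro!: derivative_eq_intros)
  have "((\<lambda>t. ip (T (z + t *\<^sub>R h) (z + t *\<^sub>R h) (z + t *\<^sub>R h)) (z + t *\<^sub>R h)) has_vector_derivative
      ip (T z z z) h + ip (T h z z + T z h z + T z z h) z) (at 0)"
    using bounded_bilinear.has_vector_derivative[OF bounded_bilinear_ip T_has_vector_derivative[OF d d d] d, of 0]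
    by simp
  from bounded_linear.has_vector_derivative[OF bounded_linear_Re this]
  have 1: "((\<lambda>t. quartic (z + t *\<^sub>R h)) has_real_derivative
      Re (ip (T z z z) h + ip (T h z z + T z h z + T z z h) z)) (at 0)"
    by (simp only: quartic_def has_real_derivative_iff_has_vector_derivative)
  have "ip (T h z z) z = ip h (T z z z)" "ip (T z z h) z = ip h (T z z z)"
    by (simp_all add: T_commute[of h z z] T_adjoint)
  moreover have "ip (T z h z) z = ip (T z z z) h"
    by (simp add: T_adjoint T_commute[of h z z])
  moreover have "Re (ip h (T z z z)) = Re (ip (T z z z) h)"
    by (subst ip_commute) simp
  ultimately show ?thesis using 1 by (simp add: ip_add_left)
qed

text \<open>
  At an extremum of \<open>quartic\<close> on the unit sphere of a real subspace closed under cubes, the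
  Lagrange condition reads $\{z;z;z\}=\mu z$, so that the extremum is a multiple of a tripotent.
\<close>

lemma quartic_extremum:
  assumes W: "subspace W" "\<And>z. z \<in> W \<Longrightarrow> T z z z \<in> W"
    and z: "z \<in> W" "ip z z = 1"
    and s: "s = 1 \<or> s = - 1"
    and ext: "\<And>x. x \<in> W \<Longrightarrow> ip x x = 1 \<Longrightarrow> s * quartic x \<le> s * quartic z"
  shows "T z z z = complex_of_real (quartic z) *s z"
proof -
  have crit: "Re (ip (T z z z) h) = 0" if h: "h \<in> W" "Re (ip h z) = 0" for h
  proof -
    let ?N = "\<lambda>t. 1 + t\<^sup>2 * Re (ip h h)"
    define g where "g t = s * (quartic (z + t *\<^sub>R h) - quartic z * (?N t)\<^sup>2)" for t
    have Npos: "?N t > 0" for t using ip_self_nonneg[of h] by (simp add: add_pos_nonneg)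
    have N: "Re (ip (z + t *\<^sub>R h) (z + t *\<^sub>R h)) = ?N t" for t
    proof -
      have "Re (ip z h) = 0" using h(2) ip_commute[of h z] by simp
      then show ?thesis using z h(2) by (simp add: ip_simps power2_eq_square)
    qed
    have le: "g t \<le> g 0" for t
    proof -
      define y where "y = (1 / sqrt (?N t)) *\<^sub>R (z + t *\<^sub>R h)"
      have "Re (ip y y) = 1"
        using Npos[of t] N[of t]
        by (simp add: y_def ip_scaleR_left ip_scaleR_right del: scaleR_add_right)
      then have "ip y y = 1" using ip_self_Re[of y] by simp
      moreover have "y \<in> W" using W(1) z(1) h(1) by (simp add: y_def subspace_add subspace_scale)
      ultimately have "s * quartic y \<le> s * quartic z" by (intro ext)
      moreover have "quartic y = quartic (z + t *\<^sub>R h) / (?N t)\<^sup>2"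
      proof -
        have "sqrt (?N t) ^ 4 = ((sqrt (?N t))\<^sup>2)\<^sup>2" by (simp only: power_mult[symmetric]) simp
        also have "\<dots> = (?N t)\<^sup>2" using Npos[of t] by simp
        finally show ?thesis by (simp add: y_def quartic_scaleR power_divide)
      qed
      ultimately have "s * quartic (z + t *\<^sub>R h) \<le> s * quartic z * (?N t)\<^sup>2"
        using Npos[of t] by (simp add: field_simps)
      then show ?thesis by (simp add: g_def algebra_simps)
    qed
    have "(g has_real_derivative s * (4 * Re (ip (T z z z) h))) (at 0)"
      unfolding g_def[abs_def] by (auto intro!: derivative_eq_intros quartic_derivative[THEN DERIV_cong])
    then have "s * (4 * Re (ip (T z z z) h)) = 0"
      using le by (intro DERIV_local_max[of g _ 0 1]) auto
    then show ?thesis using s by auto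
  qed
  define h where "h = T z z z - quartic z *\<^sub>R z"
  have hW: "h \<in> W" using W z(1) by (simp add: h_def subspace_diff subspace_scale)
  have "Re (ip h z) = 0" using z by (simp add: h_def ip_simps quartic_def)
  moreover have "Re (ip h h) = Re (ip (T z z z) h) - quartic z * Re (ip z h)"
    by (subst (1) h_def) (simp add: ip_simps)
  moreover have "Re (ip z h) = Re (ip h z)" by (subst ip_commute) simp
  ultimately have "h = 0" using crit[OF hW] ip_Re_self_eq_0[of h] by simp
  then show ?thesis by (simp add: h_def scaleR_vec_complex)
qed

lemma compact_unit_sphere: "subspace W \<Longrightarrow> compact (W \<inter> {z. ip z z = 1})"
  by (intro closed_Int_compact closed_subspace compact_ip_sphere)

lemma unit_vector_exists:
  assumes "subspace W" "x \<in> W" "x \<noteq> 0"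
  shows "(1 / sqrt (Re (ip x x))) *\<^sub>R x \<in> W \<inter> {z. ip z z = 1}"
proof -
  let ?y = "(1 / sqrt (Re (ip x x))) *\<^sub>R x"
  have "Re (ip ?y ?y) = 1"
    using ip_pos[OF assms(3)] by (simp add: ip_scaleR_left ip_scaleR_right field_simps)
  then have "ip ?y ?y = 1" using ip_self_Re[of ?y] by simp
  then show ?thesis using assms by (simp add: subspace_scale)
qed

lemma quartic_tripotent:
  assumes "T z z z = complex_of_real (quartic z) *s z" "z \<noteq> 0"
  shows "quartic z > 0" "tripotent T (sqrt (2 / quartic z) *\<^sub>R z)"
proof -
  show q: "quartic z > 0" using cube_pos[OF assms] .
  let ?s = "sqrt (2 / quartic z)"
  have "T (s *\<^sub>R z) (s *\<^sub>R z) (s *\<^sub>R z) = (s * s * s * quartic z) *\<^sub>R z" for s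
    by (simp add: T_scaleR assms(1) flip: scaleR_vec_complex)
  from this[of ?s] have "T (?s *\<^sub>R z) (?s *\<^sub>R z) (?s *\<^sub>R z) = (?s * ?s * ?s * quartic z) *\<^sub>R z" .
  also have "?s * ?s * ?s * quartic z = 2 / quartic z * ?s * quartic z"
    using q by (simp only: real_sqrt_mult_self) simp
  also have "\<dots> = 2 * ?s" using q by simp
  finally show "tripotent T (?s *\<^sub>R z)"
    by (simp add: tripotent_iff vec_eq_iff) (simp add: scaleR_conv_of_real)
qed

lemma tripotent_quartic: "tripotent T c \<Longrightarrow> quartic c = 2 * Re (ip c c)"
  by (simp add: quartic_def tripotent_iff ip_simps)

lemma orthogonal_ip:
  assumes "tripotent T u" "jt_orthogonal T u v"
  shows "ip u v = 0"
proof -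
  have "2 * ip u v = ip (T u u u) v" using assms(1) by (simp add: tripotent_iff ip_simps)
  also have "\<dots> = ip u (T v u u)" by (simp add: T_adjoint T_commute[of v u u])
  also have "\<dots> = 0" using orthogonal_sym[OF assms(2)] by (simp add: jt_orthogonal_def)
  finally show ?thesis by simp
qed

text \<open>
  A maximiser on the complex subspace orthogonal to given tripotents is minimal in \<open>Z\<close>: a
  summand of it is again orthogonal to these tripotents, and a shorter tripotent would give a
  larger value, as \<open>quartic (u / |u|) = 2 / |u|\<^sup>2\<close>.
\<close>

lemma minimal_tripotent_exists:
  assumes C: "\<And>c. c \<in> C \<Longrightarrow> tripotent T c"
    and x: "x \<noteq> 0" "\<And>c. c \<in> C \<Longrightarrow> x \<in> peirce c 0"
  shows "\<exists>u. minimal_tripotent T u \<and> (\<forall>c\<in>C. u \<in> peirce c 0)"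
proof -
  define W where "W = {z. \<forall>c\<in>C. z \<in> peirce c 0}"
  have W: "subspace W"
    by (auto simp: W_def subspace_def peirce_iff T_add T_scaleR)
  have cube: "T z z z \<in> W" if "z \<in> W" for z
    using that peirce_T[of z _ 0 z 0 z 0] by (auto simp: W_def)
  let ?S = "W \<inter> {z. ip z z = 1}"
  have "x \<in> W" using x by (simp add: W_def)
  then have "?S \<noteq> {}" using unit_vector_exists[OF W _ x(1)] by blast
  then obtain z where z: "z \<in> ?S" and max: "\<And>y. y \<in> ?S \<Longrightarrow> quartic y \<le> quartic z"
    using continuous_attains_sup[OF compact_unit_sphere[OF W] _ continuous_quartic] by blast
  have z0: "z \<noteq> 0" using z by auto
  have Tz: "T z z z = complex_of_real (quartic z) *s z"
    using quartic_extremum[OF W cube, of z 1] z max by auto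
  define c where "c = sqrt (2 / quartic z) *\<^sub>R z"
  have q: "quartic z > 0" and ct: "tripotent T c"
    using quartic_tripotent[OF Tz z0] by (auto simp: c_def)
  have cW: "c \<in> W" using z W by (simp add: c_def subspace_scale)
  have cc: "Re (ip c c) = 2 / quartic z"
    using q z by (simp add: c_def ip_simps)
  have "\<not> (\<exists>u v. tripotent T u \<and> tripotent T v \<and> u \<noteq> 0 \<and> v \<noteq> 0 \<and> jt_orthogonal T u v \<and> c = u + v)"
  proof safe
    fix u v assume u: "tripotent T u" and v: "tripotent T v" "u \<noteq> 0" "v \<noteq> 0"
      and o: "jt_orthogonal T u v" and cuv: "c = u + v"
    have o': "T u v w = 0" "T v u w = 0" for w
      using o orthogonal_sym[OF o] by (auto simp: jt_orthogonal_def)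
    have cu: "T c u c = 2 *s u"
      using u T_commute[of u u v] by (simp add: cuv T_add o' tripotent_iff)
    have "u \<in> W"
      unfolding W_def
    proof safe
      fix d assume d: "d \<in> C"
      note P = P_in_peirce[OF C[OF d], of u] and c0 = cW[unfolded W_def, simplified, rule_format, OF d]
      have "T c (P2 d u) c \<in> peirce d (- 2)" "T c (P1 d u) c \<in> peirce d (- 1)" "T c (P0 d u) c \<in> peirce d 0"
        using peirce_T[OF c0 P(1) c0] peirce_T[OF c0 P(2) c0] peirce_T[OF c0 P(3) c0] by simp_all
      moreover from this have "T c (P2 d u) c = 0" "T c (P1 d u) c = 0"
        using peirce_cases[OF C[OF d]] by fastforce+
      ultimately have "T c u c \<in> peirce d 0"
        using arg_cong[OF peirce_sum[of u d], of "\<lambda>u. T c u c"] by (simp add: T_add)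
      then have "(1/2) *s (2 *s u) \<in> peirce d 0"
        unfolding cu by (rule vec.subspace_scale[OF subspace_peirce])
      then show "u \<in> peirce d 0" by simp
    qed
    let ?y = "(1 / sqrt (Re (ip u u))) *\<^sub>R u"
    have up: "Re (ip u u) > 0" "Re (ip v v) > 0" using v ip_pos by auto
    have "quartic ?y \<le> quartic z"
      using max unit_vector_exists[OF W \<open>u \<in> W\<close> v(2)] by blast
    moreover have "quartic ?y = 2 / Re (ip u u)"
    proof -
      have "sqrt (Re (ip u u)) ^ 4 = (Re (ip u u))\<^sup>2"
        using up by (simp add: power4_eq_xxxx power2_eq_square)
      then show ?thesis
        using up by (simp add: quartic_scaleR power_divide tripotent_quartic[OF u] power2_eq_square)
    qed
    ultimately have "Re (ip c c) \<le> Re (ip u u)"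
      using up q unfolding cc by (simp add: pos_divide_le_eq mult.commute)
    moreover have "ip u v = 0" "ip v u = 0"
      using orthogonal_ip[OF u o] orthogonal_ip[OF v(1) orthogonal_sym[OF o]] by auto
    then have "Re (ip c c) = Re (ip u u) + Re (ip v v)" by (simp add: cuv ip_simps)
    ultimately show False using up by simp
  qed
  moreover have "c \<noteq> 0" using z0 q by (simp add: c_def)
  ultimately have "minimal_tripotent T c" using ct by (simp add: minimal_tripotent_def)
  then show ?thesis using cW by (auto simp: W_def)
qed

end

context jordan_triple begin

lemma ip_minimal_tripotent: "minimal_tripotent T c \<Longrightarrow> ip c c = 1"
  by (rule jip[unfolded jt_inner_product_def, THEN conjunct2, THEN conjunct2, THEN conjunct2, THEN conjunct2, rule_format])

text \<open>
  The self-adjoint part of the Peirce 2-space of a tripotent \<open>c\<close>. With \<open>x \<circ> y = \<onehalf>{x;c;y}\<close> it is a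
  formally real Jordan algebra with unit \<open>c\<close>; only the one-generator identities needed to split
  \<open>c\<close> by an idempotent are derived here.
\<close>

definition self_adjoint :: "complex ^ 'n \<Rightarrow> (complex ^ 'n) set" where
  "self_adjoint c = {x. T c c x = 2 *s x \<and> T c x c = 2 *s x}"

lemma subspace_self_adjoint: "subspace (self_adjoint c)"
  by (auto simp: subspace_def self_adjoint_def T_add T_scaleR scaleR_vec_complex T_scale
      vec.scale_right_distrib vec.scale_left_commute mult.commute)

context
  fixes c assumes c: "tripotent T c"
begin

context
  fixes x assumes x: "x \<in> self_adjoint c"
begin

private lemma x2: "T c c x = 2 *s x" "T x c c = 2 *s x" "T c x c = 2 *s x"
  using x T_commute[of x c c] by (simp_all add: self_adjoint_def)

lemma sa_commute: "T x c z = T c x z"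
proof -
  have "T x c (T c c z) = T c c (T x c z) + (2 *s T x c z - 2 *s T c x z)"
    using jordan_identity[of x c c c z] by (simp add: x2 T_scale)
  moreover have "T c c (T x c z) = T x c (T c c z)"
    using jordan_identity[of c c x c z] c by (simp add: x2 T_scale tripotent_iff)
  ultimately have "2 *s T x c z = 2 *s T c x z" by (simp add: algebra_simps)
  then show ?thesis by (simp only: vec.scale_cancel_left) simp
qed

lemma sa_square: "T (T x c x) c z = 2 *s T x x z"
  using jordan_identity[of x c x c z] by (simp add: x2 T_scale)

lemma sa_square_mem: "(1/2) *s T x c x \<in> self_adjoint c"
proof -
  have 1: "T c c (T x c x) = 2 *s T x c x"
    using jordan_identity[of c c x c x] c by (simp add: x2 T_scale tripotent_iff)
  have adj: "T c (T x c x) z = 2 *s T x x z" for z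
    by (rule ip_ext) (simp add: T_adjoint sa_square ip_simps)
  have "T c (T x c x) c = T (T x c x) c c" by (simp add: adj sa_square)
  also have "\<dots> = 2 *s T x c x" using 1 T_commute[of "T x c x" c c] by simp
  finally show ?thesis using 1 by (simp add: self_adjoint_def T_scale vec.scale_left_commute mult.commute)
qed

lemma sa_cube_mem: "T x x x \<in> self_adjoint c"
proof -
  have xxc: "T x x c = T x c x"
  proof -
    have "2 *s T x x c = T (T x c x) c c" by (simp add: sa_square)
    also have "\<dots> = 2 *s T x c x"
      using jordan_identity[of c c x c x] c T_commute[of "T x c x" c c] by (simp add: x2 T_scale tripotent_iff)
    finally show ?thesis by (simp only: vec.scale_cancel_left) simp
  qed
  have "T x x (T c x c) = T c x (T x x c) + T (T x x c) x c - T c (T x x x) c"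
    by (rule jordan_identity)
  moreover have "T c x (T x c x) = 2 *s T x x x"
  proof -
    have "T c x (T x c x) = T x c (T x c x)" by (simp add: sa_commute)
    also have "\<dots> = T (T x c x) c x" by (rule T_commute)
    finally show ?thesis by (simp add: sa_square)
  qed
  ultimately have "T c (T x x x) c = 2 *s T x x x"
    using T_commute[of "T x c x" x c] by (simp add: xxc x2 T_scale algebra_simps)
  moreover have "T c c (T x x x) = 2 *s T x x x"
    using jordan_identity[of c c x x x] by (simp add: x2 T_scale)
  ultimately show ?thesis by (simp add: self_adjoint_def)
qed

text \<open>
  Two instances of the Jordan identity compute \<open>D(x,c) D(x,x)\<close>; together they give
  \<open>D(x,c) = 2 D(y,x) - D(x,y)\<close>. Since \<open>D(x,c) = D(c,x)\<close> is self-adjoint, this forces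
  \<open>D(x,y) = D(y,x)\<close>, and both are equal to \<open>D(x,c)\<close>.
\<close>

lemma sa_tripotent_square:
  assumes "T x x x = 2 *s x"
  defines "y \<equiv> (1/2) *s T x c x"
  shows "T x c y = 2 *s x" "T y c y = 2 *s y"
proof -
  have yc: "T y c z = T x x z" for z by (simp add: y_def T_scale sa_square)
  have xxc: "T x x c = 2 *s y"
    using sa_square_mem[folded y_def] T_commute[of y c c] by (simp add: self_adjoint_def flip: yc)
  have xcx: "T x c x = 2 *s y" by (simp add: y_def)
  show xcy: "T x c y = 2 *s x"
    using T_commute[of x c y] by (simp add: yc assms(1))
  have e: "T x c z = 2 *s T y x z - T x y z" for z
  proof -
    have "T x c (T x x z) = T x x (T x c z) + 2 *s T x c z - 2 *s T y x z"
      using jordan_identity[of x c y c z] by (simp add: xcy yc x2 T_scale)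
    moreover have "T x c (T x x z) = T x x (T x c z) + 2 *s T y x z - 2 *s T x y z"
      using jordan_identity[of x c x x z] by (simp add: xcx xxc T_scale)
    ultimately have "2 *s T x c z = 2 *s (2 *s T y x z - T x y z)" by (simp add: vec_eq_iff algebra_simps)
    then show ?thesis by (simp only: vec.scale_cancel_left) simp
  qed
  have g: "T c x z = 2 *s T x y z - T y x z" for z
    by (rule ip_ext) (simp add: T_adjoint e ip_simps)
  have f: "T y x z = T x y z" for z
  proof -
    have "3 *s (T y x z - T x y z) = (2 *s T y x z - T x y z) - (2 *s T x y z - T y x z)"
      by (simp add: vec_eq_iff algebra_simps)
    also have "\<dots> = 0" by (simp only: e[symmetric] g[symmetric] sa_commute diff_self)
    finally show ?thesis by simp
  qed
  have "T y c y = T x x y" by (rule yc)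
  also have "\<dots> = T y x x" by (rule T_commute)
  also have "\<dots> = T x c x" by (simp add: e f vec_eq_iff)
  finally show "T y c y = 2 *s y" by (simp add: xcx)
qed

end

text \<open>An idempotent \<open>u\<close> splits \<open>c\<close> into the orthogonal tripotents \<open>u\<close> and \<open>c - u\<close>.\<close>

lemma sa_idempotent:
  assumes m: "minimal_tripotent T c" and u: "u \<in> self_adjoint c" "T u c u = 2 *s u"
  shows "u = 0 \<or> u = c"
proof -
  have tri: "tripotent T v" if v: "v \<in> self_adjoint c" "T v c v = 2 *s v" for v
  proof -
    have "2 *s T v v v = 2 *s (2 *s v)"
      using sa_square[OF v(1), of v] by (simp only: v(2) T_scale)
    then show ?thesis by (simp only: vec.scale_cancel_left tripotent_iff) simp
  qed
  have uu: "T u u z = T u c z" for z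
    using sa_square[OF u(1), of z] u(2) by (simp add: T_scale)
  have "c - u \<in> self_adjoint c"
    using c u(1) by (simp add: self_adjoint_def T_diff tripotent_iff vec.scale_right_diff_distrib)
  moreover have "T (c - u) c (c - u) = 2 *s (c - u)"
    using c u T_commute[of u c c]
    by (simp add: self_adjoint_def T_diff tripotent_iff vec_eq_iff)
  ultimately have "tripotent T (c - u)" by (rule tri)
  moreover have "jt_orthogonal T u (c - u)" by (simp add: jt_orthogonal_def T_diff uu)
  moreover have "c = u + (c - u)" by simp
  ultimately show ?thesis
    using m tri[OF u] unfolding minimal_tripotent_def by (metis eq_iff_diff_eq_0)
qed

text \<open>
  With \<open>y\<close> the square of \<open>x\<close>, the elements \<open>(y + x)/2\<close> and \<open>(y - x)/2\<close> are idempotents with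
  difference \<open>x\<close>.
\<close>

lemma sa_tripotent:
  assumes m: "minimal_tripotent T c" and x: "x \<in> self_adjoint c" "T x x x = 2 *s x" "x \<noteq> 0"
  shows "x = c \<or> x = - c"
proof -
  define y where "y = (1/2) *s T x c x"
  have y: "y \<in> self_adjoint c" unfolding y_def by (rule sa_square_mem[OF x(1)])
  have p: "T x c y = 2 *s x" "T y c y = 2 *s y" "T x c x = 2 *s y" "T y c x = 2 *s x"
    using sa_tripotent_square[OF x(1,2)] T_commute[of y c x] by (simp_all add: y_def)
  have half: "(1/2) *s v = (1/2 :: real) *\<^sub>R v" for v :: "complex ^ 'n" by (simp add: scaleR_vec_complex)
  define p q where "p = (1/2) *s (y + x)" and "q = (1/2) *s (y - x)"
  have "p \<in> self_adjoint c" "q \<in> self_adjoint c"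
    unfolding half p_def q_def using x(1) y subspace_self_adjoint[of c]
    by (auto intro!: subspace_scale subspace_add subspace_diff)
  moreover have "T p c p = 2 *s p" "T q c q = 2 *s q"
    unfolding p_def q_def by (simp_all only: T_scale T_add T_diff p) (simp_all add: vec_eq_iff)
  ultimately have "p = 0 \<or> p = c" "q = 0 \<or> q = c"
    by (simp_all only: sa_idempotent[OF m])
  moreover have "x = p - q" by (simp add: p_def q_def vec_eq_iff field_simps)
  ultimately show ?thesis using x(3) by (metis diff_0 diff_0_right diff_self)
qed

text \<open>
  Both extrema of \<open>quartic\<close> on the unit sphere of \<open>self_adjoint c\<close> are attained only at multiples of
  tripotents, that is at \<open>c\<close> and \<open>-c\<close>. So \<open>quartic\<close> is constant there, every point is an extremum,
  and the sphere is \<open>{c, -c}\<close>.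
\<close>

lemma self_adjoint_minimal:
  assumes m: "minimal_tripotent T c" and x: "x \<in> self_adjoint c"
  shows "\<exists>r::real. x = r *\<^sub>R c"
proof -
  let ?A = "self_adjoint c" let ?S = "?A \<inter> {z. ip z z = 1}"
  have cc: "ip c c = 1" by (rule ip_minimal_tripotent[OF m])
  note W = subspace_self_adjoint[of c]
  have cA: "c \<in> ?A" using c by (simp add: self_adjoint_def tripotent_iff)
  have ext: "z = c \<or> z = - c"
    if z: "z \<in> ?S" and s: "s = 1 \<or> s = -1" and e: "\<And>y. y \<in> ?S \<Longrightarrow> s * quartic y \<le> s * quartic z" for z s
  proof -
    have z0: "z \<noteq> 0" using z by auto
    have Tz: "T z z z = complex_of_real (quartic z) *s z"
      using quartic_extremum[OF W sa_cube_mem, of z s] z s e by blast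
    define r where "r = sqrt (2 / quartic z)"
    have r: "r > 0" "tripotent T (r *\<^sub>R z)" using quartic_tripotent[OF Tz z0] by (simp_all add: r_def)
    have d: "r *\<^sub>R z = c \<or> r *\<^sub>R z = - c"
      using sa_tripotent[OF m, of "r *\<^sub>R z"] r z z0 W by (auto simp: subspace_scale tripotent_iff)
    have "ip (r *\<^sub>R z) (r *\<^sub>R z) = 1"
      using d by (rule disjE) (simp_all only: ip_minus_left ip_minus_right cc minus_minus)
    then have "complex_of_real (r * r) = 1" using z by (simp add: ip_scaleR_left ip_scaleR_right)
    then have "r * r = 1" by (simp only: of_real_eq_1_iff)
    then have "r = 1" using r(1) square_eq_1_iff[of r] by auto
    then show ?thesis using d by simp
  qed
  have ne: "?S \<noteq> {}" using cA cc by auto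
  obtain z1 where z1: "z1 \<in> ?S" "\<And>y. y \<in> ?S \<Longrightarrow> quartic y \<le> quartic z1"
    using continuous_attains_sup[OF compact_unit_sphere[OF W] ne continuous_quartic] by blast
  obtain z2 where z2: "z2 \<in> ?S" "\<And>y. y \<in> ?S \<Longrightarrow> quartic z2 \<le> quartic y"
    using continuous_attains_inf[OF compact_unit_sphere[OF W] ne continuous_quartic] by blast
  have "quartic z1 = quartic c" "quartic z2 = quartic c"
    using ext[of z1 1] ext[of z2 "-1"] z1 z2 by (auto simp: quartic_minus)
  then have const: "quartic y = quartic c" if "y \<in> ?S" for y
    using z1(2)[OF that] z2(2)[OF that] by simp
  have unit: "z = c \<or> z = - c" if "z \<in> ?S" for z
    using ext[OF that, of 1] const that by simp
  show ?thesis
  proof (cases "x = 0")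
    case True
    then show ?thesis by (intro exI[of _ 0]) simp
  next
    case False
    let ?n = "sqrt (Re (ip x x))"
    have "?n > 0" using ip_pos[OF False] by simp
    then have "x = ?n *\<^sub>R ((1 / ?n) *\<^sub>R x)" by simp
    moreover have "(1 / ?n) *\<^sub>R x = c \<or> (1 / ?n) *\<^sub>R x = - c"
      using unit unit_vector_exists[OF W x False] by blast
    ultimately have "x = ?n *\<^sub>R c \<or> x = (- ?n) *\<^sub>R c" by (metis scaleR_minus_left scaleR_minus_right)
    then show ?thesis by blast
  qed
qed

end

text \<open>
  The multiples of minimal tripotents, as solutions of quadratic equations that are holomorphic in
  \<open>z\<close>; the equations involve neither a frame nor \<open>K\<close>.
\<close>

definition primitive :: "complex ^ 'n \<Rightarrow> bool" where
  "primitive z \<longleftrightarrow> (\<forall>x. T z x z = (2 * ip z x) *s z)"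

text \<open>
  The element \<open>x = {c;w;c}\<close> lies in the Peirce 2-space, on which \<open>\<onehalf>{c;\<cdot>;c}\<close> is a conjugate linear
  involution. So \<open>x\<close> is a complex combination of two self-adjoint elements, hence a multiple of \<open>c\<close>,
  and the inner product with \<open>c\<close> determines the factor.
\<close>

lemma minimal_tripotent_primitive:
  assumes m: "minimal_tripotent T c"
  shows "primitive c"
  unfolding primitive_def
proof
  fix w
  have c: "tripotent T c" using m by (simp add: minimal_tripotent_def)
  have cc: "ip c c = 1" by (rule ip_minimal_tripotent[OF m])
  define x where "x = T c w c"
  have x2: "T c c x = 2 *s x"
    using cube_DP[OF cubeT[OF c], of w] by (simp add: x_def)
  have PP: "T c (T c x c) c = 4 *s x"
    using cube_PP[OF cubeT[OF c], of x] by (simp add: x2 T_scale vec_eq_iff)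
  have x2': "T c c (T c x c) = 2 *s T c x c"
    using cube_DP[OF cubeT[OF c], of x] by simp
  have "x + (1/2) *s T c x c \<in> self_adjoint c"
    by (simp add: self_adjoint_def T_add T_scale x2 x2' PP vec_eq_iff)
  then obtain r1 :: real where r1: "x + (1/2) *s T c x c = r1 *\<^sub>R c"
    using self_adjoint_minimal[OF c m] by blast
  have "\<i> *s (x - (1/2) *s T c x c) \<in> self_adjoint c"
    by (simp add: self_adjoint_def T_diff T_scale x2 x2' PP vec_eq_iff algebra_simps)
  then obtain r2 :: real where r2: "\<i> *s (x - (1/2) *s T c x c) = r2 *\<^sub>R c"
    using self_adjoint_minimal[OF c m] by blast
  have "x = (1/2) *s ((x + (1/2) *s T c x c) - \<i> *s (\<i> *s (x - (1/2) *s T c x c)))"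
    by (simp add: vec_eq_iff field_simps)
  also have "\<dots> = ((r1 - \<i> * r2) / 2) *s c"
    unfolding r1 r2 by (simp add: scaleR_vec_complex vec_eq_iff field_simps)
  finally obtain l where l: "x = l *s c" by blast
  have "l = ip x c" using l cc by (simp add: ip_simps)
  also have "\<dots> = ip c (T w c c)" by (simp add: x_def T_adjoint)
  also have "\<dots> = ip (T c c c) w" by (simp add: T_commute[of w] T_adjoint)
  also have "\<dots> = 2 * ip c w" using c by (simp add: tripotent_iff ip_simps)
  finally show "T c w c = (2 * ip c w) *s c" using l by (simp add: x_def)
qed

end

section \<open>Frames and joint Peirce spaces\<close>

context jordan_triple begin

lemma primitive_tripotent:
  assumes "primitive c" "ip c c = 1"
  shows "tripotent T c"
  using assms by (simp add: primitive_def tripotent_iff)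

lemma primitive_peirce2:
  assumes "primitive c" "ip c c = 1" "z \<in> peirce c 2"
  shows "z = ip z c *s c"
proof -
  note tri = primitive_tripotent[OF assms(1,2)]
  have Dz: "T c c z = 2 *s z" using assms(3) by (simp add: peirce_iff)
  have "4 *s z = T c (T c z c) c"
    using cube_PP[OF cubeT[OF tri], of z] by (simp add: Dz T_scale) (simp add: vec_eq_iff)
  also have "\<dots> = 4 *s (ip z c *s c)"
    using assms(1,2) ip_commute[of z c] by (simp add: primitive_def T_scale)
  finally show ?thesis by (simp only: vec.scale_cancel_left) simp
qed

lemma primitive_P2:
  assumes "primitive c" "ip c c = 1"
  shows "P2 c z = ip z c *s c"
proof -
  note tri = primitive_tripotent[OF assms]
  have "ip z c = ip (P2 c z + P1 c z + P0 c z) c" by (subst peirce_sum[of z c]) (rule refl)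
  also have "\<dots> = ip (P2 c z) c"
    using peirce_orthogonal[OF P_in_peirce(2)[OF tri] self_peirce[OF tri]]
      peirce_orthogonal[OF P_in_peirce(3)[OF tri] self_peirce[OF tri]] by (simp add: ip_add_left)
  finally show ?thesis
    using primitive_peirce2[OF assms P_in_peirce(1)[OF tri], of z] by simp
qed

text \<open>
  If \<open>D(x,y)\<close> vanishes between two complementary orthogonal subspaces, both are ideals:
  associativity of the inner product moves the triple product across.
\<close>

lemma orthogonal_ideal:
  assumes sub: "vec.subspace I" "vec.subspace J"
    and sum: "\<And>z. \<exists>x\<in>I. \<exists>y\<in>J. z = x + y"
    and orth: "\<And>x y. x \<in> I \<Longrightarrow> y \<in> J \<Longrightarrow> ip x y = 0"
    and D: "\<And>x y z. x \<in> I \<Longrightarrow> y \<in> J \<Longrightarrow> T x y z = 0"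
  shows "jt_ideal T I"
proof -
  have D': "T y x z = 0" if "x \<in> I" "y \<in> J" for x y z
    by (rule ip_ext) (simp add: T_adjoint D that)
  have memI: "z \<in> I" if z: "\<And>y. y \<in> J \<Longrightarrow> ip z y = 0" for z
  proof -
    obtain x y where xy: "x \<in> I" "y \<in> J" "z = x + y" using sum by blast
    then have "ip y y = 0" using z[OF xy(2)] orth[OF xy(1,2)] by (simp add: ip_add_left)
    then show ?thesis using xy by (simp add: ip_self_eq_0)
  qed
  have in_I: "T x u v \<in> I" if "x \<in> I" "u \<in> I" "v \<in> I" for x u v
  proof (rule memI)
    fix y assume y: "y \<in> J"
    have "ip (T x u v) y = ip v (T y x u)" by (simp add: T_adjoint T_commute[of u x y])
    then show "ip (T x u v) y = 0" using D'[OF that(1) y] by simp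
  qed
  have left: "T x u v \<in> I" if "x \<in> I" for x u v
  proof -
    obtain u1 u2 where u: "u1 \<in> I" "u2 \<in> J" "u = u1 + u2" using sum by blast
    obtain v1 v2 where v: "v1 \<in> I" "v2 \<in> J" "v = v1 + v2" using sum by blast
    have "T x u1 v2 = 0" using D'[OF u(1) v(2), of x] T_commute[of x u1 v2] by simp
    then have "T x u v = T x u1 v1" using D[OF that u(2)] by (simp add: u v T_add)
    then show ?thesis using in_I that u v by simp
  qed
  have mid: "T u x v \<in> I" if "x \<in> I" for x u v
  proof -
    obtain u1 u2 where u: "u1 \<in> I" "u2 \<in> J" "u = u1 + u2" using sum by blast
    have "T u x v = T u1 x v" using D'[OF that u(2)] by (simp add: u T_add)
    then show ?thesis using left[OF u(1)] by simp
  qed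
  show ?thesis
    unfolding jt_ideal_def using sub left mid T_commute by metis
qed

end

locale jordan_frame = jordan_triple +
  fixes r a b :: nat and e :: "nat \<Rightarrow> complex ^ 'a"
  assumes frame: "jt_frame T r e" and type: "jt_type T e r a b" and irreducible: "jt_irreducible T"
begin

abbreviation jp :: "nat \<Rightarrow> nat \<Rightarrow> (complex ^ 'a) set" where
  "jp i j \<equiv> joint_peirce T r e i j"

lemma jp_iff: "z \<in> jp i j \<longleftrightarrow> (\<forall>k\<in>{1..r}. z \<in> peirce (e k) (of_bool (i = k) + of_bool (j = k)))"
  by (simp add: joint_peirce_def peirce_iff)

lemma jp_commute: "jp i j = jp j i"
  by (auto simp: jp_iff add.commute)

lemma subspace_jp: "vec.subspace (jp i j)"
  using subspace_peirce by (auto simp: jp_iff vec.subspace_def)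

lemma minimal_e: "k \<in> {1..r} \<Longrightarrow> minimal_tripotent T (e k)"
  and orthogonal_e: "k \<in> {1..r} \<Longrightarrow> l \<in> {1..r} \<Longrightarrow> k \<noteq> l \<Longrightarrow> jt_orthogonal T (e k) (e l)"
  using frame by (auto simp: jt_frame_def)

lemma tripotent_e: "k \<in> {1..r} \<Longrightarrow> tripotent T (e k)"
  and e_nonzero: "k \<in> {1..r} \<Longrightarrow> e k \<noteq> 0"
  using minimal_e by (auto simp: minimal_tripotent_def)

lemma ip_e: "k \<in> {1..r} \<Longrightarrow> ip (e k) (e k) = 1"
  by (rule ip_minimal_tripotent[OF minimal_e])

lemma primitive_e: "k \<in> {1..r} \<Longrightarrow> primitive (e k)"
  by (rule minimal_tripotent_primitive[OF minimal_e])

lemma e_peirce0: "k \<in> {1..r} \<Longrightarrow> l \<in> {1..r} \<Longrightarrow> k \<noteq> l \<Longrightarrow> e l \<in> peirce (e k) 0"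
  using orthogonal_e peirce0_iff_orthogonal tripotent_e by blast

lemma e_jp: "k \<in> {1..r} \<Longrightarrow> e k \<in> jp k k"
  using e_peirce0 self_peirce[OF tripotent_e] by (auto simp: jp_iff)

lemma D_e_commute:
  assumes "k \<in> {1..r}" "l \<in> {1..r}"
  shows "T (e k) (e k) (T (e l) (e l) z) = T (e l) (e l) (T (e k) (e k) z)"
proof (cases "k = l")
  case False
  then have "T (e k) (e k) (e l) = 0" using e_peirce0[OF assms] by (simp add: peirce_iff)
  then show ?thesis using jordan_identity[of "e k" "e k" "e l" "e l" z] T_commute[of "e l" "e k" "e k"] by simp
qed simp

text \<open>
  The operators \<open>D(e\<^sub>k,e\<^sub>k)\<close> commute, so the Peirce projections of one preserve the Peirce spaces of
  the others and may be applied one after the other.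
\<close>

lemma jp_spans: "vec.span {z. \<forall>k\<in>{1..r}. \<exists>m\<in>{0,1,2}. z \<in> peirce (e k) m} = UNIV"
proof -
  let ?J = "\<lambda>n. {z. \<forall>k\<in>{1..n}. \<exists>m\<in>{0,1,2}. z \<in> peirce (e k) m}"
  have "n \<le> r \<Longrightarrow> vec.span (?J n) = UNIV" for n
  proof (induction n)
    case 0
    then show ?case by simp
  next
    case (Suc n)
    have "?J n \<subseteq> vec.span (?J (Suc n))"
    proof
      fix z assume z: "z \<in> ?J n"
      note tri = tripotent_e[of "Suc n"]
      have inv: "f z \<in> peirce (e k) m"
        if f: "f = P2 (e (Suc n)) \<or> f = P1 (e (Suc n)) \<or> f = P0 (e (Suc n))"
          and k: "k \<in> {1..n}" and m: "z \<in> peirce (e k) m" for f k m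
      proof -
        have "T (e (Suc n)) (e (Suc n)) x \<in> peirce (e k) m" if "x \<in> peirce (e k) m" for x
          using that D_e_commute[of k "Suc n" x] k Suc.prems by (simp add: peirce_iff T_scale)
        from this[OF m] this[OF this[OF m]] show ?thesis
          using f m subspace_peirce[of "e k" m] unfolding P2_def P1_def P0_def
          by (elim disjE) (simp_all add: vec.subspace_add vec.subspace_diff vec.subspace_scale)
      qed
      have "f z \<in> ?J (Suc n)"
        if f: "f = P2 (e (Suc n)) \<or> f = P1 (e (Suc n)) \<or> f = P0 (e (Suc n))" for f
      proof -
        have "\<exists>m\<in>{0,1,2}. f z \<in> peirce (e k) m" if k: "k \<in> {1..Suc n}" for k
        proof (cases "k = Suc n")
          case True
          then show ?thesis using f P_in_peirce[OF tri] Suc.prems by auto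
        next
          case False
          then have "k \<in> {1..n}" using k by auto
          then show ?thesis using z inv[OF f] by blast
        qed
        then show ?thesis by blast
      qed
      then have "P2 (e (Suc n)) z \<in> vec.span (?J (Suc n))" "P1 (e (Suc n)) z \<in> vec.span (?J (Suc n))"
          "P0 (e (Suc n)) z \<in> vec.span (?J (Suc n))"
        by (blast intro: vec.span_base)+
      then show "z \<in> vec.span (?J (Suc n))"
        by (subst peirce_sum[of z "e (Suc n)"]) (intro vec.span_add)
    qed
    then have "vec.span (?J n) \<subseteq> vec.span (?J (Suc n))"
      by (rule vec.span_minimal) simp
    then show ?case using Suc by auto
  qed
  then show ?thesis by simp
qed

lemma tripotent_sum_e: "tripotent T (\<Sum>k=1..r. e k)"
  and D_sum_e: "T (\<Sum>k=1..r. e k) (\<Sum>k=1..r. e k) z = (\<Sum>k=1..r. T (e k) (e k) z)"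
proof -
  have D: "T (\<Sum>k=1..r. e k) (\<Sum>k=1..r. e k) z = (\<Sum>k=1..r. T (e k) (e k) z)" for z
  proof -
    have "T (\<Sum>k=1..r. e k) (\<Sum>k=1..r. e k) z = (\<Sum>k=1..r. \<Sum>l=1..r. T (e k) (e l) z)"
      by (simp add: T_sum_left T_sum_mid) (rule sum.swap)
    also have "\<dots> = (\<Sum>k=1..r. \<Sum>l=1..r. if l = k then T (e k) (e k) z else 0)"
      using orthogonal_e by (intro sum.cong refl) (auto simp: jt_orthogonal_def)
    finally show ?thesis by simp
  qed
  then show "T (\<Sum>k=1..r. e k) (\<Sum>k=1..r. e k) z = (\<Sum>k=1..r. T (e k) (e k) z)" .
  have "T (e k) (e k) (\<Sum>l=1..r. e l) = 2 *s e k" if "k \<in> {1..r}" for k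
  proof -
    have "T (e k) (e k) (\<Sum>l=1..r. e l) = (\<Sum>l=1..r. if l = k then 2 *s e k else 0)"
      unfolding T_sum_right using e_peirce0[OF that] tripotent_e[OF that]
      by (intro sum.cong refl) (auto simp: peirce_iff tripotent_iff)
    then show ?thesis using that by simp
  qed
  then show "tripotent T (\<Sum>k=1..r. e k)"
    unfolding tripotent_iff D vec.scale_sum_right by (rule sum.cong[OF refl])
qed

text \<open>
  The weights of a joint eigenvector add up to its weight with respect to the tripotent
  \<open>\<Sum>e\<^sub>k\<close>, which is at most \<open>2\<close>. That leaves only the weights that define the spaces $Z_{ij}$.
\<close>

lemma weight_cases:
  fixes m :: "nat \<Rightarrow> int"
  assumes m: "\<And>k. k \<in> {1..r} \<Longrightarrow> m k \<in> {0,1,2}" and s: "(\<Sum>k=1..r. m k) \<in> {0,1,2}"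
  shows "\<exists>i j. i \<le> j \<and> j \<le> r \<and> (\<forall>k\<in>{1..r}. m k = of_bool (i = k) + of_bool (j = k))"
proof -
  have nn: "0 \<le> m k" if "k \<in> {1..r}" for k using m[OF that] by auto
  have le: "(\<Sum>k\<in>S. m k) \<le> 2" if "S \<subseteq> {1..r}" for S
  proof -
    have "(\<Sum>k\<in>S. m k) \<le> (\<Sum>k=1..r. m k)" using that nn by (intro sum_mono2) auto
    then show ?thesis using s by auto
  qed
  consider "\<forall>k\<in>{1..r}. m k = 0" | i where "i \<in> {1..r}" "m i = 2" | i where "i \<in> {1..r}" "m i = 1"
    using m by fastforce
  then show ?thesis
  proof cases
    case 1
    then show ?thesis by (intro exI[of _ 0]) auto
  next
    case 2
    have "m k = 0" if "k \<in> {1..r}" "k \<noteq> i" for k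
      using le[of "{i, k}"] 2 that nn[OF that(1)] by auto
    then show ?thesis using 2 by (intro exI[of _ i]) auto
  next
    case 3
    show ?thesis
    proof (cases "\<exists>j\<in>{1..r}. j \<noteq> i \<and> m j \<noteq> 0")
      case True
      then obtain j where j: "j \<in> {1..r}" "j \<noteq> i" "m j \<noteq> 0" by auto
      have mj: "m j = 1" using le[of "{i, j}"] 3 j nn[OF j(1)] by auto
      have "m k = 0" if "k \<in> {1..r}" "k \<noteq> i" "k \<noteq> j" for k
        using le[of "{i, j, k}"] 3 j mj that nn[OF that(1)] by auto
      then show ?thesis using 3 j mj by (intro exI[of _ "min i j"] exI[of _ "max i j"]) (auto simp: min_def max_def)
    next
      case False
      then show ?thesis using 3 by (intro exI[of _ 0] exI[of _ i]) auto
    qed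
  qed
qed

lemma jp_total: "vec.span (\<Union>j\<in>{..r}. \<Union>i\<in>{..j}. jp i j) = UNIV"
proof -
  have "{z. \<forall>k\<in>{1..r}. \<exists>m\<in>{0,1,2}. z \<in> peirce (e k) m} \<subseteq> (\<Union>j\<in>{..r}. \<Union>i\<in>{..j}. jp i j)"
  proof
    fix z assume "z \<in> {z. \<forall>k\<in>{1..r}. \<exists>m\<in>{0,1,2}. z \<in> peirce (e k) m}"
    then obtain m where m: "\<And>k. k \<in> {1..r} \<Longrightarrow> m k \<in> {0,1,2::int} \<and> z \<in> peirce (e k) (m k)"
      by (auto simp: Ball_def Bex_def) metis
    show "z \<in> (\<Union>j\<in>{..r}. \<Union>i\<in>{..j}. jp i j)"
    proof (cases "z = 0")
      case True
      then have "z \<in> jp 0 0" using subspace_jp by (simp add: vec.subspace_0)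
      then show ?thesis by auto
    next
      case False
      have "T (\<Sum>k=1..r. e k) (\<Sum>k=1..r. e k) z = (\<Sum>k=1..r. of_int (m k) *s z)"
        unfolding D_sum_e using m by (intro sum.cong refl) (auto simp: peirce_iff)
      then have "z \<in> peirce (\<Sum>k=1..r. e k) (\<Sum>k=1..r. m k)"
        by (simp add: peirce_iff vec.scale_sum_left)
      then have "(\<Sum>k=1..r. m k) \<in> {0,1,2}"
        using peirce_cases[OF tripotent_sum_e _ False] by blast
      then obtain i j where ij: "i \<le> j" "j \<le> r" and "\<forall>k\<in>{1..r}. m k = of_bool (i = k) + of_bool (j = k)"
        using weight_cases[of m] m by blast
      then have "z \<in> jp i j" unfolding jp_iff using m by metis
      then show ?thesis using ij by auto
    qed
  qed
  then show ?thesis using jp_spans vec.span_mono by blast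
qed

lemma jp_orthogonal:
  assumes "x \<in> jp i j" "y \<in> jp i' j'" "k \<in> {1..r}"
    and "(of_bool (i = k) + of_bool (j = k) :: int) \<noteq> of_bool (i' = k) + of_bool (j' = k)"
  shows "ip x y = 0"
  using peirce_orthogonal[of x "e k" _ y] assms unfolding jp_iff by blast

text \<open>Maximality of the frame: a non-zero space would contain a minimal tripotent orthogonal to all \<open>e\<^sub>k\<close>.\<close>

lemma jp_00: "jp 0 0 = {0}"
proof -
  have "x = 0" if x: "x \<in> jp 0 0" for x
  proof (rule ccontr)
    assume "x \<noteq> 0"
    moreover have "x \<in> peirce c 0" if "c \<in> e ` {1..r}" for c
      using x that by (auto simp: jp_iff)
    ultimately obtain u where u: "minimal_tripotent T u" "\<forall>c\<in>e ` {1..r}. u \<in> peirce c 0"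
      using minimal_tripotent_exists[of "e ` {1..r}" x] tripotent_e by blast
    have "jt_orthogonal T u (e k)" if "k \<in> {1..r}" for k
      using u(2) that peirce0_iff_orthogonal[OF tripotent_e[OF that]] orthogonal_sym by blast
    then show False using frame u(1) unfolding jt_frame_def by blast
  qed
  then show ?thesis using subspace_jp vec.subspace_0 by blast
qed

lemma jp_diag:
  assumes "k \<in> {1..r}" "z \<in> jp k k"
  shows "z = ip z (e k) *s e k"
proof -
  have "z \<in> peirce (e k) 2" using assms(2)[unfolded jp_iff, rule_format, OF assms(1)] by simp
  then show ?thesis by (rule primitive_peirce2[OF primitive_e[OF assms(1)] ip_e[OF assms(1)]])
qed

lemma dim_jp_diag:
  assumes k: "k \<in> {1..r}"
  shows "vec.dim (jp k k) = 1"
proof -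
  have "onb {e k} (jp k k)"
  proof -
    have "vec.span {e k} = jp k k"
    proof
      show "vec.span {e k} \<subseteq> jp k k" using e_jp[OF k] by (intro vec.span_minimal subspace_jp) auto
      show "jp k k \<subseteq> vec.span {e k}"
        using jp_diag[OF k] by (metis insertI1 subsetI vec.span_base vec.span_scale)
    qed
    then show ?thesis using ip_e[OF k] by (simp add: onb_def)
  qed
  then show ?thesis using onb_card by fastforce
qed

lemma dim_jp_offdiag:
  assumes "i \<in> {1..r}" "j \<in> {1..r}" "i \<noteq> j"
  shows "vec.dim (jp i j) = a"
proof -
  have *: "1 \<le> i \<Longrightarrow> i < j \<Longrightarrow> j \<le> r \<Longrightarrow> vec.dim (jp i j) = a" for i j
    using type unfolding jt_type_def by blast
  show ?thesis
  proof (cases "i < j")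
    case True
    then show ?thesis using * assms by auto
  next
    case False
    then show ?thesis using *[of j i] assms by (subst jp_commute) auto
  qed
qed

lemma dim_jp_0: "j \<in> {1..r} \<Longrightarrow> vec.dim (jp 0 j) = b"
  using type unfolding jt_type_def by auto

end

context jordan_frame begin

lemma jp_peirce: "z \<in> jp i j \<Longrightarrow> k \<in> {1..r} \<Longrightarrow> z \<in> peirce (e k) (of_bool (i = k) + of_bool (j = k))"
  by (simp add: jp_iff)

lemma jp_weights_inj:
  assumes "i \<le> j" "j \<le> r" "i' \<le> j'" "j' \<le> r"
    and "\<And>k. k \<in> {1..r} \<Longrightarrow> (of_bool (i = k) + of_bool (j = k) :: int) = of_bool (i' = k) + of_bool (j' = k)"
  shows "i = i' \<and> j = j'"
proof -
  have h: "(of_bool (i = k) + of_bool (j = k) :: int) = of_bool (i' = k) + of_bool (j' = k)" if "k = 0 \<or> k \<in> {1..r}" "k \<noteq> 0" for k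
    using assms(5) that by blast
  have j: "j = j'"
  proof (rule ccontr)
    assume "j \<noteq> j'"
    then consider "j < j'" | "j' < j" by linarith
    then show False
      using h[of j] h[of j'] assms(1-4) by cases (auto simp: of_bool_def split: if_splits)
  qed
  moreover have "i = i'"
  proof (rule ccontr)
    assume "i \<noteq> i'"
    then consider "i < i'" | "i' < i" by linarith
    then show False
      using h[of i] h[of i'] assms(1-4) j by cases (auto simp: of_bool_def split: if_splits)
  qed
  ultimately show ?thesis by simp
qed

text \<open>The sum of the dimensions of all $Z_{ij}$, doubled to avoid the fraction \<open>a/2\<close>.\<close>

lemma dimension: "2 * CARD('a) = r * (2 + a * (r - 1) + 2 * b)"
proof -
  let ?I = "SIGMA j:{..r}. {..j}"
  obtain B where B: "\<And>x. onb (B x) (jp (snd x) (fst x))"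
    using choice[of "\<lambda>x B. onb B (jp (snd x) (fst x))"] onb_exists[OF subspace_jp] by blast
  have orth: "ip x y = 0"
    if "p \<in> ?I" "q \<in> ?I" "p \<noteq> q" "x \<in> jp (snd p) (fst p)" "y \<in> jp (snd q) (fst q)" for p q x y
  proof (rule ccontr)
    assume nz: "ip x y \<noteq> 0"
    have "(of_bool (snd p = k) + of_bool (fst p = k) :: int) = of_bool (snd q = k) + of_bool (fst q = k)"
      if "k \<in> {1..r}" for k
      using jp_orthogonal[OF \<open>x \<in> _\<close> \<open>y \<in> _\<close> that] nz by blast
    then have "snd p = snd q \<and> fst p = fst q"
      using that(1,2) by (intro jp_weights_inj) auto
    then show False using that(3) by (simp add: prod_eq_iff)
  qed
  have fin: "finite ?I" by simp
  have "(\<Union>j\<in>{..r}. \<Union>i\<in>{..j}. jp i j) \<subseteq> (\<Union>p\<in>?I. jp (snd p) (fst p))" by force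
  then have U: "vec.span (\<Union>p\<in>?I. jp (snd p) (fst p)) = UNIV"
    using vec.span_mono jp_total by blast
  have "onb (\<Union>p\<in>?I. B p) UNIV"
    unfolding U[symmetric] by (rule onb_UN(1)[OF fin B orth])
  moreover have "card (\<Union>p\<in>?I. B p) = (\<Sum>p\<in>?I. vec.dim (jp (snd p) (fst p)))"
    by (rule onb_UN(2)[OF fin B orth])
  ultimately have "CARD('a) = (\<Sum>p\<in>?I. vec.dim (jp (snd p) (fst p)))"
    using onb_card[of _ UNIV] by (simp only: vec_dim_card)
  also have "\<dots> = (\<Sum>j\<le>r. \<Sum>i\<le>j. vec.dim (jp i j))"
    by (subst sum.Sigma) (auto simp: case_prod_beta)
  also have "\<dots> = (\<Sum>j\<le>r. if j = 0 then 0 else b + a * (j - 1) + 1)"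
  proof (rule sum.cong[OF refl])
    fix j assume j: "j \<in> {..r}"
    show "(\<Sum>i\<le>j. vec.dim (jp i j)) = (if j = 0 then 0 else b + a * (j - 1) + 1)"
    proof (cases j)
      case 0
      then show ?thesis by (simp add: jp_00)
    next
      case (Suc n)
      have "{..j} = insert 0 (insert j {1..n})" using Suc by auto
      then have "(\<Sum>i\<le>j. vec.dim (jp i j)) = vec.dim (jp 0 j) + (vec.dim (jp j j) + (\<Sum>i=1..n. vec.dim (jp i j)))"
        using Suc by simp
      also have "(\<Sum>i=1..n. vec.dim (jp i j)) = (\<Sum>i=1..n. a)"
        using j Suc by (intro sum.cong refl dim_jp_offdiag) auto
      finally show ?thesis using j Suc by (simp add: dim_jp_0 dim_jp_diag)
    qed
  qed
  finally have "CARD('a) = (\<Sum>j\<le>r. if j = 0 then 0 else b + a * (j - 1) + 1)" .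
  moreover have "2 * (\<Sum>j\<le>n. if j = 0 then 0 else b + a * (j - 1) + 1) = n * (2 + a * (n - 1) + 2 * b)" for n
  proof (induction n)
    case (Suc n)
    then show ?case by (cases n) (auto simp: algebra_simps)
  qed simp
  ultimately show ?thesis by simp
qed

text \<open>
  For \<open>x\<close>, \<open>y\<close> preserving the span of \<open>B\<close>, both \<open>D(x,y)\<close> and its adjoint \<open>D(y,x)\<close> act on \<open>B\<close> by
  mutually adjoint matrices, so the two correction terms of the Jordan identity cancel.
\<close>

lemma casimir_commute:
  assumes B: "onb B V" and xy: "\<And>u. u \<in> V \<Longrightarrow> T x y u \<in> V" "\<And>u. u \<in> V \<Longrightarrow> T y x u \<in> V"
  shows "T x y (\<Sum>u\<in>B. T u u z) = (\<Sum>u\<in>B. T u u (T x y z))"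
proof -
  have "T x y (\<Sum>u\<in>B. T u u z) = (\<Sum>u\<in>B. T u u (T x y z)) + (\<Sum>u\<in>B. T (T x y u) u z) - (\<Sum>u\<in>B. T u (T y x u) z)"
    unfolding T_sum_right jordan_identity[of x y _ _ z] sum.distrib[symmetric] sum_subtractf[symmetric]
    by (intro sum.cong refl) (simp add: T_commute[of _ x y])
  moreover have "(\<Sum>u\<in>B. T (T x y u) u z) = (\<Sum>u\<in>B. T u (T y x u) z)"
  proof -
    have "(\<Sum>u\<in>B. T (T x y u) u z) = (\<Sum>u\<in>B. \<Sum>v\<in>B. ip (T x y u) v *s T v u z)"
    proof (rule sum.cong[OF refl])
      fix u assume "u \<in> B"
      then have "T x y u \<in> V" using xy onb_subset[OF B] by blast
      from onb_expand[OF B this] show "T (T x y u) u z = (\<Sum>v\<in>B. ip (T x y u) v *s T v u z)"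
        by (metis (no_types, lifting) T_scale_left T_sum_left sum.cong)
    qed
    also have "\<dots> = (\<Sum>v\<in>B. \<Sum>u\<in>B. cnj (ip (T y x v) u) *s T v u z)"
      by (subst sum.swap) (intro sum.cong refl, metis T_adjoint ip_commute)
    also have "\<dots> = (\<Sum>v\<in>B. T v (T y x v) z)"
    proof (rule sum.cong[OF refl])
      fix v assume "v \<in> B"
      then have "T y x v \<in> V" using xy onb_subset[OF B] by blast
      from onb_expand[OF B this] show "(\<Sum>u\<in>B. cnj (ip (T y x v) u) *s T v u z) = T v (T y x v) z"
        by (metis (no_types, lifting) T_scale_mid T_sum_mid sum.cong)
    qed
    finally show ?thesis .
  qed
  ultimately show ?thesis by simp
qed

lemma peirce1_span:
  assumes k: "k \<in> {1..r}"
  shows "peirce (e k) 1 = vec.span (\<Union>l\<in>{0..r} - {k}. jp l k)"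
proof
  have "jp l k \<subseteq> peirce (e k) 1" if "l \<noteq> k" for l
    using jp_peirce[OF _ k, of _ l k] that by auto
  then show "vec.span (\<Union>l\<in>{0..r} - {k}. jp l k) \<subseteq> peirce (e k) 1"
    by (intro vec.span_minimal subspace_peirce) auto
  interpret P: Vector_Spaces.linear "(*s)" "(*s)" "P1 (e k)" by (rule clinear_P)
  have "P1 (e k) ` (\<Union>j\<in>{..r}. \<Union>i\<in>{..j}. jp i j) \<subseteq> vec.span (\<Union>l\<in>{0..r} - {k}. jp l k)"
  proof (rule image_subsetI)
    fix x assume "x \<in> (\<Union>j\<in>{..r}. \<Union>i\<in>{..j}. jp i j)"
    then obtain i j where x: "i \<le> j" "j \<le> r" "x \<in> jp i j" by auto
    have "x \<in> peirce (e k) (of_bool (i = k) + of_bool (j = k))" using x(3) k by (simp add: jp_iff)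
    note P1x = P_eigen(2)[OF this]
    consider "i = k" "j \<noteq> k" | "j = k" "i \<noteq> k" | "(i = k) = (j = k)" by blast
    then show "P1 (e k) x \<in> vec.span (\<Union>l\<in>{0..r} - {k}. jp l k)"
    proof cases
      case 1
      then have "P1 (e k) x = x" "x \<in> jp j k" using P1x x(3) jp_commute by auto
      then show ?thesis using 1 x by (intro vec.span_base) auto
    next
      case 2
      then have "P1 (e k) x = x" using P1x by auto
      then show ?thesis using 2 x by (intro vec.span_base) auto
    next
      case 3
      then have "P1 (e k) x = 0" using P1x by auto
      then show ?thesis by (simp add: vec.span_zero)
    qed
  qed
  then have "vec.span (P1 (e k) ` (\<Union>j\<in>{..r}. \<Union>i\<in>{..j}. jp i j)) \<subseteq> vec.span (\<Union>l\<in>{0..r} - {k}. jp l k)"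
    by (rule vec.span_minimal) simp
  then have sub: "range (P1 (e k)) \<subseteq> vec.span (\<Union>l\<in>{0..r} - {k}. jp l k)"
    by (simp add: P.span_image jp_total)
  show "peirce (e k) 1 \<subseteq> vec.span (\<Union>l\<in>{0..r} - {k}. jp l k)"
  proof
    fix z assume "z \<in> peirce (e k) 1"
    then have "P1 (e k) z = z" using P_eigen(2)[of z "e k" 1] by simp
    moreover have "P1 (e k) z \<in> vec.span (\<Union>l\<in>{0..r} - {k}. jp l k)" using sub by blast
    ultimately show "z \<in> vec.span (\<Union>l\<in>{0..r} - {k}. jp l k)" by (simp only:)
  qed
qed

lemma peirce0_span:
  assumes k: "k \<in> {1..r}"
  shows "peirce (e k) 0 \<subseteq> vec.span (\<Union>j\<in>{1..r} - {k}. \<Union>i\<in>{0..r} - {k}. jp i j)"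
    (is "_ \<subseteq> vec.span ?S")
proof
  interpret P: Vector_Spaces.linear "(*s)" "(*s)" "P0 (e k)" by (rule clinear_P)
  have "P0 (e k) ` (\<Union>j\<in>{..r}. \<Union>i\<in>{..j}. jp i j) \<subseteq> vec.span ?S"
  proof (rule image_subsetI)
    fix x assume "x \<in> (\<Union>j\<in>{..r}. \<Union>i\<in>{..j}. jp i j)"
    then obtain i j where x: "i \<le> j" "j \<le> r" "x \<in> jp i j" by auto
    have "x \<in> peirce (e k) (of_bool (i = k) + of_bool (j = k))" using x(3) k by (simp add: jp_iff)
    note P0x = P_eigen(3)[OF this]
    show "P0 (e k) x \<in> vec.span ?S"
    proof (cases "i = k \<or> j = k \<or> j = 0")
      case True
      then have "P0 (e k) x = 0" using P0x x jp_00 by (cases "j = 0") (auto simp: P.zero)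
      then show ?thesis by (simp add: vec.span_zero)
    next
      case False
      then have "P0 (e k) x = x" using P0x by auto
      moreover have "j \<in> {1..r} - {k}" "i \<in> {0..r} - {k}" using False x by auto
      then have "x \<in> ?S" using x(3) by blast
      ultimately show ?thesis by (simp add: vec.span_base)
    qed
  qed
  then have "vec.span (P0 (e k) ` (\<Union>j\<in>{..r}. \<Union>i\<in>{..j}. jp i j)) \<subseteq> vec.span ?S"
    by (rule vec.span_minimal) simp
  then have sub: "range (P0 (e k)) \<subseteq> vec.span ?S"
    by (simp add: P.span_image jp_total)
  fix z assume "z \<in> peirce (e k) 0"
  then have "P0 (e k) z = z" using P_eigen(3)[of z "e k" 0] by simp
  moreover have "P0 (e k) z \<in> vec.span ?S" using sub by blast
  ultimately show "z \<in> vec.span ?S" by (simp only:)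
qed

text \<open>
  The operator $\sum_u D(u,u)$, with \<open>u\<close> running through an orthonormal basis of the Peirce
  1-space of \<open>c\<close>, is the scalar \<open>a\<close> on the Peirce 0-space: this is a trace count on the frame
  elements, and \<open>D(z,e\<^sub>j)\<close> transports it to the other joint Peirce spaces.
\<close>

lemma peirce1_basis:
  assumes k: "k \<in> {1..r}"
  obtains B where "onb B (peirce (e k) 1)" "card B = a * (r - 1) + b"
    "\<And>z. z \<in> peirce (e k) 0 \<Longrightarrow> (\<Sum>u\<in>B. T u u z) = of_nat a *s z"
proof -
  let ?I = "{0..r} - {k}" let ?V = "peirce (e k) 1"
  obtain B where B: "\<And>l. onb (B l) (jp l k)"
    using choice[of "\<lambda>l B. onb B (jp l k)"] onb_exists[OF subspace_jp] by blast
  have orth: "ip x y = 0" if "l \<in> ?I" "l' \<in> ?I" "l \<noteq> l'" "x \<in> jp l k" "y \<in> jp l' k" for l l' x y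
    using jp_orthogonal[OF that(4,5), of "if l = 0 then l' else l"] that(1-3) by (auto split: if_splits)
  let ?B = "\<Union>l\<in>?I. B l"
  have fin: "finite ?I" by simp
  have onbB: "onb ?B ?V"
    unfolding peirce1_span[OF k] by (rule onb_UN(1)[OF fin B orth])
  have card: "card ?B = (\<Sum>l\<in>?I. vec.dim (jp l k))"
    by (rule onb_UN(2)[OF fin B orth])
  have "(\<Sum>l\<in>?I. vec.dim (jp l k)) = a * (r - 1) + b"
  proof -
    have I: "?I = insert 0 ({1..r} - {k})" using k by auto
    have "(\<Sum>l\<in>{1..r} - {k}. vec.dim (jp l k)) = (\<Sum>l\<in>{1..r} - {k}. a)"
      using k by (intro sum.cong refl dim_jp_offdiag) auto
    then show ?thesis using k by (simp add: I dim_jp_0)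
  qed
  with card have card': "card ?B = a * (r - 1) + b" by simp
  define E where "E z = (\<Sum>u\<in>?B. T u u z)" for z
  have E_lin: "clinear E"
    by (simp add: E_def clinear_iff T_add T_scale sum.distrib vec.scale_sum_right)
  have E_comm: "T x y (E z) = E (T x y z)" if "x \<in> peirce (e k) 0" "y \<in> peirce (e k) 0" for x y z
    unfolding E_def
    by (rule casimir_commute[OF onbB]) (use peirce_T[OF that(1,2)] peirce_T[OF that(2,1)] in force)+
  have E_e: "E (e j) = of_nat a *s e j" if j: "j \<in> {1..r}" "j \<noteq> k" for j
  proof -
    have ej: "e j \<in> peirce (e k) 0" using e_peirce0 k j by auto
    have "T (e j) (e j) (E (e j)) = E (2 *s e j)"
      using E_comm[OF ej ej, of "e j"] tripotent_e[OF j(1)] by (simp add: tripotent_iff)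
    also have "\<dots> = 2 *s E (e j)" using E_lin by (simp add: clinear_iff)
    finally have "E (e j) \<in> peirce (e j) 2" by (simp add: peirce_iff)
    then have 1: "E (e j) = ip (E (e j)) (e j) *s e j"
      by (rule primitive_peirce2[OF primitive_e[OF j(1)] ip_e[OF j(1)]])
    have "ip (E (e j)) (e j) = (\<Sum>u\<in>?B. ip u (T (e j) (e j) u))"
    proof -
      have "ip (T u u (e j)) (e j) = ip u (T (e j) (e j) u)" for u
        using T_adjoint[of "e j" u u "e j"] T_commute[of u u "e j"] T_commute[of u "e j" "e j"] by simp
      then show ?thesis by (simp add: E_def ip_sum_left)
    qed
    also have "\<dots> = (\<Sum>u\<in>?B. if u \<in> B j then 1 else 0)"
    proof (rule sum.cong[OF refl])
      fix u assume "u \<in> ?B"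
      then obtain l where l: "l \<in> ?I" "u \<in> B l" by blast
      then have ul: "u \<in> jp l k" using onb_subset[OF B] by blast
      have uu: "ip u u = 1" using onb_ip[OF B l(2,2)] by simp
      have "u \<in> B j \<longleftrightarrow> l = j"
        using orth[of l j u u] uu l ul j onb_subset[OF B, of u j] by (metis DiffI atLeastAtMost_iff le0 singletonD zero_neq_one)
      moreover have "T (e j) (e j) u = of_bool (l = j) *s u"
        using jp_peirce[OF ul j(1)] j(2) by (simp add: peirce_iff)
      ultimately show "ip u (T (e j) (e j) u) = (if u \<in> B j then 1 else 0)"
        using uu by (simp add: ip_simps)
    qed
    also have "\<dots> = of_nat (card (?B \<inter> B j))"
      using onb_finite[OF onbB] by (simp add: sum.If_cases Int_def)
    also have "?B \<inter> B j = B j" using j by auto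
    also have "card (B j) = a" using onb_card[OF B] dim_jp_offdiag[of j k] j k by simp
    finally show ?thesis using 1 by simp
  qed
  have "E z = of_nat a *s z" if "z \<in> peirce (e k) 0" for z
  proof -
    have "z \<in> vec.span (\<Union>j\<in>{1..r} - {k}. \<Union>i\<in>{0..r} - {k}. jp i j)"
      using peirce0_span[OF k] that by blast
    then show ?thesis
    proof (induction rule: vec.span_induct_alt)
      case base
      then show ?case by (simp add: E_def)
    next
      case (step c x y)
      from step(1) obtain i j where x: "j \<in> {1..r}" "j \<noteq> k" "i \<in> {0..r}" "i \<noteq> k" "x \<in> jp i j" by blast
      have "E x = of_nat a *s x"
      proof (cases "i = j")
        case True
        then have "x = ip x (e j) *s e j" using jp_diag x by simp
        moreover have "E (c *s e j) = of_nat a *s (c *s e j)" for c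
          using E_e[OF x(1,2)] E_lin by (simp add: clinear_iff vec.scale_left_commute mult.commute)
        ultimately show ?thesis by metis
      next
        case False
        have x0: "x \<in> peirce (e k) 0" using jp_peirce[OF x(5) k] x(2,4) by simp
        have e0: "e j \<in> peirce (e k) 0" using e_peirce0 k x by auto
        have "x \<in> peirce (e j) 1" using jp_peirce[OF x(5,1)] False by simp
        then have "x = T x (e j) (e j)" using T_commute[of x "e j" "e j"] by (simp add: peirce_iff)
        moreover have "E (T x (e j) (e j)) = of_nat a *s T x (e j) (e j)"
          using E_comm[OF x0 e0, of "e j"] by (simp add: E_e[OF x(1,2)] T_scale)
        ultimately show ?thesis by metis
      qed
      then show ?case using E_lin step(2) by (simp add: clinear_iff vec.scale_right_distrib vec.scale_left_commute mult.commute)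
    qed
  qed
  then show ?thesis using that[of ?B] onbB card' by (simp add: E_def)
qed

text \<open>
  If \<open>a = 0\<close>, then the Peirce 0-space of \<open>e\<^sub>1\<close> and the sum of its Peirce 1- and 2-spaces are
  complementary ideals. The essential point is \<open>D(x,u) = 0\<close> for $x\in Z_{01}$ and $u\in Z_{0j}$: as
  \<open>{x;u;e\<^sub>j}\<close> lies in $Z_{1j}=0$, the operator \<open>D(x,u)\<close> commutes with \<open>D(e\<^sub>j,e\<^sub>j)\<close>, but it also lowers the
  eigenvalues of \<open>D(e\<^sub>j,e\<^sub>j)\<close> by \<open>1\<close>.
\<close>

lemma multiplicity_pos:
  assumes r: "2 \<le> r"
  shows "0 < a"
proof (rule ccontr)
  assume "\<not> 0 < a"
  then have "a = 0" by simp
  have jp0: "jp i j = {0}" if "i \<in> {1..r}" "j \<in> {1..r}" "i \<noteq> j" for i j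
  proof -
    obtain B where B: "onb B (jp i j)" using onb_exists[OF subspace_jp] by blast
    then have "card B = 0" using onb_card[OF B] dim_jp_offdiag[OF that] \<open>a = 0\<close> by simp
    then have "B = {}" using onb_finite[OF B] by simp
    then show ?thesis using onb_span[OF B] by simp
  qed
  have k: "1 \<in> {1..r}" using r by simp
  let ?J = "peirce (e 1) 0" let ?I = "{z. P0 (e 1) z = 0}"
  have tri: "tripotent T (e 1)" using tripotent_e k by blast
  have I_split: "P2 (e 1) z + P1 (e 1) z = z" if "z \<in> ?I" for z
    using peirce_sum[of z "e 1", symmetric] that by simp
  have D1: "T x y z = 0" if x: "x \<in> jp 0 1" and y: "y \<in> ?J" for x y z
  proof -
    have "y \<in> vec.span (\<Union>j\<in>{1..r} - {1}. \<Union>i\<in>{0..r} - {1}. jp i j)"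
      using peirce0_span[OF k] y by blast
    then show ?thesis
    proof (induction rule: vec.span_induct_alt)
      case (step c u y)
      from step(1) obtain i j where u: "j \<in> {1..r}" "j \<noteq> 1" "i \<in> {0..r}" "i \<noteq> 1" "u \<in> jp i j" by blast
      have xj: "x \<in> peirce (e j) 0" using jp_peirce[OF x u(1)] u(1,2) by simp
      then have ej: "jt_orthogonal T (e j) x" "jt_orthogonal T x (e j)"
        using peirce0_iff_orthogonal tripotent_e[OF u(1)] orthogonal_sym by blast+
      have "T x u z = 0"
      proof -
        consider "i = j" | "i = 0" | "i \<noteq> j" "i \<in> {1..r}" using u(3) by force
        then show ?thesis
        proof cases
          case 1
          then have "u = ip u (e j) *s e j" using jp_diag u by simp
          then have "T x u z = cnj (ip u (e j)) *s T x (e j) z" by (metis T_scale_mid)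
          then show ?thesis using ej(2) by (simp add: jt_orthogonal_def)
        next
          case 2
          have uj: "u \<in> peirce (e j) 1" using jp_peirce[OF u(5,1)] 2 u(1) by simp
          have "T x u (e j) \<in> jp 1 j"
            unfolding jp_iff
          proof
            fix l assume l: "l \<in> {1..r}"
            have "x \<in> peirce (e l) (of_bool (1 = l))" using x l by (simp add: jp_iff)
            moreover have "u \<in> peirce (e l) (of_bool (j = l))" using u(5) l 2 by (simp add: jp_iff)
            moreover have "e j \<in> peirce (e l) (2 * of_bool (j = l))" using e_jp[OF u(1)] l by (simp add: jp_iff)
            ultimately have "T x u (e j) \<in> peirce (e l) (of_bool (1 = l) - of_bool (j = l) + 2 * of_bool (j = l))"
              by (rule peirce_T)
            then show "T x u (e j) \<in> peirce (e l) (of_bool (1 = l) + of_bool (j = l))" by (simp add: algebra_simps)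
          qed
          then have 0: "T x u (e j) = 0" using jp0[OF k u(1)] u(2) by auto
          have "T x u (T (e j) (e j) z) = T (e j) (e j) (T x u z)"
            using jordan_identity[of x u "e j" "e j" z] 0 ej(1) by (simp add: jt_orthogonal_def)
          moreover have "T (e j) (e j) (T x u z) = T x u (T (e j) (e j) z) - T x u z"
            using jordan_identity[of "e j" "e j" x u z] xj uj T_commute[of u "e j" "e j"]
            by (simp add: peirce_iff)
          ultimately show ?thesis by simp
        next
          case 3
          then show ?thesis using jp0[of i j] u by auto
        qed
      qed
      then show ?case using step(2) by (simp add: T_add T_scale)
    qed simp
  qed
  have V: "peirce (e 1) 1 \<subseteq> jp 0 1"
  proof -
    have "(\<Union>l\<in>{0..r} - {1}. jp l 1) \<subseteq> jp 0 1"
    proof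
      fix x assume "x \<in> (\<Union>l\<in>{0..r} - {1}. jp l 1)"
      then obtain l where l: "l \<in> {0..r}" "l \<noteq> 1" "x \<in> jp l 1" by blast
      show "x \<in> jp 0 1"
      proof (cases "l = 0")
        case False
        then have "x = 0" using jp0[of l 1] l k by auto
        then show ?thesis using subspace_jp by (simp add: vec.subspace_0)
      qed (use l in simp)
    qed
    then show ?thesis unfolding peirce1_span[OF k] by (intro vec.span_minimal subspace_jp)
  qed
  have D: "T x y z = 0" if x: "x \<in> ?I" and y: "y \<in> ?J" for x y z
  proof -
    have "T (P1 (e 1) x) y z = 0" using D1 V P_in_peirce(2)[OF tri] y by blast
    moreover have "T (P2 (e 1) x) y z = 0"
      using y peirce0_iff_orthogonal[OF tri] primitive_P2[OF primitive_e[OF k] ip_e[OF k], of x]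
      by (simp add: T_scale jt_orthogonal_def)
    ultimately have "T (P2 (e 1) x + P1 (e 1) x) y z = 0" by (simp add: T_add)
    then show ?thesis by (simp only: I_split[OF x])
  qed
  interpret P: Vector_Spaces.linear "(*s)" "(*s)" "P0 (e 1)" by (rule clinear_P)
  have subI: "vec.subspace ?I" by (auto simp: vec.subspace_def P.zero P.add P.scale simp del: One_nat_def)
  have orth: "ip x y = 0" if x: "x \<in> ?I" and y: "y \<in> ?J" for x y
  proof -
    have "ip (P2 (e 1) x + P1 (e 1) x) y = 0"
      using peirce_orthogonal[OF P_in_peirce(1)[OF tri] y] peirce_orthogonal[OF P_in_peirce(2)[OF tri] y]
      by (simp add: ip_add_left)
    then show ?thesis by (simp only: I_split[OF x])
  qed
  have J0: "P0 (e 1) y = y" if "y \<in> ?J" for y using P_eigen(3)[OF that] by simp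
  have sum: "\<exists>x\<in>?I. \<exists>y\<in>?J. z = x + y" for z
    using P_in_peirce(3)[OF tri, of z] J0
    by (intro bexI[of _ "z - P0 (e 1) z"] bexI[of _ "P0 (e 1) z"]) (auto simp: P.diff simp del: One_nat_def)
  have "jt_ideal T ?I" by (rule orthogonal_ideal[OF subI subspace_peirce sum orth D])
  moreover have "jt_ideal T ?J"
  proof (rule orthogonal_ideal[OF subspace_peirce subI])
    show "\<exists>x\<in>?J. \<exists>y\<in>?I. z = x + y" for z using sum[of z] by (metis add.commute)
    show "ip x y = 0" if "x \<in> ?J" "y \<in> ?I" for x y
      using orth[OF that(2,1)] by (subst ip_commute) simp
    show "T x y z = 0" if "x \<in> ?J" "y \<in> ?I" for x y z
      by (rule ip_ext) (simp only: T_adjoint D[OF that(2,1)] ip_zero_left ip_zero_right)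
  qed
  moreover have "?I \<noteq> {0}"
  proof -
    have "e 1 \<in> ?I" using P_eigen(3)[OF self_peirce[OF tri]] by simp
    then show ?thesis using e_nonzero[OF k] by blast
  qed
  moreover have "?J \<noteq> {0}" using e_peirce0[OF k, of 2] e_nonzero[of 2] r by auto
  moreover have "?I \<inter> ?J = {0}"
    using J0 subI subspace_peirce[of "e 1" 0] by (auto simp: vec.subspace_0)
  ultimately show False using irreducible sum unfolding jt_irreducible_def by blast
qed

end

section \<open>The group and the manifold of rank-one elements\<close>

lemma continuous_matrix_vector:
  fixes f :: "'b::topological_space \<Rightarrow> complex ^ 'n::finite ^ 'm::finite"
  shows "continuous_on S f \<Longrightarrow> continuous_on S (\<lambda>g. f g *v z)"
  unfolding matrix_vector_mult_def
  by (intro continuous_on_vec_lambda continuous_on_sum continuous_on_mult continuous_on_component continuous_on_const)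

lemma continuous_matrix_mult:
  fixes k :: "complex ^ 'n::finite ^ 'n"
  shows "continuous_on S (\<lambda>g. k ** g)"
  unfolding matrix_matrix_mult_def
  by (intro continuous_on_vec_lambda continuous_on_sum continuous_on_mult continuous_on_component continuous_on_const continuous_on_id)

lemma mat_vector: "mat c *v z = c *s (z :: complex ^ 'n::finite)"
proof -
  have "(\<Sum>j\<in>UNIV. (if i = j then c else 0) * z $ j) = c * z $ i" for i
    by (subst sum.cong[OF refl, of _ _ "\<lambda>j. if i = j then c * z $ i else 0"]) auto
  then show ?thesis by (simp add: mat_def matrix_vector_mult_def vec_eq_iff)
qed

lemma bounded_matrices:
  fixes S :: "(complex ^ 'n::finite ^ 'm::finite) set"
  assumes "\<And>j. \<exists>B. \<forall>g\<in>S. norm (g *v axis j 1) \<le> B"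
  shows "bounded S"
proof -
  obtain B where B: "\<And>j g. g \<in> S \<Longrightarrow> norm (g *v axis j 1) \<le> B j"
    using assms by metis
  have "norm g \<le> (\<Sum>i\<in>(UNIV :: 'm set). \<Sum>j\<in>UNIV. B j)" if g: "g \<in> S" for g
  proof -
    have "norm (g $ i $ j) \<le> B j" for i j
    proof -
      have "g $ i $ j = (g *v axis j 1) $ i"
        by (simp add: matrix_vector_mult_def axis_def if_distrib[of "(*) _"] cong: if_cong)
      then show ?thesis using B[OF g, of j] Finite_Cartesian_Product.norm_nth_le[of "g *v axis j 1" i] by simp
    qed
    moreover have "norm (g $ i) \<le> (\<Sum>j\<in>UNIV. norm (g $ i $ j))" for i
      by (simp add: norm_vec_def L2_set_le_sum)
    ultimately have "norm (g $ i) \<le> (\<Sum>j\<in>UNIV. B j)" for i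
      by (meson order.trans sum_mono)
    moreover have "norm g \<le> (\<Sum>i\<in>UNIV. norm (g $ i))"
      unfolding norm_vec_def[of g] by (rule L2_set_le_sum) simp
    ultimately show ?thesis by (meson order.trans sum_mono)
  qed
  then show ?thesis by (auto simp: bounded_iff)
qed

lemma cis_Arg_unit: "cmod c = 1 \<Longrightarrow> cis (Arg c) = c"
  using cis_Arg[of c] by (cases "c = 0") (auto simp: sgn_eq)

context jordan_triple begin

lemma K_aut: "k \<in> jt_K T \<Longrightarrow> k \<in> jt_aut T"
  unfolding jt_K_def using connected_component_subset by blast

lemma K_T: "k \<in> jt_K T \<Longrightarrow> k *v T u v w = T (k *v u) (k *v v) (k *v w)"
  using K_aut[of k] by (simp add: jt_aut_def)

lemma one_in_aut: "mat 1 \<in> jt_aut T"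
  by (auto simp: jt_aut_def invertible_def intro!: exI[of _ "mat 1"])

lemma one_in_K: "mat 1 \<in> jt_K T"
  by (simp add: jt_K_def one_in_aut)

lemma aut_mult: "k \<in> jt_aut T \<Longrightarrow> l \<in> jt_aut T \<Longrightarrow> k ** l \<in> jt_aut T"
  by (simp add: jt_aut_def invertible_mult flip: matrix_vector_mul_assoc)

lemma in_K_I:
  assumes "connected C" "C \<subseteq> jt_aut T" "l \<in> C" "l \<in> jt_K T" "k \<in> C"
  shows "k \<in> jt_K T"
proof -
  have "connected_component (jt_aut T) l k" using assms by (auto simp: connected_component_def)
  moreover have "connected_component (jt_aut T) (mat 1) l" using assms(4) by (simp add: jt_K_def)
  ultimately show ?thesis using connected_component_trans by (auto simp: jt_K_def)
qed

lemma connected_K: "connected (jt_K T)"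
  by (simp add: jt_K_def)

lemma K_mult:
  assumes "k \<in> jt_K T" "l \<in> jt_K T"
  shows "k ** l \<in> jt_K T"
proof (rule in_K_I[of "(\<lambda>g. k ** g) ` jt_K T"])
  show "connected ((\<lambda>g. k ** g) ` jt_K T)"
    by (intro connected_continuous_image continuous_matrix_mult connected_K)
  show "(\<lambda>g. k ** g) ` jt_K T \<subseteq> jt_aut T" using assms K_aut aut_mult by blast
  show "k \<in> (\<lambda>g. k ** g) ` jt_K T" using one_in_K by (intro image_eqI[of _ _ "mat 1"]) simp_all
qed (use assms in auto)

lemma K_inverse:
  assumes k: "k \<in> jt_K T"
  obtains l where "l \<in> jt_K T" "l ** k = mat 1" "k ** l = mat 1"
    "\<And>z. l *v (k *v z) = z" "\<And>z. k *v (l *v z) = z"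
proof -
  obtain l where l: "k ** l = mat 1" "l ** k = mat 1"
    using K_aut[OF k] by (auto simp: jt_aut_def invertible_def)
  have lk: "l *v (k *v z) = z" "k *v (l *v z) = z" for z
    by (simp_all add: l matrix_vector_mul_assoc)
  have "l *v T u v w = T (l *v u) (l *v v) (l *v w)" for u v w
    using K_T[OF k, of "l *v u" "l *v v" "l *v w"] by (metis lk)
  then have la: "l \<in> jt_aut T" using l by (auto simp: jt_aut_def invertible_def)
  have "l \<in> jt_K T"
  proof (rule in_K_I[of "(\<lambda>g. l ** g) ` jt_K T"])
    show "connected ((\<lambda>g. l ** g) ` jt_K T)"
      by (intro connected_continuous_image continuous_matrix_mult connected_K)
    show "(\<lambda>g. l ** g) ` jt_K T \<subseteq> jt_aut T" using la K_aut aut_mult by blast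
    show "mat 1 \<in> (\<lambda>g. l ** g) ` jt_K T" using k l by (metis imageI)
    show "l \<in> (\<lambda>g. l ** g) ` jt_K T" using one_in_K by (intro image_eqI[of _ _ "mat 1"]) simp_all
  qed (rule one_in_K)
  then show ?thesis using that l lk by blast
qed

text \<open>
  Limits of elements of \<open>K\<close> still preserve the triple product and the inner product, hence are
  automorphisms, and the closure of the connected set \<open>K\<close> is connected; so \<open>K\<close> is closed.
\<close>

lemma compact_K: "compact (jt_K T)"
proof -
  have ip: "ip (g *v z) (g *v w) = ip z w" if "g \<in> closure (jt_K T)" for g z w
  proof -
    have "closed {g. ip (g *v z) (g *v w) = ip z w}"
      by (intro closed_Collect_eq continuous_ip continuous_matrix_vector continuous_on_id continuous_on_const)
    moreover have "jt_K T \<subseteq> {g. ip (g *v z) (g *v w) = ip z w}" using ip_K by blast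
    ultimately have "closure (jt_K T) \<subseteq> {g. ip (g *v z) (g *v w) = ip z w}" by (simp add: closure_minimal)
    then show ?thesis using that by blast
  qed
  have hom: "g *v T u v w = T (g *v u) (g *v v) (g *v w)" if "g \<in> closure (jt_K T)" for g u v w
  proof -
    have "closed {g. g *v T u v w = T (g *v u) (g *v v) (g *v w)}"
      by (intro closed_Collect_eq continuous_T continuous_matrix_vector continuous_on_id)
    moreover have "jt_K T \<subseteq> {g. g *v T u v w = T (g *v u) (g *v v) (g *v w)}" using K_T by blast
    ultimately have "closure (jt_K T) \<subseteq> {g. g *v T u v w = T (g *v u) (g *v v) (g *v w)}"
      by (simp add: closure_minimal)
    then show ?thesis using that by blast
  qed
  have "invertible g" if g: "g \<in> closure (jt_K T)" for g
  proof -
    have "\<exists>B. B ** g = mat 1"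
      unfolding matrix_left_invertible_ker using ip[OF g] ip_self_eq_0 by metis
    then show ?thesis using invertible_left_inverse by blast
  qed
  then have sub: "closure (jt_K T) \<subseteq> jt_aut T" using hom by (auto simp: jt_aut_def)
  have "closure (jt_K T) \<subseteq> jt_K T"
    using in_K_I[OF connected_imp_connected_closure[OF connected_K] sub _ one_in_K] closure_subset one_in_K by blast
  then have "closed (jt_K T)" using closure_subset_eq by blast
  moreover have "bounded (jt_K T)"
  proof (rule bounded_matrices)
    fix j
    obtain C where "\<And>z. norm z \<le> C * sqrt (Re (ip z z))" using norm_le_ip by blast
    then show "\<exists>B. \<forall>g\<in>jt_K T. norm (g *v axis j 1) \<le> B"
      by (intro exI[of _ "C * sqrt (Re (ip (axis j 1) (axis j 1)))"] ballI) (metis ip_K)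
  qed
  ultimately show ?thesis by (simp add: compact_eq_bounded_closed)
qed

lemma continuous_cis_path: "continuous_on S (\<lambda>s. mat (cis s) :: complex ^ 'n ^ 'n)"
proof -
  have "continuous_on S (\<lambda>s. if i = j then cis s else 0)" for i j :: 'n
    by (cases "i = j") (auto intro: continuous_on_cis continuous_on_id)
  then show ?thesis unfolding mat_def by (intro continuous_on_vec_lambda)
qed

lemma rotation_in_K:
  assumes "cmod c = 1"
  shows "mat c \<in> jt_K T"
proof -
  let ?C = "range (\<lambda>s. mat (cis s) :: complex ^ 'n ^ 'n)"
  have "connected ?C" by (intro connected_continuous_image continuous_cis_path) simp
  moreover have "?C \<subseteq> jt_aut T"
  proof safe
    fix s
    have "mat (cis s) ** mat (cis (- s)) = (mat 1 :: complex ^ 'n ^ 'n)"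
      "mat (cis (- s)) ** mat (cis s) = (mat 1 :: complex ^ 'n ^ 'n)"
      by (simp_all add: matrix_eq mat_vector cis_mult flip: matrix_vector_mul_assoc)
    moreover have "cis s * (cnj (cis s) * cis s) = cis s" by (simp add: cis_cnj cis_mult)
    ultimately show "mat (cis s) \<in> jt_aut T"
      by (auto simp: jt_aut_def invertible_def mat_vector T_scale cis_cnj cis_mult)
  qed
  moreover have "mat 1 \<in> ?C" by (intro image_eqI[of _ _ 0]) simp_all
  moreover have "mat c \<in> ?C" using cis_Arg_unit[OF assms]
    by (intro image_eqI[of _ _ "Arg c"]) auto
  ultimately show ?thesis using in_K_I[of ?C "mat 1"] one_in_K by blast
qed

subsection \<open>Peirce scaling\<close>

text \<open>
  Up to a factor, the flow of \<open>D(c,c)\<close>. It extends to all complex parameters, including \<open>0\<close>, and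
  preserves the equation of rank-one elements; it contracts \<open>z\<close> to its Peirce 2-component.
\<close>

definition scaling :: "complex ^ 'n \<Rightarrow> complex \<Rightarrow> complex ^ 'n \<Rightarrow> complex ^ 'n" where
  "scaling c \<zeta> z = P2 c z + \<zeta> *s P1 c z + \<zeta>\<^sup>2 *s P0 c z"

lemma scaling_one: "scaling c 1 z = z"
  by (simp add: scaling_def peirce_sum[of z c, symmetric])

lemma clinear_scaling: "clinear (scaling c \<zeta>)"
  using clinear_P[of c] unfolding scaling_def clinear_iff
  by (simp add: vec.scale_right_distrib vec_eq_iff algebra_simps)

lemma continuous_scaling:
  "continuous_on S f \<Longrightarrow> continuous_on S g \<Longrightarrow> continuous_on S (\<lambda>x. scaling c (f x) (g x))"
  unfolding scaling_def P2_def P1_def P0_def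
  by (intro continuous_intros)

lemma scaling_eigen:
  assumes "z \<in> peirce c m" "m = 0 \<or> m = 1 \<or> m = 2"
  shows "scaling c \<zeta> z = \<zeta> ^ nat (2 - m) *s z"
  using P_eigen[OF assms(1)] assms(2) by (auto simp: scaling_def numeral_2_eq_2)

context
  fixes c assumes c: "tripotent T c"
begin

lemma peirce_induct:
  assumes "\<And>x m. m = 0 \<or> m = 1 \<or> m = 2 \<Longrightarrow> x \<in> peirce c m \<Longrightarrow> Q x"
    and "\<And>x y. Q x \<Longrightarrow> Q y \<Longrightarrow> Q (x + y)"
  shows "Q z"
proof -
  have "Q (P2 c z)" "Q (P1 c z)" "Q (P0 c z)"
    using assms(1)[OF _ P_in_peirce(1)[OF c]] assms(1)[OF _ P_in_peirce(2)[OF c]]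
      assms(1)[OF _ P_in_peirce(3)[OF c]] by blast+
  then show ?thesis using assms(2) by (subst peirce_sum[of z c]) blast
qed

lemma scaling_add: "scaling c \<zeta> (x + y) = scaling c \<zeta> x + scaling c \<zeta> y"
  and scaling_smult: "scaling c \<zeta> (d *s x) = d *s scaling c \<zeta> x"
  using clinear_scaling[of c \<zeta>] by (simp_all add: clinear_iff)

lemma scaling_adjoint: "ip (scaling c \<zeta> x) y = ip x (scaling c (cnj \<zeta>) y)"
proof (induction x rule: peirce_induct)
  case (1 x m)
  show ?case
  proof (induction y rule: peirce_induct)
    case (1 y l)
    then show ?case
      using \<open>m = 0 \<or> m = 1 \<or> m = 2\<close> \<open>x \<in> peirce c m\<close> peirce_orthogonal[of x c m y l]
      by (cases "m = l") (simp_all add: scaling_eigen ip_simps)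
  qed (simp add: scaling_add ip_add_right)
qed (simp add: scaling_add ip_add_left)

lemma scaling_scaling: "scaling c \<zeta> (scaling c \<xi> z) = scaling c (\<zeta> * \<xi>) z"
proof (induction z rule: peirce_induct)
  case (1 x m)
  then show ?case by (simp add: scaling_eigen scaling_smult power_mult_distrib mult.commute)
qed (simp add: scaling_add)

text \<open>
  With \<open>x\<close>, \<open>y\<close>, \<open>z\<close> of Peirce weights \<open>i\<close>, \<open>j\<close>, \<open>k\<close>, the two sides carry the powers of \<open>\<zeta>\<close> with
  exponents \<open>(2 - i) + (2 - k)\<close> and \<open>(2 - j) + (2 - (i - j + k))\<close>, which are equal.
\<close>

lemma scaling_T: "T (scaling c \<zeta> x) y (scaling c \<zeta> z) = scaling c \<zeta> (T x (scaling c (cnj \<zeta>) y) z)"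
proof (induction x rule: peirce_induct)
  case x: (1 x i)
  show ?case
  proof (induction y rule: peirce_induct)
    case y: (1 y j)
    show ?case
    proof (induction z rule: peirce_induct)
      case z: (1 z k)
      show ?case
      proof (cases "T x y z = 0")
        case False
        have p: "T x y z \<in> peirce c (i - j + k)" by (rule peirce_T[OF x(2) y(2) z(2)])
        then have s: "i - j + k = 0 \<or> i - j + k = 1 \<or> i - j + k = 2" using peirce_cases[OF c] False by blast
        have e: "nat (2 - i) + nat (2 - k) = nat (2 - j) + nat (2 - (i - j + k))"
          using x(1) y(1) z(1) s by auto
        have "\<zeta> ^ nat (2 - i) * \<zeta> ^ nat (2 - k) = \<zeta> ^ nat (2 - j) * \<zeta> ^ nat (2 - (i - j + k))"
          by (simp only: power_add[symmetric] e)
        then show ?thesis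
          using scaling_eigen[OF x(2,1)] scaling_eigen[OF y(2,1)] scaling_eigen[OF z(2,1)] scaling_eigen[OF p s]
          by (simp add: T_scale scaling_smult mult.commute)
      qed (use x y z in \<open>simp add: scaling_eigen T_scale scaling_smult vec.scale_zero_right
            linear_0[OF clinear_imp_linear[OF clinear_scaling]]\<close>)
    qed (simp add: scaling_add T_add)
  qed (simp add: scaling_add T_add)
qed (simp add: scaling_add T_add)

lemma scaling_in_K:
  assumes "cmod \<zeta> = 1"
  shows "matrix (scaling c \<zeta>) \<in> jt_K T"
proof -
  let ?M = "\<lambda>s. matrix (scaling c (cis s))" let ?C = "range ?M"
  have mv: "matrix (scaling c \<zeta>) *v z = scaling c \<zeta> z" for \<zeta> z
    by (simp add: matrix_works clinear_scaling)
  have "continuous_on UNIV ?M"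
    unfolding matrix_def
    by (intro continuous_on_vec_lambda continuous_on_component continuous_scaling continuous_on_const continuous_on_cis continuous_on_id)
  then have "connected ?C" by (intro connected_continuous_image) auto
  moreover have "?C \<subseteq> jt_aut T"
  proof safe
    fix s
    have "?M s ** ?M (- s) = mat 1" "?M (- s) ** ?M s = mat 1"
      by (simp_all add: matrix_eq mv scaling_scaling cis_mult scaling_one flip: matrix_vector_mul_assoc)
    moreover have "scaling c (cnj (cis s)) (scaling c (cis s) v) = v" for v
      by (simp add: scaling_scaling cis_cnj cis_mult scaling_one)
    ultimately show "?M s \<in> jt_aut T"
      by (auto simp: jt_aut_def invertible_def mv scaling_T)
  qed
  moreover have "mat 1 \<in> ?C"
    by (intro image_eqI[of _ _ 0]) (simp_all add: matrix_eq mv scaling_one)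
  moreover have "matrix (scaling c \<zeta>) \<in> ?C" using cis_Arg_unit[OF assms]
    by (intro image_eqI[of _ _ "Arg \<zeta>"]) auto
  ultimately show ?thesis using in_K_I[of ?C "mat 1"] one_in_K by blast
qed

lemma primitive_scaling: "primitive z \<Longrightarrow> primitive (scaling c \<zeta> z)"
  by (simp add: primitive_def scaling_T scaling_smult scaling_adjoint)

end

lemma primitive_smult: "primitive z \<Longrightarrow> primitive (d *s z)"
  by (simp add: primitive_def T_scale ip_scale_left mult_ac)

lemma primitive_K:
  assumes "k \<in> jt_K T" "primitive z"
  shows "primitive (k *v z)"
  unfolding primitive_def
proof
  fix x
  obtain l where l: "\<And>z. l *v (k *v z) = z" "\<And>z. k *v (l *v z) = z" using K_inverse[OF assms(1)] by metis
  have "T (k *v z) (k *v (l *v x)) (k *v z) = k *v T z (l *v x) z" using K_T[OF assms(1)] by simp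
  also have "\<dots> = (2 * ip z (l *v x)) *s (k *v z)"
    using assms(2) by (simp add: primitive_def vec.scale)
  also have "ip z (l *v x) = ip (k *v z) x" using ip_K[OF assms(1), of z "l *v x"] l by simp
  finally show "T (k *v z) x (k *v z) = (2 * ip (k *v z) x) *s (k *v z)" by (simp add: l)
qed

lemma derivation_commutator: "derivation (\<lambda>z. T x y z - T y x z)"
  unfolding derivation_def
proof (intro conjI allI)
  show "clinear (\<lambda>z. T x y z - T y x z)"
    by (simp add: clinear_iff T_add T_scale vec.scale_right_diff_distrib)
  fix u v w
  show "T x y (T u v w) - T y x (T u v w)
      = T (T x y u - T y x u) v w + T u (T x y v - T y x v) w + T u v (T x y w - T y x w)"
    using T_commute[of v x y] T_commute[of v y x] jordan_identity[of x y u v w] jordan_identity[of y x u v w]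
    by (simp add: T_diff)
qed

lemma exp_derivative_0:
  assumes X: "derivation X"
  shows "((\<lambda>t. ip (matrix (exp_op X t) *v z) w) has_vector_derivative ip (X z) w) (at 0)"
proof -
  have lin: "clinear X" using X by (simp add: derivation_def)
  have "((\<lambda>t. exp_op X t z) has_vector_derivative X z) (at 0)"
    using exp_op_derivative[OF lin, of z 0] by simp
  from bounded_linear.has_vector_derivative[OF bounded_bilinear.bounded_linear_left[OF bounded_bilinear_ip] this]
  show ?thesis by (simp add: matrix_exp_op[OF lin])
qed

text \<open>The derivative of \<open>(z|c)\<close> along the one-parameter subgroup of \<open>K\<close> generated by \<open>D(c,u) - D(u,c)\<close>.\<close>

lemma rotation_component:
  assumes "primitive c" "ip c c = 1" "u \<in> peirce c 1"
  shows "ip (T c u z - T u c z) c = ip z u"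
proof -
  note tri = primitive_tripotent[OF assms(1,2)]
  have "ip (T c u z) c = ip z u"
    using assms(3) by (simp add: T_adjoint T_commute[of u c c] peirce_iff)
  moreover have "ip c u = 0" using peirce_orthogonal[OF self_peirce[OF tri] assms(3)] by simp
  then have "ip (T u c z) c = 0" using assms(1) by (simp add: T_adjoint primitive_def)
  ultimately show ?thesis by (simp add: ip_diff_left)
qed

text \<open>Without Peirce 1-component, \<open>{z;c;z}\<close> is a multiple of \<open>c\<close>; but it is also \<open>2(z|c)z\<close>.\<close>

lemma primitive_P1_zero:
  assumes c: "primitive c" "ip c c = 1" and z: "primitive z" "P1 c z = 0" "ip z c \<noteq> 0"
  shows "z = ip z c *s c"
proof -
  note tri = primitive_tripotent[OF c]
  have zs: "z = ip z c *s c + P0 c z"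
    using peirce_sum[of z c] primitive_P2[OF c, of z] z(2) by simp
  let ?\<phi> = "ip z c"
  have o: "jt_orthogonal T c (P0 c z)" using peirce0_iff_orthogonal[OF tri] P_in_peirce(3)[OF tri] by blast
  then have o': "T c (P0 c z) w = 0" "T (P0 c z) c w = 0" for w
    using orthogonal_sym[OF o] by (auto simp: jt_orthogonal_def)
  have "T (?\<phi> *s c + P0 c z) c (?\<phi> *s c + P0 c z) = (2 * ?\<phi>\<^sup>2) *s c"
    using tri T_commute[of c c "P0 c z"] by (simp add: T_add T_scale o' tripotent_iff power2_eq_square mult_ac)
  then have "(2 * ?\<phi>) *s z = (2 * ?\<phi>\<^sup>2) *s c"
    using z(1) zs by (simp add: primitive_def)
  then have "(2 * ?\<phi>) *s z = (2 * ?\<phi>) *s (?\<phi> *s c)" by (simp add: power2_eq_square mult_ac)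
  then show ?thesis using z(3) by (simp only: vec.scale_cancel_left) simp
qed

end

context jordan_frame begin

text \<open>
  If all these inner products vanished, so would their derivatives along \<open>K\<close>, which are the inner
  products with the Peirce 1-spaces of the \<open>e\<^sub>i\<close>. Then \<open>z\<close> would lie in $Z_{00}=0$.
\<close>

lemma ip_frame_nonzero:
  assumes z: "z \<noteq> 0"
  shows "\<exists>i\<in>{1..r}. \<exists>k\<in>jt_K T. ip (k *v z) (e i) \<noteq> 0"
proof (rule ccontr)
  assume "\<not> ?thesis"
  then have 0: "ip (k *v z) (e i) = 0" if "i \<in> {1..r}" "k \<in> jt_K T" for i k using that by blast
  have "z \<in> peirce (e i) 0" if i: "i \<in> {1..r}" for i
  proof -
    note tri = tripotent_e[OF i]
    have zi: "ip z (e i) = 0" using 0[OF i one_in_K] by simp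
    have "ip z u = 0" if u: "u \<in> peirce (e i) 1" for u
    proof -
      have "((\<lambda>t::real. 0) has_vector_derivative ip (T (e i) u z - T u (e i) z) (e i)) (at 0)"
        using exp_derivative_0[OF derivation_commutator, of "e i" u z "e i"]
          0[OF i exp_derivation_in_K[OF derivation_commutator]] by simp
      then have "ip (T (e i) u z - T u (e i) z) (e i) = 0"
        using has_vector_derivative_const vector_derivative_unique_at by blast
      then show ?thesis using rotation_component[OF primitive_e[OF i] ip_e[OF i] u, of z] by simp
    qed
    from this[OF P_in_peirce(2)[OF tri]] have "ip z (P1 (e i) z) = 0" .
    moreover have "ip z (P1 (e i) z) = ip (P2 (e i) z + P1 (e i) z + P0 (e i) z) (P1 (e i) z)"
      using peirce_sum[of z "e i"] by (rule arg_cong)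
    moreover have "ip (P2 (e i) z) (P1 (e i) z) = 0" "ip (P0 (e i) z) (P1 (e i) z) = 0"
      using peirce_orthogonal[OF P_in_peirce(1)[OF tri] P_in_peirce(2)[OF tri]]
        peirce_orthogonal[OF P_in_peirce(3)[OF tri] P_in_peirce(2)[OF tri]] by auto
    ultimately have "P1 (e i) z = 0" by (simp add: ip_add_left ip_self_eq_0)
    moreover have "P2 (e i) z = 0" using primitive_P2[OF primitive_e[OF i] ip_e[OF i], of z] zi by simp
    ultimately have "z = P0 (e i) z" using peirce_sum[of z "e i"] by simp
    then show ?thesis using P_in_peirce(3)[OF tri, of z] by (simp only:)
  qed
  then have "z \<in> jp 0 0" by (auto simp: jp_iff)
  then show False using jp_00 z by auto
qed

text \<open>
  Move \<open>z\<close> by the compact group \<open>K\<close> so that its inner product with some \<open>e\<^sub>i\<close> is as large as possible.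
  The derivative along \<open>D(e\<^sub>i,u) - D(u,e\<^sub>i)\<close> then shows that the Peirce 1-component vanishes, which
  for a primitive element leaves only the multiple of \<open>e\<^sub>i\<close>.
\<close>

lemma primitive_conjugate:
  assumes z: "primitive z" "z \<noteq> 0"
  shows "\<exists>i\<in>{1..r}. \<exists>k\<in>jt_K T. \<exists>l>0. z = k *v (l *\<^sub>R e i)"
proof -
  obtain i k1 where i: "i \<in> {1..r}" and k1: "k1 \<in> jt_K T" "ip (k1 *v z) (e i) \<noteq> 0"
    using ip_frame_nonzero[OF z(2)] by blast
  note tri = tripotent_e[OF i] and c = primitive_e[OF i] ip_e[OF i]
  have "continuous_on (jt_K T) (\<lambda>k. (cmod (ip (k *v z) (e i)))\<^sup>2)"
    by (intro continuous_on_power continuous_on_norm continuous_ip continuous_matrix_vector continuous_on_id continuous_on_const)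
  then obtain k where k: "k \<in> jt_K T"
    and max: "\<And>l. l \<in> jt_K T \<Longrightarrow> (cmod (ip (l *v z) (e i)))\<^sup>2 \<le> (cmod (ip (k *v z) (e i)))\<^sup>2"
    using continuous_attains_sup[OF compact_K] one_in_K by blast
  define y where "y = k *v z"
  define \<phi> where "\<phi> = ip y (e i)"
  have "(cmod \<phi>)\<^sup>2 > 0" using max[OF k1(1)] k1(2) by (auto simp: \<phi>_def y_def intro: less_le_trans[rotated])
  then have \<phi>0: "\<phi> \<noteq> 0" by auto
  \<comment> \<open>the factor \<open>cnj \<phi>\<close> makes the derivative of \<open>\<bar>(y|e\<^sub>i)\<bar>\<^sup>2\<close> a positive multiple of the squared length of the component\<close>
  define u where "u = cnj \<phi> *s P1 (e i) y"
  have u: "u \<in> peirce (e i) 1"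
    unfolding u_def by (intro vec.subspace_scale subspace_peirce P_in_peirce[OF tri])
  define X where "X z = T (e i) u z - T u (e i) z" for z
  have X: "derivation X" unfolding X_def[abs_def] by (rule derivation_commutator)
  let ?h = "\<lambda>t. ip (matrix (exp_op X t) *v y) (e i)"
  have h: "(?h has_vector_derivative ip y u) (at 0)"
    using exp_derivative_0[OF X, of y "e i"] rotation_component[OF c u, of y] by (simp add: X_def)
  have "clinear X" using X by (simp add: derivation_def)
  then have h0: "?h 0 = \<phi>" by (simp add: matrix_exp_op \<phi>_def)
  have "((\<lambda>t. (cmod (?h t))\<^sup>2) has_real_derivative 2 * Re (cnj \<phi> * ip y u)) (at 0)"
  proof -
    have "((\<lambda>t. ?h t * cnj (?h t)) has_vector_derivative \<phi> * cnj (ip y u) + ip y u * cnj \<phi>) (at 0)"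
      using has_vector_derivative_mult[OF h bounded_linear.has_vector_derivative[OF bounded_linear_cnj h]] h0 by simp
    from bounded_linear.has_vector_derivative[OF bounded_linear_Re this]
    show ?thesis
      by (simp add: has_real_derivative_iff_has_vector_derivative complex_mult_cnj cmod_power2 algebra_simps)
  qed
  moreover have "(cmod (?h t))\<^sup>2 \<le> (cmod (?h 0))\<^sup>2" for t
    using max[OF K_mult[OF exp_derivation_in_K[OF X, of t] k]] h0
    by (simp add: \<phi>_def y_def matrix_vector_mul_assoc)
  ultimately have "2 * Re (cnj \<phi> * ip y u) = 0"
    by (intro DERIV_local_max[of "\<lambda>t. (cmod (?h t))\<^sup>2" _ 0 1]) auto
  moreover have "ip y u = \<phi> * ip (P1 (e i) y) (P1 (e i) y)"
  proof -
    have "ip y (P1 (e i) y) = ip (P2 (e i) y + P1 (e i) y + P0 (e i) y) (P1 (e i) y)"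
      using peirce_sum[of y "e i"] by (rule arg_cong)
    also have "\<dots> = ip (P1 (e i) y) (P1 (e i) y)"
      using peirce_orthogonal[OF P_in_peirce(1)[OF tri] P_in_peirce(2)[OF tri], of y y]
        peirce_orthogonal[OF P_in_peirce(3)[OF tri] P_in_peirce(2)[OF tri], of y y] by (simp add: ip_add_left)
    finally show ?thesis by (simp add: u_def ip_scale_right)
  qed
  moreover define m where "m = (cmod \<phi>)\<^sup>2"
  have "cnj \<phi> * (\<phi> * w) = complex_of_real m * w" for w
    unfolding m_def complex_norm_square by (simp add: mult_ac)
  ultimately have "Re (complex_of_real m * ip (P1 (e i) y) (P1 (e i) y)) = 0" by simp
  then have "m * Re (ip (P1 (e i) y) (P1 (e i) y)) = 0" by simp
  moreover have "m \<noteq> 0" using \<phi>0 by (simp add: m_def)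
  ultimately have "Re (ip (P1 (e i) y) (P1 (e i) y)) = 0" by simp
  then have "P1 (e i) y = 0" by (simp only: ip_Re_self_eq_0)
  then have y: "y = \<phi> *s e i"
    using primitive_P1_zero[OF c primitive_K[OF k z(1)]] \<phi>0 by (simp add: \<phi>_def y_def)
  obtain l where l: "l \<in> jt_K T" "\<And>z. l *v (k *v z) = z" using K_inverse[OF k] by metis
  have sg: "cmod (sgn \<phi>) = 1" using \<phi>0 by (simp add: norm_sgn)
  have "z = (l ** mat (sgn \<phi>)) *v (cmod \<phi> *\<^sub>R e i)"
  proof -
    have "z = l *v y" using l(2) by (simp add: y_def)
    also have "y = mat (sgn \<phi>) *v (cmod \<phi> *\<^sub>R e i)"
      using \<phi>0 by (simp add: y mat_vector scaleR_vec_complex sgn_eq)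
    finally show ?thesis by (simp add: matrix_vector_mul_assoc)
  qed
  moreover have "l ** mat (sgn \<phi>) \<in> jt_K T" by (intro K_mult l rotation_in_K sg)
  moreover have "cmod \<phi> > 0" using \<phi>0 by simp
  ultimately show ?thesis using i by blast
qed

theorem rank_one_iff: "z \<in> rank_one T r e \<longleftrightarrow> z \<noteq> 0 \<and> primitive z"
  and rank_one_conjugate: "z \<in> rank_one T r e \<longleftrightarrow> (\<exists>i\<in>{1..r}. \<exists>k\<in>jt_K T. \<exists>l>0. z = k *v (l *\<^sub>R e i))"
proof -
  have 1: "\<exists>i\<in>{1..r}. \<exists>k\<in>jt_K T. \<exists>l>0. z = k *v (l *\<^sub>R e i)" if z: "z \<in> rank_one T r e" for z
  proof -
    obtain k c where k: "k \<in> jt_K T" "\<forall>i\<in>{1..r}. 0 \<le> (c i :: real)"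
        "z = k *v (\<Sum>i=1..r. c i *\<^sub>R e i)" "card {i\<in>{1..r}. c i \<noteq> 0} = 1"
      using z by (auto simp: rank_one_def jt_has_rank_def)
    obtain i where i: "{i\<in>{1..r}. c i \<noteq> 0} = {i}" using k(4) card_1_singletonE by blast
    have ir: "i \<in> {1..r}" "c i \<noteq> 0" using i by blast+
    have "c j = 0" if "j \<in> {1..r}" "j \<noteq> i" for j using i that by blast
    then have "(\<Sum>j=1..r. c j *\<^sub>R e j) = (\<Sum>j=1..r. if j = i then c i *\<^sub>R e i else 0)"
      by (intro sum.cong) auto
    then have "(\<Sum>j=1..r. c j *\<^sub>R e j) = c i *\<^sub>R e i" using ir(1) by simp
    moreover have "c i > 0" using ir k(2) by (simp add: order_less_le)
    ultimately show ?thesis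
      using k(3) ir(1) by (intro bexI[of _ i] bexI[OF _ k(1)] exI[of _ "c i"]) simp_all
  qed
  have 2: "z \<noteq> 0 \<and> primitive z" if ik: "i \<in> {1..r}" "k \<in> jt_K T" "l > 0" "z = k *v (l *\<^sub>R e i)" for z i k l
  proof
    show "primitive z" using ik primitive_K primitive_smult[OF primitive_e] by (simp add: scaleR_vec_complex)
    have "ip z z = l * l" using ik ip_K[OF ik(2)] ip_e[OF ik(1)] by (simp add: ip_scaleR_left ip_scaleR_right)
    then show "z \<noteq> 0" using ik(3) by auto
  qed
  have 3: "z \<in> rank_one T r e" if ik: "i \<in> {1..r}" "k \<in> jt_K T" "l > 0" "z = k *v (l *\<^sub>R e i)" for z i k l
  proof -
    let ?c = "\<lambda>j. if j = i then l else 0"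
    have "(\<Sum>j=1..r. ?c j *\<^sub>R e j) = (\<Sum>j=1..r. if j = i then l *\<^sub>R e i else 0)"
      by (intro sum.cong) auto
    also have "\<dots> = l *\<^sub>R e i" using ik by simp
    finally have "z = k *v (\<Sum>j=1..r. ?c j *\<^sub>R e j)" using ik by simp
    moreover have "{j\<in>{1..r}. ?c j \<noteq> 0} = {i}" using ik by auto
    then have "card {j\<in>{1..r}. ?c j \<noteq> 0} = 1" by simp
    moreover have "\<forall>j\<in>{1..r}. 0 \<le> ?c j" using ik by auto
    ultimately show ?thesis
      unfolding rank_one_def jt_has_rank_def mem_Collect_eq
      by (intro bexI[OF _ ik(2)] exI[of _ ?c] conjI)
  qed
  show "z \<in> rank_one T r e \<longleftrightarrow> z \<noteq> 0 \<and> primitive z"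
  proof
    assume "z \<in> rank_one T r e"
    from 1[OF this] show "z \<noteq> 0 \<and> primitive z" by (elim bexE exE conjE) (rule 2)
  next
    assume "z \<noteq> 0 \<and> primitive z"
    then have "\<exists>i\<in>{1..r}. \<exists>k\<in>jt_K T. \<exists>l>0. z = k *v (l *\<^sub>R e i)" by (intro primitive_conjugate) simp_all
    then show "z \<in> rank_one T r e" by (elim bexE exE conjE) (rule 3)
  qed
  show "z \<in> rank_one T r e \<longleftrightarrow> (\<exists>i\<in>{1..r}. \<exists>k\<in>jt_K T. \<exists>l>0. z = k *v (l *\<^sub>R e i))"
  proof
    assume "\<exists>i\<in>{1..r}. \<exists>k\<in>jt_K T. \<exists>l>0. z = k *v (l *\<^sub>R e i)"
    then show "z \<in> rank_one T r e" by (elim bexE exE conjE) (rule 3)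
  qed (rule 1)
qed

lemma rank_one_tripotent_iff: "c \<in> rank_one_tripotents T r e \<longleftrightarrow> primitive c \<and> ip c c = 1"
proof -
  have "tripotent T c \<longleftrightarrow> ip c c = 1" if "primitive c" "c \<noteq> 0"
  proof -
    have "T c c c = (2 * ip c c) *s c" using that(1) by (simp add: primitive_def)
    then show ?thesis using that(2) by (simp only: tripotent_iff vec.scale_cancel_right) simp
  qed
  moreover have "c \<noteq> 0" if "ip c c = 1" using that by auto
  moreover have "c \<in> rank_one_tripotents T r e \<longleftrightarrow> tripotent T c \<and> c \<in> rank_one T r e"
    by (simp add: rank_one_tripotents_def rank_one_def)
  ultimately show ?thesis using rank_one_iff by blast
qed

end

section \<open>Moments of the invariant measure\<close>

lemma has_vector_derivative_sequentially:
  assumes "(f has_vector_derivative D) (at 0)"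
  shows "(\<lambda>n. real (Suc n) *\<^sub>R (f (1 / real (Suc n)) - f 0)) \<longlonglongrightarrow> D"
proof -
  have "((\<lambda>h. norm (f h - f 0 - h *\<^sub>R D) / norm h) \<longlongrightarrow> 0) (at 0)"
    using assms by (simp add: has_vector_derivative_def has_derivative_at)
  moreover have "filterlim (\<lambda>n. 1 / real (Suc n)) (at 0) sequentially"
    unfolding filterlim_at using LIMSEQ_inverse_real_of_nat by (simp add: inverse_eq_divide)
  ultimately have "(\<lambda>n. norm (f (1 / real (Suc n)) - f 0 - (1 / real (Suc n)) *\<^sub>R D) / norm (1 / real (Suc n))) \<longlonglongrightarrow> 0"
    by (rule filterlim_compose)
  also have "(\<lambda>n. norm (f (1 / real (Suc n)) - f 0 - (1 / real (Suc n)) *\<^sub>R D) / norm (1 / real (Suc n)))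
      = (\<lambda>n. norm (real (Suc n) *\<^sub>R (f (1 / real (Suc n)) - f 0) - D))"
  proof
    fix n
    have "real (Suc n) *\<^sub>R (f (1 / real (Suc n)) - f 0) - D
        = real (Suc n) *\<^sub>R (f (1 / real (Suc n)) - f 0 - (1 / real (Suc n)) *\<^sub>R D)"
      by (simp add: scaleR_diff_right)
    then show "norm (f (1 / real (Suc n)) - f 0 - (1 / real (Suc n)) *\<^sub>R D) / norm (1 / real (Suc n))
        = norm (real (Suc n) *\<^sub>R (f (1 / real (Suc n)) - f 0) - D)"
      by (simp add: mult.commute)
  qed
  finally show ?thesis by (simp add: LIM_zero_iff tendsto_norm_zero_iff)
qed

text \<open>
  Holomorphic functions with continuous derivative. Continuity is required along linear vector
  fields, because the flows of derivations have these as their generators.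
\<close>

definition has_chol_derivative ::
  "(complex ^ 'n::finite \<Rightarrow> complex) \<Rightarrow> (complex ^ 'n \<Rightarrow> complex ^ 'n \<Rightarrow> complex) \<Rightarrow> bool" where
  "has_chol_derivative F F' \<longleftrightarrow> (\<forall>z. (F has_derivative F' z) (at z)) \<and>
     (\<forall>z x y. F' z (x + y) = F' z x + F' z y) \<and> (\<forall>z c x. F' z (c *s x) = c * F' z x) \<and>
     (\<forall>X. clinear X \<longrightarrow> continuous_on UNIV (\<lambda>z. F' z (X z)))"

lemma has_chol_derivativeD:
  assumes "has_chol_derivative F F'"
  shows "(F has_derivative F' z) (at z)" "F' z (x + y) = F' z x + F' z y" "F' z (c *s x) = c * F' z x"
    "clinear X \<Longrightarrow> continuous_on UNIV (\<lambda>z. F' z (X z))"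
  using assms unfolding has_chol_derivative_def by simp_all

lemma has_chol_derivative_continuous:
  "has_chol_derivative F F' \<Longrightarrow> continuous_on UNIV F"
  by (meson continuous_at_imp_continuous_on has_chol_derivative_def has_derivative_continuous)

lemma has_chol_derivative_mult:
  assumes F: "has_chol_derivative F F'" and G: "has_chol_derivative G G'"
  shows "has_chol_derivative (\<lambda>z. F z * G z) (\<lambda>z h. F z * G' z h + F' z h * G z)"
  unfolding has_chol_derivative_def
proof (intro conjI allI impI)
  show "((\<lambda>z. F z * G z) has_derivative (\<lambda>h. F z * G' z h + F' z h * G z)) (at z)" for z
    using F G unfolding has_chol_derivative_def by (intro has_derivative_mult) auto
  show "continuous_on UNIV (\<lambda>z. F z * G' z (X z) + F' z (X z) * G z)" if "clinear X" for X
    using F G that has_chol_derivative_continuous[OF F] has_chol_derivative_continuous[OF G]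
    unfolding has_chol_derivative_def by (intro continuous_intros) auto
qed (use F G in \<open>simp_all add: has_chol_derivative_def algebra_simps\<close>)

lemma has_chol_derivative_power:
  assumes F: "has_chol_derivative F F'"
  shows "has_chol_derivative (\<lambda>z. F z ^ m) (\<lambda>z h. of_nat m * F z ^ (m - 1) * F' z h)"
proof (induction m)
  case 0
  then show ?case by (simp add: has_chol_derivative_def)
next
  case (Suc m)
  have "(\<lambda>z h. F z * (of_nat m * F z ^ (m - 1) * F' z h) + F' z h * F z ^ m)
      = (\<lambda>z h. of_nat (Suc m) * F z ^ (Suc m - 1) * F' z h)"
  proof (intro ext)
    fix z h
    have "F z * (of_nat m * F z ^ (m - 1) * F' z h) = of_nat m * F z ^ m * F' z h"
      by (cases m) (simp_all add: mult_ac)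
    then show "F z * (of_nat m * F z ^ (m - 1) * F' z h) + F' z h * F z ^ m
        = of_nat (Suc m) * F z ^ (Suc m - 1) * F' z h"
      by (simp add: algebra_simps)
  qed
  with has_chol_derivative_mult[OF F Suc] show ?case by simp
qed

context hermitian_form begin

lemma has_chol_derivative_ip: "has_chol_derivative (\<lambda>z. ip z u) (\<lambda>z h. ip h u)"
  unfolding has_chol_derivative_def
proof (intro conjI allI impI)
  show "((\<lambda>z. ip z u) has_derivative (\<lambda>h. ip h u)) (at z)" for z
    by (rule bounded_linear_imp_has_derivative[OF bounded_bilinear.bounded_linear_left[OF bounded_bilinear_ip]])
  show "continuous_on UNIV (\<lambda>z. ip (X z) u)" if "clinear X" for X
    using linear_continuous_on[OF clinear_bounded[OF that], of UNIV] by (intro continuous_ip continuous_on_const)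
qed (simp_all add: ip_add_left ip_scale_left)

end

locale jordan_sphere = jordan_frame T ip r a b e
  for T :: "'n::finite triple" and ip and r a b :: nat and e :: "nat \<Rightarrow> complex ^ 'n" +
  fixes \<sigma> :: "(complex ^ 'n) measure"
  assumes invariant: "invariant_prob_measure T (rank_one_tripotents T r e) \<sigma>"
begin

sublocale prob_space \<sigma>
  using invariant by (simp add: invariant_prob_measure_def)

abbreviation sphere :: "(complex ^ 'n) set" where
  "sphere \<equiv> rank_one_tripotents T r e"

lemma space_sigma: "space \<sigma> = sphere"
  and sets_sigma: "sets \<sigma> = sets (restrict_space borel sphere)"
  using invariant by (simp_all add: invariant_prob_measure_def)

lemma primitive_closed: "closed {z. primitive z}"
proof -
  have "{z. primitive z} = (\<Inter>x. {z. T z x z = (2 * ip z x) *s z})" by (auto simp: primitive_def)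
  moreover have "closed (\<Inter>x. {z. T z x z = (2 * ip z x) *s z})"
    by (intro closed_INT ballI closed_Collect_eq continuous_T continuous_smult_vec continuous_on_mult continuous_ip
        continuous_on_id continuous_on_const)
  ultimately show ?thesis by simp
qed

lemma compact_sphere: "compact sphere"
proof -
  have "sphere = {z. primitive z} \<inter> {z. ip z z = 1}" by (auto simp: rank_one_tripotent_iff)
  then show ?thesis using closed_Int_compact[OF primitive_closed compact_ip_sphere] by simp
qed

lemma sphere_K: "k \<in> jt_K T \<Longrightarrow> s \<in> sphere \<Longrightarrow> k *v s \<in> sphere"
  by (simp add: rank_one_tripotent_iff primitive_K ip_K)

lemma measurable_sigma: "continuous_on sphere f \<Longrightarrow> f \<in> borel_measurable \<sigma>"
  for f :: "complex ^ 'n \<Rightarrow> 'b::topological_space"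
  unfolding measurable_cong_sets[OF sets_sigma refl] by (rule borel_measurable_continuous_on_restrict)

lemma bounded_on_sphere:
  fixes f :: "complex ^ 'n \<Rightarrow> 'b::real_normed_vector"
  assumes "continuous_on sphere f"
  shows "\<exists>B. \<forall>s\<in>sphere. norm (f s) \<le> B"
  using compact_imp_bounded[OF compact_continuous_image[OF assms compact_sphere]]
  by (auto simp: bounded_iff)

lemma integrable_sigma:
  fixes f :: "complex ^ 'n \<Rightarrow> 'b::{banach, second_countable_topology}"
  assumes "continuous_on sphere f"
  shows "integrable \<sigma> f"
proof -
  obtain B where "\<forall>s\<in>sphere. norm (f s) \<le> B" using bounded_on_sphere[OF assms] by blast
  then show ?thesis
    using measurable_sigma[OF assms] by (intro integrable_const_bound[of _ B]) (auto simp: space_sigma)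
qed

lemma integral_K:
  fixes f :: "complex ^ 'n \<Rightarrow> 'b::{banach, second_countable_topology}"
  assumes k: "k \<in> jt_K T" and f: "f \<in> borel_measurable \<sigma>"
  shows "(LINT s|\<sigma>. f (k *v s)) = (LINT s|\<sigma>. f s)"
proof -
  have "continuous_on sphere ((*v) k)" unfolding matrix_vector_mult_def
    by (intro continuous_on_vec_lambda continuous_on_sum continuous_on_mult continuous_on_component continuous_on_const continuous_on_id)
  then have "(*v) k \<in> measurable \<sigma> (restrict_space borel sphere)"
    using sphere_K[OF k] by (intro measurable_restrict_space2 measurable_sigma) (auto simp: space_sigma)
  then have m: "(*v) k \<in> measurable \<sigma> \<sigma>"
    by (simp add: measurable_cong_sets[OF refl sets_sigma])
  have "distr \<sigma> \<sigma> ((*v) k) = \<sigma>" using invariant k by (simp add: invariant_prob_measure_def)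
  then show ?thesis using integral_distr[OF m f] by simp
qed

text \<open>
  The integral of \<open>F\<close> over \<open>\<sigma>\<close> is constant along one-parameter subgroups of \<open>K\<close>; its derivative at time
  \<open>0\<close> is taken by dominated convergence of difference quotients.
\<close>

lemma integral_derivation:
  fixes F :: "complex ^ 'n \<Rightarrow> complex"
  assumes X: "derivation X"
    and F: "\<And>z. (F has_derivative F' z) (at z)"
    and cont: "continuous_on UNIV (\<lambda>z. F' z (X z))"
  shows "(LINT s|\<sigma>. F' s (X s)) = 0"
proof -
  have lin: "clinear X" using X by (simp add: derivation_def)
  define k where "k t = matrix (exp_op X t)" for t
  have k: "k t *v z = exp_op X t z" "k t \<in> jt_K T" for t z
    using matrix_exp_op[OF lin] exp_derivation_in_K[OF X] by (simp_all add: k_def)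
  have Fc: "continuous_on UNIV F"
    using F by (meson continuous_at_imp_continuous_on has_derivative_continuous)
  have d: "((\<lambda>t. F (k t *v z)) has_vector_derivative F' (k t *v z) (X (k t *v z))) (at t)" for z t
  proof -
    have "((\<lambda>t. exp_op X t z) has_derivative (\<lambda>x. x *\<^sub>R X (exp_op X t z))) (at t)"
      using exp_op_derivative[OF lin, of z t UNIV] by (simp add: has_vector_derivative_def exp_op_commute[OF lin])
    from has_derivative_compose[OF this F]
    have "((\<lambda>t. F (exp_op X t z)) has_derivative (\<lambda>x. F' (exp_op X t z) (x *\<^sub>R X (exp_op X t z)))) (at t)" .
    moreover have "F' w (x *\<^sub>R v) = x *\<^sub>R F' w v" for w x v
      using F[of w] by (simp add: has_derivative_def bounded_linear.linear linear_scale)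
    ultimately show ?thesis by (simp add: has_vector_derivative_def k)
  qed
  obtain B where B: "\<And>s. s \<in> sphere \<Longrightarrow> norm (F' s (X s)) \<le> B"
    using bounded_on_sphere[OF continuous_on_subset[OF cont subset_UNIV]] by blast
  define h where "h n s = (real (Suc n)) *\<^sub>R (F (k (1 / Suc n) *v s) - F s)" for n s
  have hc: "continuous_on sphere (\<lambda>s. F (k t *v s))" for t
  proof -
    have "continuous_on sphere ((*v) (k t))" unfolding matrix_vector_mult_def
      by (intro continuous_on_vec_lambda continuous_on_sum continuous_on_mult continuous_on_component continuous_on_const continuous_on_id)
    from continuous_on_compose2[OF Fc this] show ?thesis by simp
  qed
  note Fs = continuous_on_subset[OF Fc subset_UNIV, of sphere]
  have "(\<lambda>n. LINT s|\<sigma>. h n s) \<longlonglongrightarrow> (LINT s|\<sigma>. F' s (X s))"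
  proof (rule integral_dominated_convergence)
    show "(\<lambda>s. F' s (X s)) \<in> borel_measurable \<sigma>"
      by (rule measurable_sigma[OF continuous_on_subset[OF cont subset_UNIV]])
    show "h n \<in> borel_measurable \<sigma>" for n
      unfolding h_def[abs_def] by (intro measurable_sigma continuous_intros hc Fs)
    show "integrable \<sigma> (\<lambda>s. B)" by simp
    show "AE s in \<sigma>. (\<lambda>n. h n s) \<longlonglongrightarrow> F' s (X s)"
    proof (rule AE_I2)
      fix s
      have "k 0 *v s = s" by (simp add: k)
      then have "((\<lambda>t. F (k t *v s)) has_vector_derivative F' s (X s)) (at 0)" using d[of s 0] by simp
      from has_vector_derivative_sequentially[OF this] show "(\<lambda>n. h n s) \<longlonglongrightarrow> F' s (X s)"
        by (simp add: h_def \<open>k 0 *v s = s\<close>)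
    qed
    show "AE s in \<sigma>. norm (h n s) \<le> B" for n
    proof (rule AE_I2)
      fix s assume "s \<in> space \<sigma>"
      then have s: "s \<in> sphere" by (simp add: space_sigma)
      have "k 0 *v s = s" by (simp add: k)
      have "norm (F (k (1 / real (Suc n)) *v s) - F (k 0 *v s)) \<le> B * norm (1 / real (Suc n) - 0)"
      proof (rule differentiable_bound[of "{0..1 / real (Suc n)}" "\<lambda>t. F (k t *v s)"
            "\<lambda>t x. x *\<^sub>R F' (k t *v s) (X (k t *v s))"])
        fix t
        show "((\<lambda>t. F (k t *v s)) has_derivative (\<lambda>x. x *\<^sub>R F' (k t *v s) (X (k t *v s))))
            (at t within {0..1 / real (Suc n)})"
          using d[of s t] by (simp add: has_vector_derivative_def has_derivative_at_withinI)
        show "onorm (\<lambda>x. x *\<^sub>R F' (k t *v s) (X (k t *v s))) \<le> B"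
          using B[OF sphere_K[OF k(2) s], of t] by (intro onorm_le) (simp add: mult.commute[of B] mult_left_mono)
      qed auto
      then have "real (Suc n) * norm (F (k (1 / real (Suc n)) *v s) - F s) \<le> real (Suc n) * (B * (1 / real (Suc n)))"
        using \<open>k 0 *v s = s\<close> by (intro mult_left_mono) auto
      then show "norm (h n s) \<le> B" by (simp add: h_def del: of_nat_Suc)
    qed
  qed
  moreover have "(LINT s|\<sigma>. h n s) = 0" for n
    using integral_K[OF k(2) measurable_sigma[OF Fs]]
    by (simp add: h_def Bochner_Integration.integral_diff[OF integrable_sigma[OF hc] integrable_sigma[OF Fs]])
  ultimately have "(\<lambda>n. 0) \<longlonglongrightarrow> (LINT s|\<sigma>. F' s (X s))" by simp
  then show ?thesis by (rule LIMSEQ_unique[OF _ tendsto_const])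
qed

text \<open>
  On holomorphic functions in \<open>L\<^sup>2(\<sigma>)\<close>, the vector fields \<open>D(u,v)\<close> and \<open>D(v,u)\<close> are adjoint to each
  other.
\<close>

lemma integral_adjoint:
  assumes F: "has_chol_derivative F F'" and G: "has_chol_derivative G G'"
  shows "(LINT s|\<sigma>. F' s (T u v s) * cnj (G s)) = (LINT s|\<sigma>. F s * cnj (G' s (T v u s)))"
proof -
  define f where "f u v = (LINT s|\<sigma>. F' s (T u v s) * cnj (G s)) - (LINT s|\<sigma>. F s * cnj (G' s (T v u s)))" for u v
  note FG = has_chol_derivativeD[OF F] has_chol_derivativeD[OF G]
  note Fc = has_chol_derivative_continuous[OF F] and Gc = has_chol_derivative_continuous[OF G]
  have F'c: "continuous_on UNIV (\<lambda>s. F' s (T u v s))" and G'c: "continuous_on UNIV (\<lambda>s. G' s (T u v s))" for u v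
    by (rule FG T_clinear)+
  have i1: "integrable \<sigma> (\<lambda>s. F' s (T u v s) * cnj (G s))" for u v
    by (rule integrable_sigma[OF continuous_on_subset[OF _ subset_UNIV]]) (intro continuous_intros F'c Gc)
  have i2: "integrable \<sigma> (\<lambda>s. F s * cnj (G' s (T u v s)))" for u v
    by (rule integrable_sigma[OF continuous_on_subset[OF _ subset_UNIV]]) (intro continuous_intros G'c Fc)
  have "f u v = 0"
  proof (rule sesquilinear_zero[of f])
    show "f (u + u') v = f u v + f u' v" "f u (v + v') = f u v + f u v'" for u u' v v'
      using i1 i2 FG by (simp_all add: f_def T_add distrib_left distrib_right)
    show "f (c *s u) v = c * f u v" "f u (c *s v) = cnj c * f u v" for c u v
    proof -
      have "(\<lambda>s. F' s (T (c *s u) v s) * cnj (G s)) = (\<lambda>s. c * (F' s (T u v s) * cnj (G s)))"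
        "(\<lambda>s. F s * cnj (G' s (T v (c *s u) s))) = (\<lambda>s. c * (F s * cnj (G' s (T v u s))))"
        "(\<lambda>s. F' s (T u (c *s v) s) * cnj (G s)) = (\<lambda>s. cnj c * (F' s (T u v s) * cnj (G s)))"
        "(\<lambda>s. F s * cnj (G' s (T (c *s v) u s))) = (\<lambda>s. cnj c * (F s * cnj (G' s (T v u s))))"
        using FG by (simp_all add: T_scale mult_ac)
      note e = this
      show "f (c *s u) v = c * f u v" "f u (c *s v) = cnj c * f u v"
        unfolding f_def e integral_mult_right_zero by (simp_all only: right_diff_distrib)
    qed
    show "f u u = 0" for u
    proof -
      let ?X = "\<lambda>z. \<i> *s T u u z"
      have "(LINT s|\<sigma>. F s * cnj (G' s (?X s)) + F' s (?X s) * cnj (G s)) = 0"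
      proof (rule integral_derivation[OF derivation_T_self[of u], of "\<lambda>z. F z * cnj (G z)" "\<lambda>z h. F z * cnj (G' z h) + F' z h * cnj (G z)"])
        show "((\<lambda>z. F z * cnj (G z)) has_derivative (\<lambda>h. F z * cnj (G' z h) + F' z h * cnj (G z))) (at z)" for z
          by (intro has_derivative_mult bounded_linear.has_derivative[OF bounded_linear_cnj] FG)
        show "continuous_on UNIV (\<lambda>z. F z * cnj (G' z (?X z)) + F' z (?X z) * cnj (G z))"
          unfolding FG by (intro continuous_intros Fc Gc F'c G'c)
      qed
      also have "(\<lambda>s. F s * cnj (G' s (?X s)) + F' s (?X s) * cnj (G s))
          = (\<lambda>s. \<i> * (F' s (T u u s) * cnj (G s) - F s * cnj (G' s (T u u s))))"
        using FG by (auto simp: algebra_simps)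
      finally show ?thesis using i1 i2 by (simp add: f_def)
    qed
  qed
  then show ?thesis by (simp add: f_def)
qed

end

context jordan_sphere begin

definition moment :: "complex ^ 'n \<Rightarrow> nat \<Rightarrow> real" where
  "moment c m = (LINT s|\<sigma>. (cmod (ip s c)) ^ (2 * m))"

lemma integral_norm_square:
  "(LINT s|\<sigma>. F s * cnj (F s)) = complex_of_real (LINT s|\<sigma>. (cmod (F s))\<^sup>2)"
  by (simp only: complex_norm_square[symmetric] integral_complex_of_real)

lemma moment_complex: "(LINT s|\<sigma>. ip s c ^ m * cnj (ip s c ^ m)) = complex_of_real (moment c m)"
  unfolding integral_norm_square moment_def by (simp add: norm_power power_mult[symmetric] mult.commute)

lemma moment_0: "moment c 0 = 1"
  by (simp add: moment_def prob_space)

lemma continuous_ip_left: "continuous_on S (\<lambda>s. ip s u)"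
  by (intro continuous_ip continuous_on_id continuous_on_const)

lemma moment_K:
  assumes "k \<in> jt_K T"
  shows "moment (k *v c) m = moment c m"
proof -
  have "moment (k *v c) m = (LINT s|\<sigma>. (cmod (ip (k *v s) (k *v c))) ^ (2 * m))"
    unfolding moment_def
    by (rule integral_K[OF assms, symmetric]) (intro measurable_sigma continuous_intros continuous_ip_left)
  then show ?thesis by (simp add: ip_K[OF assms] moment_def)
qed

context
  fixes c assumes c: "primitive c" "ip c c = 1"
begin

lemma tri: "tripotent T c"
  by (rule primitive_tripotent[OF c])

lemma ip_T_c: "u \<in> peirce c 1 \<Longrightarrow> ip (T c u s) c = ip s u"
  "u \<in> peirce c 1 \<Longrightarrow> ip (T u c s) c = 0"
proof -
  assume u: "u \<in> peirce c 1"
  show "ip (T c u s) c = ip s u" using u by (simp add: T_adjoint T_commute[of u c c] peirce_iff)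
  have "ip c u = 0" using peirce_orthogonal[OF self_peirce[OF tri] u] by simp
  then show "ip (T u c s) c = 0" using c(1) by (simp add: T_adjoint primitive_def)
qed

lemma T_peirce1_c:
  assumes u: "u \<in> peirce c 1"
  shows "T u u c = ip u u *s c"
proof -
  have "T u u c \<in> peirce c 2" using peirce_T[OF u u self_peirce[OF tri]] by simp
  then have "T u u c = ip (T u u c) c *s c" by (rule primitive_peirce2[OF c])
  also have "ip (T u u c) c = ip u u"
    using ip_T_c(1)[OF u, of u] T_commute[of u u c] by simp
  finally show ?thesis .
qed

text \<open>
  The function \<open>m (s|c)\<^bsup>m-1\<^esup>(s|u)\<close> is the derivative of \<open>(s|c)\<^bsup>m\<^esup>\<close> along \<open>D(c,u)\<close>. On the other factor,
  the adjoint field \<open>D(u,c)\<close> annihilates \<open>(s|c)\<close> and turns \<open>(s|u)\<close> into \<open>(u|u)(s|c)\<close>.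
\<close>

lemma moment_peirce1:
  assumes u: "u \<in> peirce c 1" and m: "1 \<le> m"
  shows "real m * (LINT s|\<sigma>. (cmod (ip s c ^ (m - 1) * ip s u))\<^sup>2) = Re (ip u u) * moment c m"
proof -
  note F = has_chol_derivative_power[OF has_chol_derivative_ip[of c], of m]
  note G = has_chol_derivative_mult[OF has_chol_derivative_power[OF has_chol_derivative_ip[of c], of "m - 1"] has_chol_derivative_ip[of u]]
  have uu: "ip (T u c s) u = ip u u * ip s c" for s
    using ip_commute[of u u] T_commute[of c u u] T_peirce1_c[OF u]
    by (simp add: T_adjoint ip_scale_right)
  let ?G = "\<lambda>s. ip s c ^ (m - 1) * ip s u"
  have "of_nat m * (LINT s|\<sigma>. ?G s * cnj (?G s))
      = (LINT s|\<sigma>. of_nat m * ip s c ^ (m - 1) * ip (T c u s) c * cnj (ip s c ^ (m - 1) * ip s u))"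
    by (simp only: ip_T_c(1)[OF u] integral_mult_right_zero[symmetric] mult.assoc)
  also have "\<dots> = (LINT s|\<sigma>. ip s c ^ m * cnj (ip s c ^ (m - 1) * ip (T u c s) u
      + of_nat (m - 1) * ip s c ^ (m - 1 - 1) * ip (T u c s) c * ip s u))"
    by (rule integral_adjoint[OF F G])
  also have "\<dots> = (LINT s|\<sigma>. ip u u * (ip s c ^ m * cnj (ip s c ^ m)))"
  proof (rule Bochner_Integration.integral_cong[OF refl])
    fix s
    have p: "ip s c ^ (m - 1) * ip s c = ip s c ^ m" using m by (cases m) simp_all
    have "ip s c ^ (m - 1) * (ip u u * ip s c) = ip u u * ip s c ^ m" by (simp only: p[symmetric] mult_ac)
    then have "ip s c ^ (m - 1) * ip (T u c s) u + of_nat (m - 1) * ip s c ^ (m - 1 - 1) * ip (T u c s) c * ip s u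
        = ip u u * ip s c ^ m"
      by (simp only: ip_T_c(2)[OF u] uu mult_zero_right mult_zero_left add_0_right)
    moreover have "cnj (ip u u) = ip u u" by (rule ip_commute[symmetric])
    ultimately show "ip s c ^ m * cnj (ip s c ^ (m - 1) * ip (T u c s) u
        + of_nat (m - 1) * ip s c ^ (m - 1 - 1) * ip (T u c s) c * ip s u) = ip u u * (ip s c ^ m * cnj (ip s c ^ m))"
      by (simp only: complex_cnj_mult mult_ac)
  qed
  also have "\<dots> = complex_of_real (Re (ip u u) * moment c m)"
    using ip_self_Re[of u] by (simp only: integral_mult_right_zero moment_complex of_real_mult)
  finally have "complex_of_real (real m * (LINT s|\<sigma>. (cmod (?G s))\<^sup>2)) = complex_of_real (Re (ip u u) * moment c m)"
    by (simp only: integral_norm_square of_real_mult of_real_of_nat_eq)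
  then show ?thesis by (simp only: of_real_eq_iff)
qed

lemma ip_P1: "u \<in> peirce c 1 \<Longrightarrow> ip (P1 c s) u = ip s u"
  and ip_P0: "u \<in> peirce c 0 \<Longrightarrow> ip (P0 c s) u = ip s u"
proof -
  note P = P_in_peirce[OF tri, of s]
  have s: "ip s u = ip (P2 c s) u + ip (P1 c s) u + ip (P0 c s) u" for u
    using arg_cong[OF peirce_sum[of s c], of "\<lambda>x. ip x u"] by (simp only: ip_add_left)
  show "ip (P1 c s) u = ip s u" if u: "u \<in> peirce c 1"
    using s[of u] peirce_orthogonal[OF P(1) u] peirce_orthogonal[OF P(3) u] by simp
  show "ip (P0 c s) u = ip s u" if u: "u \<in> peirce c 0"
    using s[of u] peirce_orthogonal[OF P(1) u] peirce_orthogonal[OF P(2) u] by simp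
qed

lemma ip_self_peirce:
  assumes B: "onb B (peirce c 1)" and B0: "onb B0 (peirce c 0)"
  shows "Re (ip s s) = (cmod (ip s c))\<^sup>2 + (\<Sum>u\<in>B. (cmod (ip s u))\<^sup>2) + (\<Sum>w\<in>B0. (cmod (ip s w))\<^sup>2)"
proof -
  note P = P_in_peirce[OF tri, of s]
  have z: "ip (P2 c s) (P1 c s) = 0" "ip (P2 c s) (P0 c s) = 0" "ip (P1 c s) (P2 c s) = 0"
      "ip (P1 c s) (P0 c s) = 0" "ip (P0 c s) (P2 c s) = 0" "ip (P0 c s) (P1 c s) = 0"
    using peirce_orthogonal[OF P(1) P(2)] peirce_orthogonal[OF P(1) P(3)] peirce_orthogonal[OF P(2) P(1)]
      peirce_orthogonal[OF P(2) P(3)] peirce_orthogonal[OF P(3) P(1)] peirce_orthogonal[OF P(3) P(2)] by auto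
  have "ip s s = ip (P2 c s + P1 c s + P0 c s) (P2 c s + P1 c s + P0 c s)"
    by (simp only: peirce_sum[symmetric])
  then have "ip s s = ip (P2 c s) (P2 c s) + ip (P1 c s) (P1 c s) + ip (P0 c s) (P0 c s)"
    by (simp add: ip_add_left ip_add_right z)
  moreover have "Re (ip (P1 c s) (P1 c s)) = (\<Sum>u\<in>B. (cmod (ip s u))\<^sup>2)"
    unfolding onb_norm_expand[OF B P(2)] using ip_P1 onb_subset[OF B] by (intro sum.cong) auto
  moreover have "Re (ip (P0 c s) (P0 c s)) = (\<Sum>u\<in>B0. (cmod (ip s u))\<^sup>2)"
    unfolding onb_norm_expand[OF B0 P(3)] using ip_P0 onb_subset[OF B0] by (intro sum.cong) auto
  moreover have "ip (P2 c s) (P2 c s) = complex_of_real ((cmod (ip s c))\<^sup>2)"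
    unfolding primitive_P2[OF c] complex_norm_square using c(2) by (simp add: ip_scale_left ip_scale_right)
  ultimately show ?thesis by simp
qed

lemma peirce_dimension:
  assumes B: "onb B (peirce c 1)" and B0: "onb B0 (peirce c 0)"
  shows "1 + card B + card B0 = CARD('n)"
proof -
  define W where "W m = peirce c (int m)" for m
  define BB where "BB m = (if m = 2 then {c} else if m = 1 then B else B0)" for m :: nat
  have c2: "onb {c} (peirce c 2)"
  proof -
    have "vec.span {c} = peirce c 2"
    proof
      show "vec.span {c} \<subseteq> peirce c 2" using self_peirce[OF tri] by (intro vec.span_minimal subspace_peirce) auto
      show "peirce c 2 \<subseteq> vec.span {c}"
      proof
        fix z assume "z \<in> peirce c 2"
        from primitive_peirce2[OF c this] show "z \<in> vec.span {c}"
          by (metis insertI1 vec.span_base vec.span_scale)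
      qed
    qed
    then show ?thesis using c(2) by (simp add: onb_def)
  qed
  have BB: "onb (BB m) (W m)" if "m \<in> {0,1,2}" for m
    using that B B0 c2 by (auto simp: BB_def W_def)
  have orth: "ip x y = 0" if "m \<in> {0,1,2}" "l \<in> {0,1,2}" "m \<noteq> l" "x \<in> W m" "y \<in> W l" for m l x y
    using peirce_orthogonal[of x c "int m" y "int l"] that by (simp add: W_def)
  have fin: "finite {0,1,2::nat}" by simp
  have "z \<in> vec.span (\<Union>m\<in>{0,1,2}. W m)" for z
  proof -
    have "P2 c z + P1 c z + P0 c z \<in> vec.span (\<Union>m\<in>{0,1,2}. W m)"
      using P_in_peirce[OF tri, of z] by (intro vec.span_add vec.span_base) (auto simp: W_def)
    then show ?thesis by (simp only: peirce_sum[symmetric])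
  qed
  then have U: "vec.span (\<Union>m\<in>{0,1,2}. W m) = UNIV" by blast
  have "onb (\<Union>m\<in>{0,1,2}. BB m) UNIV"
    unfolding U[symmetric] by (rule onb_UN(1)[OF fin BB orth])
  then have "card (\<Union>m\<in>{0,1,2}. BB m) = vec.dim (UNIV :: (complex ^ 'n) set)"
    by (rule onb_card)
  moreover have "card (\<Union>m\<in>{0,1,2}. BB m) = (\<Sum>m\<in>{0,1,2}. vec.dim (W m))"
    by (rule onb_UN(2)[OF fin BB orth])
  moreover have W: "W 2 = peirce c 2" "W 1 = peirce c 1" "W 0 = peirce c 0" by (simp_all add: W_def)
  have "card {c} = vec.dim (W 2)" "card B = vec.dim (W 1)" "card B0 = vec.dim (W 0)"
    unfolding W by (rule onb_card[OF c2] onb_card[OF B] onb_card[OF B0])+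
  ultimately show ?thesis by (simp only: vec_dim_card) simp
qed

text \<open>
  For \<open>w\<close> in the Peirce 0-space, the equation of rank-one elements turns \<open>2(s|c)(s|w)\<close> into a
  quadratic expression in the Peirce 1-component of \<open>s\<close>; this makes \<open>(s|c)\<^bsup>m-1\<^esup>(s|w)\<close> a combination
  of derivatives along \<open>D(c,u)\<close>, which can be moved to the other factor.
\<close>

context
  fixes B \<kappa>
  assumes B: "onb B (peirce c 1)" and E: "\<And>z. z \<in> peirce c 0 \<Longrightarrow> (\<Sum>u\<in>B. T u u z) = complex_of_real \<kappa> *s z"
begin

lemma rank_one_quadratic:
  assumes s: "primitive s" and w: "w \<in> peirce c 0"
  shows "2 * ip s c * ip s w = (\<Sum>u\<in>B. ip s u * ip s (T c u w))"
proof -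
  note P = P_in_peirce[OF tri, of s]
  have "2 * ip s c * ip s w = ip (T s c s) w" using s by (simp add: primitive_def ip_scale_left)
  also have "\<dots> = ip s (T c s w)" by (simp add: T_adjoint)
  also have "T c s w = T c (P2 c s + P1 c s + P0 c s) w" by (simp only: peirce_sum[symmetric])
  also have "\<dots> = T c (P1 c s) w"
  proof -
    have "T c (P2 c s) w = 0" using w by (simp add: primitive_P2[OF c] T_scale peirce_iff)
    moreover have "T c (P0 c s) w = 0"
      using P(3) peirce0_iff_orthogonal[OF tri] by (simp add: jt_orthogonal_def)
    ultimately show ?thesis by (simp add: T_add)
  qed
  also have "P1 c s = (\<Sum>u\<in>B. ip s u *s u)"
    using onb_expand[OF B P(2)] ip_P1 onb_subset[OF B] by (metis (mono_tags, lifting) sum.cong)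
  finally show ?thesis by (simp add: T_sum_mid T_scale ip_sum_right ip_scale_right)
qed

lemma T_T_peirce:
  assumes u: "u \<in> peirce c 1" and w: "w \<in> peirce c 0"
  shows "T u c (T c u w) = T u u w"
proof -
  have "T u c w \<in> peirce c (- 1)" using peirce_T[OF u self_peirce[OF tri] w] by simp
  then have "T u c w = 0" using peirce_cases[OF tri] by fastforce
  moreover have "T u c c = u" using u T_commute[of u c c] by (simp add: peirce_iff)
  moreover have "T c c w = 0" using w by (simp add: peirce_iff)
  ultimately show ?thesis
    using jordan_identity[of u c c u w] by (simp add: T_peirce1_c[OF u] T_scale)
qed

lemma moment_peirce0:
  assumes w: "w \<in> peirce c 0" and m: "1 \<le> m"
  shows "real m * (2 * (real m - 1) + \<kappa>) * (LINT s|\<sigma>. (cmod (ip s c ^ (m - 1) * ip s w))\<^sup>2)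
    = \<kappa> * Re (ip w w) * moment c m"
proof -
  define v where "v u = T c u w" for u
  have BV: "u \<in> peirce c 1" if "u \<in> B" for u using onb_subset[OF B that] .
  have v: "v u \<in> peirce c 1" if "u \<in> B" for u
    using peirce_T[OF self_peirce[OF tri] BV[OF that] w] by (simp add: v_def)
  let ?G = "\<lambda>s. ip s c ^ (m - 1) * ip s w" and ?F = "\<lambda>u s. ip s c ^ (m - 1) * ip s (v u)"
  let ?D = "\<lambda>u s. ip s c ^ (m - 1) * ip (T c u s) (v u) + of_nat (m - 1) * ip s c ^ (m - 1 - 1) * ip (T c u s) c * ip s (v u)"
  have E': "(\<Sum>u\<in>B. T u c (v u)) = complex_of_real \<kappa> *s w"
    using E[OF w] T_T_peirce[OF BV w] by (simp add: v_def)
  have adj: "(LINT s|\<sigma>. ?D u s * cnj (?G s)) = complex_of_real (LINT s|\<sigma>. (cmod (?F u s))\<^sup>2)" if u: "u \<in> B" for u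
  proof -
    note F = has_chol_derivative_mult[OF has_chol_derivative_power[OF has_chol_derivative_ip[of c], of "m - 1"] has_chol_derivative_ip[of "v u"]]
    note G = has_chol_derivative_mult[OF has_chol_derivative_power[OF has_chol_derivative_ip[of c], of "m - 1"] has_chol_derivative_ip[of w]]
    have "(LINT s|\<sigma>. ?D u s * cnj (?G s)) = (LINT s|\<sigma>. ?F u s * cnj (ip s c ^ (m - 1) * ip (T u c s) w
        + of_nat (m - 1) * ip s c ^ (m - 1 - 1) * ip (T u c s) c * ip s w))"
      by (rule integral_adjoint[OF F G])
    also have "\<dots> = (LINT s|\<sigma>. ?F u s * cnj (?F u s))"
      by (simp add: ip_T_c(2)[OF BV[OF u]] T_adjoint[of u c _ w] v_def)
    finally show ?thesis by (simp only: integral_norm_square)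
  qed
  have Dsum: "(\<Sum>u\<in>B. ?D u s) = complex_of_real (2 * (real m - 1) + \<kappa>) * ?G s" if s: "s \<in> sphere" for s
  proof -
    have "(\<Sum>u\<in>B. ip (T c u s) (v u)) = ip s (\<Sum>u\<in>B. T u c (v u))"
      by (simp add: T_adjoint ip_sum_right)
    also have "\<dots> = \<kappa> * ip s w" by (simp add: E' ip_scale_right)
    finally have 1: "(\<Sum>u\<in>B. ip (T c u s) (v u)) = \<kappa> * ip s w" .
    have 2: "(\<Sum>u\<in>B. ip (T c u s) c * ip s (v u)) = 2 * ip s c * ip s w"
      using rank_one_quadratic[OF _ w, of s] s ip_T_c(1)[OF BV] by (simp add: rank_one_tripotent_iff v_def)
    have "(\<Sum>u\<in>B. ?D u s) = ip s c ^ (m - 1) * (\<Sum>u\<in>B. ip (T c u s) (v u))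
        + of_nat (m - 1) * ip s c ^ (m - 1 - 1) * (\<Sum>u\<in>B. ip (T c u s) c * ip s (v u))"
      by (simp add: sum.distrib sum_distrib_left mult.assoc)
    also have "of_nat (m - 1) * ip s c ^ (m - 1 - 1) * (\<Sum>u\<in>B. ip (T c u s) c * ip s (v u))
        = 2 * of_nat (m - 1) * (ip s c ^ (m - 1) * ip s w)"
      unfolding 2 by (cases "m - 1") simp_all
    finally show ?thesis using m by (simp add: 1 of_nat_diff algebra_simps)
  qed
  have int: "integrable \<sigma> (\<lambda>s. ?D u s * cnj (?G s))" for u
  proof -
    have "continuous_on sphere (\<lambda>s. ip (T c u s) x)" for x
      by (intro continuous_ip continuous_T continuous_on_id continuous_on_const)
    then show ?thesis by (intro integrable_sigma continuous_intros continuous_ip_left)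
  qed
  have "complex_of_real (2 * (real m - 1) + \<kappa>) * complex_of_real (LINT s|\<sigma>. (cmod (?G s))\<^sup>2)
      = (LINT s|\<sigma>. complex_of_real (2 * (real m - 1) + \<kappa>) * ?G s * cnj (?G s))"
    by (simp only: integral_norm_square[symmetric] integral_mult_right_zero[symmetric] mult.assoc)
  also have "\<dots> = (LINT s|\<sigma>. (\<Sum>u\<in>B. ?D u s * cnj (?G s)))"
    by (rule Bochner_Integration.integral_cong[OF refl]) (simp only: space_sigma Dsum[symmetric] sum_distrib_right)
  also have "\<dots> = (\<Sum>u\<in>B. LINT s|\<sigma>. ?D u s * cnj (?G s))"
    by (rule Bochner_Integration.integral_sum[OF int])
  also have "\<dots> = complex_of_real (\<Sum>u\<in>B. LINT s|\<sigma>. (cmod (?F u s))\<^sup>2)"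
    unfolding of_real_sum by (rule sum.cong[OF refl adj])
  finally have eq: "(2 * (real m - 1) + \<kappa>) * (LINT s|\<sigma>. (cmod (?G s))\<^sup>2) = (\<Sum>u\<in>B. LINT s|\<sigma>. (cmod (?F u s))\<^sup>2)"
    by (simp only: of_real_mult[symmetric] of_real_eq_iff)
  have "(\<Sum>u\<in>B. ip (v u) (v u)) = ip w (\<Sum>u\<in>B. T u c (v u))"
    by (simp add: ip_sum_right v_def T_adjoint)
  also have "\<dots> = \<kappa> * ip w w" by (simp add: E' ip_scale_right)
  finally have "(\<Sum>u\<in>B. ip (v u) (v u)) = \<kappa> * ip w w" .
  from arg_cong[OF this, of Re] have vv: "(\<Sum>u\<in>B. Re (ip (v u) (v u))) = \<kappa> * Re (ip w w)" by simp
  have "real m * (\<Sum>u\<in>B. LINT s|\<sigma>. (cmod (?F u s))\<^sup>2) = (\<Sum>u\<in>B. Re (ip (v u) (v u)) * moment c m)"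
    unfolding sum_distrib_left by (intro sum.cong refl moment_peirce1 v m)
  also have "\<dots> = \<kappa> * Re (ip w w) * moment c m" by (simp add: sum_distrib_right[symmetric] vv)
  finally show ?thesis by (simp only: eq[symmetric] mult.assoc)
qed

text \<open>
  Since \<open>s\<close> has length 1, \<open>\<bar>(s|c)\<bar>\<^bsup>2(m-1)\<^esup>\<close> is the sum of its products with \<open>\<bar>(s|u)\<bar>\<^sup>2\<close> over an orthonormal
  basis adapted to the Peirce decomposition of \<open>c\<close>.
\<close>

lemma moment_step:
  assumes m: "1 \<le> m" and B0: "onb B0 (peirce c 0)"
  shows "real m * (2 * (real m - 1) + \<kappa>) * moment c (m - 1)
    = ((real m + card B) * (2 * (real m - 1) + \<kappa>) + card B0 * \<kappa>) * moment c m"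
proof -
  let ?I = "\<lambda>u. LINT s|\<sigma>. (cmod (ip s c ^ (m - 1) * ip s u))\<^sup>2"
  have int: "integrable \<sigma> (\<lambda>s. (cmod (ip s c ^ (m - 1) * ip s u))\<^sup>2)" for u
    by (intro integrable_sigma continuous_intros continuous_ip_left)
  have pm: "(cmod (ip s c)) ^ (2 * m) = (cmod (ip s c ^ (m - 1) * ip s c))\<^sup>2" for s
  proof -
    have "ip s c ^ (m - 1) * ip s c = ip s c ^ m" using m by (cases m) simp_all
    then show ?thesis by (simp add: norm_power power_mult[symmetric] mult.commute)
  qed
  have "moment c (m - 1) = (LINT s|\<sigma>. (cmod (ip s c ^ (m - 1) * ip s c))\<^sup>2
      + (\<Sum>u\<in>B. (cmod (ip s c ^ (m - 1) * ip s u))\<^sup>2) + (\<Sum>w\<in>B0. (cmod (ip s c ^ (m - 1) * ip s w))\<^sup>2))"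
    unfolding moment_def
  proof (rule Bochner_Integration.integral_cong[OF refl])
    fix s assume "s \<in> space \<sigma>"
    then have "ip s s = 1" by (simp add: space_sigma rank_one_tripotent_iff)
    then have "(cmod (ip s c)) ^ (2 * (m - 1)) = (cmod (ip s c ^ (m - 1)))\<^sup>2 * ((cmod (ip s c))\<^sup>2 + (\<Sum>u\<in>B. (cmod (ip s u))\<^sup>2) + (\<Sum>w\<in>B0. (cmod (ip s w))\<^sup>2))"
      using ip_self_peirce[OF B B0, of s] by (simp add: norm_power power_mult[symmetric] mult.commute)
    then show "(cmod (ip s c)) ^ (2 * (m - 1)) = (cmod (ip s c ^ (m - 1) * ip s c))\<^sup>2
      + (\<Sum>u\<in>B. (cmod (ip s c ^ (m - 1) * ip s u))\<^sup>2) + (\<Sum>w\<in>B0. (cmod (ip s c ^ (m - 1) * ip s w))\<^sup>2)"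
      by (simp add: norm_mult power_mult_distrib distrib_left sum_distrib_left)
  qed
  also have "\<dots> = moment c m + (\<Sum>u\<in>B. ?I u) + (\<Sum>w\<in>B0. ?I w)"
    unfolding moment_def pm using int
    by (simp add: Bochner_Integration.integral_add Bochner_Integration.integral_sum Bochner_Integration.integrable_add Bochner_Integration.integrable_sum)
  finally have eq: "moment c (m - 1) = moment c m + (\<Sum>u\<in>B. ?I u) + (\<Sum>w\<in>B0. ?I w)" .
  define l where "l = 2 * (real m - 1) + \<kappa>"
  have one: "Re (ip u u) = 1" if "u \<in> B \<or> u \<in> B0" for u
    using that onb_ip[OF B, of u u] onb_ip[OF B0, of u u] by auto
  have "real m * (\<Sum>u\<in>B. ?I u) = (\<Sum>u\<in>B. moment c m)"
    unfolding sum_distrib_left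
  proof (rule sum.cong[OF refl])
    fix u assume u: "u \<in> B"
    show "real m * ?I u = moment c m" using moment_peirce1[OF onb_subset[OF B u] m] one[of u] u by simp
  qed
  then have h1: "real m * (\<Sum>u\<in>B. ?I u) = card B * moment c m" by simp
  have "real m * l * (\<Sum>w\<in>B0. ?I w) = (\<Sum>w\<in>B0. \<kappa> * moment c m)"
    unfolding sum_distrib_left
  proof (rule sum.cong[OF refl])
    fix w assume w: "w \<in> B0"
    show "real m * l * ?I w = \<kappa> * moment c m"
      using moment_peirce0[OF onb_subset[OF B0 w] m] one[of w] w by (simp add: l_def)
  qed
  then have h2: "real m * l * (\<Sum>w\<in>B0. ?I w) = card B0 * (\<kappa> * moment c m)" by simp
  have "real m * l * moment c (m - 1)
      = real m * l * moment c m + l * (real m * (\<Sum>u\<in>B. ?I u)) + real m * l * (\<Sum>w\<in>B0. ?I w)"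
    unfolding eq by (simp only: distrib_left mult_ac)
  then have "real m * l * moment c (m - 1) = ((real m + card B) * l + card B0 * \<kappa>) * moment c m"
    unfolding h1 h2 by (simp only: distrib_right distrib_left mult_ac)
  then show ?thesis by (simp only: l_def)
qed

end

end

lemma multiplicity_positive: "k \<in> {1..r} \<Longrightarrow> 0 < a"
  using multiplicity_pos type by (cases "r = 1") (auto simp: jt_type_def)

text \<open>
  With the dimensions of the Peirce spaces inserted, the coefficient in \<open>moment_step\<close> factors as
  \<open>2 (m - 1 + d/r)(m - 1 + ar/2)\<close>.
\<close>

theorem moment_formula:
  assumes k: "k \<in> {1..r}"
  shows "moment (e k) m = fact m * pochhammer (real a / 2) m
    / (pochhammer (real CARD('n) / real r) m * pochhammer (real a * real r / 2) m)"
proof -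
  note c = primitive_e[OF k] ip_e[OF k]
  obtain B where B: "onb B (peirce (e k) 1)" and cB: "card B = a * (r - 1) + b"
    and E: "\<And>z. z \<in> peirce (e k) 0 \<Longrightarrow> (\<Sum>u\<in>B. T u u z) = of_nat a *s z"
    using peirce1_basis[OF k] by blast
  obtain B0 where B0: "onb B0 (peirce (e k) 0)" using onb_exists[OF subspace_peirce] by blast
  have r: "real r \<ge> 1" using k by auto
  have a: "real a > 0" using multiplicity_positive[OF k] by simp
  define D where "D = real CARD('n) / real r"
  have rb: "real (card B) = real a * (real r - 1) + real b" using cB r by (simp add: of_nat_diff)
  have "real (2 * CARD('n)) = real (r * (2 + a * (r - 1) + 2 * b))" by (simp only: dimension)
  then have d: "real CARD('n) = real r * (1 + real a * (real r - 1) / 2 + real b)"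
    using r by (simp add: of_nat_diff field_simps)
  then have D: "D = 1 + real a * (real r - 1) / 2 + real b" using r by (simp add: D_def)
  have n0: "real (card B0) = real r * D - 1 - (real a * (real r - 1) + real b)"
  proof -
    have "real (1 + card B + card B0) = real CARD('n)" by (simp only: peirce_dimension[OF c B B0])
    then have "1 + real (card B) + real (card B0) = real CARD('n)" by simp
    moreover have "y = w - 1 - x" if "1 + x + y = w" for x y w :: real using that by simp
    ultimately have "real (card B0) = real CARD('n) - 1 - real (card B)" by blast
    then show ?thesis unfolding rb d D .
  qed
  have Dpos: "D > 0" using r a by (simp add: D add_pos_nonneg)
  show ?thesis
    unfolding D_def[symmetric]
  proof (induction m)
    case 0
    then show ?case by (simp add: moment_0)
  next
    case (Suc m)
    let ?A = "real a / 2"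
    have E': "\<And>z. z \<in> peirce (e k) 0 \<Longrightarrow> (\<Sum>u\<in>B. T u u z) = complex_of_real (real a) *s z" using E by simp
    have "(real m + 1) * (2 * real m + real a) * moment (e k) m
        = ((real m + 1 + real (card B)) * (2 * real m + real a) + real (card B0) * real a) * moment (e k) (Suc m)"
      using moment_step[OF c B E' _ B0, of "Suc m"] by (simp add: add_ac)
    also have "(real m + 1 + real (card B)) * (2 * real m + real a) + real (card B0) * real a
        = 2 * (real m + D) * (real m + real a * real r / 2)"
      unfolding rb n0 D by (simp add: field_simps power2_eq_square)
    finally have "(real m + 1) * (?A + real m) * moment (e k) m
        = (D + real m) * (real a * real r / 2 + real m) * moment (e k) (Suc m)"
      by (simp add: field_simps)
    moreover have "D + real m > 0" "real a * real r / 2 + real m > 0" using Dpos r a by (simp_all add: add_pos_nonneg)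
    moreover have "M = N / (X * Y)" if "N = X * Y * M" "X > 0" "Y > 0" for M N X Y :: real
      using that by simp
    ultimately have "moment (e k) (Suc m)
        = (real m + 1) * (?A + real m) * moment (e k) m / ((D + real m) * (real a * real r / 2 + real m))" by blast
    also have "\<dots> = (fact m * (real m + 1)) * (pochhammer ?A m * (?A + real m))
        / ((pochhammer D m * (D + real m)) * (pochhammer (real a * real r / 2) m * (real a * real r / 2 + real m)))"
      unfolding Suc by (simp only: times_divide_eq_right times_divide_eq_left divide_divide_eq_left mult_ac)
    finally show ?case by (simp only: pochhammer_Suc fact_Suc of_nat_Suc mult_ac add_ac of_nat_mult)
  qed
qed

end

section \<open>Laplace transforms\<close>

text \<open>Euler's integral for \<open>Gamma (\<beta> / \<alpha>)\<close> with the substitution \<open>u = \<nu> t\<^sup>\<alpha>\<close>.\<close>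

lemma nn_integral_powr_exp:
  fixes \<alpha> \<nu> \<beta> :: real
  assumes "0 < \<alpha>" "0 < \<nu>" "0 < \<beta>"
  shows "(\<integral>\<^sup>+ t\<in>{0<..}. ennreal (t powr (\<beta> - 1) * exp (- \<nu> * t powr \<alpha>)) \<partial>lborel)
    = ennreal (\<nu> powr (- \<beta> / \<alpha>) * Gamma (\<beta> / \<alpha>) / \<alpha>)"
proof -
  let ?f = "\<lambda>u::real. u powr (\<beta> / \<alpha> - 1) / exp u" let ?g = "\<lambda>t. \<nu> * t powr \<alpha>"
  have b: "\<beta> / \<alpha> > 0" using assms by simp
  have img: "?g ` {0<..} = {0<..}"
  proof safe
    fix u :: real assume "u > 0"
    then have "?g ((u / \<nu>) powr (1 / \<alpha>)) = u" using assms by (simp add: powr_powr)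
    then show "u \<in> ?g ` {0<..}" using \<open>u > 0\<close> assms by (intro image_eqI[of _ _ "(u / \<nu>) powr (1 / \<alpha>)"]) auto
  qed (use assms in auto)
  have "(?f has_integral Gamma (\<beta> / \<alpha>)) {0<..}"
    using Gamma_integral_real[OF b] has_integral_spike_set_eq[of "{0..}" "{0<..}" ?f]
    by (subst has_integral_spike_set_eq[of _ "{0::real..}"]) (auto intro: negligible_subset[of "{0}"])
  moreover from this have "?f absolutely_integrable_on {0<..}"
    by (intro nonnegative_absolutely_integrable_1) auto
  ultimately have 1: "?f absolutely_integrable_on (?g ` {0<..}) \<and> integral (?g ` {0<..}) ?f = Gamma (\<beta> / \<alpha>)"
    unfolding img by (auto intro: integral_unique)
  have inj: "inj_on ?g {0<..}"
  proof (rule inj_onI)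
    fix x y assume "x \<in> {0<..}" "y \<in> {0<..}" "?g x = ?g y"
    then have "(x powr \<alpha>) powr (1 / \<alpha>) = (y powr \<alpha>) powr (1 / \<alpha>)" using assms by simp
    then show "x = y" using assms \<open>x \<in> _\<close> \<open>y \<in> _\<close> by (simp add: powr_powr)
  qed
  have der: "(?g has_field_derivative \<nu> * (\<alpha> * t powr (\<alpha> - 1))) (at t within {0<..})" if "t \<in> {0<..}" for t
    using that by (auto intro!: derivative_eq_intros)
  have "(\<lambda>t. \<bar>\<nu> * (\<alpha> * t powr (\<alpha> - 1))\<bar> * ?f (?g t)) absolutely_integrable_on {0<..} \<and>
      integral {0<..} (\<lambda>t. \<bar>\<nu> * (\<alpha> * t powr (\<alpha> - 1))\<bar> * ?f (?g t)) = Gamma (\<beta> / \<alpha>)"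
    using has_absolute_integral_change_of_variables_1'[OF _ der inj, of ?f "Gamma (\<beta> / \<alpha>)"] 1 by simp
  then have "((\<lambda>t. \<bar>\<nu> * (\<alpha> * t powr (\<alpha> - 1))\<bar> * ?f (?g t)) has_integral Gamma (\<beta> / \<alpha>)) {0<..}"
    using set_lebesgue_integral_eq_integral(1) has_integral_iff by blast
  moreover have "\<bar>\<nu> * (\<alpha> * t powr (\<alpha> - 1))\<bar> * ?f (?g t)
      = \<alpha> * \<nu> powr (\<beta> / \<alpha>) * (t powr (\<beta> - 1) * exp (- \<nu> * t powr \<alpha>))" if "t \<in> {0<..}" for t
  proof -
    have e: "\<alpha> * (\<beta> / \<alpha> - 1) = \<beta> - \<alpha>" using assms by (simp add: field_simps)
    have E1: "?g t powr (\<beta> / \<alpha> - 1) = \<nu> powr (\<beta> / \<alpha> - 1) * t powr (\<beta> - \<alpha>)"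
      using that assms by (simp only: powr_mult powr_powr e)
    have E2: "\<nu> * \<nu> powr (\<beta> / \<alpha> - 1) = \<nu> powr (\<beta> / \<alpha>)"
      using assms powr_add[of \<nu> 1 "\<beta> / \<alpha> - 1"] by simp
    have E3: "t powr (\<alpha> - 1) * t powr (\<beta> - \<alpha>) = t powr (\<beta> - 1)"
      by (simp add: powr_add[symmetric])
    have E4: "\<bar>\<nu> * (\<alpha> * t powr (\<alpha> - 1))\<bar> = \<nu> * (\<alpha> * t powr (\<alpha> - 1))"
      using assms by (simp add: abs_mult)
    have E5: "exp (- \<nu> * t powr \<alpha>) = 1 / exp (?g t)" by (simp add: exp_minus inverse_eq_divide)
    have "\<bar>\<nu> * (\<alpha> * t powr (\<alpha> - 1))\<bar> * ?f (?g t)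
        = \<alpha> * (\<nu> * \<nu> powr (\<beta> / \<alpha> - 1)) * ((t powr (\<alpha> - 1) * t powr (\<beta> - \<alpha>)) * (1 / exp (?g t)))"
      unfolding E4 E1 by (simp only: mult_ac times_divide_eq_right mult_1_right)
    then show ?thesis by (simp only: E2 E3 E5)
  qed
  ultimately have "((\<lambda>t. \<alpha> * \<nu> powr (\<beta> / \<alpha>) * (t powr (\<beta> - 1) * exp (- \<nu> * t powr \<alpha>))) has_integral Gamma (\<beta> / \<alpha>)) {0<..}"
    using has_integral_cong[of "{0<..}"] by (metis (no_types, lifting))
  from has_integral_mult_right[OF this, of "1 / (\<alpha> * \<nu> powr (\<beta> / \<alpha>))"]
  have "((\<lambda>t. t powr (\<beta> - 1) * exp (- \<nu> * t powr \<alpha>)) has_integral \<nu> powr (- \<beta> / \<alpha>) * Gamma (\<beta> / \<alpha>) / \<alpha>) {0<..}"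
    using assms by (simp add: powr_minus field_simps)
  then show ?thesis
    by (intro nn_integral_has_integral_lebesgue') auto
qed

lemma nn_integral_powr_exp_linear:
  assumes "0 < (x::real)" "0 < s"
  shows "(\<integral>\<^sup>+ t\<in>{0<..}. ennreal (t powr (s - 1) * exp (- x * t)) \<partial>lborel) = ennreal (x powr (- s) * Gamma s)"
proof -
  have "(\<integral>\<^sup>+ t\<in>{0<..}. ennreal (t powr (s - 1) * exp (- x * t)) \<partial>lborel)
      = (\<integral>\<^sup>+ t\<in>{0<..}. ennreal (t powr (s - 1) * exp (- x * t powr 1)) \<partial>lborel)"
    by (intro nn_integral_cong) (auto simp: indicator_def)
  then show ?thesis using nn_integral_powr_exp[of 1 x s] assms by simp
qed

lemma laplace_powr:
  assumes "0 < (x::real)" "0 < s"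
  shows "set_integrable lborel {0<..} (\<lambda>t. t powr (s - 1) * exp (- x * t))"
    and "(LINT t:{0<..}|lborel. t powr (s - 1) * exp (- x * t)) = x powr (- s) * Gamma s"
proof -
  have "has_bochner_integral lborel (\<lambda>t. indicator {0<..} t *\<^sub>R (t powr (s - 1) * exp (- x * t))) (x powr (- s) * Gamma s)"
  proof (rule has_bochner_integral_nn_integral)
    show "(\<integral>\<^sup>+ t. ennreal (indicator {0<..} t *\<^sub>R (t powr (s - 1) * exp (- x * t))) \<partial>lborel) = ennreal (x powr (- s) * Gamma s)"
      unfolding nn_integral_powr_exp_linear[OF assms, symmetric]
      by (intro nn_integral_cong) (auto simp: indicator_def)
  qed (use assms Gamma_real_pos[of s] in auto)
  then show "set_integrable lborel {0<..} (\<lambda>t. t powr (s - 1) * exp (- x * t))"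
    "(LINT t:{0<..}|lborel. t powr (s - 1) * exp (- x * t)) = x powr (- s) * Gamma s"
    by (simp_all add: set_integrable_def set_lebesgue_integral_def has_bochner_integral_iff)
qed

lemma laplace_exp:
  assumes "0 < (x::real)"
  shows "set_integrable lborel {0<..} (\<lambda>t. exp (- x * t))" "(LINT t:{0<..}|lborel. exp (- x * t)) = 1 / x"
proof -
  have "set_integrable lborel {0<..} (\<lambda>t. exp (- x * t)) \<longleftrightarrow> set_integrable lborel {0<..} (\<lambda>t. t powr (1 - 1) * exp (- x * t))"
    by (rule set_integrable_cong) auto
  then show "set_integrable lborel {0<..} (\<lambda>t. exp (- x * t))" using laplace_powr(1)[OF assms, of 1] by simp
  have "(LINT t:{0<..}|lborel. exp (- x * t)) = (LINT t:{0<..}|lborel. t powr (1 - 1) * exp (- x * t))"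
    by (rule set_lebesgue_integral_cong) auto
  then show "(LINT t:{0<..}|lborel. exp (- x * t)) = 1 / x" using laplace_powr(2)[OF assms, of 1] assms by (simp add: powr_minus inverse_eq_divide)
qed

lemma laplace_exp_complex:
  assumes "0 < Re c"
  shows "set_integrable lborel {0<..} (\<lambda>t. exp (- c * complex_of_real t))"
    and "(LINT t:{0<..}|lborel. exp (- c * complex_of_real t)) = 1 / c"
proof -
  have c0: "c \<noteq> 0" using assms by auto
  show int: "set_integrable lborel {0<..} (\<lambda>t. exp (- c * complex_of_real t))"
  proof (rule set_integrable_bound[OF laplace_exp(1)[OF assms]])
    show "set_borel_measurable lborel {0<..} (\<lambda>t. exp (- c * complex_of_real t))"
      unfolding set_borel_measurable_def by measurable
    show "AE t\<in>{0<..} in lborel. norm (exp (- c * complex_of_real t)) \<le> norm (exp (- Re c * t))"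
      by simp
  qed
  have "(LBINT t=0..\<infinity>. exp (- c * complex_of_real t)) = 0 - (- 1 / c)"
  proof (rule interval_integral_FTC_integrable[where F="\<lambda>t. - exp (- c * complex_of_real t) / c"])
    show "((\<lambda>t. - exp (- c * complex_of_real t) / c) has_vector_derivative exp (- c * complex_of_real t)) (at t)" for t
      using c0 by (auto intro!: derivative_eq_intros has_vector_derivative_real_field)
    show "isCont (\<lambda>t. exp (- c * complex_of_real t)) t" for t by (intro continuous_intros)
    show "set_integrable lborel (einterval 0 \<infinity>) (\<lambda>t. exp (- c * complex_of_real t))"
      using int by (simp add: einterval_def greaterThan_def zero_ereal_def)
    have "((\<lambda>t. - exp (- c * complex_of_real t) / c) \<longlongrightarrow> - exp (- c * complex_of_real 0) / c) (at_right 0)"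
      using c0 by (intro tendsto_intros)
    then show "(((\<lambda>t. - exp (- c * complex_of_real t) / c) \<circ> real_of_ereal) \<longlongrightarrow> - 1 / c) (at_right 0)"
      by (simp add: ereal_tendsto_simps zero_ereal_def)
    have "((\<lambda>t. exp (- Re c * t)) \<longlongrightarrow> 0) at_top"
      using assms by real_asymp
    then have "((\<lambda>t. exp (- c * complex_of_real t)) \<longlongrightarrow> 0) at_top"
      by (intro tendsto_norm_zero_cancel[of "\<lambda>t. exp (- c * complex_of_real t)"]) simp
    then have "((\<lambda>t. - exp (- c * complex_of_real t) / c) \<longlongrightarrow> - 0 / c) at_top"
      using c0 by (intro tendsto_intros)
    then show "(((\<lambda>t. - exp (- c * complex_of_real t) / c) \<circ> real_of_ereal) \<longlongrightarrow> 0) (at_left \<infinity>)"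
      by (simp add: ereal_tendsto_simps)
  qed simp
  then show "(LINT t:{0<..}|lborel. exp (- c * complex_of_real t)) = 1 / c"
    using interval_integral_to_infinity_eq[where f="\<lambda>t. exp (- c * complex_of_real t)" and a=0]
    by (simp add: zero_ereal_def)
qed

text \<open>
  Uniqueness of the Laplace transform from its values at integers: with \<open>T = e\<^bsup>-Y\<^esup>\<close> the function
  is orthogonal to all polynomials in \<open>T\<close>, hence by Weierstrass to itself.
\<close>

lemma laplace_unique:
  fixes u :: "real \<Rightarrow> real"
  assumes cont: "continuous_on {0..} u" and bd: "\<And>Y. 0 \<le> Y \<Longrightarrow> \<bar>u Y\<bar> \<le> C * exp (2 * Y)"
    and zero: "\<And>n::nat. 3 \<le> n \<Longrightarrow> (LINT Y:{0<..}|lborel. exp (- n * Y) * u Y) = 0"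
    and Y: "0 \<le> Y"
  shows "u Y = 0"
proof -
  have C0: "C \<ge> 0" using bd[of 0] by simp
  \<comment> \<open>the factor \<open>exp (- 3 Y)\<close> outweighs the growth of \<open>u\<close>, so that \<open>h\<close> decays and \<open>h (- ln T)\<close> extends continuously to \<open>T = 0\<close>\<close>
  define h where "h Y = exp (- 3 * Y) * u Y" for Y
  have hb: "\<bar>h Y\<bar> \<le> C * exp (- 1 * Y)" if "0 \<le> Y" for Y
  proof -
    have "\<bar>h Y\<bar> \<le> exp (- 3 * Y) * (C * exp (2 * Y))"
      unfolding h_def abs_mult using bd[OF that] by (intro mult_mono) auto
    also have "\<dots> = C * exp (- 1 * Y)" by (simp add: exp_add[symmetric])
    finally show ?thesis .
  qed
  have hc: "continuous_on {0..} h" unfolding h_def by (intro continuous_intros cont)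
  have hc0: "continuous_on {0<..} h" using hc by (rule continuous_on_subset) auto
  have meas: "set_borel_measurable lborel {0<..} (\<lambda>Y. g Y * h Y)" if "continuous_on {0<..} g" for g
  proof -
    have "continuous_on {0<..} (\<lambda>Y. g Y * h Y)"
      using that by (intro continuous_intros hc0)
    then show ?thesis
      using borel_measurable_continuous_on_indicator[of "{0<..}" "\<lambda>Y. g Y * h Y"]
      by (simp add: set_borel_measurable_def)
  qed
  have int: "set_integrable lborel {0<..} (\<lambda>Y. g Y * h Y)"
    if g: "continuous_on {0<..} g" "\<And>Y. 0 < Y \<Longrightarrow> \<bar>g Y\<bar> \<le> b" for g b
  proof (rule set_integrable_bound)
    show "set_integrable lborel {0<..} (\<lambda>Y. b * C * exp (- 1 * Y))"
      using laplace_exp(1)[of 1] by simp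
    have "\<bar>g Y\<bar> * \<bar>h Y\<bar> \<le> b * C * exp (- 1 * Y)" if Y: "0 < Y" for Y
    proof -
      have "\<bar>g Y\<bar> * \<bar>h Y\<bar> \<le> b * (C * exp (- 1 * Y))"
        using hb[of Y] Y g(2)[OF Y] order_trans[OF abs_ge_zero g(2)[OF Y]] by (intro mult_mono) auto
      then show ?thesis by (simp add: mult.assoc)
    qed
    then have "\<bar>g Y * h Y\<bar> \<le> \<bar>b * C * exp (- 1 * Y)\<bar>" if "0 < Y" for Y
      using that by (metis abs_ge_self abs_mult order_trans)
    then show "AE Y\<in>{0<..} in lborel. norm (g Y * h Y) \<le> norm (b * C * exp (- 1 * Y))" by simp
  qed (rule meas[OF g(1)])
  have ec: "continuous_on {0<..} (\<lambda>Y::real. exp (- Y) ^ i)" for i by (intro continuous_intros)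
  have poly: "(LINT Y:{0<..}|lborel. (\<Sum>i\<le>n. a i * exp (- Y) ^ i) * h Y) = 0" for a :: "nat \<Rightarrow> real" and n
  proof -
    have 1: "set_integrable lborel {0<..} (\<lambda>Y. exp (- Y) ^ i * h Y)" for i
      by (rule int[where b=1]) (auto intro: ec simp: power_le_one)
    have 2: "(LINT Y:{0<..}|lborel. exp (- Y) ^ i * h Y) = 0" for i
    proof -
      have "(\<lambda>Y. exp (- Y) ^ i * h Y) = (\<lambda>Y. exp (- real (i + 3) * Y) * u Y)"
        by (auto simp: h_def exp_of_nat_mult[symmetric] exp_add[symmetric] algebra_simps)
      then show ?thesis using zero[of "i + 3"] by simp
    qed
    have "(LINT Y:{0<..}|lborel. (\<Sum>i\<le>n. a i * exp (- Y) ^ i) * h Y)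
        = (LINT Y:{0<..}|lborel. (\<Sum>i\<le>n. a i * (exp (- Y) ^ i * h Y)))"
      by (simp add: sum_distrib_right mult.assoc)
    also have "\<dots> = (\<Sum>i\<le>n. LINT Y:{0<..}|lborel. a i * (exp (- Y) ^ i * h Y))"
      using 1 unfolding set_lebesgue_integral_def set_integrable_def scaleR_sum_right
      by (intro Bochner_Integration.integral_sum) (simp add: mult.left_commute)
    also have "\<dots> = 0" using 2 by simp
    finally show ?thesis .
  qed
  define v where "v T = (if T > 0 then T ^ 3 * u (- ln T) else 0)" for T :: real
  have vh: "v (exp (- Y)) = h Y" for Y by (simp add: v_def h_def exp_of_nat_mult[symmetric])
  have vb: "\<bar>v T\<bar> \<le> C * T" if "0 \<le> T" "T \<le> 1" for T
  proof (cases "T > 0")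
    case True
    have "\<bar>h (- ln T)\<bar> \<le> C * exp (- 1 * - ln T)" using True that by (intro hb) simp
    moreover have "v T = h (- ln T)" using vh[of "- ln T"] True by simp
    ultimately show ?thesis using True by simp
  qed (use that C0 in \<open>simp add: v_def\<close>)
  have vc: "continuous_on {0..1} v"
    unfolding continuous_on_eq_continuous_within
  proof
    fix x :: real assume x: "x \<in> {0..1}"
    show "continuous (at x within {0..1}) v"
    proof (cases "x = 0")
      case True
      have "(v \<longlongrightarrow> 0) (at 0 within {0..1})"
      proof (rule Lim_null_comparison)
        show "eventually (\<lambda>T. norm (v T) \<le> C * T) (at 0 within {0..1})"
          using vb by (auto simp: eventually_at_filter)
        show "((\<lambda>T. C * T) \<longlongrightarrow> 0) (at 0 within {0..1})" by (auto intro!: tendsto_eq_intros)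
      qed
      then show ?thesis using True by (simp add: continuous_within v_def)
    next
      case False
      have "continuous_on {0<..1} (\<lambda>T. T ^ 3 * u (- ln T))"
        by (intro continuous_intros continuous_on_compose2[OF cont]) auto
      then have "continuous_on {0<..1} v"
        by (rule continuous_on_eq) (auto simp: v_def)
      then have "continuous (at x within {0<..1}) v"
        using x False by (auto simp: continuous_on_eq_continuous_within)
      moreover have "at x within {0..1} = at x within {0<..1}"
        using x False by (intro at_within_nhd[of _ "{0<..}"]) auto
      ultimately show ?thesis by (simp add: continuous_within)
    qed
  qed
  let ?I = "LINT Y:{0<..}|lborel. h Y * h Y"
  have hh: "set_integrable lborel {0<..} (\<lambda>Y. h Y * h Y)"
  proof (rule int[of _ C])
    show "\<bar>h Y\<bar> \<le> C" if "0 < Y" for Y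
    proof -
      have "C * exp (- 1 * Y) \<le> C * 1" using that C0 by (intro mult_left_mono) auto
      then show ?thesis using hb[of Y] that by simp
    qed
  qed (rule hc0)
  have "\<bar>?I\<bar> \<le> \<epsilon> * C" if \<epsilon>: "\<epsilon> > 0" for \<epsilon>
  proof -
    obtain p where p: "polynomial_function p" "\<And>T. T \<in> {0..1} \<Longrightarrow> norm (v T - p T) < \<epsilon>"
      using Stone_Weierstrass_polynomial_function[OF compact_Icc vc \<epsilon>] by blast
    then obtain a n where an: "p = (\<lambda>x. \<Sum>i\<le>n. a i * x ^ i)"
      by (auto simp: real_polynomial_function_eq[symmetric] real_polynomial_function_iff_sum)
    have pc: "continuous_on {0<..} (\<lambda>Y. p (exp (- Y)))" unfolding an by (intro continuous_intros)
    have pb: "\<bar>h Y - p (exp (- Y))\<bar> \<le> \<epsilon>" if "0 < Y" for Y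
      using p(2)[of "exp (- Y)"] that vh[of Y] by (simp add: less_imp_le)
    have hpc: "continuous_on {0<..} (\<lambda>Y. h Y - p (exp (- Y)))"
      by (intro continuous_intros hc0 pc)
    have i1: "set_integrable lborel {0<..} (\<lambda>Y. (h Y - p (exp (- Y))) * h Y)"
      by (rule int[OF hpc pb])
    have "set_integrable lborel {0<..} (\<lambda>Y. h Y * h Y - (h Y - p (exp (- Y))) * h Y)"
      by (rule set_integral_diff(1)[OF hh i1])
    then have i2: "set_integrable lborel {0<..} (\<lambda>Y. p (exp (- Y)) * h Y)" by (simp add: algebra_simps)
    have "?I = (LINT Y:{0<..}|lborel. (h Y - p (exp (- Y))) * h Y + p (exp (- Y)) * h Y)"
      by (simp add: algebra_simps)
    also have "\<dots> = (LINT Y:{0<..}|lborel. (h Y - p (exp (- Y))) * h Y)"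
      using set_integral_add(2)[OF i1 i2] poly[of a n] by (simp add: an)
    also have "\<bar>\<dots>\<bar> \<le> (LINT Y:{0<..}|lborel. \<epsilon> * C * exp (- 1 * Y))"
    proof -
      have "\<bar>LINT Y:{0<..}|lborel. (h Y - p (exp (- Y))) * h Y\<bar> \<le> (LINT Y:{0<..}|lborel. \<bar>(h Y - p (exp (- Y))) * h Y\<bar>)"
        using set_integral_norm_bound[OF i1] by simp
      also have "\<dots> \<le> (LINT Y:{0<..}|lborel. \<epsilon> * C * exp (- 1 * Y))"
      proof (rule set_integral_mono)
        show "set_integrable lborel {0<..} (\<lambda>Y. \<bar>(h Y - p (exp (- Y))) * h Y\<bar>)" using set_integrable_abs[OF i1] .
        show "set_integrable lborel {0<..} (\<lambda>Y. \<epsilon> * C * exp (- 1 * Y))" using laplace_exp(1)[of 1] by simp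
        show "\<bar>(h Y - p (exp (- Y))) * h Y\<bar> \<le> \<epsilon> * C * exp (- 1 * Y)" if "Y \<in> {0<..}" for Y
        proof -
          have "\<bar>h Y - p (exp (- Y))\<bar> * \<bar>h Y\<bar> \<le> \<epsilon> * (C * exp (- 1 * Y))"
            using that hb[of Y] pb[of Y] \<epsilon> by (intro mult_mono) auto
          then show ?thesis by (simp add: abs_mult mult.assoc)
        qed
      qed
      finally show ?thesis .
    qed
    also have "\<dots> = \<epsilon> * C" using laplace_exp(2)[of 1] by simp
    finally show ?thesis .
  qed
  note le = this
  have "?I = 0"
  proof (rule ccontr)
    assume "?I \<noteq> 0"
    then have "\<bar>?I\<bar> \<le> \<bar>?I\<bar> / (2 * (C + 1)) * C" using C0 by (intro le) auto
    also have "\<dots> < \<bar>?I\<bar>" using \<open>?I \<noteq> 0\<close> C0 by (simp add: field_simps add_nonneg_pos)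
    finally show False by simp
  qed
  then have "AE Y in lborel. indicator {0<..} Y *\<^sub>R (h Y * h Y) = 0"
    using hh unfolding set_lebesgue_integral_def set_integrable_def
    by (subst (asm) integral_nonneg_eq_0_iff_AE) (auto simp: indicator_def)
  then obtain N where N: "{Y. indicator {0<..} Y *\<^sub>R (h Y * h Y) \<noteq> 0} \<subseteq> N" "N \<in> null_sets lborel"
    by (auto elim!: AE_E simp: null_sets_def)
  show ?thesis
  proof (rule ccontr)
    assume "u Y \<noteq> 0"
    then have "h Y \<noteq> 0" by (simp add: h_def)
    then obtain d where d: "d > 0" "\<And>Z. Z \<in> {0..} \<Longrightarrow> dist Z Y < d \<Longrightarrow> dist (h Z) (h Y) < \<bar>h Y\<bar>"
      using hc Y unfolding continuous_on_iff by (metis atLeast_iff zero_less_abs_iff)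
    have "{Y<..<Y+d} \<subseteq> N"
    proof
      fix Z assume "Z \<in> {Y<..<Y+d}"
      moreover from this have "h Z \<noteq> 0" using d(2)[of Z] Y by (auto simp: dist_real_def)
      ultimately show "Z \<in> N" using N(1) Y by auto
    qed
    then have "emeasure lborel {Y<..<Y+d} \<le> emeasure lborel N" using N(2) by (intro emeasure_mono) auto
    then show False using N(2) d(1) by (simp add: null_sets_def)
  qed
qed

section \<open>Exponential asymptotics of Mittag-Leffler sums\<close>

lemma norm_powr_of_real: "z \<noteq> 0 \<Longrightarrow> norm (z powr complex_of_real c) = norm z powr c"
  by (simp add: powr_def norm_exp_eq_Re)

text \<open>
  The solutions \<open>z \<noteq> 1\<close> of \<open>z\<^sup>-\<^sup>q = 1\<close> lie on the unit circle and have an argument of absolute value at least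
  \<open>2\<pi>/q\<close>, so their real part is at most the cosine below. The bound \<open>1/4\<close> keeps \<open>z\<close> away from \<open>0\<close>.
\<close>

lemma powr_eq_one_halfplane:
  fixes q :: real
  assumes q: "0 < q"
  defines "k \<equiv> max (1/4) (cos (min pi (2 * pi / q)))"
  shows "k < 1" and "Re z > k \<Longrightarrow> z powr (- complex_of_real q) = 1 \<Longrightarrow> z = 1"
proof -
  let ?\<theta> = "min pi (2 * pi / q)"
  have \<theta>: "0 < ?\<theta>" "?\<theta> \<le> pi" using q by auto
  have "cos ?\<theta> < cos 0" using \<theta> by (intro cos_monotone_0_pi) auto
  then show "k < 1" by (simp add: k_def)
  assume z: "Re z > k" and 1: "z powr (- complex_of_real q) = 1"
  have z0: "z \<noteq> 0" using z by (auto simp: k_def)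
  have "exp (- complex_of_real q * Ln z) = 1" using 1 z0 by (simp add: powr_def)
  then obtain n where n: "Re (- complex_of_real q * Ln z) = 0" "Im (- complex_of_real q * Ln z) = of_int (2 * n) * pi"
    unfolding exp_eq_1 by blast
  have re: "Re (Ln z) = 0" using n(1) q by simp
  have im: "- q * Im (Ln z) = 2 * of_int n * pi" using n(2) by simp
  have zexp: "z = exp (Ln z)" using z0 by simp
  show "z = 1"
  proof (cases "n = 0")
    case True
    then have "Ln z = 0" using re im q by (simp add: complex_eq_iff)
    then show ?thesis using zexp by simp
  next
    case False
    have "\<bar>Im (Ln z)\<bar> = 2 * pi * \<bar>of_int n\<bar> / q"
    proof -
      have "q * \<bar>Im (Ln z)\<bar> = \<bar>- q * Im (Ln z)\<bar>" using q by (simp add: abs_mult)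
      also have "\<dots> = 2 * \<bar>of_int n\<bar> * pi" unfolding im by (simp add: abs_mult)
      finally show ?thesis using q by (simp add: field_simps)
    qed
    moreover have "1 \<le> \<bar>real_of_int n\<bar>" using False by linarith
    then have "2 * pi * 1 / q \<le> 2 * pi * \<bar>of_int n\<bar> / q" using q by (intro divide_right_mono mult_left_mono) auto
    ultimately have "?\<theta> \<le> \<bar>Im (Ln z)\<bar>" by simp
    moreover have "\<bar>Im (Ln z)\<bar> \<le> pi"
      using Im_Ln_le_pi[OF z0] mpi_less_Im_Ln[OF z0] by simp
    ultimately have "cos \<bar>Im (Ln z)\<bar> \<le> cos ?\<theta>" using \<theta> by (intro cos_monotone_0_pi_le) auto
    moreover have "Re z = cos (Im (Ln z))" by (subst zexp) (simp add: Re_exp re)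
    ultimately have "Re z \<le> k" by (simp add: k_def)
    then show ?thesis using z by simp
  qed
qed

text \<open>
  The transform \<open>z\<^sup>-\<^sup>s/(1 - z\<^sup>-\<^sup>q)\<close> of a Mittag-Leffler sum has a simple pole at \<open>1\<close> with residue \<open>1/q\<close>.
  Subtracting \<open>1/(q z\<^sup>2(z - 1))\<close>, the transform of \<open>(e\<^sup>Y - 1 - Y)/q\<close>, removes it and keeps cubic
  decay.
\<close>

lemma transform_remainder:
  fixes q s :: real
  assumes q: "0 < q" and s: "3 \<le> s"
  obtains k C :: real and R :: "complex \<Rightarrow> complex" where "1/2 \<le> k" "k < 1" "R holomorphic_on {z. Re z > k}" "continuous_on {z. Re z \<ge> k} R"
    "\<And>z. Re z \<ge> k \<Longrightarrow> norm (R z) \<le> C / norm z ^ 3" "0 \<le> C"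
    "\<And>x. 1 < x \<Longrightarrow> R (complex_of_real x) = complex_of_real (x powr (- s) / (1 - x powr (- q)) - 1 / (q * x\<^sup>2 * (x - 1)))"
proof -
  define k0 where "k0 = max (1/4) (cos (min pi (2 * pi / q)))"
  have k0: "k0 < 1" "1/4 \<le> k0" using powr_eq_one_halfplane(1)[OF q] by (simp_all add: k0_def)
  have only1: "z = 1" if "Re z > k0" "z powr (- complex_of_real q) = 1" for z
    using powr_eq_one_halfplane(2)[OF q] that by (simp add: k0_def)
  \<comment> \<open>to the right of \<open>k0\<close>, so that \<open>R\<close> is continuous up to the boundary of \<open>Re z \<ge> k\<close>\<close>
  define k where "k = (1 + k0) / 2"
  have k: "1/2 \<le> k" "k < 1" "k0 < k" using k0 by (simp_all add: k_def)
  let ?H = "{z. Re z > k0}"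
  have H: "open ?H" by (simp add: open_halfspace_Re_gt)
  have one: "1 \<in> ?H" using k0 by simp
  have nonneg: "z \<notin> \<real>\<^sub>\<le>\<^sub>0" "z \<noteq> 0" if "z \<in> ?H" for z
    using that k0 by (auto simp: complex_nonpos_Reals_iff)
  define F where "F z = 1 - z powr (- complex_of_real q)" for z :: complex
  have F: "F holomorphic_on ?H" unfolding F_def using nonneg by (intro holomorphic_intros) auto
  have F1: "F 1 = 0" by (simp add: F_def)
  have dF: "deriv F 1 = q"
  proof (rule DERIV_imp_deriv)
    show "(F has_field_derivative complex_of_real q) (at 1)"
      unfolding F_def by (auto intro!: derivative_eq_intros)
  qed
  define N where "N z = (if z = 1 then deriv F 1 else (F z - F 1) / (z - 1))" for z
  have N: "N holomorphic_on ?H" unfolding N_def using pole_lemma_open[OF F H, of 1] by simp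
  have N0: "N z \<noteq> 0" if "z \<in> ?H" for z
    using only1[of z] that q by (auto simp: N_def dF F1 F_def)
  define h where "h z = z powr (- complex_of_real s) / N z - 1 / (q * z\<^sup>2)" for z :: complex
  have h: "h holomorphic_on ?H" unfolding h_def using nonneg N N0 q by (intro holomorphic_intros) auto
  have h1: "h 1 = 0" by (simp add: h_def N_def dF)
  define R where "R z = (if z = 1 then deriv h 1 else (h z - h 1) / (z - 1))" for z
  have R: "R holomorphic_on ?H" unfolding R_def using pole_lemma_open[OF h H, of 1] by simp
  have Rz: "R z = z powr (- complex_of_real s) / F z - 1 / (q * z\<^sup>2 * (z - 1))" if "z \<in> ?H" "z \<noteq> 1" for z :: complex
    using that N0[OF that(1)] nonneg(2)[OF that(1)] q
    by (simp add: R_def h1 h_def N_def F1 dF diff_divide_distrib) (simp add: field_simps dF)?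
  have sub: "{z. Re z \<ge> k} \<subseteq> ?H" using k by auto
  have Rc: "continuous_on {z. Re z \<ge> k} R"
    using holomorphic_on_imp_continuous_on[OF R] sub by (rule continuous_on_subset)
  define \<rho> where "\<rho> = max 2 (2 powr (1 / q))"
  have \<rho>: "2 \<le> \<rho>" by (simp add: \<rho>_def)
  have far: "norm (R z) * norm z ^ 3 \<le> 2 + 2 / q" if z: "Re z \<ge> k" "norm z \<ge> \<rho>" for z
  proof -
    have zH: "z \<in> ?H" and z1: "z \<noteq> 1" and nz: "norm z \<ge> 2" and z0: "z \<noteq> 0" using sub z \<rho> by auto
    have "norm z powr (- q) \<le> (2 powr (1 / q)) powr (- q)"
      using z(2) q by (intro powr_mono2') (auto simp: \<rho>_def)
    also have "\<dots> = 1 / 2" using q by (simp add: powr_powr powr_minus)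
    finally have "norm (z powr (- complex_of_real q)) \<le> 1 / 2"
      using norm_powr_of_real[OF z0, of "- q"] by simp
    then have Fz: "norm (F z) \<ge> 1 / 2" unfolding F_def
      using norm_triangle_ineq2[of 1 "z powr (- complex_of_real q)"] by simp
    have "norm (z powr (- complex_of_real s)) \<le> norm z powr (- 3)"
      using norm_powr_of_real[OF z0, of "- s"] nz s by (simp add: powr_mono)
    also have "\<dots> = 1 / norm z ^ 3"
      using nz by (simp add: powr_minus powr_numeral inverse_eq_divide)
    finally have "norm (z powr (- complex_of_real s) / F z) \<le> (1 / norm z ^ 3) / (1 / 2)"
      unfolding norm_divide using Fz by (intro frac_le) auto
    moreover have "norm (1 / (q * z\<^sup>2 * (z - 1))) \<le> 2 / (q * norm z ^ 3)"
    proof -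
      have "norm z / 2 \<le> norm (z - 1)" using nz norm_triangle_ineq2[of z 1] by simp
      then have "q * norm z ^ 2 * (norm z / 2) \<le> q * norm z ^ 2 * norm (z - 1)" using q by (intro mult_left_mono) auto
      moreover have "0 < q * norm z ^ 2 * (norm z / 2)" using q z0 by simp
      ultimately have "1 / (q * norm z ^ 2 * norm (z - 1)) \<le> 1 / (q * norm z ^ 2 * (norm z / 2))"
        by (intro frac_le) auto
      then show ?thesis using q by (simp add: norm_divide norm_mult norm_power power2_eq_square power3_eq_cube mult_ac)
    qed
    ultimately have "norm (R z) \<le> 2 / norm z ^ 3 + 2 / (q * norm z ^ 3)"
      unfolding Rz[OF zH z1] by (intro order.trans[OF norm_triangle_ineq4] add_mono) auto
    then have "norm (R z) * norm z ^ 3 \<le> (2 / norm z ^ 3 + 2 / (q * norm z ^ 3)) * norm z ^ 3"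
      by (intro mult_right_mono) auto
    also have "\<dots> = 2 + 2 / q" using z0 q by (simp add: field_simps)
    finally show ?thesis .
  qed
  have "compact ({z. Re z \<ge> k} \<inter> cball 0 \<rho>)"
    by (intro closed_Int_compact closed_halfspace_Re_ge compact_cball)
  moreover have "continuous_on ({z. Re z \<ge> k} \<inter> cball 0 \<rho>) (\<lambda>z. R z * z ^ 3)"
    using continuous_on_subset[OF Rc, of "{z. Re z \<ge> k} \<inter> cball 0 \<rho>"] by (intro continuous_intros) auto
  ultimately have "bounded ((\<lambda>z. R z * z ^ 3) ` ({z. Re z \<ge> k} \<inter> cball 0 \<rho>))"
    by (intro compact_imp_bounded compact_continuous_image)
  then obtain C1 where C1: "\<And>z. Re z \<ge> k \<Longrightarrow> norm z \<le> \<rho> \<Longrightarrow> norm (R z) * norm z ^ 3 \<le> C1"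
  proof -
    obtain A where "\<forall>x\<in>{z. k \<le> Re z} \<inter> cball 0 \<rho>. norm (R x * x ^ 3) \<le> A"
      using \<open>bounded _\<close> unfolding bounded_iff by auto
    then show ?thesis by (intro that[of A]) (auto simp: norm_mult norm_power)
  qed
  define C where "C = max C1 (2 + 2 / q)"
  have decay: "norm (R z) \<le> C / norm z ^ 3" if z: "Re z \<ge> k" for z
  proof -
    have "norm (R z) * norm z ^ 3 \<le> C"
      using far[OF z] C1[OF z] by (cases "norm z \<le> \<rho>") (auto simp: C_def le_max_iff_disj)
    moreover have "norm z > 0" using z k by auto
    ultimately show ?thesis by (simp add: field_simps)
  qed
  have "R (complex_of_real x) = complex_of_real (x powr (- s) / (1 - x powr (- q)) - 1 / (q * x\<^sup>2 * (x - 1)))" if "1 < x" for x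
    using Rz[of "complex_of_real x"] that k0 by (simp add: F_def powr_of_real[symmetric])
  moreover have "R holomorphic_on {z. Re z > k}" using R by (rule holomorphic_on_subset) (use k in auto)
  moreover have "0 \<le> C" using q by (simp add: C_def le_max_iff_disj)
  ultimately show ?thesis using that k Rc decay by blast
qed

text \<open>
  Cauchy's formula for the half-plane \<open>Re z > k\<close>, pulled back to the unit disc by
  \<open>\<zeta> \<mapsto> k - 1 + 2/(1 - \<zeta>)\<close>. The decay of \<open>R\<close> makes the density \<open>\<Psi>\<close> bounded. Up to sign, the
  kernel \<open>1/(\<tau> - x)\<close> is the Laplace transform of \<open>e\<^bsup>\<tau>Y\<^esup>\<close>, which is of order \<open>e\<^bsup>kY\<^esup>\<close>.
\<close>

lemma halfplane_representation:
  fixes k C :: real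
  assumes k: "1/2 \<le> k" and C: "0 \<le> C" and R: "R holomorphic_on {z. Re z > k}" "continuous_on {z. Re z \<ge> k} R"
    and decay: "\<And>z. Re z \<ge> k \<Longrightarrow> norm (R z) \<le> C / norm z ^ 3"
  obtains \<Psi> \<tau> :: "real \<Rightarrow> complex" and C' where "0 \<le> C'" "\<And>t. norm (\<Psi> t) \<le> C'" "\<And>t. 0 < t \<Longrightarrow> t < 1 \<Longrightarrow> Re (\<tau> t) = k"
    "continuous_on {0<..<1} \<Psi>" "continuous_on {0<..<1} \<tau>"
    "\<And>x. k < x \<Longrightarrow> ((\<lambda>t. \<Psi> t / (\<tau> t - complex_of_real x)) has_integral R (complex_of_real x)) {0<..<1}"
proof -
  define w where "w \<zeta> = 2 / (1 - \<zeta>)" for \<zeta> :: complex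
  define m where "m \<zeta> = k - 1 + w \<zeta>" for \<zeta>
  have Rew: "Re (w \<zeta>) = 2 * (1 - Re \<zeta>) / (norm (1 - \<zeta>))\<^sup>2" for \<zeta>
    by (simp add: w_def Re_divide cmod_power2)
  have n1: "(norm (1 - \<zeta>))\<^sup>2 = 1 - 2 * Re \<zeta> + (norm \<zeta>)\<^sup>2" for \<zeta> :: complex
    unfolding cmod_power2 by (simp add: power2_eq_square algebra_simps)
  have Rew1: "Re (w \<zeta>) = 1" if "norm \<zeta> = 1" "\<zeta> \<noteq> 1" for \<zeta>
  proof -
    have "(norm (1 - \<zeta>))\<^sup>2 = 2 * (1 - Re \<zeta>)" using n1[of \<zeta>] that by simp
    moreover have "(norm (1 - \<zeta>))\<^sup>2 \<noteq> 0" using that by simp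
    ultimately show ?thesis unfolding Rew by simp
  qed
  have Rew2: "Re (w \<zeta>) > 1" if "norm \<zeta> < 1" for \<zeta>
  proof -
    have "(norm \<zeta>)\<^sup>2 < 1\<^sup>2" using that by (intro power_strict_mono) auto
    then have "(norm (1 - \<zeta>))\<^sup>2 < 2 * (1 - Re \<zeta>)" using n1[of \<zeta>] by simp
    moreover have "(norm (1 - \<zeta>))\<^sup>2 > 0" using that by auto
    ultimately show ?thesis unfolding Rew by (simp add: field_simps)
  qed
  have Rem: "Re (m \<zeta>) \<ge> k" if "norm \<zeta> \<le> 1" "\<zeta> \<noteq> 1" for \<zeta>
    using Rew1[of \<zeta>] Rew2[of \<zeta>] that by (cases "norm \<zeta> = 1") (auto simp: m_def)
  have wm: "norm (w \<zeta>) \<le> 3 * norm (m \<zeta>)" if "norm \<zeta> \<le> 1" "\<zeta> \<noteq> 1" for \<zeta>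
  proof -
    have a: "1 / 2 \<le> norm (m \<zeta>)" using Rem[OF that] k complex_Re_le_cmod[of "m \<zeta>"] by linarith
    have "w \<zeta> = m \<zeta> + (1 - k)" by (simp add: m_def)
    then have "norm (w \<zeta>) \<le> norm (m \<zeta>) + \<bar>1 - k\<bar>" by (metis norm_of_real norm_triangle_ineq of_real_1 of_real_diff)
    moreover have "\<bar>1 - k\<bar> \<le> 2 * norm (m \<zeta>)"
    proof (cases "k \<le> 1")
      case True then show ?thesis using a k by simp
    next
      case False then show ?thesis using Rem[OF that] complex_Re_le_cmod[of "m \<zeta>"] by simp
    qed
    ultimately show ?thesis by simp
  qed
  have Rm: "norm (R (m \<zeta>)) \<le> 27 * C / norm (w \<zeta>) ^ 3" if z: "norm \<zeta> \<le> 1" "\<zeta> \<noteq> 1" for \<zeta>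
  proof -
    have "norm (w \<zeta>) > 0" using z by (simp add: w_def)
    then have "norm (w \<zeta>) ^ 3 \<le> (3 * norm (m \<zeta>)) ^ 3" using wm[OF z] by (intro power_mono) auto
    then have "norm (w \<zeta>) ^ 3 / 27 \<le> norm (m \<zeta>) ^ 3" by (simp add: power_mult_distrib)
    moreover have "0 < norm (w \<zeta>) ^ 3 / 27" using \<open>norm (w \<zeta>) > 0\<close> by simp
    ultimately have "C / norm (m \<zeta>) ^ 3 \<le> C / (norm (w \<zeta>) ^ 3 / 27)"
      using C by (intro frac_le) auto
    also have "\<dots> = 27 * C / norm (w \<zeta>) ^ 3" by simp
    finally show ?thesis using decay[OF Rem[OF z]] by linarith
  qed
  \<comment> \<open>the factor \<open>w\<close> turns the Cauchy kernel of the disc into that of the half-plane\<close>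
  define G where "G \<zeta> = (if \<zeta> = 1 then 0 else w \<zeta> * R (m \<zeta>))" for \<zeta>
  have Gb: "norm (G \<zeta>) \<le> 27 * C * (norm (1 - \<zeta>))\<^sup>2" if "norm \<zeta> \<le> 1" for \<zeta>
  proof (cases "\<zeta> = 1")
    case False
    let ?w = "norm (w \<zeta>)"
    have w0: "?w > 0" using False by (simp add: w_def)
    have "norm (G \<zeta>) \<le> ?w * (27 * C / ?w ^ 3)"
      using mult_left_mono[OF Rm[OF that False], of ?w] False w0 by (simp add: G_def norm_mult)
    also have "\<dots> = 27 * C / ?w\<^sup>2" using w0 by (simp add: power2_eq_square power3_eq_cube)
    also have "?w\<^sup>2 = 4 / (norm (1 - \<zeta>))\<^sup>2" by (simp add: w_def norm_divide power_divide)
    also have "27 * C / (4 / (norm (1 - \<zeta>))\<^sup>2) \<le> 27 * C * (norm (1 - \<zeta>))\<^sup>2"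
      using C by (simp add: field_simps)
    finally show ?thesis .
  qed (use C in \<open>simp add: G_def\<close>)
  have wc: "continuous_on {\<zeta>. \<zeta> \<noteq> 1} w" unfolding w_def by (intro continuous_intros) auto
  have mc: "continuous_on {\<zeta>. \<zeta> \<noteq> 1} m" unfolding m_def by (intro continuous_intros wc)
  have Gc1: "continuous_on (cball 0 1 - {1}) G"
  proof -
    have "continuous_on (cball 0 1 - {1}) (\<lambda>\<zeta>. w \<zeta> * R (m \<zeta>))"
      by (intro continuous_intros continuous_on_compose2[OF R(2)] continuous_on_subset[OF wc] continuous_on_subset[OF mc])
        (use Rem in auto)
    then show ?thesis by (rule continuous_on_eq) (auto simp: G_def)
  qed
  have Gc: "continuous_on (cball 0 1) G"
    unfolding continuous_on_eq_continuous_within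
  proof
    fix \<zeta> :: complex assume z: "\<zeta> \<in> cball 0 1"
    show "continuous (at \<zeta> within cball 0 1) G"
    proof (cases "\<zeta> = 1")
      case True
      have "(G \<longlongrightarrow> 0) (at 1 within cball 0 1)"
      proof (rule Lim_null_comparison)
        show "eventually (\<lambda>\<zeta>. norm (G \<zeta>) \<le> 27 * C * (norm (1 - \<zeta>))\<^sup>2) (at 1 within cball 0 1)"
          using Gb by (auto simp: eventually_at_filter)
        have "((\<lambda>\<zeta>::complex. 27 * C * (norm (1 - \<zeta>))\<^sup>2) \<longlongrightarrow> 27 * C * (norm (1 - 1 :: complex))\<^sup>2) (at 1 within cball 0 1)"
          by (intro tendsto_mult tendsto_const tendsto_power tendsto_norm tendsto_diff tendsto_ident_at)
        then show "((\<lambda>\<zeta>::complex. 27 * C * (norm (1 - \<zeta>))\<^sup>2) \<longlongrightarrow> 0) (at 1 within cball 0 1)" by simp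
      qed
      then show ?thesis using True by (simp add: continuous_within G_def)
    next
      case False
      have "continuous (at \<zeta> within cball 0 1 - {1}) G"
        using Gc1 z False by (auto simp: continuous_on_eq_continuous_within)
      moreover have "at \<zeta> within cball 0 1 = at \<zeta> within (cball 0 1 - {1})"
        using False by (intro at_within_nhd[of _ "- {1}"]) auto
      ultimately show ?thesis by (simp add: continuous_within)
    qed
  qed
  have Gh: "G holomorphic_on ball 0 1"
  proof -
    have mh: "m holomorphic_on ball 0 1" unfolding m_def w_def by (intro holomorphic_intros) auto
    have "w holomorphic_on ball 0 1" unfolding w_def by (intro holomorphic_intros) auto
    moreover have "(R \<circ> m) holomorphic_on ball 0 1"
      using Rew2 by (intro holomorphic_on_compose_gen[OF mh R(1)]) (auto simp: m_def)
    ultimately have "(\<lambda>\<zeta>. w \<zeta> * (R \<circ> m) \<zeta>) holomorphic_on ball 0 1" by (intro holomorphic_intros)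
    then show ?thesis by (rule holomorphic_transform) (auto simp: G_def)
  qed
  define c where "c t = exp (2 * complex_of_real pi * \<i> * complex_of_real t)" for t
  have cn: "norm (c t) = 1" for t by (simp add: c_def norm_exp_eq_Re)
  have c1: "c t \<noteq> 1" if t: "0 < t" "t < 1" for t
  proof
    assume "c t = 1"
    then obtain n :: int where "2 * pi * t = of_int (2 * n) * pi" unfolding c_def exp_eq_1 by auto
    then have "t = of_int n" by simp
    then show False using t by (metis of_int_0_less_iff of_int_less_1_iff int_one_le_iff_zero_less not_less)
  qed
  define \<Psi> where "\<Psi> t = w (c t) * G (c t) / 2 * c t" for t
  have "norm (\<Psi> t) \<le> 27 * C * 2" for t
  proof (cases "c t = 1")
    case False
    have nz: "norm (1 - c t) > 0" "norm (1 - c t) \<le> 2" using False norm_triangle_ineq4[of 1 "c t"] cn[of t] by auto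
    have "\<Psi> t = 1 / (1 - c t) * G (c t) * c t" using False by (simp add: \<Psi>_def w_def field_simps)
    then have "norm (\<Psi> t) = norm (G (c t)) / norm (1 - c t)"
      by (simp add: norm_mult norm_divide cn)
    also have "\<dots> \<le> 27 * C * (norm (1 - c t))\<^sup>2 / norm (1 - c t)"
      using Gb[of "c t"] cn[of t] by (intro divide_right_mono) auto
    also have "\<dots> = 27 * C * norm (1 - c t)" using nz by (simp add: power2_eq_square)
    also have "\<dots> \<le> 27 * C * 2" using nz C by (intro mult_left_mono) auto
    finally show ?thesis .
  qed (use C in \<open>simp add: \<Psi>_def G_def\<close>)
  moreover have "Re (m (c t)) = k" if "0 < t" "t < 1" for t
    using Rew1[OF cn c1[OF that]] by (simp add: m_def)
  moreover have cc: "continuous_on {0<..<1} c" unfolding c_def by (intro continuous_intros)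
  have "continuous_on {0<..<1} \<Psi>" unfolding \<Psi>_def
    by (intro continuous_intros continuous_on_compose2[OF wc cc] continuous_on_compose2[OF Gc cc] cc) (use c1 cn in auto)
  moreover have "continuous_on {0<..<1} (\<lambda>t. m (c t))"
    by (intro continuous_on_compose2[OF mc cc]) (use c1 in auto)
  moreover have "((\<lambda>t. \<Psi> t / (m (c t) - complex_of_real x)) has_integral R (complex_of_real x)) {0<..<1}"
    if x: "k < x" for x
  proof -
    define \<xi> where "\<xi> = (x - k - 1) / (x - k + 1)"
    have \<xi>: "\<bar>\<xi>\<bar> < 1" using x by (simp add: \<xi>_def abs_less_iff field_simps)
    have xk: "x - k + 1 \<noteq> 0" using x by simp
    have w\<xi>: "w (complex_of_real \<xi>) = complex_of_real (x - k + 1)"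
    proof -
      have "1 - \<xi> = 2 / (x - k + 1)" using xk by (simp add: \<xi>_def field_simps)
      then have "2 / (1 - \<xi>) = x - k + 1" using xk by simp
      then show ?thesis by (metis w_def of_real_1 of_real_diff of_real_divide of_real_numeral)
    qed
    have m\<xi>: "m (complex_of_real \<xi>) = complex_of_real x" unfolding m_def w\<xi> by simp
    have "((\<lambda>u. G u / (u - complex_of_real \<xi>)) has_contour_integral 2 * complex_of_real pi * \<i> * G (complex_of_real \<xi>)) (circlepath 0 1)"
      by (rule Cauchy_integral_circlepath[OF Gc Gh]) (use \<xi> in simp)
    then have "((\<lambda>t. G (circlepath 0 1 t) / (circlepath 0 1 t - complex_of_real \<xi>) * vector_derivative (circlepath 0 1) (at t within {0..1}))
        has_integral 2 * complex_of_real pi * \<i> * G (complex_of_real \<xi>)) {0..1}"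
      by (simp add: has_contour_integral_def)
    then have "((\<lambda>t. G (c t) / (c t - complex_of_real \<xi>) * (2 * complex_of_real pi * \<i> * c t))
        has_integral 2 * complex_of_real pi * \<i> * G (complex_of_real \<xi>)) {0..1}"
    proof (rule has_integral_eq[rotated])
      fix t :: real assume "t \<in> {0..1}"
      then have vd: "vector_derivative (circlepath 0 1) (at t within {0..1}) = 2 * complex_of_real pi * \<i> * c t"
        using vector_derivative_circlepath01[of t 0 1] by (simp add: c_def mult_ac)
      show "G (circlepath 0 1 t) / (circlepath 0 1 t - complex_of_real \<xi>) * vector_derivative (circlepath 0 1) (at t within {0..1})
        = G (c t) / (c t - complex_of_real \<xi>) * (2 * complex_of_real pi * \<i> * c t)"
        unfolding vd by (simp add: circlepath c_def)
    qed
    from has_integral_mult_right[OF this, of "1 / (2 * complex_of_real pi * \<i>) / X" for X]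
    have scaled: "((\<lambda>t. G (c t) / (c t - complex_of_real \<xi>) * c t / X) has_integral G (complex_of_real \<xi>) / X) {0..1}" for X
      by (simp add: mult_ac)
    have "((\<lambda>t. G (c t) / (c t - complex_of_real \<xi>) * c t / (x - k + 1)) has_integral G (complex_of_real \<xi>) / (x - k + 1)) {0..1}"
      by (rule scaled)
    moreover have "G (complex_of_real \<xi>) / (x - k + 1) = R (complex_of_real x)"
    proof -
      have "complex_of_real \<xi> \<noteq> 1" using \<xi> by auto
      moreover have "complex_of_real x - k + 1 \<noteq> 0" using xk by (metis of_real_1 of_real_add of_real_diff of_real_eq_0_iff)
      ultimately show ?thesis by (simp add: G_def m\<xi> w\<xi>)
    qed
    moreover have "G (c t) / (c t - complex_of_real \<xi>) * c t / (x - k + 1) = \<Psi> t / (m (c t) - complex_of_real x)"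
      if t: "t \<in> {0<..<1}" for t
    proof -
      have ct: "c t \<noteq> 1" using c1 t by auto
      have X: "complex_of_real x - k + 1 \<noteq> 0" using xk by (metis of_real_1 of_real_add of_real_diff of_real_eq_0_iff)
      have "Re (m (c t)) = k" using Rew1[OF cn ct] by (simp add: m_def)
      then have mx: "m (c t) - complex_of_real x \<noteq> 0" using x by auto
      have "(c t - complex_of_real \<xi>) * (complex_of_real x - k + 1) * w (c t) = 2 * (m (c t) - complex_of_real x)"
      proof -
        have e: "complex_of_real \<xi> * (complex_of_real x - k + 1) = complex_of_real x - k - 1"
          using X by (simp add: \<xi>_def)
        have "(c t - complex_of_real \<xi>) * (complex_of_real x - k + 1) = c t * (complex_of_real x - k + 1) - (complex_of_real x - k - 1)"
          by (simp only: left_diff_distrib e)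
        also have "\<dots> * w (c t) = 2 * (m (c t) - complex_of_real x)"
          using ct unfolding m_def w_def by (simp add: field_simps)
        finally show ?thesis .
      qed
      moreover have "w (c t) \<noteq> 0" using ct by (simp add: w_def)
      ultimately have "(c t - complex_of_real \<xi>) * (complex_of_real x - k + 1) = 2 * (m (c t) - complex_of_real x) / w (c t)"
        by (simp add: field_simps)
      moreover have "G (c t) / (c t - complex_of_real \<xi>) * c t / (complex_of_real x - k + 1)
          = G (c t) * c t / ((c t - complex_of_real \<xi>) * (complex_of_real x - k + 1))" by simp
      ultimately show ?thesis using mx \<open>w (c t) \<noteq> 0\<close> by (simp add: \<Psi>_def mult_ac)
    qed
    ultimately have "((\<lambda>t. G (c t) / (c t - complex_of_real \<xi>) * c t / (x - k + 1)) has_integral R (complex_of_real x)) {0<..<1}"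
      using has_integral_Icc_iff_Ioo by metis
    then show ?thesis
      by (rule has_integral_eq[rotated]) (rule \<open>\<And>t. t \<in> {0<..<1} \<Longrightarrow> _ = _\<close>)
  qed
  ultimately show ?thesis using that[of "27 * C * 2" \<Psi> "\<lambda>t. m (c t)"] C by simp
qed

text \<open>Euler's integral restricted to \<open>t \<ge> A\<close>.\<close>

lemma Gamma_lower_bound:
  fixes s A :: real
  assumes s: "1 \<le> s" and A: "0 < A"
  shows "A powr (s - 1) * exp (- A) \<le> Gamma s"
proof -
  have "(\<integral>\<^sup>+ t. ennreal (A powr (s - 1) * exp (- t)) * indicator {A..} t \<partial>lborel) = ennreal (0 - (- (A powr (s - 1)) * exp (- A)))"
  proof (rule nn_integral_FTC_atLeast[where F="\<lambda>t. - (A powr (s - 1)) * exp (- t)"])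
    show "((\<lambda>t. - (A powr (s - 1)) * exp (- t)) \<longlongrightarrow> 0) at_top" by real_asymp
  qed (auto intro!: derivative_eq_intros)
  then have "ennreal (A powr (s - 1) * exp (- A)) = (\<integral>\<^sup>+ t. ennreal (A powr (s - 1) * exp (- t)) * indicator {A..} t \<partial>lborel)"
    by simp
  also have "\<dots> \<le> (\<integral>\<^sup>+ t\<in>{0<..}. ennreal (t powr (s - 1) * exp (- 1 * t)) \<partial>lborel)"
    using A s by (intro nn_integral_mono) (auto simp: indicator_def intro!: ennreal_leI powr_mono2)
  also have "\<dots> = ennreal (Gamma s)"
    using nn_integral_powr_exp_linear[of 1 s] s by simp
  finally show ?thesis using Gamma_real_pos[of s] s by (simp add: ennreal_le_iff)
qed

context
  fixes q s :: real
  assumes q: "0 < q" and s: "3 \<le> s"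
begin

text \<open>The lower bound for \<open>Gamma\<close> at \<open>A = 2Y\<close> gives geometric decay at the price of the growth \<open>e\<^bsup>2Y\<^esup>\<close>.\<close>

lemma mittag_leffler_term_le:
  assumes "0 \<le> Y"
  shows "Y powr (q * real m + s - 1) / Gamma (q * real m + s) \<le> exp (2 * Y) * (2 powr (- q)) ^ m"
proof (cases "Y = 0")
  case False
  then have Y: "0 < Y" using assms by simp
  let ?s = "q * real m + s"
  have s1: "1 \<le> ?s" using q s by (simp add: add_nonneg_pos le_add_same_cancel2 add_increasing)
  have G: "(2 * Y) powr (?s - 1) * exp (- (2 * Y)) \<le> Gamma ?s"
    using Gamma_lower_bound[OF s1, of "2 * Y"] Y by simp
  have "Y powr (?s - 1) / Gamma ?s \<le> Y powr (?s - 1) / ((2 * Y) powr (?s - 1) * exp (- (2 * Y)))"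
    using Y G by (intro divide_left_mono mult_pos_pos) (auto intro: less_le_trans[OF _ G])
  also have "\<dots> = exp (2 * Y) / 2 powr (?s - 1)"
    using Y by (simp add: powr_mult exp_minus field_simps)
  also have "\<dots> = exp (2 * Y) * (2 powr (- (?s - 1)))"
    by (simp only: powr_minus divide_inverse)
  also have "\<dots> \<le> exp (2 * Y) * 2 powr (- q * real m)"
    using s by (intro mult_left_mono powr_mono) auto
  also have "2 powr (- q * real m) = (2 powr (- q)) ^ m"
    by (simp add: powr_realpow[symmetric] powr_powr)
  finally show ?thesis by (simp add: algebra_simps)
qed (use q s in simp)

lemma mittag_leffler_ratio: "norm (2 powr (- q)) < 1"
  using q powr_less_mono[of "- q" 0 2] by simp

lemma mittag_leffler_term_nonneg:
  "0 \<le> Y powr (q * real m + s - 1) / Gamma (q * real m + s)"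
  using q s by (intro divide_nonneg_pos Gamma_real_pos) (auto intro: add_nonneg_pos)

lemma mittag_leffler_summable:
  assumes "0 \<le> Y"
  shows "summable (\<lambda>m. Y powr (q * real m + s - 1) / Gamma (q * real m + s))"
proof (rule summable_comparison_test')
  show "summable (\<lambda>m. exp (2 * Y) * (2 powr (- q)) ^ m)"
    by (intro summable_mult summable_geometric mittag_leffler_ratio)
  show "norm (Y powr (q * real m + s - 1) / Gamma (q * real m + s)) \<le> exp (2 * Y) * (2 powr (- q)) ^ m" for m
    using mittag_leffler_term_le[OF assms, of m] mittag_leffler_term_nonneg[of Y m] by simp
qed

definition "mittag_leffler Y = (\<Sum>m. Y powr (q * real m + s - 1) / Gamma (q * real m + s))"

lemma mittag_leffler_nonneg: "0 \<le> Y \<Longrightarrow> 0 \<le> mittag_leffler Y"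
  unfolding mittag_leffler_def by (intro suminf_nonneg mittag_leffler_summable mittag_leffler_term_nonneg)

lemma mittag_leffler_le: 
  assumes "0 \<le> Y"
  shows "mittag_leffler Y \<le> 1 / (1 - 2 powr (- q)) * exp (2 * Y)"
proof -
  have "mittag_leffler Y \<le> (\<Sum>m. exp (2 * Y) * (2 powr (- q)) ^ m)"
    unfolding mittag_leffler_def
    by (intro suminf_le mittag_leffler_term_le mittag_leffler_summable assms summable_mult summable_geometric mittag_leffler_ratio)
  also have "\<dots> = exp (2 * Y) * (1 / (1 - 2 powr (- q)))"
    using mittag_leffler_ratio by (simp add: suminf_mult summable_geometric suminf_geometric)
  finally show ?thesis by (simp add: mult.commute)
qed

lemma mittag_leffler_continuous: "continuous_on {0..} mittag_leffler"
proof -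
  have B: "continuous_on {0..B} mittag_leffler" for B
  proof -
    have "uniform_limit {0..B} (\<lambda>n Y. \<Sum>m<n. Y powr (q * real m + s - 1) / Gamma (q * real m + s)) mittag_leffler sequentially"
      unfolding mittag_leffler_def[abs_def]
    proof (rule Weierstrass_m_test)
      show "summable (\<lambda>m. exp (2 * B) * (2 powr (- q)) ^ m)"
        by (intro summable_mult summable_geometric mittag_leffler_ratio)
      fix m Y assume "Y \<in> {0..B}"
      then have b: "exp (2 * Y) * (2 powr (- q)) ^ m \<le> exp (2 * B) * (2 powr (- q)) ^ m"
        by (intro mult_right_mono) auto
      then show "norm (Y powr (q * real m + s - 1) / Gamma (q * real m + s)) \<le> exp (2 * B) * (2 powr (- q)) ^ m"
        unfolding real_norm_def abs_of_nonneg[OF mittag_leffler_term_nonneg]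
        using order.trans[OF mittag_leffler_term_le b] \<open>Y \<in> {0..B}\<close> by simp
    qed
    moreover have "continuous_on {0..B} (\<lambda>Y. \<Sum>m<n. Y powr (q * real m + s - 1) / Gamma (q * real m + s))" for n
    proof (intro continuous_on_sum continuous_on_divide continuous_on_const continuous_on_powr' continuous_on_id)
      fix m
      have "0 < Gamma (q * real m + s)" using q s by (intro Gamma_real_pos add_nonneg_pos) auto
      then show "\<forall>x\<in>{0..B}. Gamma (q * real m + s) \<noteq> 0" by simp
      have "0 < q * real m + (s - 1)" using q s by (intro add_nonneg_pos) auto
      then show "\<forall>x\<in>{0..B}. 0 \<le> x \<and> (x = 0 \<longrightarrow> 0 < q * real m + s - 1)" by (auto simp: algebra_simps)
    qed
    ultimately show ?thesis by (intro uniform_limit_theorem[where F=sequentially]) auto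
  qed
  show ?thesis
    unfolding continuous_on_eq_continuous_within
  proof
    fix Y :: real assume Y: "Y \<in> {0..}"
    have "continuous (at Y within {0..Y + 1}) mittag_leffler"
      using B[of "Y + 1"] Y by (auto simp: continuous_on_eq_continuous_within)
    moreover have "at Y within {0..Y + 1} = at Y within {0..}"
      by (rule at_within_nhd[of _ "{..<Y + 1}"]) auto
    ultimately show "continuous (at Y within {0..}) mittag_leffler" by (simp add: continuous_within)
  qed
qed

text \<open>Termwise transformation produces a geometric series in \<open>x\<^sup>-\<^sup>q\<close>.\<close>

lemma mittag_leffler_laplace:
  assumes x: "1 < x"
  shows "set_integrable lborel {0<..} (\<lambda>Y. exp (- x * Y) * mittag_leffler Y)"
    and "(LINT Y:{0<..}|lborel. exp (- x * Y) * mittag_leffler Y) = x powr (- s) / (1 - x powr (- q))"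
proof -
  define f where "f m Y = indicator {0<..} Y *\<^sub>R (exp (- x * Y) * (Y powr (q * real m + s - 1) / Gamma (q * real m + s)))" for m Y
  have pos: "0 < q * real m + s" for m using q s by (intro add_nonneg_pos) auto
  have G0: "Gamma (q * real m + s) \<noteq> 0" for m using Gamma_real_pos[OF pos[of m]] by simp
  have f_eq: "f m = (\<lambda>Y. (1 / Gamma (q * real m + s)) *\<^sub>R (indicator {0<..} Y *\<^sub>R (Y powr (q * real m + s - 1) * exp (- x * Y))))" for m
    by (auto simp: f_def fun_eq_iff)
  have f: "integrable lborel (f m)" for m
    unfolding f_eq using laplace_powr(1)[of x, OF _ pos[of m]] x
    by (intro integrable_scaleR_right) (simp add: set_integrable_def)
  have fi: "(LINT Y|lborel. f m Y) = x powr (- s) * (x powr (- q)) ^ m" for m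
  proof -
    have "(LINT Y|lborel. f m Y) = (1 / Gamma (q * real m + s)) * (x powr (- (q * real m + s)) * Gamma (q * real m + s))"
      unfolding f_eq integral_scaleR_right using laplace_powr(2)[of x, OF _ pos[of m]] x
      by (simp add: set_lebesgue_integral_def)
    also have "\<dots> = x powr (- s) * (x powr (- q)) ^ m"
      using G0[of m] x by (simp add: powr_realpow[symmetric] powr_powr powr_add[symmetric] algebra_simps)
    finally show ?thesis .
  qed
  have nonneg: "0 \<le> f m Y" for m Y
    unfolding f_def by (intro scaleR_nonneg_nonneg mult_nonneg_nonneg mittag_leffler_term_nonneg) auto
  have ratio: "norm (x powr (- q)) < 1" using q x powr_less_mono[of "- q" 0 x] by simp
  have sm: "AE Y in lborel. summable (\<lambda>m. norm (f m Y))"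
  proof (rule AE_I2)
    fix Y :: real
    show "summable (\<lambda>m. norm (f m Y))"
      unfolding real_norm_def abs_of_nonneg[OF nonneg] unfolding f_def
      using mittag_leffler_summable[of Y] by (cases "Y > 0") (auto simp del: times_divide_eq_right intro!: summable_mult)
  qed
  have si: "summable (\<lambda>m. LINT Y|lborel. norm (f m Y))"
    using nonneg ratio by (simp add: fi abs_of_nonneg summable_geometric summable_mult)
  have eq: "(\<Sum>m. f m Y) = indicator {0<..} Y *\<^sub>R (exp (- x * Y) * mittag_leffler Y)" for Y
    using mittag_leffler_summable[of Y] by (cases "Y > 0") (auto simp: f_def mittag_leffler_def suminf_mult simp del: times_divide_eq_right)
  show "set_integrable lborel {0<..} (\<lambda>Y. exp (- x * Y) * mittag_leffler Y)"
    using integrable_suminf[OF f sm si] by (simp add: eq set_integrable_def)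
  have "(LINT Y:{0<..}|lborel. exp (- x * Y) * mittag_leffler Y) = (\<Sum>m. LINT Y|lborel. f m Y)"
    using integral_suminf[OF f sm si] by (simp add: eq set_lebesgue_integral_def)
  also have "\<dots> = x powr (- s) * (1 / (1 - x powr (- q)))"
    using ratio by (simp add: fi suminf_mult summable_geometric suminf_geometric)
  finally show "(LINT Y:{0<..}|lborel. exp (- x * Y) * mittag_leffler Y) = x powr (- s) / (1 - x powr (- q))"
    by simp
qed

end

lemma laplace_exp_minus_linear:
  assumes x: "1 < (x::real)"
  shows "set_integrable lborel {0<..} (\<lambda>Y. exp (- x * Y) * (exp Y - 1 - Y))"
    and "(LINT Y:{0<..}|lborel. exp (- x * Y) * (exp Y - 1 - Y)) = 1 / (x\<^sup>2 * (x - 1))"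
proof -
  have i2: "set_integrable lborel {0<..} (\<lambda>Y. Y powr (2 - 1) * exp (- x * Y))"
    and e2: "(LINT Y:{0<..}|lborel. Y powr (2 - 1) * exp (- x * Y)) = x powr (- 2) * Gamma 2"
    using laplace_powr[of x 2] x by auto
  note i = laplace_exp(1)[of "x - 1"] laplace_exp(1)[of x] i2
  have eq: "exp (- x * Y) * (exp Y - 1 - Y) = exp (- (x - 1) * Y) - exp (- x * Y) - Y powr (2 - 1) * exp (- x * Y)"
    if "Y \<in> {0<..}" for Y
    using that by (simp add: algebra_simps exp_add[symmetric])
  have "set_integrable lborel {0<..} (\<lambda>Y. exp (- (x - 1) * Y) - exp (- x * Y) - Y powr (2 - 1) * exp (- x * Y))"
    by (intro set_integral_diff i) (use x in auto)
  moreover have "set_integrable lborel {0<..} (\<lambda>Y. exp (- x * Y) * (exp Y - 1 - Y))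
      \<longleftrightarrow> set_integrable lborel {0<..} (\<lambda>Y. exp (- (x - 1) * Y) - exp (- x * Y) - Y powr (2 - 1) * exp (- x * Y))"
    by (intro set_integrable_cong refl eq)
  ultimately show "set_integrable lborel {0<..} (\<lambda>Y. exp (- x * Y) * (exp Y - 1 - Y))" by blast
  have "(LINT Y:{0<..}|lborel. exp (- x * Y) * (exp Y - 1 - Y))
     = (LINT Y:{0<..}|lborel. exp (- (x - 1) * Y) - exp (- x * Y) - Y powr (2 - 1) * exp (- x * Y))"
    by (intro set_lebesgue_integral_cong eq allI impI) auto
  also have "\<dots> = (LINT Y:{0<..}|lborel. exp (- (x - 1) * Y)) - (LINT Y:{0<..}|lborel. exp (- x * Y))
      - (LINT Y:{0<..}|lborel. Y powr (2 - 1) * exp (- x * Y))"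
    by (subst set_integral_diff(2), (intro set_integral_diff i; use x in auto), rule i2)
      (subst set_integral_diff(2), use i x in auto)
  also have "\<dots> = 1 / (x - 1) - 1 / x - 1 / x\<^sup>2"
    unfolding e2 using laplace_exp(2)[of "x - 1"] laplace_exp(2)[of x] x
    by (simp add: powr_minus powr_numeral inverse_eq_divide Gamma_numeral)
  also have "\<dots> = 1 / (x\<^sup>2 * (x - 1))" using x by (simp add: field_simps power2_eq_square)
  finally show "(LINT Y:{0<..}|lborel. exp (- x * Y) * (exp Y - 1 - Y)) = 1 / (x\<^sup>2 * (x - 1))" .
qed

text \<open>
  By Fubini the Laplace transform may be taken under the integral sign, where \<open>e\<^bsup>\<tau>Y\<^esup>\<close> has the transform
  \<open>1/(x - \<tau>)\<close>.
\<close>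

lemma exponential_superposition:
  fixes \<psi> \<tau> :: "real \<Rightarrow> complex"
  assumes [measurable]: "\<psi> \<in> borel_measurable borel" "\<tau> \<in> borel_measurable borel"
    and bd: "\<And>t. norm (\<psi> t) \<le> C * indicator {0<..<1} t" and re': "\<forall>t\<in>{0<..<1}. Re (\<tau> t) = k"
  defines "H \<equiv> \<lambda>Y. LINT t|lborel. \<psi> t * exp (\<tau> t * complex_of_real Y)"
  shows "continuous_on UNIV H" and "norm (H Y) \<le> C * exp (k * Y)"
    and "k < x \<Longrightarrow> set_integrable lborel {0<..} (\<lambda>Y. complex_of_real (exp (- x * Y)) * H Y)"
    and "k < x \<Longrightarrow> (LINT Y:{0<..}|lborel. complex_of_real (exp (- x * Y)) * H Y) = (LINT t|lborel. \<psi> t / (complex_of_real x - \<tau> t))"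
proof -
  have re: "Re (\<tau> t) = k" if "0 < t" "t < 1" for t using re' that by auto
  have n: "norm (\<psi> t * exp (\<tau> t * complex_of_real Y)) \<le> C * exp (k * Y) * indicator {0<..<1} t" for t Y
  proof (cases "t \<in> {0<..<1}")
    case True
    then have "norm (\<psi> t * exp (\<tau> t * complex_of_real Y)) = norm (\<psi> t) * exp (k * Y)"
      using re[of t] by (simp add: norm_mult norm_exp_eq_Re)
    then show ?thesis using bd[of t] True by simp
  qed (use bd[of t] in simp)
  have ind: "integrable lborel (indicator {0<..<1::real} :: real \<Rightarrow> real)" by simp
  have indi: "(LINT t|lborel. indicator {0<..<1::real} t) = (1::real)" by simp
  have int: "integrable lborel (\<lambda>t. \<psi> t * exp (\<tau> t * complex_of_real Y))" for Y
    by (rule Bochner_Integration.integrable_bound[OF integrable_mult_right[OF ind, of "C * exp (k * Y)"]])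
      (use n in \<open>auto intro!: AE_I2 order.trans[OF n]\<close>)
  have C: "0 \<le> C" using bd[of "1/2"] order.trans[OF norm_ge_zero] by fastforce
  show "continuous_on UNIV H"
  proof (rule continuous_on_sequentiallyI)
    fix u :: "nat \<Rightarrow> real" and a assume u: "u \<longlonglongrightarrow> a"
    then have "Bseq u" by (intro convergent_imp_Bseq) (auto simp: convergent_def)
    then obtain B where B: "\<And>n. \<bar>u n\<bar> \<le> B" unfolding Bseq_def by auto
    show "(\<lambda>n. H (u n)) \<longlonglongrightarrow> H a"
      unfolding H_def
    proof (rule integral_dominated_convergence[where w="\<lambda>t::real. C * exp (\<bar>k\<bar> * B) * indicator {0<..<1} t"])
      show "AE t in lborel. (\<lambda>i. \<psi> t * exp (\<tau> t * complex_of_real (u i))) \<longlonglongrightarrow> \<psi> t * exp (\<tau> t * complex_of_real a)"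
        by (intro AE_I2 tendsto_intros u)
      have "k * u i \<le> \<bar>k\<bar> * B" for i
      proof -
        have "k * u i \<le> \<bar>k\<bar> * \<bar>u i\<bar>" by (simp add: abs_mult[symmetric])
        also have "\<dots> \<le> \<bar>k\<bar> * B" using B by (intro mult_left_mono) auto
        finally show ?thesis .
      qed
      then have "C * exp (k * u i) * indicator {0<..<1} t \<le> C * exp (\<bar>k\<bar> * B) * indicator {0<..<1} t" for i and t :: real
        using C by (intro mult_right_mono mult_left_mono) auto
      then show "AE t in lborel. norm (\<psi> t * exp (\<tau> t * complex_of_real (u i))) \<le> C * exp (\<bar>k\<bar> * B) * indicator {0<..<1} t" for i
        using n order.trans by (intro AE_I2) blast
      show "integrable lborel (\<lambda>t::real. C * exp (\<bar>k\<bar> * B) * indicator {0<..<1} t)"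
        by (intro integrable_mult_right ind)
    qed measurable
  qed
  have Hb: "norm (H Y) \<le> C * exp (k * Y)" for Y
  proof -
    have "norm (H Y) \<le> (LINT t|lborel. norm (\<psi> t * exp (\<tau> t * complex_of_real Y)))"
      unfolding H_def by (rule integral_norm_bound)
    also have "\<dots> \<le> (LINT t::real|lborel. C * exp (k * Y) * indicator {0<..<1} t)"
      by (intro integral_mono integrable_norm int integrable_mult_right ind n)
    also have "\<dots> = C * exp (k * Y)" by simp
    finally show ?thesis .
  qed
  then show "norm (H Y) \<le> C * exp (k * Y)" .
  assume x: "k < x"
  have Hm [measurable]: "H \<in> borel_measurable borel"
    using \<open>continuous_on UNIV H\<close> by (rule borel_measurable_continuous_onI)
  show "set_integrable lborel {0<..} (\<lambda>Y. complex_of_real (exp (- x * Y)) * H Y)"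
  proof (rule set_integrable_bound)
    show "set_integrable lborel {0<..} (\<lambda>Y. C * exp (- (x - k) * Y))"
      using laplace_exp(1)[of "x - k"] x by (intro set_integrable_mult_right) auto
    show "set_borel_measurable lborel {0<..} (\<lambda>Y. complex_of_real (exp (- x * Y)) * H Y)"
      unfolding set_borel_measurable_def by measurable
    have "norm (complex_of_real (exp (- x * Y)) * H Y) \<le> exp (- x * Y) * (C * exp (k * Y))" for Y
      using Hb[of Y] by (simp add: norm_mult)
    also have "exp (- x * Y) * (C * exp (k * Y)) = C * exp (- (x - k) * Y)" for Y
      by (simp add: algebra_simps exp_add[symmetric])
    finally show "AE Y\<in>{0<..} in lborel. norm (complex_of_real (exp (- x * Y)) * H Y) \<le> norm (C * exp (- (x - k) * Y))"
      using C by simp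
  qed
  define f where "f t Y = indicator {0<..} Y *\<^sub>R (\<psi> t * exp (- (complex_of_real x - \<tau> t) * complex_of_real Y))" for t Y
  have fm: "case_prod f \<in> borel_measurable (lborel \<Otimes>\<^sub>M lborel)" unfolding f_def by measurable
  have g: "integrable (lborel \<Otimes>\<^sub>M lborel) (\<lambda>(t :: real, Y :: real). C * indicator {0<..<1} t * (indicator {0<..} Y *\<^sub>R exp (- (x - k) * Y)))"
  proof -
    have "integrable lborel (\<lambda>t. C * indicator {0<..<1::real} t)" by (intro integrable_mult_right ind)
    moreover have "integrable lborel (\<lambda>Y::real. indicator {0<..} Y *\<^sub>R exp (- (x - k) * Y))"
      using laplace_exp(1)[of "x - k"] x by (simp add: set_integrable_def)
    ultimately show ?thesis
      by (intro lborel_pair.Fubini_integrable) (auto simp: norm_mult abs_mult simp del: mult_eq_0_iff intro!: integrable_mult_left integrable_abs)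
  qed
  have "norm (f t Y) \<le> C * indicator {0<..<1} t * (indicator {0<..} Y *\<^sub>R exp (- (x - k) * Y))" for t Y
  proof (cases "Y > 0")
    case True
    have "f t Y = (\<psi> t * exp (\<tau> t * complex_of_real Y)) * complex_of_real (exp (- x * Y))"
      using True by (simp add: f_def exp_of_real[symmetric] algebra_simps exp_add[symmetric] exp_diff exp_minus field_simps)
    then have "norm (f t Y) \<le> (C * exp (k * Y) * indicator {0<..<1} t) * exp (- x * Y)"
      using mult_right_mono[OF n[of t Y], of "exp (- x * Y)"] by (simp only: norm_mult norm_of_real) simp
    also have "\<dots> = C * indicator {0<..<1} t * exp (- (x - k) * Y)"
      by (simp add: algebra_simps exp_add[symmetric])
    finally show ?thesis using True by simp
  qed (simp add: f_def)
  then have fi: "integrable (lborel \<Otimes>\<^sub>M lborel) (case_prod f)"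
    by (intro Bochner_Integration.integrable_bound[OF g fm]) (auto intro!: AE_I2 order.trans[OF _ abs_ge_self])
  have "(LINT Y:{0<..}|lborel. complex_of_real (exp (- x * Y)) * H Y) = (LINT Y|lborel. LINT t|lborel. f t Y)"
    unfolding set_lebesgue_integral_def
  proof (rule Bochner_Integration.integral_cong[OF refl])
    fix Y
    have "f t Y = (indicator {0<..} Y *\<^sub>R complex_of_real (exp (- x * Y))) * (\<psi> t * exp (\<tau> t * complex_of_real Y))" for t
      by (simp add: f_def exp_of_real[symmetric] algebra_simps exp_add[symmetric] exp_diff exp_minus field_simps)
    then show "indicator {0<..} Y *\<^sub>R (complex_of_real (exp (- x * Y)) * H Y) = (LINT t|lborel. f t Y)"
      by (simp add: H_def)
  qed
  also have "\<dots> = (LINT t|lborel. LINT Y|lborel. f t Y)" by (rule lborel_pair.Fubini_integral[OF fi])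
  also have "\<dots> = (LINT t|lborel. \<psi> t / (complex_of_real x - \<tau> t))"
  proof (rule Bochner_Integration.integral_cong[OF refl])
    fix t
    show "(LINT Y|lborel. f t Y) = \<psi> t / (complex_of_real x - \<tau> t)"
    proof (cases "t \<in> {0<..<1}")
      case True
      have "(LINT Y|lborel. f t Y) = \<psi> t * (LINT Y:{0<..}|lborel. exp (- (complex_of_real x - \<tau> t) * complex_of_real Y))"
        unfolding f_def set_lebesgue_integral_def by (simp add: mult_scaleR_right[symmetric] del: mult_scaleR_right)
      then show ?thesis using laplace_exp_complex(2)[of "complex_of_real x - \<tau> t"] re[of t] True x by simp
    next
      case False
      then have "\<psi> t = 0" using bd[of t] by simp
      then show ?thesis by (simp add: f_def)
    qed
  qed
  finally show "(LINT Y:{0<..}|lborel. complex_of_real (exp (- x * Y)) * H Y) = (LINT t|lborel. \<psi> t / (complex_of_real x - \<tau> t))" .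
qed

text \<open>
  The Laplace transform of the sum minus \<open>(e\<^sup>Y - 1 - Y)/q\<close> is the function \<open>R\<close> of \<open>transform_remainder\<close>.
  By \<open>halfplane_representation\<close>, \<open>R\<close> is also the transform of a function of order \<open>e\<^bsup>kY\<^esup>\<close>. The two functions
  agree by uniqueness of the Laplace transform.
\<close>

theorem mittag_leffler_asymptotics:
  fixes q s :: real
  assumes q: "0 < q" and s: "3 \<le> s"
  obtains k C where "1/2 \<le> k" "k < 1" "0 \<le> C"
    "\<And>Y. 0 \<le> Y \<Longrightarrow> \<bar>(\<Sum>m. Y powr (q * real m + s - 1) / Gamma (q * real m + s)) - exp Y / q\<bar> \<le> C * exp (k * Y)"
proof -
  obtain k C :: real and R :: "complex \<Rightarrow> complex" where k: "1/2 \<le> k" "k < 1" and R: "R holomorphic_on {z. Re z > k}" "continuous_on {z. Re z \<ge> k} R"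
    "\<And>z. Re z \<ge> k \<Longrightarrow> norm (R z) \<le> C / norm z ^ 3" and C: "0 \<le> C"
    and Rx: "\<And>x. 1 < x \<Longrightarrow> R (complex_of_real x) = complex_of_real (x powr (- s) / (1 - x powr (- q)) - 1 / (q * x\<^sup>2 * (x - 1)))"
    by (rule transform_remainder[OF q s], rule that) blast+
  obtain \<Psi> \<tau> :: "real \<Rightarrow> complex" and C' where C': "0 \<le> C'" and \<Psi>: "\<And>t. norm (\<Psi> t) \<le> C'" and \<tau>: "\<And>t. 0 < t \<Longrightarrow> t < 1 \<Longrightarrow> Re (\<tau> t) = k"
    and cont: "continuous_on {0<..<1} \<Psi>" "continuous_on {0<..<1} \<tau>"
    and int: "\<And>x. k < x \<Longrightarrow> ((\<lambda>t. \<Psi> t / (\<tau> t - complex_of_real x)) has_integral R (complex_of_real x)) {0<..<1}"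
    by (rule halfplane_representation[OF k(1) C R], assumption, rule that) blast+
  define \<psi> where "\<psi> t = indicator {0<..<1} t *\<^sub>R \<Psi> t" for t
  define \<tau>' where "\<tau>' t = indicator {0<..<1} t *\<^sub>R \<tau> t" for t
  have m: "\<psi> \<in> borel_measurable borel" "\<tau>' \<in> borel_measurable borel"
    unfolding \<psi>_def \<tau>'_def by (intro borel_measurable_continuous_on_indicator cont; simp)+
  have \<psi>: "norm (\<psi> t) \<le> C' * indicator {0<..<1} t" for t using \<Psi>[of t] by (simp add: \<psi>_def indicator_def)
  have \<tau>': "\<forall>t\<in>{0<..<1}. Re (\<tau>' t) = k" using \<tau> by (simp add: \<tau>'_def)
  define H where "H Y = (LINT t|lborel. \<psi> t * exp (\<tau>' t * complex_of_real Y))" for Y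
  note H0 = exponential_superposition[OF m]
  note H1 = H0[OF \<psi>]
  note H = H1[OF \<tau>', folded H_def]
  define S where "S = mittag_leffler q s"
  note S = mittag_leffler_continuous[OF q s, folded S_def] mittag_leffler_le[OF q s, folded S_def]
    mittag_leffler_laplace[OF q s, folded S_def] mittag_leffler_nonneg[OF q s, folded S_def]
  define A where "A = 1 / (1 - 2 powr (- q))"
  have A: "0 \<le> A" using mittag_leffler_ratio[OF q s] by (simp add: A_def)
  define u where "u Y = S Y - (exp Y - 1 - Y) / q + Re (H Y)" for Y
  have lin: "0 \<le> exp Y - 1 - Y" for Y :: real using exp_ge_add_one_self[of Y] by linarith
  have "u Y = 0" if "0 \<le> Y" for Y
  proof (rule laplace_unique[OF _ _ _ that])
    show "continuous_on {0..} u"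
      unfolding u_def by (intro continuous_intros S(1) continuous_on_subset[OF H(1)]) (use q in auto)
    show "\<bar>u Y\<bar> \<le> (A + 1 / q + C') * exp (2 * Y)" if Y: "0 \<le> Y" for Y
    proof -
      have "\<bar>S Y\<bar> \<le> A * exp (2 * Y)" using S(2,5)[OF Y] by (simp add: A_def)
      moreover have "exp Y - 1 - Y \<le> exp (2 * Y)"
      proof -
        have "exp Y \<le> exp (2 * Y)" using Y by simp
        then show ?thesis using Y by linarith
      qed
      then have "(exp Y - 1 - Y) / q \<le> exp (2 * Y) / q" using q by (intro divide_right_mono) auto
      then have "\<bar>(exp Y - 1 - Y) / q\<bar> \<le> 1 / q * exp (2 * Y)" using lin[of Y] q by simp
      moreover have "\<bar>Re (H Y)\<bar> \<le> C' * exp (2 * Y)"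
      proof -
        have "k * Y \<le> 2 * Y" using k Y by (intro mult_right_mono) auto
        then have "C' * exp (k * Y) \<le> C' * exp (2 * Y)" using C' by (intro mult_left_mono) auto
        then show ?thesis using H(2)[of Y] abs_Re_le_cmod[of "H Y"] by linarith
      qed
      ultimately show ?thesis unfolding u_def distrib_right by linarith
    qed
    show "(LINT Y:{0<..}|lborel. exp (- real n * Y) * u Y) = 0" if n: "3 \<le> real n" for n :: nat
    proof -
      define x where "x = real n"
      have x: "1 < x" "k < x" using n k unfolding x_def by linarith+
      let ?h = "\<lambda>Y. complex_of_real (exp (- x * Y)) * H Y"
      have h: "set_integrable lborel {0<..} ?h" by (rule H(3)[OF x(2)])
      have hi: "(LINT Y:{0<..}|lborel. ?h Y) = - R (complex_of_real x)"
      proof -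
        have "set_integrable lborel {0<..<1} (\<lambda>t. \<Psi> t / (\<tau> t - complex_of_real x))"
        proof (rule set_integrable_bound)
          show "set_integrable lborel {0<..<1::real} (\<lambda>t::real. C' / (x - k))" by (simp add: set_integrable_def)
          have "continuous_on {0<..<1} (\<lambda>t. \<Psi> t / (\<tau> t - complex_of_real x))"
          proof (intro continuous_intros cont ballI notI)
            fix t :: real assume t: "t \<in> {0<..<1}" and "\<tau> t - complex_of_real x = 0"
            then have "\<tau> t = complex_of_real x" by simp
            then show False using \<tau>[of t] t x by simp
          qed
          then show "set_borel_measurable lborel {0<..<1} (\<lambda>t. \<Psi> t / (\<tau> t - complex_of_real x))"
            unfolding set_borel_measurable_def
            by (simp only: measurable_lborel2) (intro borel_measurable_continuous_on_indicator; simp)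
          have "norm (\<Psi> t / (\<tau> t - complex_of_real x)) \<le> C' / (x - k)" if t: "t \<in> {0<..<1}" for t
          proof -
            have "x - k \<le> norm (\<tau> t - complex_of_real x)"
              using abs_Re_le_cmod[of "\<tau> t - complex_of_real x"] \<tau>[of t] t x by simp
            then show ?thesis unfolding norm_divide using \<Psi>[of t] x C' by (intro frac_le) auto
          qed
          then show "AE t\<in>{0<..<1} in lborel. norm (\<Psi> t / (\<tau> t - complex_of_real x)) \<le> norm (C' / (x - k))"
            using x C' by (intro AE_I2) auto
        qed
        from set_borel_integral_eq_integral(2)[OF this]
        have "(LINT t:{0<..<1}|lborel. \<Psi> t / (\<tau> t - complex_of_real x)) = R (complex_of_real x)"
          using int[OF x(2)] by (simp add: integral_unique)
        moreover have "(LINT t|lborel. \<psi> t / (complex_of_real x - \<tau>' t)) = - (LINT t:{0<..<1}|lborel. \<Psi> t / (\<tau> t - complex_of_real x))"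
          unfolding set_lebesgue_integral_def Bochner_Integration.integral_minus[symmetric]
          by (intro Bochner_Integration.integral_cong) (auto simp: \<psi>_def \<tau>'_def indicator_def minus_divide_right simp del: minus_divide_right[symmetric])
        ultimately show ?thesis using H(4)[OF x(2)] by simp
      qed
      have re: "set_integrable lborel {0<..} (\<lambda>Y. exp (- x * Y) * Re (H Y))"
        and rei: "(LINT Y:{0<..}|lborel. exp (- x * Y) * Re (H Y)) = - Re (R (complex_of_real x))"
      proof -
        have *: "indicator {0<..} Y *\<^sub>R (exp (- x * Y) * Re (H Y)) = Re (indicator {0<..} Y *\<^sub>R ?h Y)" for Y by simp
        show "set_integrable lborel {0<..} (\<lambda>Y. exp (- x * Y) * Re (H Y))"
          using h unfolding set_integrable_def * by (rule integrable_Re)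
        have "(LINT Y:{0<..}|lborel. exp (- x * Y) * Re (H Y)) = Re (LINT Y:{0<..}|lborel. ?h Y)"
          using h unfolding set_integrable_def set_lebesgue_integral_def * by (rule integral_Re)
        then show "(LINT Y:{0<..}|lborel. exp (- x * Y) * Re (H Y)) = - Re (R (complex_of_real x))" unfolding hi by simp
      qed
      note E = laplace_exp_minus_linear[OF x(1)]
      have E': "set_integrable lborel {0<..} (\<lambda>Y. (1 / q) * (exp (- x * Y) * (exp Y - 1 - Y)))"
        using E(1) by (rule set_integrable_mult_right)
      note S' = S(3)[OF x(1)] S(4)[OF x(1)]
      have "(LINT Y:{0<..}|lborel. exp (- x * Y) * u Y)
          = (LINT Y:{0<..}|lborel. (exp (- x * Y) * S Y - (1 / q) * (exp (- x * Y) * (exp Y - 1 - Y))) + exp (- x * Y) * Re (H Y))"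
        by (intro set_lebesgue_integral_cong) (auto simp: u_def algebra_simps diff_divide_distrib add_divide_distrib)
      also have "\<dots> = (LINT Y:{0<..}|lborel. exp (- x * Y) * S Y) - (LINT Y:{0<..}|lborel. (1 / q) * (exp (- x * Y) * (exp Y - 1 - Y)))
          + (LINT Y:{0<..}|lborel. exp (- x * Y) * Re (H Y))"
        by (simp only: set_integral_add(2)[OF set_integral_diff(1)[OF S'(1) E'] re] set_integral_diff(2)[OF S'(1) E'])
      also have "\<dots> = x powr (- s) / (1 - x powr (- q)) - (1 / q) * (1 / (x\<^sup>2 * (x - 1))) - Re (R (complex_of_real x))"
        unfolding set_integral_mult_right S'(2) E(2) rei by simp
      also have "\<dots> = 0" unfolding Rx[OF x(1)] by simp
      finally show ?thesis by (simp add: x_def)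
    qed
  qed
  then have S_eq: "S Y = (exp Y - 1 - Y) / q - Re (H Y)" if "0 \<le> Y" for Y using that unfolding u_def by fastforce
  have "\<bar>S Y - exp Y / q\<bar> \<le> (2 / q + C') * exp (k * Y)" if Y: "0 \<le> Y" for Y
  proof -
    have "1 + Y \<le> 2 * (1 + k * Y)" using mult_right_mono[OF k(1) Y] by (simp add: algebra_simps)
    also have "\<dots> \<le> 2 * exp (k * Y)" by (intro mult_left_mono exp_ge_add_one_self) simp
    finally have "1 + Y \<le> 2 * exp (k * Y)" .
    then have "(1 + Y) / q \<le> 2 * exp (k * Y) / q" using q by (intro divide_right_mono) auto
    moreover have "S Y - exp Y / q = - ((1 + Y) / q) - Re (H Y)" unfolding S_eq[OF Y] using q by (simp add: field_simps)
    moreover have "0 \<le> (1 + Y) / q" using Y q by simp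
    moreover have "\<bar>Re (H Y)\<bar> \<le> C' * exp (k * Y)" using H(2)[of Y] abs_Re_le_cmod[of "H Y"] by linarith
    ultimately have "\<bar>S Y - exp Y / q\<bar> \<le> 2 * exp (k * Y) / q + C' * exp (k * Y)" by linarith
    then show ?thesis by (simp add: distrib_right)
  qed
  then show ?thesis using that[of k "2 / q + C'"] k q C' by (simp add: S_def mittag_leffler_def[OF q s])
qed

section \<open>Circle means and Laurent coefficients\<close>

abbreviation circ :: "real \<Rightarrow> complex" where "circ t \<equiv> cis (2 * pi * t)"

lemma circ_eq_exp: "circ t = exp (2 * complex_of_real pi * \<i> * complex_of_real t)"
  by (simp add: cis_conv_exp mult_ac)

lemma circle_mean_entire:
  assumes G: "G holomorphic_on UNIV"
  shows "((\<lambda>t. G (circ t)) has_integral G 0) {0..1}"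
proof -
  have "((\<lambda>u. G u / (u - 0)) has_contour_integral (2 * of_real pi * \<i> * G 0)) (circlepath 0 1)"
    using G by (intro Cauchy_integral_circlepath_simple holomorphic_on_subset[OF G]) auto
  then have "((\<lambda>t. G (circlepath 0 1 t) / circlepath 0 1 t * vector_derivative (circlepath 0 1) (at t within {0..1}))
      has_integral 2 * of_real pi * \<i> * G 0) {0..1}"
    by (simp add: has_contour_integral_def)
  then have "((\<lambda>t. 2 * of_real pi * \<i> * G (circ t)) has_integral 2 * of_real pi * \<i> * G 0) {0..1}"
  proof (rule has_integral_eq[rotated])
    fix t :: real assume "t \<in> {0..1}"
    then have vd: "vector_derivative (circlepath 0 1) (at t within {0..1}) = 2 * of_real pi * \<i> * circ t"
      using vector_derivative_circlepath01[of t 0 1] by (simp add: cis_conv_exp mult_ac)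
    have "circlepath 0 1 t = circ t" by (simp add: circlepath circ_eq_exp)
    then show "G (circlepath 0 1 t) / circlepath 0 1 t * vector_derivative (circlepath 0 1) (at t within {0..1}) = 2 * of_real pi * \<i> * G (circ t)"
      unfolding vd by simp
  qed
  from has_integral_mult_right[OF this, of "1 / (2 * of_real pi * \<i>)"] show ?thesis by simp
qed

text \<open>
  The mean of \<open>h\<close> over a circle around the puncture does not depend on the radius or the starting
  point: pulling back by \<open>exp\<close> makes it \<open>P(\<zeta> + 2\<pi>i) - P(\<zeta>)\<close> for a primitive \<open>P\<close> of a \<open>2\<pi>i\<close>-periodic entire
  function, and this difference has derivative zero.
\<close>

lemma circle_mean_const:
  assumes h: "h holomorphic_on - {0}"
  obtains A where "\<And>w. w \<noteq> 0 \<Longrightarrow> ((\<lambda>t. h (w * circ t)) has_integral A) {0..1}"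
proof -
  define G where "G \<zeta> = h (exp \<zeta>)" for \<zeta>
  have "G holomorphic_on UNIV"
  proof -
    have "(h \<circ> exp) holomorphic_on UNIV"
      by (rule holomorphic_on_compose_gen[OF holomorphic_on_exp h]) auto
    then show ?thesis by (simp add: G_def[abs_def] o_def)
  qed
  then obtain P where P: "\<And>\<zeta>. (P has_field_derivative G \<zeta>) (at \<zeta>)"
    using holomorphic_convex_primitive'[of UNIV G] by auto
  define Q where "Q \<zeta> = P (\<zeta> + 2 * of_real pi * \<i>) - P \<zeta>" for \<zeta>
  have per: "G (\<zeta> + 2 * of_real pi * \<i>) = G \<zeta>" for \<zeta> by (simp add: G_def exp_add)
  have "(Q has_field_derivative 0) (at \<zeta>)" for \<zeta>
  proof -
    have "((\<lambda>\<zeta>. P (\<zeta> + 2 * of_real pi * \<i>)) has_field_derivative G (\<zeta> + 2 * of_real pi * \<i>)) (at \<zeta>)"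
      using P[of "\<zeta> + 2 * of_real pi * \<i>"] by (simp add: DERIV_shift)
    from DERIV_diff[OF this P[of \<zeta>]] show ?thesis by (simp add: per Q_def[abs_def])
  qed
  then have Q: "Q \<zeta> = Q 0" for \<zeta>
    using has_field_derivative_zero_constant[of UNIV Q] by force
  have "((\<lambda>t. h (w * circ t)) has_integral Q 0 / (2 * of_real pi * \<i>)) {0..1}" if w: "w \<noteq> 0" for w
  proof -
    let ?p = "\<lambda>t. Ln w + 2 * of_real pi * \<i> * complex_of_real t"
    have "((\<lambda>t. 2 * of_real pi * \<i> * G (?p t)) has_integral P (?p 1) - P (?p 0)) {0..1}"
    proof (rule fundamental_theorem_of_calculus)
      fix t :: real
      have "(?p has_vector_derivative 2 * of_real pi * \<i>) (at t within {0..1})"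
        by (auto intro!: derivative_eq_intros)
      from field_vector_diff_chain_within[OF this has_field_derivative_at_within[OF P]]
      show "((\<lambda>t. P (?p t)) has_vector_derivative 2 * of_real pi * \<i> * G (?p t)) (at t within {0..1})"
        by (simp add: o_def)
    qed simp
    also have "P (?p 1) - P (?p 0) = Q 0" using Q[of "Ln w"] by (simp add: Q_def)
    finally have "((\<lambda>t. 2 * of_real pi * \<i> * G (?p t)) has_integral Q 0) {0..1}" .
    from has_integral_mult_right[OF this, of "1 / (2 * of_real pi * \<i>)"]
    show ?thesis using w by (simp add: G_def exp_add circ_eq_exp)
  qed
  then show ?thesis by (rule that)
qed

text \<open>By \<open>circle_mean_const\<close> any other circle around the puncture gives the same coefficient.\<close>

definition laurent_coeff :: "(complex \<Rightarrow> complex) \<Rightarrow> int \<Rightarrow> complex" where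
  "laurent_coeff h m = integral {0..1} (\<lambda>t. h (circ t) * circ t powi (- m))"

lemma laurent_coeff_integral:
  assumes h: "h holomorphic_on - {0}" and w: "w \<noteq> 0"
  shows "((\<lambda>t. h (w * circ t) * (w * circ t) powi (- m)) has_integral laurent_coeff h m) {0..1}"
proof -
  have "(\<lambda>\<tau>. h \<tau> * \<tau> powi (- m)) holomorphic_on - {0}"
    by (intro holomorphic_on_mult h holomorphic_on_power_int holomorphic_on_ident) auto
  then obtain A where A: "\<And>w. w \<noteq> 0 \<Longrightarrow> ((\<lambda>t. h (w * circ t) * (w * circ t) powi (- m)) has_integral A) {0..1}"
    by (rule circle_mean_const) blast
  from A[of 1] have "laurent_coeff h m = A" by (simp add: laurent_coeff_def integral_unique)
  then show ?thesis using A[OF w] by simp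
qed

text \<open>
  For \<open>m \<noteq> 0\<close>, passing from the circle of radius 1 to that of radius 2 multiplies the mean by \<open>2\<^sup>-\<^sup>m\<close> but
  must not change it.
\<close>

lemma laurent_coeff_const: "laurent_coeff (\<lambda>_. c) m = (if m = 0 then c else 0)"
proof (cases "m = 0")
  case False
  have h: "(\<lambda>_. c) holomorphic_on - {0}" by simp
  let ?I = "laurent_coeff (\<lambda>_. c) m"
  have "2 powi (- m) * (c * (1 * \<tau>) powi (- m)) = c * (2 * \<tau>) powi (- m)" for \<tau> :: complex
    by (simp add: power_int_mult_distrib)
  then have "((\<lambda>t. c * (2 * circ t) powi (- m)) has_integral 2 powi (- m) * ?I) {0..1}"
    using has_integral_mult_right[OF laurent_coeff_integral[OF h, of 1 m], of "2 powi (- m)"] by (simp only: one_neq_zero not_False_eq_True simp_thms)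
  then have "2 powi (- m) * ?I = ?I"
    by (rule has_integral_unique) (rule laurent_coeff_integral[OF h], simp)
  moreover have "(2 :: complex) powi (- m) \<noteq> 1"
  proof
    assume "(2 :: complex) powi (- m) = 1"
    then have "norm ((2 :: complex) powi (- m)) = 1" by simp
    then have "(2 :: real) powi (- m) = 2 powi 0" by (simp add: norm_power_int)
    then show False using power_int_strict_increasing[of 0 "- m" "2::real"] power_int_strict_increasing[of "- m" 0 "2::real"] False
      by (cases "m < 0") auto
  qed
  ultimately show ?thesis using False by simp
qed (simp add: laurent_coeff_def integral_unique[OF has_integral_const_real])

lemma integral_sums_geometric:
  fixes f :: "nat \<Rightarrow> real \<Rightarrow> complex"
  assumes c: "\<And>n. continuous_on {0..1} (f n)" and b: "\<And>n t. t \<in> {0..1} \<Longrightarrow> norm (f n t) \<le> B * (1/2) ^ n"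
    and i: "\<And>n. (f n has_integral I n) {0..1}" and s: "((\<lambda>t. \<Sum>n. f n t) has_integral J) {0..1}"
  shows "I sums J"
proof -
  have "uniform_limit {0..1} (\<lambda>N t. \<Sum>n<N. f n t) (\<lambda>t. \<Sum>n. f n t) sequentially"
    by (rule Weierstrass_m_test[OF b]) (auto intro!: summable_mult summable_geometric)
  then obtain I' J' where I': "\<And>N. ((\<lambda>t. \<Sum>n<N. f n t) has_integral I' N) {0..1}"
    "((\<lambda>t. \<Sum>n. f n t) has_integral J') {0..1}" "I' \<longlonglongrightarrow> J'"
    by (rule uniform_limit_integral) (auto intro!: continuous_on_sum c)
  have "I' = (\<lambda>N. \<Sum>n<N. I n)"
  proof
    fix N
    have "((\<lambda>t. \<Sum>n<N. f n t) has_integral (\<Sum>n<N. I n)) {0..1}" by (intro has_integral_sum i) auto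
    with I'(1) show "I' N = (\<Sum>n<N. I n)" by (rule has_integral_unique)
  qed
  moreover have "J' = J" using I'(2) s by (rule has_integral_unique)
  ultimately show ?thesis using I'(3) by (simp add: sums_def)
qed

text \<open>
  Laurent's theorem. Means of \<open>\<tau> (h \<tau> - h \<lambda>)/(\<tau> - \<lambda>)\<close> over a circle outside and a circle inside \<open>\<bar>\<tau>\<bar> = \<bar>\<lambda>\<bar>\<close> agree;
  expanding the Cauchy kernel into geometric series gives the two halves of the expansion.
\<close>

theorem laurent_expansion:
  assumes h: "h holomorphic_on - {0}" and l0: "l \<noteq> 0"
  obtains N where "(\<lambda>n. laurent_coeff h (int n) * l ^ n) sums (h l - N)"
    "(\<lambda>n. laurent_coeff h (- int (Suc n)) * inverse l ^ Suc n) sums N"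
proof -
  define q where "q \<tau> = (if \<tau> = l then deriv h l else (h \<tau> - h l) / (\<tau> - l))" for \<tau>
  have "q holomorphic_on - {0}" unfolding q_def by (rule pole_lemma_open[OF h]) auto
  then have "(\<lambda>\<tau>. \<tau> * q \<tau>) holomorphic_on - {0}" by (intro holomorphic_intros)
  then obtain A where A: "\<And>w. w \<noteq> 0 \<Longrightarrow> ((\<lambda>t. (w * circ t) * q (w * circ t)) has_integral A) {0..1}"
    by (rule circle_mean_const) blast
  define g where "g \<tau> = h \<tau> - h l" for \<tau>
  have g: "g holomorphic_on - {0}" unfolding g_def by (intro holomorphic_intros h)
  have gcoeff: "laurent_coeff g m = laurent_coeff h m - (if m = 0 then h l else 0)" for m
  proof -
    have "((\<lambda>t. g (1 * circ t) * (1 * circ t) powi (- m)) has_integral laurent_coeff h m - laurent_coeff (\<lambda>_. h l) m) {0..1}"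
      unfolding g_def left_diff_distrib by (intro has_integral_diff laurent_coeff_integral h) auto
    from has_integral_unique[OF laurent_coeff_integral[OF g one_neq_zero] this] show ?thesis
      by (simp add: laurent_coeff_const)
  qed
  have cont: "continuous_on {0..1} (\<lambda>t. g (w * circ t))" if "w \<noteq> 0" for w
    using that by (intro continuous_on_compose2[OF holomorphic_on_imp_continuous_on[OF g]] continuous_intros) auto
  have bd: "\<exists>B. \<forall>t\<in>{0..1}. norm (g (w * circ t)) \<le> B" if "w \<noteq> 0" for w
    using compact_imp_bounded[OF compact_continuous_image[OF cont[OF that] compact_Icc]] by (auto simp: bounded_iff)
  have outer: "(\<lambda>n. laurent_coeff g (int n) * l ^ n) sums A"
  proof -
    define w where "w = 2 * l"
    have w: "w \<noteq> 0" using l0 by (simp add: w_def)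
    obtain B where B: "\<And>t. t \<in> {0..1} \<Longrightarrow> norm (g (w * circ t)) \<le> B" using bd[OF w] by blast
    have quot: "norm (l / (w * circ t)) = 1/2" for t using l0 by (simp add: w_def norm_divide norm_mult)
    show ?thesis
    proof (rule integral_sums_geometric[where f="\<lambda>n t. g (w * circ t) * (l / (w * circ t)) ^ n"])
      show "continuous_on {0..1} (\<lambda>t. g (w * circ t) * (l / (w * circ t)) ^ n)" for n
        using w by (intro continuous_intros cont[OF w]) auto
      show "norm (g (w * circ t) * (l / (w * circ t)) ^ n) \<le> B * (1/2) ^ n" if "t \<in> {0..1}" for n t
        unfolding norm_mult norm_power quot using B[OF that] by (intro mult_right_mono) auto
      show "((\<lambda>t. g (w * circ t) * (l / (w * circ t)) ^ n) has_integral laurent_coeff g (int n) * l ^ n) {0..1}" for n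
      proof -
        have "g \<tau> * \<tau> powi (- int n) * l ^ n = g \<tau> * (l / \<tau>) ^ n" for \<tau>
          by (simp add: power_int_minus power_mult_distrib divide_inverse power_inverse)
        then show ?thesis using has_integral_mult_left[OF laurent_coeff_integral[OF g w, of "int n"], of "l ^ n"] by (simp only:)
      qed
      have eq: "(\<Sum>n. g (w * circ t) * (l / (w * circ t)) ^ n) = (w * circ t) * q (w * circ t)" for t
      proof -
        let ?\<tau> = "w * circ t"
        have nz: "?\<tau> \<noteq> 0" using w by simp
        have ne: "?\<tau> \<noteq> l" using quot[of t] l0 by (auto simp: norm_divide)
        have "(\<Sum>n. g ?\<tau> * (l / ?\<tau>) ^ n) = g ?\<tau> * (1 / (1 - l / ?\<tau>))"
          using quot[of t] by (subst suminf_mult) (auto intro!: summable_geometric simp: suminf_geometric)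
        also have "1 - l / ?\<tau> = (?\<tau> - l) / ?\<tau>" using nz by (simp add: diff_divide_distrib del: mult_eq_0_iff)
        also have "g ?\<tau> * (1 / ((?\<tau> - l) / ?\<tau>)) = ?\<tau> * q ?\<tau>" using ne by (simp add: q_def g_def)
        finally show ?thesis .
      qed
      show "((\<lambda>t. \<Sum>n. g (w * circ t) * (l / (w * circ t)) ^ n) has_integral A) {0..1}"
        unfolding eq by (rule A[OF w])
    qed
  qed
  have inner: "(\<lambda>n. - (laurent_coeff g (- int (Suc n)) * inverse l ^ Suc n)) sums A"
  proof -
    define w where "w = l / 2"
    have w: "w \<noteq> 0" using l0 by (simp add: w_def)
    obtain B where B: "\<And>t. t \<in> {0..1} \<Longrightarrow> norm (g (w * circ t)) \<le> B" using bd[OF w] by blast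
    have quot: "norm ((w * circ t) / l) = 1/2" for t using l0 by (simp add: w_def norm_divide norm_mult)
    show ?thesis
    proof (rule integral_sums_geometric[where f="\<lambda>n t. - (g (w * circ t) * ((w * circ t) / l) ^ Suc n)" and B=B])
      show "continuous_on {0..1} (\<lambda>t. - (g (w * circ t) * ((w * circ t) / l) ^ Suc n))" for n
        using l0 by (intro continuous_intros cont[OF w]) auto
      show "norm (- (g (w * circ t) * ((w * circ t) / l) ^ Suc n)) \<le> B * (1/2) ^ n" if "t \<in> {0..1}" for n t
      proof -
        have "norm (g (w * circ t)) * (1/2) ^ Suc n \<le> B * (1/2) ^ n"
          using B[OF that] order.trans[OF norm_ge_zero B[OF that]] by (intro mult_mono) auto
        then show ?thesis unfolding norm_minus_cancel norm_mult[of "g _"] norm_power quot .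
      qed
      show "((\<lambda>t. - (g (w * circ t) * ((w * circ t) / l) ^ Suc n)) has_integral - (laurent_coeff g (- int (Suc n)) * inverse l ^ Suc n)) {0..1}" for n
      proof -
        have "- (g \<tau> * \<tau> powi (- (- int (Suc n))) * inverse l ^ Suc n) = - (g \<tau> * (\<tau> / l) ^ Suc n)" for \<tau>
          by (simp only: minus_minus power_int_of_nat divide_inverse power_mult_distrib mult.assoc)
        then show ?thesis
          using has_integral_neg[OF has_integral_mult_left[OF laurent_coeff_integral[OF g w, of "- int (Suc n)"], of "inverse l ^ Suc n"]]
          by (simp only:)
      qed
      have eq: "(\<Sum>n. - (g (w * circ t) * ((w * circ t) / l) ^ Suc n)) = (w * circ t) * q (w * circ t)" for t
      proof -
        let ?\<tau> = "w * circ t"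
        have ne: "?\<tau> \<noteq> l" using quot[of t] l0 by auto
        have "(\<Sum>n. - (g ?\<tau> * (?\<tau> / l) ^ Suc n)) = (\<Sum>n. - (g ?\<tau> * (?\<tau> / l)) * (?\<tau> / l) ^ n)"
          by (intro suminf_cong) simp
        also have "\<dots> = - (g ?\<tau> * (?\<tau> / l)) * (1 / (1 - ?\<tau> / l))"
          using quot[of t] by (subst suminf_mult) (auto intro!: summable_geometric simp: suminf_geometric)
        also have "1 - ?\<tau> / l = (l - ?\<tau>) / l" using l0 by (simp add: diff_divide_distrib)
        also have "- (g ?\<tau> * (?\<tau> / l)) * (1 / ((l - ?\<tau>) / l)) = ?\<tau> * q ?\<tau>"
        proof -
          have "q ?\<tau> = - (g ?\<tau> / (l - ?\<tau>))" using ne by (simp add: q_def g_def minus_divide_right)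
          then show ?thesis using l0 by simp
        qed
        finally show ?thesis .
      qed
      show "((\<lambda>t. \<Sum>n. - (g (w * circ t) * ((w * circ t) / l) ^ Suc n)) has_integral A) {0..1}"
        unfolding eq by (rule A[OF w])
    qed
  qed
  have "(\<lambda>n. laurent_coeff h (int n) * l ^ n) sums (h l - (- A))"
  proof -
    have "(\<lambda>n. if n = 0 then h l else 0) sums h l"
      using sums_If_finite_set[of "{0::nat}" "\<lambda>_. h l"] by simp
    from sums_add[OF outer this] have "(\<lambda>n. laurent_coeff g (int n) * l ^ n + (if n = 0 then h l else 0)) sums (h l - (- A))"
      by (simp add: add.commute)
    moreover have "laurent_coeff g (int n) * l ^ n + (if n = 0 then h l else 0) = laurent_coeff h (int n) * l ^ n" for n
      by (simp add: gcoeff)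
    ultimately show ?thesis by simp
  qed
  moreover have "(\<lambda>n. laurent_coeff h (- int (Suc n)) * inverse l ^ Suc n) sums (- A)"
    using sums_minus[OF inner] by (simp add: gcoeff del: power_Suc)
  ultimately show ?thesis by (rule that)
qed

section \<open>Holomorphic functions on the manifold of rank one elements\<close>

lemma holomorphic_on_submanifold_continuous:
  assumes "holomorphic_on_submanifold f M"
  shows "continuous_on M f"
  unfolding continuous_on_def
proof
  fix z assume z: "z \<in> M"
  from bspec[OF assms[unfolded holomorphic_on_submanifold_def] z]
  obtain U F where U: "open U" "z \<in> U" "\<forall>w\<in>U \<inter> M. f w = F w" and F: "holomorphic_several F U" by auto
  from bspec[OF F[unfolded holomorphic_several_def] U(2)]
  obtain F' where F': "(F has_derivative F') (at z)" by auto
  have lim: "(F \<longlongrightarrow> F z) (at z within M)"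
    by (rule tendsto_within_subset[OF has_derivative_continuous[OF F', unfolded continuous_at] subset_UNIV])
  have ev: "eventually (\<lambda>w. F w = f w) (at z within M)"
    unfolding eventually_at_topological
  proof (intro exI[of _ U] conjI ballI impI U(1) U(2))
    fix w assume "w \<in> U" "w \<in> M"
    then show "F w = f w" using bspec[OF U(3), of w] by (simp only: Int_iff simp_thms)
  qed
  from tendsto_cong[THEN iffD1, OF ev lim] have "(f \<longlongrightarrow> F z) (at z within M)" .
  moreover have "f z = F z" using U z by simp
  ultimately show "(f \<longlongrightarrow> f z) (at z within M)" by simp
qed

text \<open>
  The chain rule for a local extension of \<open>f\<close>. Quadratic curves suffice because \<open>scaling\<close> is quadratic in
  its parameter.
\<close>

lemma holomorphic_on_submanifold_curve:
  assumes f: "holomorphic_on_submanifold f M" and V: "open V"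
    and M: "\<And>\<zeta>. \<zeta> \<in> V \<Longrightarrow> u + \<zeta> *s v + \<zeta>\<^sup>2 *s w \<in> M"
  shows "(\<lambda>\<zeta>. f (u + \<zeta> *s v + \<zeta>\<^sup>2 *s w)) holomorphic_on V"
proof -
  let ?g = "\<lambda>\<zeta>. u + \<zeta> *s v + \<zeta>\<^sup>2 *s w"
  note bl = bounded_bilinear.bounded_linear_left[OF bounded_bilinear_smult_vec]
  have g: "(?g has_derivative (\<lambda>h. h *s (v + (2 * \<zeta>) *s w))) (at \<zeta>)" for \<zeta>
  proof -
    have "((\<lambda>\<zeta>. \<zeta>\<^sup>2) has_derivative (\<lambda>h. 2 * \<zeta> * h)) (at \<zeta>)"
      by (auto intro!: derivative_eq_intros)
    from bounded_linear.has_derivative[OF bl this]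
    have "((\<lambda>\<zeta>. \<zeta>\<^sup>2 *s w) has_derivative (\<lambda>h. (2 * \<zeta> * h) *s w)) (at \<zeta>)" .
    moreover have "((\<lambda>\<zeta>. \<zeta> *s v) has_derivative (\<lambda>h. h *s v)) (at \<zeta>)"
      by (rule bounded_linear_imp_has_derivative[OF bl])
    ultimately have "(?g has_derivative (\<lambda>h. 0 + h *s v + (2 * \<zeta> * h) *s w)) (at \<zeta>)"
      by (intro has_derivative_add has_derivative_const)
    moreover have "(\<lambda>h. 0 + h *s v + (2 * \<zeta> * h) *s w) = (\<lambda>h. h *s (v + (2 * \<zeta>) *s w))"
      by (simp add: fun_eq_iff vec_eq_iff algebra_simps)
    ultimately show ?thesis by simp
  qed
  have gc: "continuous_on UNIV ?g" by (intro continuous_intros)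
  have "(\<lambda>\<zeta>. f (?g \<zeta>)) field_differentiable (at \<zeta>)" if z: "\<zeta> \<in> V" for \<zeta>
  proof -
    obtain U F where U: "open U" "?g \<zeta> \<in> U" "\<forall>w\<in>U \<inter> M. f w = F w" and F: "holomorphic_several F U"
      using bspec[OF f[unfolded holomorphic_on_submanifold_def] M[OF z]] by auto
    obtain F' where F': "Vector_Spaces.linear (*s) (*) F'" "(F has_derivative F') (at (?g \<zeta>))"
      using bspec[OF F[unfolded holomorphic_several_def] U(2)] by auto
    have lin: "F' (h *s x) = h * F' x" for h x
      using F'(1) by (simp add: Vector_Spaces.linear_iff)
    from has_derivative_compose[OF g F'(2)]
    have "((\<lambda>\<zeta>. F (?g \<zeta>)) has_field_derivative F' (v + (2 * \<zeta>) *s w)) (at \<zeta>)"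
      unfolding has_field_derivative_def lin mult.commute[of _ "F' _"] .
    moreover have "open (?g -` U \<inter> V)"
      by (intro open_Int open_vimage U(1) gc V)
    moreover have "\<zeta> \<in> ?g -` U \<inter> V" using U z by simp
    moreover have "F (?g x) = f (?g x)" if "x \<in> ?g -` U \<inter> V" for x using U(3) M that by simp
    ultimately have "((\<lambda>\<zeta>. f (?g \<zeta>)) has_field_derivative F' (v + (2 * \<zeta>) *s w)) (at \<zeta>)"
      by (rule has_field_derivative_transform_within_open)
    then show ?thesis by (auto simp: field_differentiable_def)
  qed
  then show ?thesis by (simp add: holomorphic_on_def field_differentiable_at_within)
qed

lemma (in hermitian_form) ip_cauchy_schwarz_unit:
  assumes c: "ip c c = 1"
  shows "(cmod (ip s c))\<^sup>2 \<le> Re (ip s s)"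
proof -
  define u where "u = ip s c"
  have u: "ip s c = u" "ip c s = cnj u" unfolding u_def by (rule refl, rule ip_commute)
  have "ip (s - u *s c) (s - u *s c) = ip s s - complex_of_real ((cmod u)\<^sup>2)"
    unfolding complex_norm_square by (simp add: ip_diff_left ip_diff_right ip_scale_left ip_scale_right c u)
  then have "Re (ip (s - u *s c) (s - u *s c)) = Re (ip s s) - (cmod u)\<^sup>2"
    by (simp only: minus_complex.sel Re_complex_of_real)
  then show ?thesis using ip_self_nonneg[of "s - u *s c"] by (simp add: u_def)
qed

context jordan_sphere begin

lemma measurable_sigma_id [measurable]: "(\<lambda>s. s) \<in> borel_measurable \<sigma>"
  by (rule measurable_sigma[OF continuous_on_id])

text \<open>
  By Fubini, averaging the integrals over \<open>t\<close> amounts to averaging the integrand. Below, the integrals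
  are equal because \<open>t\<close> parametrises a circle subgroup of \<open>K\<close>.
\<close>

lemma integral_circle_mean:
  fixes F :: "real \<Rightarrow> complex ^ 'n \<Rightarrow> complex"
  assumes F: "(\<lambda>x. F (fst x) (snd x)) \<in> borel_measurable (lborel \<Otimes>\<^sub>M \<sigma>)"
    and bd: "\<And>t s. s \<in> sphere \<Longrightarrow> norm (F t s) \<le> B"
    and I: "\<And>t. (LINT s|\<sigma>. F t s) = I"
    and m: "\<And>s. s \<in> sphere \<Longrightarrow> ((\<lambda>t. F t s) has_integral m s) {0..1}"
  shows "(LINT s|\<sigma>. m s) = I"
proof -
  interpret P: pair_sigma_finite lborel \<sigma>
    by (intro pair_sigma_finite.intro sigma_finite_lborel sigma_finite_measure_axioms)
  define f where "f t s = indicator {0..1} t *\<^sub>R F t s" for t s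
  have fm: "(\<lambda>(t, s). f t s) \<in> borel_measurable (lborel \<Otimes>\<^sub>M \<sigma>)"
    unfolding f_def case_prod_beta by (intro borel_measurable_scaleR F) measurable
  have g: "integrable (lborel \<Otimes>\<^sub>M \<sigma>) (\<lambda>(t, s). B * indicator {0..1} (t :: real))"
    by (intro P.Fubini_integrable) (auto simp: abs_mult prob_space intro!: integrable_mult_right)
  have "integrable (lborel \<Otimes>\<^sub>M \<sigma>) (\<lambda>(t, s). f t s)"
  proof (rule Bochner_Integration.integrable_bound[OF g fm])
    show "AE x in lborel \<Otimes>\<^sub>M \<sigma>. norm (case x of (t, s) \<Rightarrow> f t s) \<le> norm (case x of (t, s) \<Rightarrow> B * indicator {0..1} (t :: real))"
      using bd by (intro AE_I2) (auto simp: space_pair_measure space_sigma f_def indicator_def intro: order.trans[OF _ abs_ge_self])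
  qed
  then have "(LINT s|\<sigma>. LINT t|lborel. f t s) = (LINT t|lborel. LINT s|\<sigma>. f t s)"
    by (intro P.Fubini_integral) simp
  also have "\<dots> = (LINT t::real|lborel. indicator {0..1} t *\<^sub>R I)" by (simp add: f_def I)
  also have "\<dots> = I" by simp
  also have "(LINT s|\<sigma>. LINT t|lborel. f t s) = (LINT s|\<sigma>. m s)"
  proof (rule Bochner_Integration.integral_cong[OF refl])
    fix s assume "s \<in> space \<sigma>"
    then have s: "s \<in> sphere" by (simp add: space_sigma)
    have Fs: "(\<lambda>t. F t s) \<in> borel_measurable lborel"
      using measurable_compose[OF measurable_Pair2'[OF \<open>s \<in> space \<sigma>\<close>] F] by (simp only: fst_conv snd_conv)
    have "set_integrable lborel {0..1} (\<lambda>t. F t s)"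
      unfolding set_integrable_def
    proof (rule Bochner_Integration.integrable_bound)
      show "integrable lborel (\<lambda>t::real. B * indicator {0..1} t)" by (intro integrable_mult_right) simp
      show "(\<lambda>t. indicator {0..1} t *\<^sub>R F t s) \<in> borel_measurable lborel"
        by (intro borel_measurable_scaleR Fs) simp
      show "AE t in lborel. norm (indicator {0..1} t *\<^sub>R F t s) \<le> norm (B * indicator {0..1} t)"
        using bd[OF s] by (intro AE_I2) (simp add: indicator_def order.trans[OF _ abs_ge_self])
    qed
    from set_borel_integral_eq_integral(2)[OF this] m[OF s]
    show "(LINT t|lborel. f t s) = m s" by (simp add: f_def set_lebesgue_integral_def integral_unique)
  qed
  finally show ?thesis by simp
qed

abbreviation "M \<equiv> rank_one T r e"

lemma sphere_rank_one: "s \<in> sphere \<Longrightarrow> \<tau> \<noteq> 0 \<Longrightarrow> \<tau> *s s \<in> M"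
  using primitive_smult by (auto simp: rank_one_iff rank_one_tripotent_iff)

lemma rank_one_sphere:
  assumes "z \<in> M"
  shows "0 < Re (ip z z)" "\<exists>c\<in>sphere. z = complex_of_real (sqrt (Re (ip z z))) *s c"
proof -
  let ?x = "Re (ip z z)" let ?t = "complex_of_real (sqrt ?x)"
  have z: "z \<noteq> 0" "primitive z" using assms by (auto simp: rank_one_iff)
  show x: "0 < ?x" using z by (simp add: ip_pos)
  have "primitive ((1 / ?t) *s z)" by (rule primitive_smult[OF z(2)])
  moreover have "ip ((1 / ?t) *s z) ((1 / ?t) *s z) = 1"
  proof -
    have "ip z z = ?t * ?t" using x by (subst ip_self_Re) (simp flip: of_real_mult)
    moreover have "?t \<noteq> 0" using x by simp
    ultimately show ?thesis using z(1) by (simp add: ip_scale_left ip_scale_right ip_self_eq_0)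
  qed
  ultimately have "(1 / ?t) *s z \<in> sphere" by (simp add: rank_one_tripotent_iff)
  moreover have "z = ?t *s ((1 / ?t) *s z)" using x by (simp add: vec.scale_scale)
  ultimately show "\<exists>c\<in>sphere. z = ?t *s c" by blast
qed

context
  fixes f c
  assumes f: "holomorphic_on_submanifold f M" and c: "c \<in> sphere"
begin

lemma prim: "primitive c" "ip c c = 1"
  using c by (auto simp: rank_one_tripotent_iff)

lemma ip_scaling: "ip (scaling c \<zeta> s) c = ip s c"
proof -
  have tri: "tripotent T c" by (rule primitive_tripotent[OF prim])
  have "scaling c (cnj \<zeta>) c = c" using scaling_eigen[OF self_peirce[OF tri], of "cnj \<zeta>"] by simp
  then show ?thesis by (simp add: scaling_adjoint[OF tri])
qed

lemma scaling_sphere: "cmod \<zeta> = 1 \<Longrightarrow> s \<in> sphere \<Longrightarrow> scaling c \<zeta> s \<in> sphere"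
  using sphere_K[OF scaling_in_K[OF primitive_tripotent[OF prim]]] by (simp add: matrix_works clinear_scaling)

lemma smult_sphere: "cmod \<zeta> = 1 \<Longrightarrow> s \<in> sphere \<Longrightarrow> \<zeta> *s s \<in> sphere"
  using sphere_K[OF rotation_in_K] by (simp add: mat_vector)

lemma line_holomorphic: "(\<lambda>\<tau>. f (\<tau> *s c)) holomorphic_on - {0}"
  using holomorphic_on_submanifold_curve[OF f, of "- {0}" 0 c 0] sphere_rank_one[OF c] by (simp add: open_Compl)

text \<open>
  At \<open>\<zeta> = 0\<close> the element \<open>scaling c \<zeta> s\<close> becomes \<open>(s|c)c\<close>, which is still non-zero, so
  \<open>\<zeta> \<mapsto> f (\<tau> scaling c \<zeta> s)\<close> is entire and has the mean value property.
\<close>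

lemma scaling_circle_mean:
  assumes s: "s \<in> sphere" "ip s c \<noteq> 0" and \<tau>: "\<tau> \<noteq> 0"
  shows "((\<lambda>t. f (\<tau> *s scaling c (circ t) s)) has_integral f ((\<tau> * ip s c) *s c)) {0..1}"
proof -
  let ?G = "\<lambda>\<zeta>. f (\<tau> *s scaling c \<zeta> s)"
  have eq: "\<tau> *s scaling c \<zeta> s = \<tau> *s P2 c s + \<zeta> *s (\<tau> *s P1 c s) + \<zeta>\<^sup>2 *s (\<tau> *s P0 c s)" for \<zeta>
    by (simp add: scaling_def vec_eq_iff algebra_simps)
  have "\<tau> *s scaling c \<zeta> s \<in> M" for \<zeta>
  proof -
    have "scaling c \<zeta> s \<noteq> 0" using s(2) ip_scaling[of \<zeta> s] by auto
    moreover have "primitive (scaling c \<zeta> s)"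
      using primitive_scaling[OF primitive_tripotent[OF prim]] s by (simp add: rank_one_tripotent_iff)
    ultimately show ?thesis using \<tau> primitive_smult by (simp add: rank_one_iff)
  qed
  then have "?G holomorphic_on UNIV"
    unfolding eq by (intro holomorphic_on_submanifold_curve[OF f open_UNIV])
  from circle_mean_entire[OF this]
  show ?thesis by (simp add: scaling_def primitive_P2[OF prim] vec.scale_scale)
qed

lemma bounded_scaled_sphere:
  assumes "\<tau> \<noteq> 0"
  obtains B where "0 \<le> B" "\<And>\<zeta> s. cmod \<zeta> = 1 \<Longrightarrow> s \<in> sphere \<Longrightarrow> norm (f ((\<tau> * \<zeta>) *s s)) \<le> B"
proof -
  have "continuous_on sphere (\<lambda>s. f (\<tau> *s s))"
    by (rule continuous_on_compose2[OF holomorphic_on_submanifold_continuous[OF f]])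
      (auto intro!: continuous_intros sphere_rank_one assms)
  then obtain B where B: "\<forall>s\<in>sphere. norm (f (\<tau> *s s)) \<le> B" using bounded_on_sphere by blast
  have "norm (f ((\<tau> * \<zeta>) *s s)) \<le> B" if "cmod \<zeta> = 1" "s \<in> sphere" for \<zeta> s
    using B smult_sphere[OF that] by (metis vec.scale_scale)
  moreover from this[of 1 c] c have "0 \<le> B" by (simp add: order.trans[OF norm_ge_zero])
  ultimately show ?thesis using that by blast
qed

lemma pair_measurable:
  fixes g :: "real \<times> (complex ^ 'n) \<Rightarrow> 'b::topological_space"
  assumes "continuous_on UNIV g"
  shows "g \<in> borel_measurable (lborel \<Otimes>\<^sub>M \<sigma>)"
proof -
  have "(\<lambda>x. (fst x, snd x)) \<in> measurable (lborel \<Otimes>\<^sub>M \<sigma>) (borel \<Otimes>\<^sub>M borel)"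
    by (intro measurable_Pair measurable_compose[OF measurable_snd measurable_sigma_id]) simp
  then have "(\<lambda>x. x) \<in> measurable (lborel \<Otimes>\<^sub>M \<sigma>) borel" by (simp add: borel_prod)
  from measurable_compose[OF this borel_measurable_continuous_onI[OF assms]] show ?thesis .
qed

lemma pair_measurable_ip:
  fixes X :: "complex \<Rightarrow> complex"
  assumes "continuous_on UNIV X"
  shows "(\<lambda>x :: real \<times> (complex ^ 'n). X (ip (snd x) c)) \<in> borel_measurable (lborel \<Otimes>\<^sub>M \<sigma>)"
proof -
  have "continuous_on UNIV (\<lambda>x :: real \<times> (complex ^ 'n). ip (snd x) c)"
    by (intro continuous_ip continuous_intros)
  from measurable_compose[OF pair_measurable[OF this] borel_measurable_continuous_onI[OF assms]] show ?thesis .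
qed

text \<open>
  For \<open>\<bar>\<zeta>\<bar> = 1\<close> the maps \<open>scaling c \<zeta>\<close> belong to \<open>K\<close> and fix \<open>(s|c)\<close>, so the integrand may be replaced
  by its mean over them. The condition \<open>X 0 = 0\<close> disposes of the \<open>s\<close> orthogonal to \<open>c\<close>, for which the limit
  point \<open>(s|c)c\<close> does not belong to \<open>M\<close>.
\<close>

lemma integral_line:
  assumes X: "continuous_on UNIV X" "X 0 = 0" and \<tau>: "\<tau> \<noteq> 0"
  shows "(LINT s|\<sigma>. X (ip s c) * f (\<tau> *s s)) = (LINT s|\<sigma>. X (ip s c) * f ((\<tau> * ip s c) *s c))"
proof -
  define F where "F t s = X (ip s c) * f (\<tau> *s scaling c (circ t) s)" for t s
  have Xc: "continuous_on sphere (\<lambda>s. X (ip s c))"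
    by (intro continuous_on_compose2[OF X(1)] continuous_ip_left) auto
  obtain BX where BX: "\<forall>s\<in>sphere. norm (X (ip s c)) \<le> BX" using bounded_on_sphere[OF Xc] by blast
  obtain B where B: "0 \<le> B" "\<And>\<zeta> s. cmod \<zeta> = 1 \<Longrightarrow> s \<in> sphere \<Longrightarrow> norm (f ((\<tau> * \<zeta>) *s s)) \<le> B"
    using bounded_scaled_sphere[OF \<tau>] by blast
  have "(LINT s|\<sigma>. X (ip s c) * f ((\<tau> * ip s c) *s c)) = (LINT s|\<sigma>. X (ip s c) * f (\<tau> *s s))"
  proof (rule integral_circle_mean[of F "BX * B"])
    show "(\<lambda>x. F (fst x) (snd x)) \<in> borel_measurable (lborel \<Otimes>\<^sub>M \<sigma>)"
    proof -
      have "(\<lambda>x. \<tau> *s scaling c (circ (fst x)) (snd x)) \<in> measurable (lborel \<Otimes>\<^sub>M \<sigma>) (restrict_space borel M)"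
      proof (rule measurable_restrict_space2)
        show "(\<lambda>x. \<tau> *s scaling c (circ (fst x)) (snd x)) \<in> space (lborel \<Otimes>\<^sub>M \<sigma>) \<rightarrow> M"
          using sphere_rank_one scaling_sphere \<tau> by (auto simp: space_pair_measure space_sigma)
        show "(\<lambda>x. \<tau> *s scaling c (circ (fst x)) (snd x)) \<in> borel_measurable (lborel \<Otimes>\<^sub>M \<sigma>)"
          by (intro pair_measurable continuous_intros continuous_scaling)
      qed
      from measurable_compose[OF this borel_measurable_continuous_on_restrict[OF holomorphic_on_submanifold_continuous[OF f]]]
      have "(\<lambda>x. f (\<tau> *s scaling c (circ (fst x)) (snd x))) \<in> borel_measurable (lborel \<Otimes>\<^sub>M \<sigma>)" .
      moreover have "(\<lambda>x :: real \<times> (complex ^ 'n). X (ip (snd x) c)) \<in> borel_measurable (lborel \<Otimes>\<^sub>M \<sigma>)"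
        by (rule pair_measurable_ip[OF X(1)])
      ultimately show ?thesis unfolding F_def by measurable
    qed
    show "norm (F t s) \<le> BX * B" if "s \<in> sphere" for t s
      unfolding F_def norm_mult
      using BX that B(2)[of 1 "scaling c (circ t) s"] scaling_sphere[OF _ that, of "circ t"] order.trans[OF norm_ge_zero BX[rule_format, OF that]]
      by (intro mult_mono) auto
    show "((\<lambda>t. F t s) has_integral X (ip s c) * f ((\<tau> * ip s c) *s c)) {0..1}" if "s \<in> sphere" for s
      using has_integral_mult_right[OF scaling_circle_mean[OF that _ \<tau>], of "X (ip s c)"] X(2)
      by (cases "ip s c = 0") (auto simp: F_def)
    fix t
    have "(LINT s|\<sigma>. X (ip (matrix (scaling c (circ t)) *v s) c) * f (\<tau> *s (matrix (scaling c (circ t)) *v s))) = (LINT s|\<sigma>. X (ip s c) * f (\<tau> *s s))"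
      by (rule integral_K[OF scaling_in_K[OF primitive_tripotent[OF prim]]], simp)
        (intro measurable_sigma continuous_intros Xc continuous_on_compose2[OF holomorphic_on_submanifold_continuous[OF f]],
          use sphere_rank_one \<tau> in auto)
    then show "(LINT s|\<sigma>. F t s) = (LINT s|\<sigma>. X (ip s c) * f (\<tau> *s s))"
      by (simp add: F_def matrix_works clinear_scaling ip_scaling)
  qed
  then show ?thesis by simp
qed

abbreviation "lcoeff m \<equiv> laurent_coeff (\<lambda>\<tau>. f (\<tau> *s c)) m"

text \<open>
  After \<open>integral_line\<close> only the restriction of \<open>f\<close> to the line through \<open>c\<close> is left, and averaging over the
  rotations \<open>s \<mapsto> \<zeta>s\<close> in \<open>K\<close> selects the Laurent coefficient that matches the homogeneity of \<open>X\<close>.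
\<close>

lemma integral_coeff:
  assumes X: "continuous_on UNIV X" "X 0 = 0" and hom: "\<And>\<zeta> u. cmod \<zeta> = 1 \<Longrightarrow> X (\<zeta> * u) = \<zeta> powi (- m) * X u"
    and \<tau>: "\<tau> \<noteq> 0"
  shows "(LINT s|\<sigma>. X (ip s c) * f (\<tau> *s s)) = lcoeff m * \<tau> powi m * (LINT s|\<sigma>. X (ip s c) * ip s c powi m)"
proof -
  let ?h = "\<lambda>u. indicator (- {0}) u *\<^sub>R f (u *s c)"
  define F where "F t s = X (ip s c) * ?h (\<tau> * ip s c * circ t) * circ t powi (- m)" for t s
  obtain BX where BX: "\<forall>s\<in>sphere. norm (X (ip s c)) \<le> BX"
    using bounded_on_sphere[OF continuous_on_compose2[OF X(1) continuous_ip_left[of sphere c]]] by auto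
  obtain B where B: "0 \<le> B" "\<And>\<zeta> s. cmod \<zeta> = 1 \<Longrightarrow> s \<in> sphere \<Longrightarrow> norm (f ((\<tau> * \<zeta>) *s s)) \<le> B"
    using bounded_scaled_sphere[OF \<tau>] by blast
  have "(LINT s|\<sigma>. X (ip s c) * (lcoeff m * (\<tau> * ip s c) powi m)) = (LINT s|\<sigma>. X (ip s c) * f (\<tau> *s s))"
  proof (rule integral_circle_mean[of F "BX * B"])
    have "?h \<in> borel_measurable borel"
      by (intro borel_measurable_continuous_on_indicator holomorphic_on_imp_continuous_on line_holomorphic) simp
    moreover have "(\<lambda>x. \<tau> * ip (snd x) c * circ (fst x)) \<in> borel_measurable (lborel \<Otimes>\<^sub>M \<sigma>)"
      by (rule pair_measurable) (intro continuous_intros continuous_ip)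
    ultimately have "(\<lambda>x. ?h (\<tau> * ip (snd x) c * circ (fst x))) \<in> borel_measurable (lborel \<Otimes>\<^sub>M \<sigma>)"
      by (rule measurable_compose[rotated])
    moreover have "(\<lambda>x :: real \<times> (complex ^ 'n). X (ip (snd x) c)) \<in> borel_measurable (lborel \<Otimes>\<^sub>M \<sigma>)"
      by (rule pair_measurable_ip[OF X(1)])
    moreover have "(\<lambda>x. circ (fst x) powi (- m)) \<in> borel_measurable (lborel \<Otimes>\<^sub>M \<sigma>)"
      by (intro pair_measurable continuous_intros) auto
    ultimately show "(\<lambda>x. F (fst x) (snd x)) \<in> borel_measurable (lborel \<Otimes>\<^sub>M \<sigma>)"
      unfolding F_def by (intro borel_measurable_times)
    show "norm (F t s) \<le> BX * B" if s: "s \<in> sphere" for t s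
    proof -
      have "norm (?h (\<tau> * ip s c * circ t)) \<le> B"
      proof (cases "ip s c = 0")
        case False
        have "((\<lambda>t'. f ((\<tau> * circ t) *s scaling c (circ t') s)) has_integral f ((\<tau> * circ t * ip s c) *s c)) {0..1}"
          using \<tau> by (intro scaling_circle_mean s False) simp
        moreover have "norm (f ((\<tau> * circ t) *s scaling c (circ t') s)) \<le> B" for t'
          by (intro B(2) scaling_sphere s) simp_all
        ultimately have "norm (f ((\<tau> * circ t * ip s c) *s c)) \<le> B * measure lborel {0..1::real}"
          by (rule has_integral_bound_real[OF B(1) finite.emptyI])
        then have "norm (f ((\<tau> * ip s c * circ t) *s c)) \<le> B" by (simp add: mult_ac)
        then show ?thesis using B(1) by (simp add: indicator_def)
      qed (use B in simp)
      then show ?thesis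
        unfolding F_def norm_mult norm_power_int using BX s order.trans[OF norm_ge_zero BX[rule_format, OF s]]
        by (simp add: mult_mono)
    qed
    show "((\<lambda>t. F t s) has_integral X (ip s c) * (lcoeff m * (\<tau> * ip s c) powi m)) {0..1}" for s
    proof (cases "ip s c = 0")
      case False
      define w where "w = \<tau> * ip s c"
      have w: "w \<noteq> 0" using False \<tau> by (simp add: w_def)
      have "F t s = X (ip s c) * w powi m * (f ((w * circ t) *s c) * (w * circ t) powi (- m))" for t
        unfolding F_def w_def[symmetric] using w by (simp add: power_int_mult_distrib power_int_minus)
      then show ?thesis
        using has_integral_mult_right[OF laurent_coeff_integral[OF line_holomorphic w, of m], of "X (ip s c) * w powi m"]
        by (simp add: w_def mult_ac)
    qed (simp add: F_def X)
    fix t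
    have "(LINT s|\<sigma>. X (ip (mat (circ t) *v s) c) * ?h (\<tau> * ip (mat (circ t) *v s) c)) = (LINT s|\<sigma>. X (ip s c) * ?h (\<tau> * ip s c))"
    proof (rule integral_K[OF rotation_in_K], simp)
      have "(\<lambda>s. ?h (\<tau> * ip s c)) \<in> borel_measurable \<sigma>"
        by (rule measurable_compose[OF measurable_sigma \<open>?h \<in> borel_measurable borel\<close>])
          (intro continuous_intros continuous_ip_left)
      moreover have "(\<lambda>s. X (ip s c)) \<in> borel_measurable \<sigma>"
        by (intro measurable_sigma continuous_on_compose2[OF X(1)] continuous_ip_left) auto
      ultimately show "(\<lambda>s. X (ip s c) * ?h (\<tau> * ip s c)) \<in> borel_measurable \<sigma>" by measurable
    qed
    also have "\<dots> = (LINT s|\<sigma>. X (ip s c) * f ((\<tau> * ip s c) *s c))"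
      by (intro Bochner_Integration.integral_cong refl) (auto simp: X \<tau> indicator_def)
    also have "\<dots> = (LINT s|\<sigma>. X (ip s c) * f (\<tau> *s s))" by (rule integral_line[OF X \<tau>, symmetric])
    also have "(\<lambda>s. X (ip (mat (circ t) *v s) c) * ?h (\<tau> * ip (mat (circ t) *v s) c)) = F t"
    proof
      fix s
      have "X (circ t * ip s c) = circ t powi (- m) * X (ip s c)" by (rule hom) simp
      moreover have "\<tau> * (circ t * ip s c) = \<tau> * ip s c * circ t" by (simp add: mult_ac)
      ultimately show "X (ip (mat (circ t) *v s) c) * ?h (\<tau> * ip (mat (circ t) *v s) c) = F t s"
        unfolding F_def mat_vector ip_scale_left by (simp only: mult_ac)
    qed
    finally show "(LINT s|\<sigma>. F t s) = (LINT s|\<sigma>. X (ip s c) * f (\<tau> *s s))" .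
  qed
  then show ?thesis by (simp add: power_int_mult_distrib mult_ac flip: integral_mult_right_zero)
qed

lemma coeff_positive:
  assumes m: "1 \<le> m" and t: "0 < (t :: real)"
  shows "(LINT s|\<sigma>. f (complex_of_real t *s s) * cnj (ip s c ^ m)) = lcoeff (int m) * of_real t ^ m * of_real (moment c m)"
proof -
  have "(LINT s|\<sigma>. cnj (ip s c) ^ m * f (complex_of_real t *s s))
      = lcoeff (int m) * of_real t powi (int m) * (LINT s|\<sigma>. cnj (ip s c) ^ m * ip s c powi (int m))"
  proof (rule integral_coeff[where X="\<lambda>u. cnj u ^ m"])
    show "cnj (\<zeta> * u) ^ m = \<zeta> powi (- int m) * cnj u ^ m" if "cmod \<zeta> = 1" for \<zeta> u
    proof -
      have "inverse \<zeta> = cnj \<zeta>" using that by (simp add: inverse_complex_def complex_eq_iff cmod_power2 flip: cmod_power2)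
      then show ?thesis by (simp add: power_int_minus power_mult_distrib flip: power_inverse)
    qed
  qed (use m t in \<open>auto intro!: continuous_intros\<close>)
  then show ?thesis by (simp add: mult.commute[of "cnj _ ^ m"] moment_complex[symmetric])
qed

text \<open>
  Take \<open>X u = u\<^sup>n \<bar>u\<bar>\<^sup>2\<close>: it has the homogeneity for the coefficient with index \<open>-n\<close>, vanishes at \<open>0\<close> also
  for \<open>n = 0\<close>, and is bounded by \<open>1\<close> on the sphere. The Cauchy-Schwarz inequality concludes.
\<close>

lemma coeff_nonpositive:
  assumes t: "0 < (t :: real)"
  shows "(cmod (lcoeff (- int n)))\<^sup>2 * inverse (t\<^sup>2) ^ n * (moment c 1)\<^sup>2 \<le> (LINT s|\<sigma>. (cmod (f (complex_of_real t *s s)))\<^sup>2)"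
proof -
  let ?X = "\<lambda>u::complex. u ^ n * (u * cnj u)"
  let ?f = "\<lambda>s. f (complex_of_real t *s s)"
  have "continuous_on sphere ?f"
    using t by (intro continuous_on_compose2[OF holomorphic_on_submanifold_continuous[OF f]] continuous_intros)
      (auto intro!: sphere_rank_one)
  then have fi: "integrable \<sigma> (\<lambda>s. cmod (?f s))" "integrable \<sigma> (\<lambda>s. (cmod (?f s))\<^sup>2)"
    by (intro integrable_sigma continuous_intros; simp)+
  have "(LINT s|\<sigma>. ?X (ip s c) * ?f s) = lcoeff (- int n) * of_real t powi (- int n) * (LINT s|\<sigma>. ?X (ip s c) * ip s c powi (- int n))"
  proof (rule integral_coeff[where X="?X"])
    show "?X (\<zeta> * u) = \<zeta> powi (- (- int n)) * ?X u" if "cmod \<zeta> = 1" for \<zeta> u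
    proof -
      have "\<zeta> * cnj \<zeta> = 1" using that by (simp add: complex_norm_square[symmetric])
      then show ?thesis by (simp add: power_mult_distrib)
    qed
  qed (use t in \<open>auto intro!: continuous_intros\<close>)
  also have "(LINT s|\<sigma>. ?X (ip s c) * ip s c powi (- int n)) = (LINT s|\<sigma>. ip s c ^ 1 * cnj (ip s c ^ 1))"
  proof (intro Bochner_Integration.integral_cong refl)
    fix s show "?X (ip s c) * ip s c powi (- int n) = ip s c ^ 1 * cnj (ip s c ^ 1)"
      by (cases "ip s c = 0") (simp_all add: power_int_minus)
  qed
  also have "\<dots> = complex_of_real (moment c 1)" by (rule moment_complex)
  finally have "norm (lcoeff (- int n) * of_real t powi (- int n) * complex_of_real (moment c 1)) = norm (LINT s|\<sigma>. ?X (ip s c) * ?f s)"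
    by (simp only:)
  also have "\<dots> \<le> (LINT s|\<sigma>. norm (?X (ip s c) * ?f s))" by (rule integral_norm_bound)
  also have "\<dots> \<le> (LINT s|\<sigma>. cmod (?f s))"
  proof (rule integral_mono_AE'[OF fi(1)])
    show "AE s in \<sigma>. norm (?X (ip s c) * ?f s) \<le> cmod (?f s)"
    proof (rule AE_I2)
      fix s assume "s \<in> space \<sigma>"
      then have "ip s s = 1" by (simp add: space_sigma rank_one_tripotent_iff)
      then have "(cmod (ip s c))\<^sup>2 \<le> 1" using ip_cauchy_schwarz_unit[OF prim(2), of s] by simp
      then have "cmod (ip s c) \<le> 1" by (simp add: power_le_one_iff abs_square_le_1)
      then have "cmod (?X (ip s c)) \<le> 1" by (simp add: norm_mult norm_power mult_le_one power_le_one)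
      then show "norm (?X (ip s c) * ?f s) \<le> cmod (?f s)" unfolding norm_mult[of "?X _"] by (simp add: mult_left_le_one_le)
    qed
  qed simp
  finally have 1: "norm (lcoeff (- int n) * of_real t powi (- int n) * complex_of_real (moment c 1)) \<le> (LINT s|\<sigma>. cmod (?f s))" .
  have "(cmod (lcoeff (- int n)))\<^sup>2 * inverse (t\<^sup>2) ^ n * (moment c 1)\<^sup>2 = (norm (lcoeff (- int n) * of_real t powi (- int n) * complex_of_real (moment c 1)))\<^sup>2"
    using t by (simp add: norm_mult norm_power_int power_int_minus power_mult_distrib norm_inverse norm_power flip: power_mult power_inverse) (simp add: mult.commute)
  also have "\<dots> \<le> (LINT s|\<sigma>. cmod (?f s))\<^sup>2" using 1 by (intro power_mono) auto
  also have "\<dots> \<le> (LINT s|\<sigma>. (cmod (?f s))\<^sup>2)"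
    using variance_positive[of "\<lambda>s. cmod (?f s)"] variance_eq[OF fi] by simp
  finally show ?thesis .
qed

end

end

section \<open>The polar measure and the reproducing kernel\<close>

context jordan_sphere begin

context
  fixes \<alpha> \<nu> :: real and p :: nat
  assumes \<alpha>: "0 < \<alpha>" and \<nu>: "0 < \<nu>" and p: "2 \<le> p"
begin

abbreviation "radial \<equiv> radial_measure \<alpha> p \<nu>"

abbreviation "\<rho> \<equiv> polar_measure M \<sigma> \<alpha> p \<nu>"

definition radial_moment :: "nat \<Rightarrow> real" where
  "radial_moment m = \<alpha> ^ (p - 1) * \<nu> powr (- (real p - 1 + real m / \<alpha>)) * Gamma (real p - 1 + real m / \<alpha>)"

lemma radial_moment_pos: "0 < radial_moment m"
proof -
  have "0 < real p - 1 + real m / \<alpha>" using p \<alpha> by (intro add_pos_nonneg) auto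
  then show ?thesis using \<alpha> \<nu> by (simp add: radial_moment_def Gamma_real_pos)
qed

lemma space_radial: "space radial = {0<..}"
  and sets_radial: "sets radial = sets (restrict_space borel {0<..})"
  by (simp_all add: radial_measure_def space_restrict_space sets_restrict_space)

lemma measurable_radial_id: "(\<lambda>t. t) \<in> borel_measurable radial"
  unfolding measurable_cong_sets[OF sets_radial refl] by (rule measurable_restrict_space1) simp

lemma nn_integral_radial:
  assumes "g \<in> borel_measurable borel"
  shows "(\<integral>\<^sup>+ t. g t \<partial>radial) = (\<integral>\<^sup>+ t\<in>{0<..}. ennreal (radial_density \<alpha> p \<nu> t) * g t \<partial>lborel)"
proof -
  have "(\<lambda>t. ennreal (radial_density \<alpha> p \<nu> t)) \<in> borel_measurable (restrict_space lborel {0<..})"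
    by (intro measurable_restrict_space1 measurable_compose[OF _ measurable_ennreal]) simp
  moreover have "g \<in> borel_measurable (restrict_space lborel {0<..})"
    using assms by (intro measurable_restrict_space1) simp
  ultimately have "(\<integral>\<^sup>+ t. g t \<partial>radial) = (\<integral>\<^sup>+ t. ennreal (radial_density \<alpha> p \<nu> t) * g t \<partial>restrict_space lborel {0<..})"
    unfolding radial_measure_def by (rule nn_integral_density)
  also have "\<dots> = (\<integral>\<^sup>+ t\<in>{0<..}. ennreal (radial_density \<alpha> p \<nu> t) * g t \<partial>lborel)"
    by (rule nn_integral_restrict_space) simp
  finally show ?thesis .
qed

lemma radial_density_nonneg: "0 \<le> radial_density \<alpha> p \<nu> t"
  using \<alpha> by (simp add: radial_density_def)

lemma nn_integral_radial_moment:
  "(\<integral>\<^sup>+ t\<in>{0<..}. ennreal (radial_density \<alpha> p \<nu> t) * ennreal (t ^ m) \<partial>lborel) = ennreal (radial_moment m)"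
proof -
  let ?\<beta> = "\<alpha> * (real p - 1) + real m"
  have \<beta>: "0 < ?\<beta>" using \<alpha> p by (intro add_pos_nonneg mult_pos_pos) auto
  have "ennreal (radial_density \<alpha> p \<nu> t) * ennreal (t ^ m) = ennreal (\<alpha> ^ p) * ennreal (t powr (?\<beta> - 1) * exp (- \<nu> * t powr \<alpha>))"
    if t: "0 < t" for t
  proof -
    have "t powr (\<alpha> * (real p - 1) - 1) * t ^ m = t powr (?\<beta> - 1)"
      using t by (simp add: powr_realpow[symmetric] powr_add[symmetric] algebra_simps)
    then have "radial_density \<alpha> p \<nu> t * t ^ m = \<alpha> ^ p * (t powr (?\<beta> - 1) * exp (- \<nu> * t powr \<alpha>))"
      by (simp add: radial_density_def mult_ac)
    then show ?thesis using \<alpha> t radial_density_nonneg[of t] by (simp flip: ennreal_mult)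
  qed
  then have "(\<integral>\<^sup>+ t\<in>{0<..}. ennreal (radial_density \<alpha> p \<nu> t) * ennreal (t ^ m) \<partial>lborel)
      = (\<integral>\<^sup>+ t. ennreal (\<alpha> ^ p) * (ennreal (t powr (?\<beta> - 1) * exp (- \<nu> * t powr \<alpha>)) * indicator {0<..} t) \<partial>lborel)"
    by (intro nn_integral_cong) (auto simp: indicator_def)
  also have "\<dots> = ennreal (\<alpha> ^ p) * ennreal (\<nu> powr (- ?\<beta> / \<alpha>) * Gamma (?\<beta> / \<alpha>) / \<alpha>)"
    by (subst nn_integral_cmult) (simp, simp only: nn_integral_powr_exp[OF \<alpha> \<nu> \<beta>])
  also have "\<dots> = ennreal (radial_moment m)"
  proof -
    let ?B = "real p - 1 + real m / \<alpha>"
    have B: "?\<beta> / \<alpha> = ?B" using \<alpha> by (simp add: add_divide_distrib)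
    have e: "\<nu> powr (- ?\<beta> / \<alpha>) * Gamma (?\<beta> / \<alpha>) / \<alpha> = \<nu> powr (- ?B) * Gamma ?B / \<alpha>"
      unfolding minus_divide_left[symmetric] B ..
    have "0 < ?B" using p \<alpha> by (intro add_pos_nonneg) auto
    then have "0 \<le> \<nu> powr (- ?B) * Gamma ?B / \<alpha>" using \<alpha> Gamma_real_pos[of ?B] by simp
    then have "ennreal (\<alpha> ^ p) * ennreal (\<nu> powr (- ?B) * Gamma ?B / \<alpha>) = ennreal (\<alpha> ^ p * (\<nu> powr (- ?B) * Gamma ?B / \<alpha>))"
      using \<alpha> by (subst ennreal_mult) auto
    also have "\<alpha> ^ p * (\<nu> powr (- ?B) * Gamma ?B / \<alpha>) = radial_moment m"
    proof -
      have "\<alpha> ^ p = \<alpha> * \<alpha> ^ (p - 1)" using p by (cases p) auto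
      then show ?thesis using \<alpha> by (simp add: radial_moment_def)
    qed
    finally show ?thesis unfolding e .
  qed
  finally show ?thesis .
qed

lemma radial_power:
  "integrable radial (\<lambda>t. t ^ m)" "(LINT t|radial. t ^ m) = radial_moment m"
proof -
  have "has_bochner_integral radial (\<lambda>t. t ^ m) (radial_moment m)"
  proof (rule has_bochner_integral_nn_integral)
    show "(\<lambda>t. t ^ m) \<in> borel_measurable radial"
      by (rule borel_measurable_power[OF measurable_radial_id])
    show "AE t in radial. 0 \<le> t ^ m" by (rule AE_I2) (simp add: space_radial)
    show "(\<integral>\<^sup>+ t. ennreal (t ^ m) \<partial>radial) = ennreal (radial_moment m)"
      by (subst nn_integral_radial) (simp_all add: nn_integral_radial_moment)
  qed (rule less_imp_le[OF radial_moment_pos])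
  then show "integrable radial (\<lambda>t. t ^ m)" "(LINT t|radial. t ^ m) = radial_moment m"
    by (simp_all add: has_bochner_integral_iff)
qed

lemma finite_radial: "finite_measure radial"
proof
  have "emeasure radial (space radial) = (\<integral>\<^sup>+ t. 1 \<partial>radial)" by simp
  also have "\<dots> = ennreal (radial_moment 0)"
    using nn_integral_radial_moment[of 0] by (subst nn_integral_radial) simp_all
  finally show "emeasure radial (space radial) \<noteq> \<infinity>" by simp
qed

lemma measurable_polar: "(\<lambda>x. complex_of_real (sqrt (fst x)) *s snd x) \<in> measurable (radial \<Otimes>\<^sub>M \<sigma>) (restrict_space borel M)"
proof (rule measurable_restrict_space2)
  show "(\<lambda>x. complex_of_real (sqrt (fst x)) *s snd x) \<in> space (radial \<Otimes>\<^sub>M \<sigma>) \<rightarrow> M"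
    by (auto simp: space_pair_measure space_radial space_sigma intro!: sphere_rank_one)
  have "(\<lambda>x. (fst x, snd x)) \<in> measurable (radial \<Otimes>\<^sub>M \<sigma>) (borel \<Otimes>\<^sub>M borel)"
    by (rule measurable_Pair[OF measurable_compose[OF measurable_fst measurable_radial_id]
        measurable_compose[OF measurable_snd measurable_sigma_id]])
  then have 1: "(\<lambda>x. x) \<in> measurable (radial \<Otimes>\<^sub>M \<sigma>) borel" by (simp add: borel_prod)
  have 2: "continuous_on UNIV (\<lambda>x :: real \<times> (complex ^ 'n). complex_of_real (sqrt (fst x)) *s snd x)"
    by (intro continuous_intros)
  from measurable_compose[OF 1 borel_measurable_continuous_onI[OF 2]]
  show "(\<lambda>x. complex_of_real (sqrt (fst x)) *s snd x) \<in> borel_measurable (radial \<Otimes>\<^sub>M \<sigma>)" .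
qed

lemma polar_eq: "\<rho> = distr (radial \<Otimes>\<^sub>M \<sigma>) (restrict_space borel M) (\<lambda>x. complex_of_real (sqrt (fst x)) *s snd x)"
  unfolding polar_measure_def case_prod_beta scaleR_vec_complex ..

lemma sets_polar: "sets \<rho> = sets (restrict_space borel M)"
  by (simp add: polar_measure_def)

lemma continuous_measurable_polar: "continuous_on M g \<Longrightarrow> g \<in> borel_measurable \<rho>"
  for g :: "complex ^ 'n \<Rightarrow> 'b::topological_space"
  unfolding measurable_cong_sets[OF sets_polar refl] by (rule borel_measurable_continuous_on_restrict)

lemma polar_integral:
  fixes g :: "complex ^ 'n \<Rightarrow> complex"
  assumes c: "continuous_on M g" and i: "integrable \<rho> g"
  shows "(LINT z|\<rho>. g z) = (LINT t|radial. LINT s|\<sigma>. g (complex_of_real (sqrt t) *s s))"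
proof -
  interpret R: finite_measure radial by (rule finite_radial)
  interpret P: pair_sigma_finite radial \<sigma>
    by (intro pair_sigma_finite.intro R.sigma_finite_measure_axioms sigma_finite_measure_axioms)
  have m: "g \<in> borel_measurable (restrict_space borel M)"
    by (rule borel_measurable_continuous_on_restrict[OF c])
  have "integrable (radial \<Otimes>\<^sub>M \<sigma>) (\<lambda>x. g (complex_of_real (sqrt (fst x)) *s snd x))"
    using i unfolding polar_eq integrable_distr_eq[OF measurable_polar m] .
  from P.integral_fst'[OF this] show ?thesis
    unfolding polar_eq integral_distr[OF measurable_polar m] by simp
qed

lemma power_in_L2:
  assumes c: "c \<in> sphere"
  shows "(\<lambda>z. ip z c ^ m) \<in> holomorphic_L2 M \<rho>"
proof -
  have "holomorphic_several (\<lambda>z. ip z c ^ m) UNIV"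
    unfolding holomorphic_several_def
  proof
    fix z
    note D = has_chol_derivativeD[OF has_chol_derivative_power[OF has_chol_derivative_ip[of c], of m]]
    show "\<exists>F'. Vector_Spaces.linear (*s) (*) F' \<and> ((\<lambda>z. ip z c ^ m) has_derivative F') (at z)"
    proof (intro exI conjI)
      show "((\<lambda>z. ip z c ^ m) has_derivative (\<lambda>h. of_nat m * ip z c ^ (m - 1) * ip h c)) (at z)" by (rule D(1))
      show "Vector_Spaces.linear (*s) (*) (\<lambda>h. of_nat m * ip z c ^ (m - 1) * ip h c)"
        using ip_linear[of c] by (simp add: Vector_Spaces.linear_iff distrib_left)
    qed
  qed
  then have "holomorphic_on_submanifold (\<lambda>z. ip z c ^ m) M"
    unfolding holomorphic_on_submanifold_def by (intro ballI exI[of _ UNIV] exI[of _ "\<lambda>z. ip z c ^ m"]) simp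
  moreover have "integrable \<rho> (\<lambda>z. (cmod (ip z c ^ m))\<^sup>2)"
  proof (rule integrableI_bounded)
    have cont: "continuous_on M (\<lambda>z. (cmod (ip z c ^ m))\<^sup>2)"
      by (intro continuous_intros continuous_ip)
    show "(\<lambda>z. (cmod (ip z c ^ m))\<^sup>2) \<in> borel_measurable \<rho>"
      by (rule continuous_measurable_polar[OF cont])
    have m: "(\<lambda>z. ennreal (norm ((cmod (ip z c ^ m))\<^sup>2))) \<in> borel_measurable (restrict_space borel M)"
      by (intro measurable_compose[OF _ measurable_ennreal] borel_measurable_continuous_on_restrict continuous_on_norm[OF cont])
    have "(\<integral>\<^sup>+ s. ennreal (norm ((cmod (ip (sqrt t *\<^sub>R s) c ^ m))\<^sup>2)) \<partial>\<sigma>) \<le> ennreal (t ^ m)" if t: "0 < t" for t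
    proof -
      have "norm ((cmod (ip (sqrt t *\<^sub>R s) c ^ m))\<^sup>2) \<le> t ^ m" if "s \<in> sphere" for s
      proof -
        have "(cmod (ip s c))\<^sup>2 \<le> 1"
          using ip_cauchy_schwarz_unit[of c s] that c by (simp add: rank_one_tripotent_iff)
        then have "((cmod (ip s c))\<^sup>2) ^ m \<le> 1" by (rule power_le_one[OF zero_le_power2])
        moreover have "norm ((cmod (ip (sqrt t *\<^sub>R s) c ^ m))\<^sup>2) = t ^ m * ((cmod (ip s c))\<^sup>2) ^ m"
        proof -
          have "norm ((cmod (ip (sqrt t *\<^sub>R s) c ^ m))\<^sup>2) = ((sqrt t * cmod (ip s c))\<^sup>2) ^ m"
            using t by (simp add: ip_scaleR_left norm_mult norm_power flip: power_mult) (simp add: mult.commute)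
          then show ?thesis using t by (simp add: power_mult_distrib)
        qed
        ultimately show ?thesis using t by (simp add: mult_left_le)
      qed
      then have "(\<integral>\<^sup>+ s. ennreal (norm ((cmod (ip (sqrt t *\<^sub>R s) c ^ m))\<^sup>2)) \<partial>\<sigma>) \<le> (\<integral>\<^sup>+ s. ennreal (t ^ m) \<partial>\<sigma>)"
        by (intro nn_integral_mono ennreal_leI) (simp add: space_sigma)
      then show ?thesis by (simp add: emeasure_space_1)
    qed
    then have "(\<integral>\<^sup>+ z. ennreal (norm ((cmod (ip z c ^ m))\<^sup>2)) \<partial>\<rho>) \<le> (\<integral>\<^sup>+ t\<in>{0<..}. ennreal (radial_density \<alpha> p \<nu> t) * ennreal (t ^ m) \<partial>lborel)"
      unfolding nn_integral_polar_measure[OF invariant m]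
      by (intro nn_integral_mono) (auto simp: indicator_def intro!: mult_left_mono)
    then show "(\<integral>\<^sup>+ z. ennreal (norm ((cmod (ip z c ^ m))\<^sup>2)) \<partial>\<rho>) < \<infinity>"
      unfolding nn_integral_radial_moment by (auto intro: le_less_trans)
  qed
  ultimately show ?thesis by (simp add: holomorphic_L2_def)
qed

text \<open>
  In this context \<open>f\<close> is the kernel function at the point \<open>w = \<surd>x c\<close>; its squared norm \<open>k\<close> is the value
  of the kernel on the diagonal.
\<close>

context
  fixes f c x w
  assumes f: "f \<in> holomorphic_L2 M \<rho>" and c: "c \<in> sphere" and x: "0 < (x :: real)"
    and w: "w = complex_of_real (sqrt x) *s c"
    and reproducing: "\<And>g. g \<in> holomorphic_L2 M \<rho> \<Longrightarrow> g w = (LINT z|\<rho>. g z * cnj (f z))"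
begin

abbreviation "k \<equiv> LINT z|\<rho>. (cmod (f z))\<^sup>2"

lemma kernel_real: "f w = complex_of_real k"
  by (simp only: reproducing[OF f] complex_norm_square[symmetric] integral_complex_of_real)

lemma f_hol: "holomorphic_on_submanifold f M" and f_int: "integrable \<rho> (\<lambda>z. (cmod (f z))\<^sup>2)"
  using f by (simp_all add: holomorphic_L2_def)

text \<open>The reproducing property for \<open>z \<mapsto> (z|c)\<^sup>m\<close>, evaluated in polar coordinates.\<close>

lemma positive_coeff:
  assumes m: "1 \<le> m"
  shows "lcoeff f c (int m) * complex_of_real (moment c m * radial_moment m) = complex_of_real (sqrt x ^ m)"
proof -
  let ?g = "\<lambda>z. ip z c ^ m"
  note g = power_in_L2[OF c, of m]
  have cont: "continuous_on M (\<lambda>z. f z * cnj (?g z))"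
    by (intro continuous_intros continuous_ip holomorphic_on_submanifold_continuous[OF f_hol])
  have "integrable \<rho> (\<lambda>z. (cmod (f z))\<^sup>2 + (cmod (?g z))\<^sup>2)"
    using f_int g by (simp add: holomorphic_L2_def)
  then have int: "integrable \<rho> (\<lambda>z. f z * cnj (?g z))"
  proof (rule Bochner_Integration.integrable_bound)
    show "(\<lambda>z. f z * cnj (?g z)) \<in> borel_measurable \<rho>" by (rule continuous_measurable_polar[OF cont])
    have "norm (f z * cnj (?g z)) \<le> norm ((cmod (f z))\<^sup>2 + (cmod (?g z))\<^sup>2)" for z
    proof -
      have "0 \<le> (cmod (f z) - cmod (?g z))\<^sup>2 + (cmod (f z))\<^sup>2 + (cmod (?g z))\<^sup>2" by simp
      then have "2 * (cmod (f z) * cmod (?g z)) \<le> 2 * ((cmod (f z))\<^sup>2 + (cmod (?g z))\<^sup>2)"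
        by (simp add: power2_diff)
      then show ?thesis unfolding norm_mult complex_mod_cnj real_norm_def
        by (intro order.trans[OF _ abs_ge_self]) (simp only: mult_le_cancel_left_pos zero_less_numeral)
    qed
    then show "AE z in \<rho>. norm (f z * cnj (?g z)) \<le> norm ((cmod (f z))\<^sup>2 + (cmod (?g z))\<^sup>2)" by (intro AE_I2)
  qed
  have "?g w = (LINT z|\<rho>. cnj (f z * cnj (?g z)))"
    by (subst reproducing[OF g]) (simp add: mult.commute)
  also have "\<dots> = cnj (LINT z|\<rho>. f z * cnj (?g z))" by (rule Bochner_Integration.integral_cnj)
  finally have "cnj (?g w) = (LINT z|\<rho>. f z * cnj (?g z))" by (simp only: complex_cnj_cnj)
  also have "\<dots> = (LINT t|radial. LINT s|\<sigma>. f (complex_of_real (sqrt t) *s s) * cnj (?g (complex_of_real (sqrt t) *s s)))"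
    by (rule polar_integral[OF cont int])
  also have "\<dots> = (LINT t|radial. lcoeff f c (int m) * complex_of_real (moment c m) * complex_of_real (t ^ m))"
  proof (rule Bochner_Integration.integral_cong[OF refl])
    fix t assume "t \<in> space radial"
    then have t: "0 < t" by (simp add: space_radial)
    let ?t = "complex_of_real (sqrt t)"
    have "(LINT s|\<sigma>. f (?t *s s) * cnj (?g (?t *s s))) = ?t ^ m * (LINT s|\<sigma>. f (?t *s s) * cnj (?g s))"
      unfolding integral_mult_right_zero[symmetric]
      by (intro Bochner_Integration.integral_cong refl) (simp add: ip_scale_left power_mult_distrib mult_ac)
    also have "\<dots> = ?t ^ m * (lcoeff f c (int m) * ?t ^ m * complex_of_real (moment c m))"
      using coeff_positive[OF f_hol c m, of "sqrt t"] t by simp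
    also have "\<dots> = lcoeff f c (int m) * complex_of_real (moment c m) * (?t * ?t) ^ m"
      by (simp add: power_mult_distrib mult_ac)
    also have "?t * ?t = complex_of_real t" using t by (simp flip: of_real_mult)
    finally show "(LINT s|\<sigma>. f (?t *s s) * cnj (?g (?t *s s))) = lcoeff f c (int m) * complex_of_real (moment c m) * complex_of_real (t ^ m)"
      by simp
  qed
  also have "\<dots> = lcoeff f c (int m) * complex_of_real (moment c m) * complex_of_real (radial_moment m)"
    unfolding integral_mult_right_zero integral_complex_of_real radial_power(2) ..
  also have "cnj (?g w) = complex_of_real (sqrt x ^ m)"
    using c by (simp add: w ip_scale_left rank_one_tripotent_iff)
  finally show ?thesis by simp
qed

text \<open>
  On the shell \<open>x/8 \<le> t \<le> x/4\<close> the norm of \<open>f\<close> is at most \<open>\<surd>k\<close>, while the power of \<open>\<surd>t\<close> with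
  exponent \<open>-n\<close> is at least \<open>2\<^sup>n\<close> times that of \<open>\<surd>x\<close>.
\<close>

lemma nonpositive_coeff:
  assumes D: "0 < D" "\<And>t. x / 8 \<le> t \<Longrightarrow> t \<le> x / 4 \<Longrightarrow> D \<le> radial_density \<alpha> p \<nu> t" and mom: "0 < moment c 1"
  shows "cmod (lcoeff f c (- int n)) * inverse (sqrt x) ^ n \<le> sqrt (8 * k / (D * x * (moment c 1)\<^sup>2)) * (1 / 2) ^ n"
proof -
  let ?E = "(cmod (lcoeff f c (- int n)))\<^sup>2 * (4 / x) ^ n * (moment c 1)\<^sup>2"
  have cont: "continuous_on M (\<lambda>z. (cmod (f z))\<^sup>2)"
    by (intro continuous_intros holomorphic_on_submanifold_continuous[OF f_hol])
  have k0: "0 \<le> k" by simp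
  have m: "(\<lambda>z. ennreal ((cmod (f z))\<^sup>2)) \<in> borel_measurable (restrict_space borel M)"
    by (intro measurable_compose[OF _ measurable_ennreal] borel_measurable_continuous_on_restrict[OF cont])
  have s: "ennreal ?E \<le> (\<integral>\<^sup>+ s. ennreal ((cmod (f (sqrt t *\<^sub>R s)))\<^sup>2) \<partial>\<sigma>)" if t: "x / 8 \<le> t" "t \<le> x / 4" for t
  proof -
    have t0: "0 < t" using t x by simp
    have "continuous_on sphere (\<lambda>s. (cmod (f (complex_of_real (sqrt t) *s s)))\<^sup>2)"
      using t0 by (intro continuous_on_compose2[OF cont] continuous_intros) (auto intro!: sphere_rank_one)
    then have "(\<integral>\<^sup>+ s. ennreal ((cmod (f (complex_of_real (sqrt t) *s s)))\<^sup>2) \<partial>\<sigma>) = ennreal (LINT s|\<sigma>. (cmod (f (complex_of_real (sqrt t) *s s)))\<^sup>2)"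
      by (intro nn_integral_eq_integral integrable_sigma) auto
    moreover have "?E \<le> (LINT s|\<sigma>. (cmod (f (complex_of_real (sqrt t) *s s)))\<^sup>2)"
    proof -
      have "4 / x \<le> inverse t" using t t0 x by (simp add: field_simps)
      then have "(4 / x) ^ n \<le> inverse t ^ n" using x by (intro power_mono) auto
      then have "?E \<le> (cmod (lcoeff f c (- int n)))\<^sup>2 * inverse t ^ n * (moment c 1)\<^sup>2"
        by (intro mult_right_mono mult_left_mono) auto
      also have "\<dots> \<le> (LINT s|\<sigma>. (cmod (f (complex_of_real (sqrt t) *s s)))\<^sup>2)"
        using coeff_nonpositive[OF f_hol c, of "sqrt t" n] t0 by simp
      finally show ?thesis .
    qed
    ultimately show ?thesis by (simp add: scaleR_vec_complex ennreal_leI)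
  qed
  have "ennreal (D * ?E * (x / 8)) = (\<integral>\<^sup>+ t. ennreal (D * ?E) * indicator {x / 8..x / 4} t \<partial>lborel)"
    using D(1) x by (simp add: nn_integral_cmult_indicator flip: ennreal_mult)
  also have "\<dots> \<le> (\<integral>\<^sup>+ t\<in>{0<..}. ennreal (radial_density \<alpha> p \<nu> t) * (\<integral>\<^sup>+ s. ennreal ((cmod (f (sqrt t *\<^sub>R s)))\<^sup>2) \<partial>\<sigma>) \<partial>lborel)"
  proof (rule nn_integral_mono)
    fix t
    show "ennreal (D * ?E) * indicator {x / 8..x / 4} t
      \<le> ennreal (radial_density \<alpha> p \<nu> t) * (\<integral>\<^sup>+ s. ennreal ((cmod (f (sqrt t *\<^sub>R s)))\<^sup>2) \<partial>\<sigma>) * indicator {0<..} t"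
    proof (cases "t \<in> {x / 8..x / 4}")
      case True
      then have "t \<in> {0<..}" using x by auto
      moreover have "ennreal D * ennreal ?E \<le> ennreal (radial_density \<alpha> p \<nu> t) * (\<integral>\<^sup>+ s. ennreal ((cmod (f (sqrt t *\<^sub>R s)))\<^sup>2) \<partial>\<sigma>)"
        using True D(2)[of t] s[of t] by (intro mult_mono ennreal_leI) auto
      ultimately show ?thesis using True D(1) by (simp add: ennreal_mult)
    qed simp
  qed
  also have "\<dots> = (\<integral>\<^sup>+ z. ennreal ((cmod (f z))\<^sup>2) \<partial>\<rho>)"
    by (rule nn_integral_polar_measure[OF invariant m, symmetric])
  also have "\<dots> = ennreal k" by (intro nn_integral_eq_integral f_int) auto
  finally have "D * ?E * (x / 8) \<le> k" using k0 by (simp add: ennreal_le_iff)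
  then have 1: "(cmod (lcoeff f c (- int n)))\<^sup>2 * (4 / x) ^ n * (D * x * (moment c 1)\<^sup>2) \<le> 8 * k"
    by (simp add: mult_ac)
  have pos: "0 < D * x * (moment c 1)\<^sup>2" using D(1) x mom by simp
  have "(cmod (lcoeff f c (- int n)))\<^sup>2 * (4 / x) ^ n \<le> 8 * k / (D * x * (moment c 1)\<^sup>2)"
    using 1 pos by (simp add: pos_le_divide_eq)
  then have "(cmod (lcoeff f c (- int n)))\<^sup>2 * (4 / x) ^ n * (1 / 4) ^ n \<le> 8 * k / (D * x * (moment c 1)\<^sup>2) * (1 / 4) ^ n"
    by (intro mult_right_mono) auto
  moreover have "(4 / x) ^ n * (1 / 4) ^ n = (inverse (sqrt x) ^ n)\<^sup>2"
  proof -
    have "(inverse (sqrt x) ^ n)\<^sup>2 = ((inverse (sqrt x))\<^sup>2) ^ n" by (simp only: power_mult[symmetric] mult.commute)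
    also have "(inverse (sqrt x))\<^sup>2 = 4 / x * (1 / 4)" using x by (simp add: power_inverse inverse_eq_divide power_divide)
    finally show ?thesis by (simp only: power_mult_distrib)
  qed
  moreover have "(1 / 4 :: real) ^ n = ((1 / 2) ^ n)\<^sup>2"
  proof -
    have "((1 / 2 :: real) ^ n)\<^sup>2 = ((1 / 2)\<^sup>2) ^ n" by (simp only: power_mult[symmetric] mult.commute)
    moreover have "(1 / 2 :: real)\<^sup>2 = 1 / 4" by (simp add: power2_eq_square)
    ultimately show ?thesis by (simp only:)
  qed
  ultimately have 2: "(cmod (lcoeff f c (- int n)) * inverse (sqrt x) ^ n)\<^sup>2 \<le> 8 * k / (D * x * (moment c 1)\<^sup>2) * ((1 / 2) ^ n)\<^sup>2"
    by (simp only: power_mult_distrib mult.assoc)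
  define A where "A = 8 * k / (D * x * (moment c 1)\<^sup>2)"
  from real_sqrt_le_mono[OF 2, folded A_def]
  have "cmod (lcoeff f c (- int n)) * inverse (sqrt x) ^ n \<le> sqrt A * (1 / 2) ^ n"
    using x by (simp add: real_sqrt_mult abs_mult)
  then show ?thesis by (simp only: A_def)
qed

text \<open>
  The Laurent expansion of \<open>f\<close> on the line through \<open>c\<close>, evaluated at \<open>\<surd>x\<close>: the terms of positive index are
  known exactly, and \<open>N\<close> is the sum of the others.
\<close>

theorem kernel_expansion:
  assumes D: "0 < D" "\<And>t. x / 8 \<le> t \<Longrightarrow> t \<le> x / 4 \<Longrightarrow> D \<le> radial_density \<alpha> p \<nu> t"
    and mom: "\<And>m. 0 < moment c m"
  obtains N where "(\<lambda>m. x ^ Suc m / (moment c (Suc m) * radial_moment (Suc m))) sums (k - N)"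
    "\<bar>N\<bar> \<le> 2 * sqrt (8 * k / (D * x * (moment c 1)\<^sup>2))"
proof -
  let ?h = "\<lambda>\<tau>. f (\<tau> *s c)" let ?l = "complex_of_real (sqrt x)"
  let ?A = "sqrt (8 * k / (D * x * (moment c 1)\<^sup>2))"
  have l: "?l \<noteq> 0" using x by simp
  obtain N0 where N0: "(\<lambda>n. lcoeff f c (int n) * ?l ^ n) sums (?h ?l - N0)"
    "(\<lambda>n. lcoeff f c (- int (Suc n)) * inverse ?l ^ Suc n) sums N0"
    by (rule laurent_expansion[OF line_holomorphic[OF f_hol c] l])
  have hl: "?h ?l = complex_of_real k" using kernel_real by (simp add: w)
  have "(\<lambda>n. lcoeff f c (int (Suc n)) * ?l ^ Suc n) sums (complex_of_real k - N0 - lcoeff f c (int 0) * ?l ^ 0)"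
    using N0(1) unfolding hl by (subst sums_Suc_iff) simp
  moreover have "lcoeff f c (int (Suc n)) * ?l ^ Suc n = complex_of_real (x ^ Suc n / (moment c (Suc n) * radial_moment (Suc n)))" for n
  proof -
    let ?P = "moment c (Suc n) * radial_moment (Suc n)"
    have P: "?P \<noteq> 0" using mom[of "Suc n"] radial_moment_pos[of "Suc n"] by simp
    then have "lcoeff f c (int (Suc n)) = complex_of_real (sqrt x ^ Suc n / ?P)"
      using positive_coeff[of "Suc n"] by (simp add: field_simps del: power_Suc of_real_mult)
    then have "lcoeff f c (int (Suc n)) * ?l ^ Suc n = complex_of_real (sqrt x ^ Suc n / ?P * sqrt x ^ Suc n)"
      by (simp only: of_real_mult of_real_power)
    also have "sqrt x ^ Suc n / ?P * sqrt x ^ Suc n = (sqrt x * sqrt x) ^ Suc n / ?P" by (simp only: power_mult_distrib) simp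
    finally show ?thesis using x by simp
  qed
  ultimately have 1: "(\<lambda>n. complex_of_real (x ^ Suc n / (moment c (Suc n) * radial_moment (Suc n)))) sums (complex_of_real k - (N0 + lcoeff f c 0))"
    by (simp only:) (simp add: algebra_simps)
  define N where "N = Re (N0 + lcoeff f c 0)"
  have 2: "(\<lambda>n. x ^ Suc n / (moment c (Suc n) * radial_moment (Suc n))) sums (k - N)"
    using sums_Re[OF 1] by (simp add: N_def)
  have "(\<lambda>n. lcoeff f c (- int n) * inverse ?l ^ n) sums (N0 + lcoeff f c (- int 0) * inverse ?l ^ 0)"
    using N0(2) by (rule sums_Suc)
  then have 3: "(\<lambda>n. lcoeff f c (- int n) * inverse ?l ^ n) sums (N0 + lcoeff f c 0)" by simp
  have b: "norm (lcoeff f c (- int n) * inverse ?l ^ n) \<le> ?A * (1 / 2) ^ n" for n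
    using nonpositive_coeff[OF D mom, of n] x by (simp add: norm_mult norm_power norm_inverse)
  have g: "(\<lambda>n. ?A * (1 / 2) ^ n) sums (?A * 2)"
    using sums_mult[OF geometric_sums[of "1/2::real"], of ?A] by simp
  have "norm (\<Sum>n. lcoeff f c (- int n) * inverse ?l ^ n) \<le> (\<Sum>n. ?A * (1 / 2) ^ n)"
    by (rule norm_suminf_le[OF b sums_summable[OF g]])
  then have "norm (N0 + lcoeff f c 0) \<le> ?A * 2" using sums_unique[OF g] sums_unique[OF 3] by simp
  then have "\<bar>N\<bar> \<le> 2 * ?A" using abs_Re_le_cmod[of "N0 + lcoeff f c 0"] by (simp add: N_def)
  with 2 show ?thesis by (rule that)
qed

end

end

end

section \<open>Asymptotics of the kernel series\<close>

text \<open>Falling factorials are used because those of \<open>w\<close> cancel against the leading factors of \<open>Gamma (w + 1)\<close>.\<close>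

lemma falling_basis_expansion:
  fixes Q :: "real poly" and q c :: real
  assumes q: "q \<noteq> 0" and deg: "degree Q \<le> N"
  shows "\<exists>\<gamma>. (\<forall>u. poly Q u = (\<Sum>n\<le>N. \<gamma> n * (\<Prod>i<n. q * u + c - real i))) \<and> \<gamma> N = coeff Q N / q ^ N"
  using deg
proof (induction N arbitrary: Q)
  case 0
  then have "degree Q = 0" by simp
  then obtain x where "Q = [:x:]" by (rule degree_eq_zeroE)
  then show ?case by (intro exI[of _ "\<lambda>_. x"]) simp
next
  case (Suc N)
  define B where "B = (\<Prod>i<Suc N. [:c - real i, q:])"
  have degB: "degree B = Suc N"
    unfolding B_def using q by (subst degree_prod_eq_sum_degree) auto
  have "lead_coeff B = q ^ Suc N"
    unfolding B_def lead_coeff_prod using q by simp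
  then have B: "coeff B (Suc N) = q ^ Suc N" by (simp add: degB)
  define g where "g = coeff Q (Suc N) / q ^ Suc N"
  define Q' where "Q' = Q - smult g B"
  have "degree Q' \<le> N"
  proof (rule degree_le, intro allI impI)
    fix i assume i: "N < i"
    show "coeff Q' i = 0"
    proof (cases "i = Suc N")
      case True
      then show ?thesis using q by (simp add: Q'_def B g_def del: power_Suc)
    next
      case False
      then have "Suc N < i" using i by simp
      then show ?thesis using Suc.prems degB by (simp add: Q'_def coeff_eq_0)
    qed
  qed
  from Suc.IH[OF this]
  obtain \<gamma> where \<gamma>: "\<And>u. poly Q' u = (\<Sum>n\<le>N. \<gamma> n * (\<Prod>i<n. q * u + c - real i))" by auto
  have Bu: "poly B u = (\<Prod>i<Suc N. q * u + c - real i)" for u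
    unfolding B_def poly_prod by (intro prod.cong refl) (simp add: algebra_simps)
  have "poly Q u = (\<Sum>n\<le>Suc N. (\<gamma>(Suc N := g)) n * (\<Prod>i<n. q * u + c - real i))" for u
  proof -
    have "poly Q u = poly Q' u + g * poly B u" by (simp add: Q'_def)
    moreover have "(\<Sum>n\<le>N. (\<gamma>(Suc N := g)) n * (\<Prod>i<n. q * u + c - real i)) = poly Q' u"
      unfolding \<gamma> by (intro sum.cong) auto
    ultimately show ?thesis by (simp add: Bu del: prod.lessThan_Suc)
  qed
  then show ?case by (intro exI[of _ "\<gamma>(Suc N := g)"] conjI allI) (simp_all add: g_def)
qed

lemma Gamma_falling:
  fixes w :: real
  assumes "real n < w + 1"
  shows "Gamma (w + 1) = (\<Prod>i<n. w - real i) * Gamma (w + 1 - real n)"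
  using assms
proof (induction n)
  case (Suc n)
  have "Gamma (w + 1) = (\<Prod>i<n. w - real i) * Gamma (w + 1 - real n)" using Suc by simp
  also have "w + 1 - real n = (w - real n) + 1" by simp
  also have "Gamma ((w - real n) + 1) = (w - real n) * Gamma (w - real n)"
    using Suc.prems by (intro Gamma_plus1) (auto elim!: nonpos_Ints_cases)
  also have "w - real n = w + 1 - real (Suc n)" by simp
  finally show ?case by simp
qed simp

text \<open>
  Finitely many terms are powers of \<open>Y\<close> and negligible, so the series may as well begin at an index where
  the exponents are large enough for \<open>mittag_leffler_asymptotics\<close>.
\<close>

lemma mittag_leffler_tail:
  fixes q g :: real
  assumes q: "0 < q" and g: "1 \<le> g"
  defines "t \<equiv> \<lambda>Y n. Y powr (q * real n + g - 1) / Gamma (q * real n + g)"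
  shows "\<exists>\<kappa><1. (\<forall>Y>0. summable (t Y)) \<and> (\<lambda>Y. (\<Sum>n. t Y (Suc n)) - exp Y / q) \<in> O[at_top](\<lambda>Y. exp (\<kappa> * Y))"
proof -
  define M where "M = nat \<lceil>3 / q\<rceil>"
  have "3 / q \<le> real M" unfolding M_def by linarith
  then have M: "3 \<le> q * real M" using q by (simp add: field_simps)
  then have M1: "1 \<le> M" using q by (cases M) auto
  define s where "s = q * real M + g"
  have s: "3 \<le> s" using M g by (simp add: s_def)
  have shift: "t Y (n + M) = Y powr (q * real n + s - 1) / Gamma (q * real n + s)" for Y n
    by (simp add: t_def s_def algebra_simps)
  obtain k C where k: "1/2 \<le> k" "k < 1" "0 \<le> C"
    and bd: "\<And>Y. 0 \<le> Y \<Longrightarrow> \<bar>(\<Sum>m. Y powr (q * real m + s - 1) / Gamma (q * real m + s)) - exp Y / q\<bar> \<le> C * exp (k * Y)"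
    by (rule mittag_leffler_asymptotics[OF q s], rule that) blast+
  have sum: "summable (t Y)" if "0 < Y" for Y
    using mittag_leffler_summable[OF q s, of Y] that by (subst summable_iff_shift[of _ M, symmetric]) (simp add: shift)
  have split: "(\<Sum>n. t Y (Suc n)) = (\<Sum>n. t Y (n + M)) + (\<Sum>n<M - 1. t Y (Suc n))" if "0 < Y" for Y
  proof -
    have "summable (\<lambda>n. t Y (Suc n))" using sum[OF that] by (subst summable_Suc_iff)
    from suminf_split_initial_segment[OF this, of "M - 1"] show ?thesis using M1 by simp
  qed
  have "(\<lambda>Y. (\<Sum>n. t Y (n + M)) - exp Y / q) \<in> O[at_top](\<lambda>Y. exp (k * Y))"
    using bd by (intro bigoI[of _ C] eventually_at_top_linorderI[of 0]) (auto simp: shift)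
  moreover have "(\<lambda>Y. \<Sum>n<M - 1. t Y (Suc n)) \<in> O[at_top](\<lambda>Y. exp (k * Y))"
  proof (rule big_sum_in_bigo)
    fix n
    have "(\<lambda>Y::real. Y powr (q * real (Suc n) + g - 1)) \<in> O[at_top](\<lambda>Y. exp (k * Y))"
      using k by real_asymp
    moreover have "(\<lambda>_. inverse (Gamma (q * real (Suc n) + g))) \<in> O[at_top](\<lambda>_ :: real. 1)"
      by (rule bigoI[of _ "\<bar>inverse (Gamma (q * real (Suc n) + g))\<bar>"]) simp
    ultimately have "(\<lambda>Y. Y powr (q * real (Suc n) + g - 1) * inverse (Gamma (q * real (Suc n) + g))) \<in> O[at_top](\<lambda>Y. exp (k * Y) * 1)"
      by (rule landau_o.big.mult)
    then show "(\<lambda>Y. t Y (Suc n)) \<in> O[at_top](\<lambda>Y. exp (k * Y))"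
      by (simp only: t_def divide_inverse mult_1_right)
  qed
  ultimately have "(\<lambda>Y. ((\<Sum>n. t Y (n + M)) - exp Y / q) + (\<Sum>n<M - 1. t Y (Suc n))) \<in> O[at_top](\<lambda>Y. exp (k * Y))"
    by (rule sum_in_bigo)
  moreover have "eventually (\<lambda>Y. ((\<Sum>n. t Y (n + M)) - exp Y / q) + (\<Sum>n<M - 1. t Y (Suc n)) = (\<Sum>n. t Y (Suc n)) - exp Y / q) at_top"
    using eventually_gt_at_top[of 0] by eventually_elim (simp add: split)
  ultimately have "(\<lambda>Y. (\<Sum>n. t Y (Suc n)) - exp Y / q) \<in> O[at_top](\<lambda>Y. exp (k * Y))"
    by (rule landau_o.big.in_cong[THEN iffD1, rotated])
  then show ?thesis using k(2) sum by (intro exI[of _ k]) simp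
qed

lemma bigo_exp_mono:
  fixes f :: "real \<Rightarrow> real"
  assumes "f \<in> O[at_top](\<lambda>Y. exp (\<kappa> * Y))" "\<kappa> \<le> \<kappa>'"
  shows "f \<in> O[at_top](\<lambda>Y. exp (\<kappa>' * Y))"
proof -
  have "(\<lambda>Y. exp (\<kappa> * Y)) \<in> O[at_top](\<lambda>Y. exp (\<kappa>' * Y))"
    using assms(2) by (intro bigoI[of _ 1] eventually_at_top_linorderI[of 0]) (auto intro: mult_right_mono)
  with assms(1) show ?thesis by (rule landau_o.big_trans)
qed

text \<open>
  Expand \<open>Q\<close> in the falling factorials of \<open>qm + N\<close>. The one of degree \<open>n\<close> lowers the argument of \<open>Gamma\<close> by \<open>n\<close>
  and leaves \<open>Y\<close> to the power \<open>-(N - n)\<close> times a Mittag-Leffler sum, whose leading term is \<open>e\<^sup>Y/q\<close>.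
\<close>

theorem polynomial_exponential_series:
  fixes Q :: "real poly" and q :: real
  assumes q: "0 < q" and deg: "degree Q \<le> N"
  defines "term \<equiv> \<lambda>Y m. poly Q (real m) * Y powr (q * real m) / Gamma (q * real m + real N + 1)"
  obtains \<gamma> \<kappa> where "\<kappa> < 1" "\<gamma> N = coeff Q N / q ^ N" "\<And>Y. 0 < Y \<Longrightarrow> summable (term Y)"
    "(\<lambda>Y. (\<Sum>m. term Y (Suc m)) - exp Y / q * (\<Sum>n\<le>N. \<gamma> n / Y ^ (N - n))) \<in> O[at_top](\<lambda>Y. exp (\<kappa> * Y))"
proof -
  from falling_basis_expansion[of q Q N "real N"] q deg
  obtain \<gamma> where \<gamma>: "\<And>u. poly Q u = (\<Sum>n\<le>N. \<gamma> n * (\<Prod>i<n. q * u + real N - real i))" "\<gamma> N = coeff Q N / q ^ N"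
    by auto
  define g where "g n = real (N - n) + 1" for n
  define t where "t n Y m = Y powr (q * real m + g n - 1) / Gamma (q * real m + g n)" for n Y m
  have "\<forall>n. \<exists>\<kappa><1. (\<forall>Y>0. summable (t n Y)) \<and> (\<lambda>Y. (\<Sum>m. t n Y (Suc m)) - exp Y / q) \<in> O[at_top](\<lambda>Y. exp (\<kappa> * Y))"
  proof
    fix n
    have "1 \<le> g n" by (simp add: g_def)
    then show "\<exists>\<kappa><1. (\<forall>Y>0. summable (t n Y)) \<and> (\<lambda>Y. (\<Sum>m. t n Y (Suc m)) - exp Y / q) \<in> O[at_top](\<lambda>Y. exp (\<kappa> * Y))"
      unfolding t_def by (rule mittag_leffler_tail[OF q])
  qed
  then obtain \<kappa>0 where \<kappa>0: "\<And>n. \<kappa>0 n < 1" "\<And>n Y. 0 < Y \<Longrightarrow> summable (t n Y)"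
    "\<And>n. (\<lambda>Y. (\<Sum>m. t n Y (Suc m)) - exp Y / q) \<in> O[at_top](\<lambda>Y. exp (\<kappa>0 n * Y))"
    by (auto dest!: choice)
  define \<kappa> where "\<kappa> = Max (\<kappa>0 ` {..N})"
  have \<kappa>: "\<kappa> < 1" "\<And>n. n \<le> N \<Longrightarrow> \<kappa>0 n \<le> \<kappa>" using \<kappa>0(1) by (auto simp: \<kappa>_def)
  have term_eq: "term Y m = (\<Sum>n\<le>N. \<gamma> n / Y ^ (N - n) * t n Y m)" if Y: "0 < Y" for Y m
  proof -
    have "(\<Prod>i<n. q * real m + real N - real i) * Y powr (q * real m) / Gamma (q * real m + real N + 1) = t n Y m / Y ^ (N - n)"
      if n: "n \<le> N" for n
    proof -
      let ?w = "q * real m + real N"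
      have "0 \<le> q * real m" using q by simp
      then have G: "Gamma (?w + 1) = (\<Prod>i<n. ?w - real i) * Gamma (?w + 1 - real n)" and pos: "0 < ?w + 1 - real n"
        using n by (auto intro!: Gamma_falling)
      have "0 < Gamma (?w + 1)" using \<open>0 \<le> q * real m\<close> by (intro Gamma_real_pos) simp
      then have nz: "(\<Prod>i<n. ?w - real i) \<noteq> 0" by (metis G mult_zero_left less_irrefl)
      have g: "q * real m + g n = ?w + 1 - real n" using n by (simp add: g_def of_nat_diff)
      have "Y powr (q * real m + g n - 1) = Y powr (q * real m) * Y ^ (N - n)"
        using Y by (simp add: g_def powr_add powr_realpow)
      then have "t n Y m / Y ^ (N - n) = Y powr (q * real m) / Gamma (?w + 1 - real n)"
        using Y by (simp add: t_def g)
      also have "\<dots> = (\<Prod>i<n. ?w - real i) * Y powr (q * real m) / Gamma (?w + 1)"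
        unfolding G using nz by simp
      finally show ?thesis by simp
    qed
    then have "\<gamma> n * ((\<Prod>i<n. q * real m + real N - real i) * Y powr (q * real m) / Gamma (q * real m + real N + 1)) = \<gamma> n / Y ^ (N - n) * t n Y m"
      if "n \<le> N" for n using that by simp
    then show ?thesis
      unfolding term_def \<gamma>(1) sum_distrib_right sum_divide_distrib by (intro sum.cong refl) (simp add: mult.assoc)
  qed
  have summable: "summable (term Y)" if "0 < Y" for Y
  proof -
    have "summable (\<lambda>m. \<Sum>n\<le>N. \<gamma> n / Y ^ (N - n) * t n Y m)"
      by (intro summable_sum summable_mult \<kappa>0(2) that)
    moreover have "term Y = (\<lambda>m. \<Sum>n\<le>N. \<gamma> n / Y ^ (N - n) * t n Y m)" by (intro ext term_eq that)
    ultimately show ?thesis by (simp only:)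
  qed
  have "(\<lambda>Y. \<Sum>n\<le>N. \<gamma> n / Y ^ (N - n) * ((\<Sum>m. t n Y (Suc m)) - exp Y / q)) \<in> O[at_top](\<lambda>Y. exp (\<kappa> * Y))"
  proof (rule big_sum_in_bigo)
    fix n assume "n \<in> {..N}"
    then have "\<kappa>0 n \<le> \<kappa>" by (intro \<kappa>(2)) simp
    with \<kappa>0(3) have "(\<lambda>Y. (\<Sum>m. t n Y (Suc m)) - exp Y / q) \<in> O[at_top](\<lambda>Y. exp (\<kappa> * Y))"
      by (rule bigo_exp_mono)
    moreover have "(\<lambda>Y. \<gamma> n / Y ^ (N - n)) \<in> O[at_top](\<lambda>_. 1)"
    proof (rule bigoI[of _ "\<bar>\<gamma> n\<bar>"], rule eventually_at_top_linorderI[of 1])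
      fix Y :: real assume "1 \<le> Y"
      then have "1 \<le> Y ^ (N - n)" by simp
      then show "norm (\<gamma> n / Y ^ (N - n)) \<le> \<bar>\<gamma> n\<bar> * norm (1 :: real)"
        using frac_le[of "\<bar>\<gamma> n\<bar>" "\<bar>\<gamma> n\<bar>" 1 "Y ^ (N - n)"] \<open>1 \<le> Y\<close> by (simp add: abs_divide)
    qed
    ultimately have "(\<lambda>Y. \<gamma> n / Y ^ (N - n) * ((\<Sum>m. t n Y (Suc m)) - exp Y / q)) \<in> O[at_top](\<lambda>Y. 1 * exp (\<kappa> * Y))"
      by (rule landau_o.big.mult[rotated])
    then show "(\<lambda>Y. \<gamma> n / Y ^ (N - n) * ((\<Sum>m. t n Y (Suc m)) - exp Y / q)) \<in> O[at_top](\<lambda>Y. exp (\<kappa> * Y))" by simp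
  qed
  moreover have "(\<Sum>n\<le>N. \<gamma> n / Y ^ (N - n) * ((\<Sum>m. t n Y (Suc m)) - exp Y / q))
      = (\<Sum>m. term Y (Suc m)) - exp Y / q * (\<Sum>n\<le>N. \<gamma> n / Y ^ (N - n))" if Y: "0 < Y" for Y
  proof -
    have "(\<lambda>m. t n Y (Suc m)) sums (\<Sum>m. t n Y (Suc m))" for n
      using \<kappa>0(2)[OF Y, of n] by (intro summable_sums) (simp add: summable_Suc_iff)
    then have "(\<lambda>m. \<Sum>n\<le>N. \<gamma> n / Y ^ (N - n) * t n Y (Suc m)) sums (\<Sum>n\<le>N. \<gamma> n / Y ^ (N - n) * (\<Sum>m. t n Y (Suc m)))"
      by (intro sums_sum sums_mult)
    then have "(\<Sum>m. term Y (Suc m)) = (\<Sum>n\<le>N. \<gamma> n / Y ^ (N - n) * (\<Sum>m. t n Y (Suc m)))"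
      unfolding term_eq[OF Y] by (simp add: sums_iff)
    then show ?thesis by (simp add: right_diff_distrib sum_subtractf sum_distrib_left mult_ac)
  qed
  from eventually_mono[OF eventually_gt_at_top[of 0] this]
  have "eventually (\<lambda>Y. (\<Sum>n\<le>N. \<gamma> n / Y ^ (N - n) * ((\<Sum>m. t n Y (Suc m)) - exp Y / q))
      = (\<Sum>m. term Y (Suc m)) - exp Y / q * (\<Sum>n\<le>N. \<gamma> n / Y ^ (N - n))) at_top"
    by simp
  ultimately have "(\<lambda>Y. (\<Sum>m. term Y (Suc m)) - exp Y / q * (\<Sum>n\<le>N. \<gamma> n / Y ^ (N - n))) \<in> O[at_top](\<lambda>Y. exp (\<kappa> * Y))"
    by (rule landau_o.big.in_cong[THEN iffD1, rotated])
  with \<kappa>(1) \<gamma>(2) summable show ?thesis by (rule that)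
qed

lemma pochhammer_poly:
  "\<exists>Q :: real poly. degree Q = N \<and> lead_coeff Q = 1 \<and> (\<forall>x. poly Q x = pochhammer (z + x) N)"
proof (intro exI conjI allI)
  let ?Q = "\<Prod>i<N. [:z + real i, 1:]"
  show "degree ?Q = N" by (subst degree_prod_eq_sum_degree) auto
  show "lead_coeff ?Q = 1" by (simp add: lead_coeff_prod)
  show "poly ?Q x = pochhammer (z + x) N" for x
    by (simp add: poly_prod pochhammer_prod atLeast0LessThan algebra_simps)
qed

lemma Gamma_ratio_poly:
  fixes A z1 z2 :: real
  assumes "0 < z1" "0 < z2"
  obtains Q :: "real poly" where "degree Q = N1 + N2" "lead_coeff Q = 1"
    "\<And>m::nat. poly Q (real m) = (Gamma (z1 + real N1 + real m) * Gamma (z2 + real N2 + real m)) / (Gamma (z1 + real m) * Gamma (z2 + real m))"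
proof -
  obtain Q1 :: "real poly" where Q1: "degree Q1 = N1" "lead_coeff Q1 = 1" "\<And>x. poly Q1 x = pochhammer (z1 + x) N1"
    using pochhammer_poly by metis
  obtain Q2 :: "real poly" where Q2: "degree Q2 = N2" "lead_coeff Q2 = 1" "\<And>x. poly Q2 x = pochhammer (z2 + x) N2"
    using pochhammer_poly by metis
  have nz: "Q1 \<noteq> 0" "Q2 \<noteq> 0" using Q1(2) Q2(2) by auto
  have P: "pochhammer (z + real m) N = Gamma (z + real N + real m) / Gamma (z + real m)" if "0 < z" for z :: real and m N
    using that by (subst pochhammer_Gamma) (auto simp: add_ac elim!: nonpos_Ints_cases)
  show ?thesis
  proof (rule that[of "Q1 * Q2"])
    show "degree (Q1 * Q2) = N1 + N2" using nz Q1(1) Q2(1) by (simp add: degree_mult_eq)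
    show "lead_coeff (Q1 * Q2) = 1" unfolding lead_coeff_mult Q1(2) Q2(2) by simp
  qed (simp add: Q1(3) Q2(3) P assms)
qed

lemma (in jordan_sphere) moment_conjugate:
  assumes "c \<in> sphere"
  obtains i where "i \<in> {1..r}" "\<And>m. moment c m = moment (e i) m"
proof -
  have c: "primitive c" "ip c c = 1" using assms by (auto simp: rank_one_tripotent_iff)
  have "c \<in> M" using sphere_rank_one[OF assms, of 1] by simp
  then obtain i k l where i: "i \<in> {1..r}" and k: "k \<in> jt_K T" and l: "0 < l" "c = k *v (l *\<^sub>R e i)"
    unfolding rank_one_conjugate by blast
  have "ip c c = ip (l *\<^sub>R e i) (l *\<^sub>R e i)" unfolding l(2) by (rule ip_K[OF k])
  then have "complex_of_real (l * l) = 1" using c(2) ip_e[OF i] by (simp add: ip_scaleR_left ip_scaleR_right)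
  then have "l * l = 1" by (metis of_real_eq_1_iff)
  then have "l = 1" using l(1) by (simp add: square_eq_1_iff)
  then have "c = k *v e i" using l(2) by simp
  then show ?thesis using moment_K[OF k] i that by metis
qed

text \<open>
  By \<open>moment_formula\<close>, \<open>1 / moment c m\<close> is a ratio of Gamma functions with arguments \<open>d/r + m\<close>, \<open>ar/2 + m\<close> over
  \<open>1 + m\<close>, \<open>a/2 + m\<close>. Depending on the parity of \<open>a (r - 1)\<close>, the former exceed the latter by natural numbers
  when paired in one way or the other, so the ratio is a polynomial in \<open>m\<close>.
\<close>

lemma (in jordan_sphere) inverse_moment_poly:
  assumes r: "1 \<le> r"
  defines "L \<equiv> Gamma (real a / 2) / (Gamma (real CARD('n) / real r) * Gamma (real a * real r / 2))"
  obtains Q where "degree Q = a * (r - 1) + b" "lead_coeff Q = L" "0 < L"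
    "\<And>c m. c \<in> sphere \<Longrightarrow> 1 / moment c m = poly Q (real m)" "\<And>c m. c \<in> sphere \<Longrightarrow> 0 < moment c m"
proof -
  have a: "0 < a" using multiplicity_positive[of 1] r by simp
  define dr where "dr = real CARD('n) / real r"
  have "2 * real CARD('n) = real r * (2 + real a * (real r - 1) + 2 * real b)"
    using arg_cong[OF dimension, of real] r by (simp add: of_nat_diff distrib_left)
  then have dr: "dr = 1 + real a * (real r - 1) / 2 + real b" using r by (simp add: dr_def field_simps)
  have dr0: "0 < dr" using r by (simp add: dr add_pos_nonneg)
  have ar0: "0 < real a * real r / 2" using a r by simp
  have L: "0 < L" using a dr0 ar0 by (simp add: L_def Gamma_real_pos flip: dr_def)
  have formula: "moment c m = (1 / L) * (Gamma (real a / 2 + real m) * Gamma (1 + real m) / (Gamma (dr + real m) * Gamma (real a * real r / 2 + real m)))"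
    if c: "c \<in> sphere" for c m
  proof -
    obtain i where i: "i \<in> {1..r}" "\<And>m. moment c m = moment (e i) m" using moment_conjugate[OF c] by blast
    have P: "pochhammer z m = Gamma (z + real m) / Gamma z" if "0 < z" for z :: real
      using that by (subst pochhammer_Gamma) (auto elim!: nonpos_Ints_cases)
    have "fact m = Gamma (1 + real m)" by (simp add: Gamma_fact add.commute)
    then show ?thesis
      unfolding i(2) moment_formula[OF i(1)] dr_def[symmetric] P[OF dr0] P[OF ar0]
      using P[of "real a / 2"] a by (simp add: L_def dr_def)
  qed
  have Gpos: "0 < Gamma (z + real m)" if "0 < z" for z :: real and m
    using that by (intro Gamma_real_pos) simp
  have mom: "0 < moment c m" if "c \<in> sphere" for c m
    unfolding formula[OF that] using L Gpos[OF dr0] Gpos[OF ar0] Gpos[of "real a / 2"] Gpos[of 1] a by simp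
  obtain N1 N2 where N: "N1 + N2 = a * (r - 1) + b"
    "(dr = 1 + real N1 \<and> real a * real r / 2 = real a / 2 + real N2) \<or> (dr = real a / 2 + real N2 \<and> real a * real r / 2 = 1 + real N1)"
  proof (cases "even (a * (r - 1))")
    case True
    then obtain n where n: "a * (r - 1) = 2 * n" by blast
    from arg_cong[OF this, of real] have n': "real a * (real r - 1) = 2 * real n" using r by (simp add: of_nat_diff)
    have "dr = 1 + real (n + b)" unfolding dr n' by simp
    moreover have "real a * real r / 2 = (real a * (real r - 1) + real a) / 2" by (simp add: algebra_simps)
    then have "real a * real r / 2 = real a / 2 + real n" unfolding n' by simp
    ultimately show ?thesis using n by (intro that[of "n + b" n]) simp_all
  next
    case False
    then obtain n where n: "a * (r - 1) = 2 * n + 1" by (rule oddE)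
    from arg_cong[OF this, of real] have n': "real a * (real r - 1) = 2 * real n + 1" using r by (simp add: of_nat_diff)
    have "odd a" using False by simp
    then obtain u where u: "a = 2 * u + 1" by (rule oddE)
    have "1 \<le> r - 1" using False by (cases "r - 1") auto
    then have "a \<le> a * (r - 1)" by simp
    then have un: "u \<le> n" using n u by simp
    have u': "real a = 2 * real u + 1" using u by simp
    have "dr = real a / 2 + real (1 + (n - u) + b)" unfolding dr n' unfolding u' using un by (simp add: of_nat_diff field_simps)
    moreover have "real a * real r / 2 = (real a * (real r - 1) + real a) / 2" by (simp add: algebra_simps)
    then have "real a * real r / 2 = 1 + real (n + u)" unfolding n' unfolding u' by simp
    moreover have "n + u + (1 + (n - u) + b) = a * (r - 1) + b" using n un by simp
    ultimately show ?thesis by (intro that[of "n + u" "1 + (n - u) + b"]) simp_all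
  qed
  obtain Q :: "real poly" where Q: "degree Q = N1 + N2" "lead_coeff Q = 1"
    "\<And>m::nat. poly Q (real m) = (Gamma (1 + real N1 + real m) * Gamma (real a / 2 + real N2 + real m)) / (Gamma (1 + real m) * Gamma (real a / 2 + real m))"
    using Gamma_ratio_poly[of 1 "real a / 2" N1 N2] a by auto
  have "1 / moment c m = poly (smult L Q) (real m)" if c: "c \<in> sphere" for c m
  proof -
    have "Gamma (1 + real N1 + real m) * Gamma (real a / 2 + real N2 + real m) = Gamma (dr + real m) * Gamma (real a * real r / 2 + real m)"
      using N(2) by (auto simp only: mult.commute)
    then show ?thesis unfolding formula[OF c] by (simp add: Q(3) mult.commute)
  qed
  moreover have "degree (smult L Q) = a * (r - 1) + b" "lead_coeff (smult L Q) = L" using Q N(1) L by auto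
  ultimately show ?thesis using that[of "smult L Q"] L mom by blast
qed

section \<open>The asymptotic expansion\<close>

lemma quadratic_bound:
  fixes u W s :: real
  assumes "u\<^sup>2 \<le> W * (s + u)" "0 \<le> u" "0 \<le> W" "0 \<le> s"
  shows "u \<le> sqrt (W * s) + W"
proof (rule ccontr)
  assume "\<not> ?thesis"
  then have u: "sqrt (W * s) < u - W" "sqrt (W * s) < u" using assms(3) by linarith+
  have "sqrt (W * s) * sqrt (W * s) < (u - W) * u"
  proof (rule mult_strict_mono[OF u])
    show "0 \<le> sqrt (W * s)" using assms by simp
    then show "0 < u - W" using u(1) by linarith
  qed
  then show False using assms by (simp add: power2_eq_square algebra_simps)
qed

lemma powr_interval_lower_bound:
  fixes t :: real
  assumes "0 < a" "a \<le> t" "t \<le> b"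
  shows "min (a powr s) (b powr s) \<le> t powr s"
proof (cases "0 \<le> s")
  case True
  then have "a powr s \<le> t powr s" using assms by (intro powr_mono2) auto
  then show ?thesis by simp
next
  case False
  then have "b powr s \<le> t powr s" using assms by (intro powr_mono2') auto
  then show ?thesis by simp
qed

context jordan_sphere begin

text \<open>
  With \<open>Y = \<nu>(z|z)\<^sup>\<alpha>\<close> the series of \<open>kernel_expansion\<close> is one of \<open>polynomial_exponential_series\<close>, which gives
  the principal part. The error term \<open>n\<close> of \<open>kernel_expansion\<close> is bounded by the kernel value \<open>k\<close> itself:
  \<open>n\<^sup>2 \<le> W k\<close> with \<open>W\<close> of order \<open>e\<^bsup>\<delta>Y\<^esup>\<close> and \<open>\<delta> < 1\<close>. As \<open>k\<close> is the sum of \<open>n\<close> and a series of order \<open>e\<^sup>Y\<close>,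
  this quadratic inequality makes \<open>n\<close> of order \<open>e\<close> to the power \<open>(1 + \<delta>)Y/2\<close>, up to powers of \<open>\<nu>\<close>.
\<close>

lemma kernel_asymptotics:
  fixes \<alpha> :: real and \<K> :: "real \<Rightarrow> complex ^ 'n \<Rightarrow> complex ^ 'n \<Rightarrow> complex"
  assumes \<alpha>: "0 < \<alpha>" and p: "p = 2 + a * (r - 1) + b" and r: "1 \<le> r"
    and \<K>: "\<And>\<nu>. 0 < \<nu> \<Longrightarrow> L2_reproducing_kernel M (polar_measure M \<sigma> \<alpha> p \<nu>) (holomorphic_L2 M (polar_measure M \<sigma> \<alpha> p \<nu>)) (\<K> \<nu>)"
  defines "L \<equiv> Gamma (real a / 2) / (Gamma (real CARD('n) / real r) * Gamma (real a * real r / 2))"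
  shows "\<exists>\<eta>>0. \<exists>\<beta>. \<beta> 0 = 1 \<and> (\<forall>z\<in>M.
    (\<lambda>\<nu>. complex_of_real (1 / L / \<nu> ^ (p - 1) * exp (- \<nu> * Re (ip z z) powr \<alpha>)) * \<K> \<nu> z z
        - complex_of_real (\<Sum>j=0..p-2. \<beta> j / (\<nu> ^ j * Re (ip z z) powr (real j * \<alpha>))))
      \<in> O[at_top](\<lambda>\<nu>. complex_of_real (exp (- \<eta> * \<nu> * Re (ip z z) powr \<alpha>))))"
proof -
  define N where "N = a * (r - 1) + b"
  have pN: "p - 1 = Suc N" "p - 2 = N" "real p - 1 = real N + 1" "2 \<le> p" using p by (simp_all add: N_def)
  define q where "q = 1 / \<alpha>"
  have q: "0 < q" using \<alpha> by (simp add: q_def)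
  obtain Q where Q: "degree Q = N" "lead_coeff Q = L" and L: "0 < L"
    and moment: "\<And>c m. c \<in> sphere \<Longrightarrow> 1 / moment c m = poly Q (real m)" "\<And>c m. c \<in> sphere \<Longrightarrow> 0 < moment c m"
    by (rule inverse_moment_poly[OF r, folded N_def L_def], rule that) blast+
  define F where "F Y m = poly Q (real m) * Y powr (q * real m) / Gamma (q * real m + real N + 1)" for Y m
  obtain \<gamma> \<kappa> where \<kappa>: "\<kappa> < 1" and \<gamma>: "\<gamma> N = coeff Q N / q ^ N" and F_summable: "\<And>Y. 0 < Y \<Longrightarrow> summable (F Y)"
    and F_asymp: "(\<lambda>Y. (\<Sum>m. F Y (Suc m)) - exp Y / q * (\<Sum>n\<le>N. \<gamma> n / Y ^ (N - n))) \<in> O[at_top](\<lambda>Y. exp (\<kappa> * Y))"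
    unfolding F_def by (rule polynomial_exponential_series[OF q, of Q N]) (use Q in auto)
  define \<beta> where "\<beta> j = \<gamma> (N - j) / (L * \<alpha> ^ N)" for j
  \<comment> \<open>on the shell \<open>t \<le> x/4\<close> the radial density is at least of order \<open>e\<^bsup>-\<delta>Y\<^esup>\<close>\<close>
  define \<delta> where "\<delta> = 4 powr (- \<alpha>)"
  have \<delta>: "0 < \<delta>" "\<delta> < 1" using \<alpha> powr_less_mono[of "- \<alpha>" 0 4] by (simp_all add: \<delta>_def)
  define \<eta> where "\<eta> = min (1 - \<kappa>) ((1 - \<delta>) / 2)"
  have "0 < \<eta>" using \<kappa> \<delta> by (simp add: \<eta>_def)
  note \<eta> = this min.cobounded1[of "1 - \<kappa>" "(1 - \<delta>) / 2", folded \<eta>_def] min.cobounded2[of "1 - \<kappa>" "(1 - \<delta>) / 2", folded \<eta>_def]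
  obtain C Y0 where C: "0 < C" and bound: "\<And>Y. Y0 \<le> Y \<Longrightarrow> \<bar>(\<Sum>m. F Y (Suc m)) - exp Y / q * (\<Sum>n\<le>N. \<gamma> n / Y ^ (N - n))\<bar> \<le> C * exp (\<kappa> * Y)"
    using F_asymp by (elim landau_o.bigE) (auto simp: eventually_at_top_linorder)
  define CF where "CF = C + (\<Sum>n\<le>N. \<bar>\<gamma> n\<bar>) / q"
  have CF: "0 \<le> CF" using C q by (simp add: CF_def sum_nonneg)
  have F_le: "(\<Sum>m. F Y (Suc m)) \<le> CF * exp Y" if Y: "Y0 \<le> Y" "1 \<le> Y" for Y
  proof -
    have "(\<Sum>n\<le>N. \<gamma> n / Y ^ (N - n)) \<le> (\<Sum>n\<le>N. \<bar>\<gamma> n\<bar>)"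
    proof (rule sum_mono)
      fix n
      have "1 \<le> Y ^ (N - n)" using Y by simp
      then have "\<bar>\<gamma> n\<bar> / Y ^ (N - n) \<le> \<bar>\<gamma> n\<bar> / 1" by (intro frac_le) auto
      moreover have "\<gamma> n / Y ^ (N - n) \<le> \<bar>\<gamma> n\<bar> / Y ^ (N - n)" using Y by (intro divide_right_mono) auto
      ultimately show "\<gamma> n / Y ^ (N - n) \<le> \<bar>\<gamma> n\<bar>" by simp
    qed
    then have "exp Y / q * (\<Sum>n\<le>N. \<gamma> n / Y ^ (N - n)) \<le> exp Y / q * (\<Sum>n\<le>N. \<bar>\<gamma> n\<bar>)"
      using q by (intro mult_left_mono) auto
    moreover have "C * exp (\<kappa> * Y) \<le> C * exp Y"
      using C \<kappa> Y mult_right_mono[of \<kappa> 1 Y] by (intro mult_left_mono) auto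
    moreover have "CF * exp Y = C * exp Y + exp Y / q * (\<Sum>n\<le>N. \<bar>\<gamma> n\<bar>)"
      by (simp add: CF_def algebra_simps)
    ultimately show ?thesis using bound[OF Y(1)] by linarith
  qed
  have main: "(\<lambda>\<nu>. complex_of_real (1 / L / \<nu> ^ (p - 1) * exp (- \<nu> * Re (ip z z) powr \<alpha>)) * \<K> \<nu> z z
        - complex_of_real (\<Sum>j=0..p-2. \<beta> j / (\<nu> ^ j * Re (ip z z) powr (real j * \<alpha>))))
      \<in> O[at_top](\<lambda>\<nu>. complex_of_real (exp (- \<eta> * \<nu> * Re (ip z z) powr \<alpha>)))" if z: "z \<in> M" for z
  proof -
    define x where "x = Re (ip z z)"
    have x: "0 < x" using rank_one_sphere(1)[OF z] by (simp add: x_def)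
    obtain c where c: "c \<in> sphere" and zc: "z = complex_of_real (sqrt x) *s c"
      using rank_one_sphere(2)[OF z] by (auto simp: x_def)
    define cx where "cx = min ((x / 8) powr (\<alpha> * (real p - 1) - 1)) ((x / 4) powr (\<alpha> * (real p - 1) - 1))"
    have cx: "0 < cx" using x by (simp add: cx_def)
    \<comment> \<open>\<open>32 = 2\<^sup>2 \<cdot> 8\<close> from squaring the bound of \<open>kernel_expansion\<close>\<close>
    define B where "B = 32 / (\<alpha> ^ p * cx * x * (moment c 1)\<^sup>2)"
    have B: "0 < B" using \<alpha> cx x moment(2)[OF c, of 1] by (simp add: B_def)
    define E where "E = C / (L * \<alpha> ^ Suc N) + (sqrt (B * CF / \<alpha> ^ Suc N) + B) / L"
    have est: "\<bar>1 / L / \<nu> ^ Suc N * exp (- Y) * k - (\<Sum>j\<le>N. \<beta> j / Y ^ j)\<bar> \<le> E * exp (- \<eta> * Y)"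
      and real: "\<K> \<nu> z z = complex_of_real k"
      if \<nu>: "1 \<le> \<nu>" and Y_def: "Y = \<nu> * x powr \<alpha>" and Y: "Y0 \<le> Y" "1 \<le> Y" and k_def: "k = Re (\<K> \<nu> z z)" for \<nu> Y k
    proof -
      have \<nu>0: "0 < \<nu>" using \<nu> by simp
      have R: "(\<lambda>w. \<K> \<nu> w z) \<in> holomorphic_L2 M (polar_measure M \<sigma> \<alpha> p \<nu>)"
        "\<And>g. g \<in> holomorphic_L2 M (polar_measure M \<sigma> \<alpha> p \<nu>) \<Longrightarrow> g z = (LINT w|polar_measure M \<sigma> \<alpha> p \<nu>. g w * cnj (\<K> \<nu> w z))"
        using \<K>[OF \<nu>0] z unfolding L2_reproducing_kernel_def by auto
      note real' = kernel_real[OF \<alpha> \<nu>0 pN(4) R(1) c x zc R(2)]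
      have k: "(LINT w|polar_measure M \<sigma> \<alpha> p \<nu>. (cmod (\<K> \<nu> w z))\<^sup>2) = k" using real' by (simp add: k_def)
      then show "\<K> \<nu> z z = complex_of_real k" using real' by simp
      define D where "D = \<alpha> ^ p * exp (- \<delta> * Y) * cx"
      have D: "0 < D" using \<alpha> cx by (simp add: D_def)
      have Dt: "D \<le> radial_density \<alpha> p \<nu> t" if t: "x / 8 \<le> t" "t \<le> x / 4" for t
      proof -
        have t0: "0 < t" using t x by simp
        have "t powr \<alpha> \<le> (x / 4) powr \<alpha>" using t t0 \<alpha> by (intro powr_mono2) auto
        also have "(x / 4) powr \<alpha> = \<delta> * x powr \<alpha>" using x by (simp add: powr_divide \<delta>_def powr_minus field_simps)
        finally have "\<nu> * t powr \<alpha> \<le> \<nu> * (\<delta> * x powr \<alpha>)" using \<nu>0 by (intro mult_left_mono) auto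
        then have "exp (- \<delta> * Y) \<le> exp (- \<nu> * t powr \<alpha>)" by (simp add: Y_def mult_ac)
        moreover have "cx \<le> t powr (\<alpha> * (real p - 1) - 1)"
          unfolding cx_def using t x by (intro powr_interval_lower_bound) auto
        ultimately show ?thesis unfolding D_def radial_density_def using \<alpha> cx by (intro mult_mono) auto
      qed
      obtain n where n: "(\<lambda>m. x ^ Suc m / (moment c (Suc m) * radial_moment \<alpha> \<nu> p (Suc m))) sums (k - n)"
        and nb: "\<bar>n\<bar> \<le> 2 * sqrt (8 * k / (D * x * (moment c 1)\<^sup>2))"
        using kernel_expansion[OF \<alpha> \<nu>0 pN(4) R(1) c x zc R(2) D Dt moment(2)[OF c]] unfolding k by blast
      define S where "S = (\<Sum>m. F Y (Suc m))"
      have Y0': "0 < Y" using Y by simp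
      have F_eq: "x ^ m / (moment c m * radial_moment \<alpha> \<nu> p m) = \<nu> ^ Suc N / \<alpha> ^ Suc N * F Y m" for m
      proof -
        have ex: "real p - 1 + real m / \<alpha> = q * real m + real N + 1" using pN(3) by (simp add: q_def)
        have "q * real m + real N + 1 = real (Suc N) + q * real m" by simp
        then have pw: "\<nu> powr (- (q * real m + real N + 1)) = 1 / (\<nu> ^ Suc N * \<nu> powr (q * real m))"
          using \<nu>0 by (simp only: powr_minus powr_add powr_realpow inverse_eq_divide)
        have rm: "radial_moment \<alpha> \<nu> p m = \<alpha> ^ Suc N * (1 / (\<nu> ^ Suc N * \<nu> powr (q * real m))) * Gamma (q * real m + real N + 1)"
          unfolding radial_moment_def[OF \<alpha> \<nu>0 pN(4)] ex pw pN(1) ..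
        have Yp: "Y powr (q * real m) = \<nu> powr (q * real m) * x ^ m"
        proof -
          have "(x powr \<alpha>) powr (q * real m) = x powr real m" using \<alpha> by (simp add: powr_powr q_def)
          then show ?thesis using x \<nu>0 by (simp add: Y_def powr_mult powr_realpow)
        qed
        have "x ^ m / (moment c m * G) = (1 / moment c m) * x ^ m / G" for G by simp
        then have "x ^ m / (moment c m * G) = poly Q (real m) * x ^ m / G" for G
          unfolding moment(1)[OF c] .
        then show ?thesis unfolding rm F_def Yp by (simp only:) (simp del: power_Suc)
      qed
      have kS: "k = \<nu> ^ Suc N / \<alpha> ^ Suc N * S + n"
      proof -
        have "(\<lambda>m. F Y (Suc m)) sums S"
          unfolding S_def using F_summable[OF Y0'] by (intro summable_sums) (simp add: summable_Suc_iff)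
        then have "(\<lambda>m. \<nu> ^ Suc N / \<alpha> ^ Suc N * F Y (Suc m)) sums (\<nu> ^ Suc N / \<alpha> ^ Suc N * S)" by (rule sums_mult)
        with n have "k - n = \<nu> ^ Suc N / \<alpha> ^ Suc N * S" unfolding F_eq by (rule sums_unique2)
        then show ?thesis by simp
      qed
      have S0: "0 \<le> S"
        unfolding S_def
      proof (intro suminf_nonneg)
        show "summable (\<lambda>m. F Y (Suc m))" using F_summable[OF Y0'] by (simp add: summable_Suc_iff)
        fix m
        have "0 \<le> x ^ Suc m / (moment c (Suc m) * radial_moment \<alpha> \<nu> p (Suc m))"
          using x moment(2)[OF c, of "Suc m"] radial_moment_pos[OF \<alpha> \<nu>0 pN(4), of "Suc m"] by simp
        then have "0 \<le> \<nu> ^ Suc N / \<alpha> ^ Suc N * F Y (Suc m)" by (simp only: F_eq)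
        moreover have "0 < \<nu> ^ Suc N / \<alpha> ^ Suc N" using \<nu>0 \<alpha> by simp
        ultimately show "0 \<le> F Y (Suc m)" by (simp only: zero_le_mult_iff) auto
      qed
      \<comment> \<open>normalised like the principal part; \<open>1 \<le> \<nu>\<close> bounds one of the two factors in \<open>n'\<^sup>2\<close>\<close>
      define n' where "n' = n / \<nu> ^ Suc N"
      define W where "W = B * exp (\<delta> * Y)"
      have W: "0 \<le> W" using B by (simp add: W_def)
      have k0: "0 \<le> k" using k by (metis integral_nonneg_AE AE_I2 zero_le_power2)
      have "n\<^sup>2 \<le> (2 * sqrt (8 * k / (D * x * (moment c 1)\<^sup>2)))\<^sup>2"
        using nb by (intro abs_le_square_iff[THEN iffD1]) auto
      also have "\<dots> = 4 * (8 * k / (D * x * (moment c 1)\<^sup>2))" using k0 D x by (simp add: power_mult_distrib)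
      also have "\<dots> = W * k" by (simp add: W_def B_def D_def exp_minus field_simps)
      finally have "n\<^sup>2 \<le> W * k" .
      have \<nu>1: "1 \<le> \<nu> ^ Suc N" using \<nu> by (rule one_le_power)
      have "n'\<^sup>2 = n\<^sup>2 / \<nu> ^ Suc N / \<nu> ^ Suc N" by (simp add: n'_def power_divide power2_eq_square)
      also have "\<dots> \<le> W * k / \<nu> ^ Suc N / 1"
        using \<open>n\<^sup>2 \<le> W * k\<close> \<nu>1 W k0 \<nu>0 by (intro frac_le divide_right_mono divide_nonneg_nonneg mult_nonneg_nonneg) auto
      also have "\<dots> = W * (S / \<alpha> ^ Suc N + n')" using \<nu>0 by (simp add: kS n'_def field_simps del: power_Suc)
      also have "\<dots> \<le> W * (S / \<alpha> ^ Suc N + \<bar>n'\<bar>)" using W by (intro mult_left_mono) auto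
      finally have "\<bar>n'\<bar>\<^sup>2 \<le> W * (S / \<alpha> ^ Suc N + \<bar>n'\<bar>)" by (simp only: power2_abs)
      from quadratic_bound[OF this] have "\<bar>n'\<bar> \<le> sqrt (W * (S / \<alpha> ^ Suc N)) + W" using W S0 \<alpha> by simp
      also have "sqrt (W * (S / \<alpha> ^ Suc N)) \<le> sqrt (B * CF / \<alpha> ^ Suc N) * exp ((1 + \<delta>) / 2 * Y)"
      proof -
        have "W * (S / \<alpha> ^ Suc N) \<le> W * (CF * exp Y / \<alpha> ^ Suc N)"
          using F_le[OF Y] W \<alpha> by (intro mult_left_mono divide_right_mono) (auto simp: S_def)
        also have "\<dots> = B * CF / \<alpha> ^ Suc N * (exp ((1 + \<delta>) / 2 * Y))\<^sup>2"
          by (simp add: W_def power2_eq_square exp_add[symmetric] algebra_simps add_divide_distrib del: power_Suc)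
        finally have "sqrt (W * (S / \<alpha> ^ Suc N)) \<le> sqrt (B * CF / \<alpha> ^ Suc N * (exp ((1 + \<delta>) / 2 * Y))\<^sup>2)"
          by (rule real_sqrt_le_mono)
        then show ?thesis by (simp only: real_sqrt_mult real_sqrt_abs abs_exp_cancel)
      qed
      finally have n'b: "\<bar>n'\<bar> \<le> sqrt (B * CF / \<alpha> ^ Suc N) * exp ((1 + \<delta>) / 2 * Y) + W" by simp
      have "exp (- Y) * \<bar>n'\<bar> \<le> exp (- Y) * (sqrt (B * CF / \<alpha> ^ Suc N) * exp ((1 + \<delta>) / 2 * Y) + W)"
        using n'b by (intro mult_left_mono) auto
      also have "\<dots> = sqrt (B * CF / \<alpha> ^ Suc N) * exp (- ((1 - \<delta>) / 2) * Y) + B * exp (- (1 - \<delta>) * Y)"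
      proof -
        have "exp (- Y) * exp ((1 + \<delta>) / 2 * Y) = exp (- ((1 - \<delta>) / 2) * Y)" "exp (- Y) * exp (\<delta> * Y) = exp (- (1 - \<delta>) * Y)"
          by (simp_all add: exp_add[symmetric] field_simps)
        then show ?thesis by (simp add: W_def distrib_left mult.left_commute[of "exp (- Y)"] del: power_Suc)
      qed
      also have "\<dots> \<le> sqrt (B * CF / \<alpha> ^ Suc N) * exp (- \<eta> * Y) + B * exp (- \<eta> * Y)"
      proof (intro add_mono mult_left_mono)
        have "\<eta> * Y \<le> (1 - \<delta>) / 2 * Y" using \<eta>(3) Y0' by (intro mult_right_mono) auto
        then show "exp (- ((1 - \<delta>) / 2) * Y) \<le> exp (- \<eta> * Y)" by simp
        have "\<eta> * Y \<le> (1 - \<delta>) * Y" using \<eta>(3) \<delta> Y0' by (intro mult_right_mono) auto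
        then show "exp (- (1 - \<delta>) * Y) \<le> exp (- \<eta> * Y)" by (simp only: exp_le_cancel_iff mult_minus_left neg_le_iff_le)
      qed (use B CF \<alpha> in auto)
      finally have n'E: "exp (- Y) * \<bar>n'\<bar> \<le> (sqrt (B * CF / \<alpha> ^ Suc N) + B) * exp (- \<eta> * Y)" by (simp only: distrib_right)
      define G where "G = S - exp Y / q * (\<Sum>n\<le>N. \<gamma> n / Y ^ (N - n))"
      have "\<bar>G\<bar> \<le> C * exp (\<kappa> * Y)" using bound[OF Y(1)] by (simp add: G_def S_def)
      then have "exp (- Y) * \<bar>G\<bar> \<le> exp (- Y) * (C * exp (\<kappa> * Y))" by (intro mult_left_mono) auto
      also have "\<dots> = C * exp (- (1 - \<kappa>) * Y)" by (simp add: exp_add[symmetric] algebra_simps)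
      also have "\<dots> \<le> C * exp (- \<eta> * Y)"
      proof -
        have "\<eta> * Y \<le> (1 - \<kappa>) * Y" using \<eta>(2) Y0' by (intro mult_right_mono) auto
        then have "exp (- (1 - \<kappa>) * Y) \<le> exp (- \<eta> * Y)" by (simp only: exp_le_cancel_iff mult_minus_left neg_le_iff_le)
        then show ?thesis using C by (intro mult_left_mono) auto
      qed
      finally have GE: "exp (- Y) * \<bar>G\<bar> \<le> C * exp (- \<eta> * Y)" .
      have sum_eq: "(\<Sum>j\<le>N. \<beta> j / Y ^ j) = 1 / (L * \<alpha> ^ Suc N) * (1 / q * (\<Sum>n\<le>N. \<gamma> n / Y ^ (N - n)))"
      proof -
        have "(\<Sum>n\<le>N. \<gamma> n / Y ^ (N - n)) = (\<Sum>j\<le>N. \<gamma> (N - j) / Y ^ j)"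
          by (rule sum.reindex_bij_witness[of _ "\<lambda>j. N - j" "\<lambda>j. N - j"]) auto
        moreover have "(\<Sum>j\<le>N. \<beta> j / Y ^ j) = (\<Sum>j\<le>N. \<gamma> (N - j) / Y ^ j) / (L * \<alpha> ^ N)"
          unfolding sum_divide_distrib by (intro sum.cong refl) (simp add: \<beta>_def)
        moreover have "1 / (L * \<alpha> ^ Suc N) * (1 / q * X) = X / (L * \<alpha> ^ N)" for X
          using \<alpha> by (simp add: q_def)
        ultimately show ?thesis by (simp only:)
      qed
      have "1 / L / \<nu> ^ Suc N * exp (- Y) * k - (\<Sum>j\<le>N. \<beta> j / Y ^ j)
          = 1 / (L * \<alpha> ^ Suc N) * (exp (- Y) * G) + 1 / L * (exp (- Y) * n')"
      proof -
        have 1: "k / \<nu> ^ Suc N = S / \<alpha> ^ Suc N + n'" using \<nu>0 by (simp add: kS n'_def add_divide_distrib del: power_Suc)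
        have 2: "exp (- Y) * G = exp (- Y) * S - 1 / q * (\<Sum>n\<le>N. \<gamma> n / Y ^ (N - n))"
          by (simp add: G_def right_diff_distrib exp_minus)
        have "1 / L / \<nu> ^ Suc N * exp (- Y) * k = 1 / L * exp (- Y) * (k / \<nu> ^ Suc N)" by simp
        then show ?thesis unfolding sum_eq 2 1 by (simp add: algebra_simps del: power_Suc)
      qed
      also have "\<bar>\<dots>\<bar> \<le> 1 / (L * \<alpha> ^ Suc N) * (exp (- Y) * \<bar>G\<bar>) + 1 / L * (exp (- Y) * \<bar>n'\<bar>)"
        using L \<alpha> by (intro order.trans[OF abs_triangle_ineq]) (simp add: abs_mult)
      also have "\<dots> \<le> 1 / (L * \<alpha> ^ Suc N) * (C * exp (- \<eta> * Y)) + 1 / L * ((sqrt (B * CF / \<alpha> ^ Suc N) + B) * exp (- \<eta> * Y))"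
        using GE n'E L \<alpha> by (intro add_mono mult_left_mono) auto
      also have "\<dots> = E * exp (- \<eta> * Y)" by (simp add: E_def distrib_right del: power_Suc)
      finally show "\<bar>1 / L / \<nu> ^ Suc N * exp (- Y) * k - (\<Sum>j\<le>N. \<beta> j / Y ^ j)\<bar> \<le> E * exp (- \<eta> * Y)" .
    qed
    show ?thesis
      unfolding x_def[symmetric] pN
    proof (rule bigoI[of _ E], rule eventually_at_top_linorderI[of "max 1 (max (Y0 / x powr \<alpha>) (1 / x powr \<alpha>))"])
      fix \<nu> assume "max 1 (max (Y0 / x powr \<alpha>) (1 / x powr \<alpha>)) \<le> \<nu>"
      then have \<nu>: "1 \<le> \<nu>" "Y0 \<le> \<nu> * x powr \<alpha>" "1 \<le> \<nu> * x powr \<alpha>" using x by (simp_all add: pos_divide_le_eq)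
      note e = est[OF \<nu>(1) refl \<nu>(2,3) refl] real[OF \<nu>(1) refl \<nu>(2,3) refl]
      have "\<nu> ^ j * x powr (real j * \<alpha>) = (\<nu> * x powr \<alpha>) ^ j" for j
        using x by (simp add: power_mult_distrib powr_realpow[symmetric] powr_powr mult.commute)
      then have s: "(\<Sum>j=0..N. \<beta> j / (\<nu> ^ j * x powr (real j * \<alpha>))) = (\<Sum>j\<le>N. \<beta> j / (\<nu> * x powr \<alpha>) ^ j)"
        by (simp add: atMost_atLeast0)
      have "complex_of_real (1 / L / \<nu> ^ Suc N * exp (- \<nu> * x powr \<alpha>)) * \<K> \<nu> z z
          - complex_of_real (\<Sum>j=0..N. \<beta> j / (\<nu> ^ j * x powr (real j * \<alpha>)))
          = complex_of_real (1 / L / \<nu> ^ Suc N * exp (- (\<nu> * x powr \<alpha>)) * Re (\<K> \<nu> z z) - (\<Sum>j\<le>N. \<beta> j / (\<nu> * x powr \<alpha>) ^ j))"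
        unfolding s by (subst e(2)) (simp only: of_real_mult of_real_diff minus_mult_left)
      then show "norm (complex_of_real (1 / L / \<nu> ^ Suc N * exp (- \<nu> * x powr \<alpha>)) * \<K> \<nu> z z
          - complex_of_real (\<Sum>j=0..N. \<beta> j / (\<nu> ^ j * x powr (real j * \<alpha>))))
        \<le> E * norm (complex_of_real (exp (- \<eta> * \<nu> * x powr \<alpha>)))"
        using e(1) by (simp only: norm_of_real abs_exp_cancel mult.assoc)
    qed
  qed
  have "\<beta> 0 = 1"
  proof -
    have "q ^ N * \<alpha> ^ N = 1" using \<alpha> by (simp add: q_def power_divide)
    then have "\<gamma> N = L * \<alpha> ^ N" using \<gamma> Q \<alpha> by (simp add: q_def power_divide)
    then show ?thesis using L \<alpha> by (simp add: \<beta>_def)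
  qed
  then show ?thesis using \<eta>(1) main by blast
qed

end

theorem theorem6p1:
  fixes T :: "'n::finite triple"
    and e :: "nat \<Rightarrow> complex ^ 'n"
    and r a b d p :: nat
    and ip :: "complex ^ 'n \<Rightarrow> complex ^ 'n \<Rightarrow> complex"
    and \<sigma> :: "(complex ^ 'n) measure"
    and \<alpha> :: real
    and \<K> :: "real \<Rightarrow> complex ^ 'n \<Rightarrow> complex ^ 'n \<Rightarrow> complex"
  assumes "hermitian_jordan_triple T"
    and "jt_irreducible T"
    and "jt_frame T r e"
    and "jt_type T e r a b"
    and "d = CARD('n)"
    and "p = 2 + a * (r - 1) + b"
    and "jt_inner_product T ip"
    and "invariant_prob_measure T (rank_one_tripotents T r e) \<sigma>"
    and "0 < \<alpha>"
    and "\<And>\<nu>. 0 < \<nu> \<Longrightarrow>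
           L2_reproducing_kernel (rank_one T r e)
             (polar_measure (rank_one T r e) \<sigma> \<alpha> p \<nu>)
             (holomorphic_L2 (rank_one T r e) (polar_measure (rank_one T r e) \<sigma> \<alpha> p \<nu>))
             (\<K> \<nu>)"
  shows "\<exists>\<eta>>0. \<exists>\<beta> :: nat \<Rightarrow> real. \<beta> 0 = 1 \<and>
    (\<forall>z\<in>rank_one T r e.
      (\<lambda>\<nu>. complex_of_real
              (Gamma (real d / real r) * Gamma (real a * real r / 2)
                 / (Gamma (real a / 2) * \<nu> ^ (p - 1))
               * exp (- \<nu> * Re (ip z z) powr \<alpha>)) * \<K> \<nu> z z
            - complex_of_real
                (\<Sum>j=0..p-2. \<beta> j / (\<nu> ^ j * Re (ip z z) powr (real j * \<alpha>))))
      \<in> O[at_top](\<lambda>\<nu>. complex_of_real (exp (- \<eta> * \<nu> * Re (ip z z) powr \<alpha>))))"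
proof (cases "rank_one T r e = {}")
  case True
  then show ?thesis by (intro exI[of _ 1] conjI exI[of _ "\<lambda>_. 1"]) auto
next
  case False
  interpret jordan_sphere T ip r a b e \<sigma>
    using assms by unfold_locales auto
  obtain i where "i \<in> {1..r}" using False unfolding rank_one_conjugate[abs_def] by (metis all_not_in_conv rank_one_conjugate)
  then have r: "1 \<le> r" by simp
  have "1 / (Gamma (real a / 2) / (Gamma (real CARD('n) / real r) * Gamma (real a * real r / 2))) / \<nu> ^ (p - 1)
      = Gamma (real d / real r) * Gamma (real a * real r / 2) / (Gamma (real a / 2) * \<nu> ^ (p - 1))" for \<nu>
    by (simp add: assms(5))
  then show ?thesis
    using kernel_asymptotics[OF assms(9,6) r assms(10)] by (simp only:)
qed

end
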